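(* Let $(X,\mathfrak m,\mathscr E,\mathscr F(X))$ be a locally smoothing strongly local Dirichlet space and let $\lambda\ge 0$. If $f,g\in L^1_{\mathrm{loc}}(X,\mathfrak m)$ are locally $\lambda$-shift defective, then so is $f\vee g=\max(f,g)$. If $0\le f\in L^1_{\mathrm{loc}}(X,\mathfrak m)$ is locally $\lambda$-shift defective, then $f$ is locally shift defective (that is, locally $0$-shift defective).
   Context: Function spaces are real; inequalities between classes of functions hold $\mathfrak m$-a.e. A strongly local Dirichlet space is a quadruple $(X,\mathfrak m,\mathscr E,\mathscr F(X))$, where $X$ is a locally compact, separable, metrizable space, $\mathfrak m$ is a Radon measure on $X$ with full support, and $\mathscr E$ is a closed, symmetric, nonnegative bilinear form in $L^2(X,\mathfrak m)$ with dense domain $\mathscr F(X)$ such that: (Markov) for all contractions $T:\mathbb R\to\mathbb R$ with $T(0)=0$ and $f\in\mathscr F(X)$ one has $T\circ f\in\mathscr F(X)$ and $\mathscr E(T\circ f,T\circ f)\le\mathscr E(f,f)$; (regular) $\mathscr F(X)\cap C_c(X)$ is dense in $C_c(X)$ w.r.t. $\|\cdot\|_\infty$ and in $\mathscr F(X)$ w.r.t. $\mathscr E_1(u,v)=\mathscr E(u,v)+\int uv\,d\mathfrak m$; (strongly local) $\mathscr E(u,v)=0$ whenever $u,v\in\mathscr F(X)$ and $u$ is constant on the support of $v$. For open $U,V\subset X$, $U\Subset V$ means that $\overline U$ is a compact subset of $X$ with $\overline U\subset V$. $\mathscr F_{\mathrm{loc}}(X)$ is the set of $f\in L^2_{\mathrm{loc}}(X,\mathfrak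 m)$ such that for every open $U\Subset X$ there is $h\in\mathscr F(X)$ with $f=h$ on $U$; $\mathscr F_c(X)$ is the set of elements of $\mathscr F(X)$ with compact $\mathfrak m$-support. $\mathscr E$ extends to $\mathscr F_{\mathrm{loc}}(X)\times\mathscr F_c(X)$ by $\mathscr E(f,\phi):=\mathscr E(h,\phi)$ with $h\in\mathscr F(X)$ equal to $f$ in an open neighbourhood of the support of $\phi$; $\mathscr E_\lambda(u,v):=\mathscr E(u,v)+\lambda\int uv\,d\mathfrak m$. A function $f\in\mathscr F_{\mathrm{loc}}(X)$ is weakly $\lambda$-harmonic if $\mathscr E_\lambda(f,\phi)\le 0$ and $\mathscr E_\lambda(-f,\phi)\le0$ for all $0\le\phi\in\mathscr F_c(X)$. $H\ge0$ is the self-adjoint operator in $L^2(X,\mathfrak m)$ induced by $\mathscr E$, and $P_t=e^{-tH}$, extended consistently to a positivity preserving contraction semigroup on all $L^q(X,\mathfrak m)$, $q\in[1,\infty]$. For open $U\subset X$, $\mathscr F(U)$ is the closure of $C_c(U)\cap\mathscr F(X)$ w.r.t. $\mathscr E_1$; then $(U,\mathfrak m,\mathscr E,\mathscr F(U))$ is again a strongly local Dirichlet space, with semigroup denoted $P^U_t$; notions "on $U$" refer to this space. For $f\in\mathscr F(X)\cap L^\infty$ the energy measure $\Gamma(f)$ is defined by $\int\phi\,d\Gamma(f)=\mathscr E(f,\phi f)-\frac12\mathscr E(f^2,\phi)$ for $\phi\in\mathscr F(X)\cap C_c(X)$; it extends to $\mathscr F(X)$ and, by locality, to $\mathscr F_{\mathrm{loc}}(X)$.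 The space is: ultracontractive if $P_t(L^1(X,\mathfrak m))\subset L^\infty(X,\mathfrak m)$ for all $t>0$; doubly Feller if $P_t:C_0(X)\to C_0(X)$ for all $t\ge0$, $P_t:L^\infty(X,\mathfrak m)\to C(X)$ for all $t>0$, and $\lim_{t\to0+}P_tf(x)=f(x)$ for all $f\in C_0(X)$, $x\in X$ ($C_0$ = continuous functions vanishing at infinity); irreducible if every $f\in\mathscr F_{\mathrm{loc}}(X)$ with $\Gamma(f)=0$ is constant. It is locally smoothing if for every open $U\Subset X$: $(U,\mathfrak m,\mathscr E,\mathscr F(U))$ is ultracontractive, and there is an open $U'\subset X$ with $U\subset U'$, $U'\setminus\overline U\ne\emptyset$, such that $(U',\mathfrak m,\mathscr E,\mathscr F(U'))$ is doubly Feller and irreducible. A function $f\in L^1_{\mathrm{loc}}(X,\mathfrak m)$ is locally $\lambda$-shift defective if for every open $U\Subset X$ there is a weakly $\lambda$-harmonic $g\in C_b(U)$ on $U$ with $e^{-t\lambda}P^U_t(f|_U-g)\ge f|_U-g$ for all $t>0$; for $\lambda=0$ one says locally shift defective. *)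

theory Defs
  imports "HOL-Analysis.Analysis"
begin

text \<open>
  The quadruple (X, m, E, F). Elements of function spaces over m are represented by functions
  on the whole type: only their values on the carrier of X matter, and almost everywhere equal
  functions are different representatives of the same element. The form is only meaningful for
  arguments in the domain.
\<close>

record 'a form_space =
  fs_top :: "'a topology"
  fs_meas :: "'a measure"
  fs_form :: "('a \<Rightarrow> real) \<Rightarrow> ('a \<Rightarrow> real) \<Rightarrow> real"
  fs_dom :: "('a \<Rightarrow> real) set"


section \<open>Topology and measures\<close>

definition Cont :: "'a topology \<Rightarrow> ('a \<Rightarrow> real) set" where
  "Cont X = {f. continuous_map X euclideanreal f}"

definition Cb :: "'a topology \<Rightarrow> ('a \<Rightarrow> real) set" where
  "Cb X = {f \<in> Cont X. bounded (f ` topspace X)}"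

definition C0 :: "'a topology \<Rightarrow> ('a \<Rightarrow> real) set" where
  "C0 X = {f \<in> Cont X. \<forall>\<epsilon>>0. compactin X {x \<in> topspace X. \<bar>f x\<bar> \<ge> \<epsilon>}}"

definition top_support :: "'a topology \<Rightarrow> ('a \<Rightarrow> real) \<Rightarrow> 'a set" where
  "top_support X f = X closure_of {x \<in> topspace X. f x \<noteq> 0}"

definition Cc :: "'a topology \<Rightarrow> ('a \<Rightarrow> real) set" where
  "Cc X = {f \<in> Cont X. compactin X (top_support X f)}"

definition compactly_inside :: "'a topology \<Rightarrow> 'a set \<Rightarrow> 'a set \<Rightarrow> bool" where
  "compactly_inside X U V \<longleftrightarrow>
     openin X U \<and> openin X V \<and> compactin X (X closure_of U) \<and> X closure_of U \<subseteq> V"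

definition radon_measure :: "'a topology \<Rightarrow> 'a measure \<Rightarrow> bool" where
  "radon_measure X \<mu> \<longleftrightarrow>
     sets \<mu> = sets (sigma (topspace X) {U. openin X U}) \<and>
     (\<forall>K. compactin X K \<longrightarrow> emeasure \<mu> K < \<infinity>) \<and>
     (\<forall>A \<in> sets \<mu>. emeasure \<mu> A = (SUP K \<in> {K. compactin X K \<and> K \<subseteq> A}. emeasure \<mu> K))"

definition full_support :: "'a topology \<Rightarrow> 'a measure \<Rightarrow> bool" where
  "full_support X \<mu> \<longleftrightarrow> (\<forall>U. openin X U \<and> U \<noteq> {} \<longrightarrow> emeasure \<mu> U > 0)"

definition L1 :: "'a measure \<Rightarrow> ('a \<Rightarrow> real) set" where
  "L1 M = {f. integrable M f}"

definition L2 :: "'a measure \<Rightarrow> ('a \<Rightarrow> real) set" where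
  "L2 M = {f \<in> borel_measurable M. integrable M (\<lambda>x. (f x)\<^sup>2)}"

definition Linf :: "'a measure \<Rightarrow> ('a \<Rightarrow> real) set" where
  "Linf M = {f \<in> borel_measurable M. \<exists>C. AE x in M. \<bar>f x\<bar> \<le> C}"

definition L1_loc :: "'a form_space \<Rightarrow> ('a \<Rightarrow> real) set" where
  "L1_loc D = {f \<in> borel_measurable (fs_meas D).
     \<forall>K. compactin (fs_top D) K \<longrightarrow> set_integrable (fs_meas D) K f}"

definition L2_loc :: "'a form_space \<Rightarrow> ('a \<Rightarrow> real) set" where
  "L2_loc D = {f \<in> borel_measurable (fs_meas D).
     \<forall>K. compactin (fs_top D) K \<longrightarrow> set_integrable (fs_meas D) K (\<lambda>x. (f x)\<^sup>2)}"

text \<open>The m-support: complement of the largest open set on which the function vanishes a.e.\<close>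

definition meas_support :: "'a form_space \<Rightarrow> ('a \<Rightarrow> real) \<Rightarrow> 'a set" where
  "meas_support D f = topspace (fs_top D) -
     \<Union>{V. openin (fs_top D) V \<and> (AE x in fs_meas D. x \<in> V \<longrightarrow> f x = 0)}"


section \<open>Strongly local Dirichlet spaces\<close>

definition form_shift :: "'a form_space \<Rightarrow> real \<Rightarrow> ('a \<Rightarrow> real) \<Rightarrow> ('a \<Rightarrow> real) \<Rightarrow> real" where
  "form_shift D lam u v = fs_form D u v + lam * (\<integral>x. u x * v x \<partial>fs_meas D)"

text \<open>The squared norm of the difference with respect to \<open>E\<^sub>1\<close>.\<close>

definition E1_dist2 :: "'a form_space \<Rightarrow> ('a \<Rightarrow> real) \<Rightarrow> ('a \<Rightarrow> real) \<Rightarrow> real" where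
  "E1_dist2 D u v = form_shift D 1 (\<lambda>x. u x - v x) (\<lambda>x. u x - v x)"

text \<open>
  The second and third line say that the domain and the form live on a.e.-classes.
\<close>

definition symmetric_nonneg_form :: "'a form_space \<Rightarrow> bool" where
  "symmetric_nonneg_form D \<longleftrightarrow> (let M = fs_meas D; E = fs_form D; F = fs_dom D in
     F \<subseteq> L2 M \<and>
     (\<forall>u \<in> F. \<forall>u' \<in> borel_measurable M. (AE x in M. u x = u' x) \<longrightarrow> u' \<in> F) \<and>
     (\<forall>u \<in> F. \<forall>u' \<in> F. \<forall>v \<in> F. (AE x in M. u x = u' x) \<longrightarrow> E u v = E u' v) \<and>
     (\<lambda>x. 0) \<in> F \<and>
     (\<forall>u \<in> F. \<forall>v \<in> F. (\<lambda>x. u x + v x) \<in> F) \<and>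
     (\<forall>c. \<forall>u \<in> F. (\<lambda>x. c * u x) \<in> F) \<and>
     (\<forall>u \<in> F. \<forall>v \<in> F. \<forall>w \<in> F. E (\<lambda>x. u x + v x) w = E u w + E v w) \<and>
     (\<forall>c. \<forall>u \<in> F. \<forall>v \<in> F. E (\<lambda>x. c * u x) v = c * E u v) \<and>
     (\<forall>u \<in> F. \<forall>v \<in> F. E u v = E v u) \<and>
     (\<forall>u \<in> F. 0 \<le> E u u))"

definition densely_defined_form :: "'a form_space \<Rightarrow> bool" where
  "densely_defined_form D \<longleftrightarrow>
     (\<forall>f \<in> L2 (fs_meas D). \<forall>\<epsilon>>0. \<exists>u \<in> fs_dom D. (\<integral>x. (f x - u x)\<^sup>2 \<partial>fs_meas D) < \<epsilon>)"

definition closed_form :: "'a form_space \<Rightarrow> bool" where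
  "closed_form D \<longleftrightarrow> (\<forall>us u.
     (\<forall>n::nat. us n \<in> fs_dom D) \<and> u \<in> L2 (fs_meas D) \<and>
     (\<lambda>n. \<integral>x. (us n x - u x)\<^sup>2 \<partial>fs_meas D) \<longlonglongrightarrow> 0 \<and>
     (\<forall>\<epsilon>>0. \<exists>N. \<forall>m\<ge>N. \<forall>n\<ge>N.
        fs_form D (\<lambda>x. us m x - us n x) (\<lambda>x. us m x - us n x) < \<epsilon>)
     \<longrightarrow> u \<in> fs_dom D \<and> (\<lambda>n. fs_form D (\<lambda>x. us n x - u x) (\<lambda>x. us n x - u x)) \<longlonglongrightarrow> 0)"

definition markov_form :: "'a form_space \<Rightarrow> bool" where
  "markov_form D \<longleftrightarrow> (\<forall>T :: real \<Rightarrow> real.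
     (\<forall>a b. \<bar>T a - T b\<bar> \<le> \<bar>a - b\<bar>) \<and> T 0 = 0 \<longrightarrow>
     (\<forall>f \<in> fs_dom D. T \<circ> f \<in> fs_dom D \<and> fs_form D (T \<circ> f) (T \<circ> f) \<le> fs_form D f f))"

definition regular_form :: "'a form_space \<Rightarrow> bool" where
  "regular_form D \<longleftrightarrow>
     (\<forall>f \<in> Cc (fs_top D). \<forall>\<epsilon>>0. \<exists>g \<in> fs_dom D \<inter> Cc (fs_top D).
        \<forall>x \<in> topspace (fs_top D). \<bar>f x - g x\<bar> < \<epsilon>) \<and>
     (\<forall>f \<in> fs_dom D. \<forall>\<epsilon>>0. \<exists>g \<in> fs_dom D \<inter> Cc (fs_top D). E1_dist2 D f g < \<epsilon>)"

definition strongly_local_form :: "'a form_space \<Rightarrow> bool" where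
  "strongly_local_form D \<longleftrightarrow> (\<forall>u \<in> fs_dom D. \<forall>v \<in> fs_dom D.
     (\<exists>c. AE x in fs_meas D. x \<in> meas_support D v \<longrightarrow> u x = c) \<longrightarrow> fs_form D u v = 0)"

definition strongly_local_dirichlet_space :: "'a form_space \<Rightarrow> bool" where
  "strongly_local_dirichlet_space D \<longleftrightarrow>
     locally_compact_space (fs_top D) \<and> separable_space (fs_top D) \<and>
     metrizable_space (fs_top D) \<and>
     radon_measure (fs_top D) (fs_meas D) \<and> full_support (fs_top D) (fs_meas D) \<and>
     symmetric_nonneg_form D \<and> densely_defined_form D \<and> closed_form D \<and>
     markov_form D \<and> regular_form D \<and> strongly_local_form D"

text \<open>
  The Dirichlet space (U, m, E, F(U)). A function on U is identified with its extension by
  zero to X, so F(U) consists of the functions whose extension by zero lies in the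
  \<open>E\<^sub>1\<close>-closure of \<open>C\<^sub>c(U) \<inter> F(X)\<close>.
\<close>

definition zero_ext :: "'a set \<Rightarrow> ('a \<Rightarrow> real) \<Rightarrow> 'a \<Rightarrow> real" where
  "zero_ext U u = (\<lambda>x. if x \<in> U then u x else 0)"

definition dom_on :: "'a form_space \<Rightarrow> 'a set \<Rightarrow> ('a \<Rightarrow> real) set" where
  "dom_on D U = {u \<in> fs_dom D. \<forall>\<epsilon>>0. \<exists>v \<in> fs_dom D \<inter> Cc (fs_top D).
     top_support (fs_top D) v \<subseteq> U \<and> E1_dist2 D u v < \<epsilon>}"

definition restrict_form_space :: "'a form_space \<Rightarrow> 'a set \<Rightarrow> 'a form_space" where
  "restrict_form_space D U =
     \<lparr> fs_top = subtopology (fs_top D) U,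
       fs_meas = restrict_space (fs_meas D) U,
       fs_form = (\<lambda>u v. fs_form D (zero_ext U u) (zero_ext U v)),
       fs_dom = {u. zero_ext U u \<in> dom_on D U} \<rparr>"


section \<open>Local domain and weakly harmonic functions\<close>

definition dom_loc :: "'a form_space \<Rightarrow> ('a \<Rightarrow> real) set" where
  "dom_loc D = {f \<in> L2_loc D. \<forall>U. compactly_inside (fs_top D) U (topspace (fs_top D)) \<longrightarrow>
     (\<exists>h \<in> fs_dom D. AE x in fs_meas D. x \<in> U \<longrightarrow> f x = h x)}"

definition dom_c :: "'a form_space \<Rightarrow> ('a \<Rightarrow> real) set" where
  "dom_c D = {f \<in> fs_dom D. compactin (fs_top D) (meas_support D f)}"

text \<open>By strong locality the value does not depend on the choice of h.\<close>

definition form_loc :: "'a form_space \<Rightarrow> ('a \<Rightarrow> real) \<Rightarrow> ('a \<Rightarrow> real) \<Rightarrow> real" where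
  "form_loc D f \<phi> = fs_form D
     (SOME h. h \<in> fs_dom D \<and> (\<exists>V. openin (fs_top D) V \<and> meas_support D \<phi> \<subseteq> V \<and>
        (AE x in fs_meas D. x \<in> V \<longrightarrow> h x = f x))) \<phi>"

definition form_loc_shift ::
    "'a form_space \<Rightarrow> real \<Rightarrow> ('a \<Rightarrow> real) \<Rightarrow> ('a \<Rightarrow> real) \<Rightarrow> real" where
  "form_loc_shift D lam f \<phi> = form_loc D f \<phi> + lam * (\<integral>x. f x * \<phi> x \<partial>fs_meas D)"

definition weakly_harmonic :: "'a form_space \<Rightarrow> real \<Rightarrow> ('a \<Rightarrow> real) \<Rightarrow> bool" where
  "weakly_harmonic D lam f \<longleftrightarrow> f \<in> dom_loc D \<and>
     (\<forall>\<phi> \<in> dom_c D. (AE x in fs_meas D. 0 \<le> \<phi> x) \<longrightarrow>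
        form_loc_shift D lam f \<phi> \<le> 0 \<and> form_loc_shift D lam (\<lambda>x. - f x) \<phi> \<le> 0)"


section \<open>The heat semigroup\<close>

text \<open>
  The operator H induced by the form, as a relation between representatives:
  u is in the domain of H and \<open>H u = w\<close>.
\<close>

definition form_operator :: "'a form_space \<Rightarrow> ('a \<Rightarrow> real) \<Rightarrow> ('a \<Rightarrow> real) \<Rightarrow> bool" where
  "form_operator D u w \<longleftrightarrow> u \<in> fs_dom D \<and> w \<in> L2 (fs_meas D) \<and>
     (\<forall>v \<in> fs_dom D. fs_form D u v = (\<integral>x. w x * v x \<partial>fs_meas D))"

text \<open>
  \<open>e\<^sup>-\<^sup>t\<^sup>H\<close> on \<open>L\<^sup>2\<close>: the strongly continuous contraction semigroup whose infinitesimal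
  generator is exactly \<open>-H\<close>. This determines the operators uniquely up to a.e. equality.
\<close>

definition is_L2_semigroup ::
    "'a form_space \<Rightarrow> (real \<Rightarrow> ('a \<Rightarrow> real) \<Rightarrow> ('a \<Rightarrow> real)) \<Rightarrow> bool" where
  "is_L2_semigroup D T \<longleftrightarrow> (let M = fs_meas D in
     (\<forall>t\<ge>0. \<forall>f \<in> L2 M. T t f \<in> L2 M \<and> (\<integral>x. (T t f x)\<^sup>2 \<partial>M) \<le> (\<integral>x. (f x)\<^sup>2 \<partial>M)) \<and>
     (\<forall>t\<ge>0. \<forall>f \<in> L2 M. \<forall>g \<in> L2 M. \<forall>a b.
        AE x in M. T t (\<lambda>y. a * f y + b * g y) x = a * T t f x + b * T t g x) \<and>
     (\<forall>f \<in> L2 M. AE x in M. T 0 f x = f x) \<and>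
     (\<forall>s\<ge>0. \<forall>t\<ge>0. \<forall>f \<in> L2 M. AE x in M. T (s + t) f x = T s (T t f) x) \<and>
     (\<forall>f \<in> L2 M. ((\<lambda>t. \<integral>x. (T t f x - f x)\<^sup>2 \<partial>M) \<longlongrightarrow> 0) (at_right 0)) \<and>
     (\<forall>u \<in> L2 M. \<forall>w \<in> L2 M. form_operator D u w \<longleftrightarrow>
        ((\<lambda>t. \<integral>x. ((T t u x - u x) / t + w x)\<^sup>2 \<partial>M) \<longlongrightarrow> 0) (at_right 0)))"

definition L2_semigroup :: "'a form_space \<Rightarrow> real \<Rightarrow> ('a \<Rightarrow> real) \<Rightarrow> 'a \<Rightarrow> real" where
  "L2_semigroup D = (SOME T. is_L2_semigroup D T)"

text \<open>
  The consistent extension to all \<open>L\<^sup>q\<close>: for nonnegative f, the a.e. limit along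
  square integrable functions increasing to f (independent of the sequence, since the
  semigroup is positivity preserving); in general, by splitting f into positive and negative
  part. On \<open>L\<^sup>\<infinity>\<close> this is the adjoint of the semigroup on \<open>L\<^sup>1\<close>.
\<close>

definition heat_nonneg :: "'a form_space \<Rightarrow> real \<Rightarrow> ('a \<Rightarrow> real) \<Rightarrow> 'a \<Rightarrow> real" where
  "heat_nonneg D t f = (SOME u. u \<in> borel_measurable (fs_meas D) \<and>
     (\<exists>fs :: nat \<Rightarrow> 'a \<Rightarrow> real. (\<forall>n. fs n \<in> L2 (fs_meas D)) \<and>
        (AE x in fs_meas D. (\<forall>n. 0 \<le> fs n x) \<and> incseq (\<lambda>n. fs n x) \<and>
           (\<lambda>n. fs n x) \<longlonglongrightarrow> f x) \<and>
        (AE x in fs_meas D. (\<lambda>n. L2_semigroup D t (fs n) x) \<longlonglongrightarrow> u x)))"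

definition heat :: "'a form_space \<Rightarrow> real \<Rightarrow> ('a \<Rightarrow> real) \<Rightarrow> 'a \<Rightarrow> real" where
  "heat D t f = (\<lambda>x. heat_nonneg D t (\<lambda>y. max (f y) 0) x - heat_nonneg D t (\<lambda>y. max (- f y) 0) x)"

definition ultracontractive :: "'a form_space \<Rightarrow> bool" where
  "ultracontractive D \<longleftrightarrow> (\<forall>t>0. \<forall>f \<in> L1 (fs_meas D). heat D t f \<in> Linf (fs_meas D))"

text \<open>
  Pointwise statements refer to the continuous version of \<open>P\<^sub>t f\<close>, which is unique because m has
  full support.
\<close>

definition doubly_feller :: "'a form_space \<Rightarrow> bool" where
  "doubly_feller D \<longleftrightarrow>
     (\<forall>t\<ge>0. \<forall>f \<in> C0 (fs_top D). \<exists>u \<in> C0 (fs_top D). AE x in fs_meas D. u x = heat D t f x) \<and>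
     (\<forall>t>0. \<forall>f \<in> Linf (fs_meas D). \<exists>u \<in> Cont (fs_top D). AE x in fs_meas D. u x = heat D t f x) \<and>
     (\<forall>f \<in> C0 (fs_top D). \<forall>u :: real \<Rightarrow> 'a \<Rightarrow> real.
        (\<forall>t>0. u t \<in> Cont (fs_top D) \<and> (AE x in fs_meas D. u t x = heat D t f x)) \<longrightarrow>
        (\<forall>x \<in> topspace (fs_top D). ((\<lambda>t. u t x) \<longlongrightarrow> f x) (at_right 0)))"


section \<open>Energy measures and irreducibility\<close>

definition energy_bounded :: "'a form_space \<Rightarrow> ('a \<Rightarrow> real) \<Rightarrow> 'a measure" where
  "energy_bounded D f = (THE \<mu>. radon_measure (fs_top D) \<mu> \<and>
     (\<forall>\<phi> \<in> fs_dom D \<inter> Cc (fs_top D).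
        (\<integral>x. \<phi> x \<partial>\<mu>) =
          fs_form D f (\<lambda>x. \<phi> x * f x) - 1 / 2 * fs_form D (\<lambda>x. (f x)\<^sup>2) \<phi>))"

text \<open>Extension to F(X) by \<open>E\<^sub>1\<close>-continuity.\<close>

definition energy_dom :: "'a form_space \<Rightarrow> ('a \<Rightarrow> real) \<Rightarrow> 'a measure" where
  "energy_dom D f = (THE \<mu>. radon_measure (fs_top D) \<mu> \<and>
     (\<forall>fs :: nat \<Rightarrow> 'a \<Rightarrow> real.
        (\<forall>n. fs n \<in> fs_dom D \<inter> Linf (fs_meas D)) \<and> (\<lambda>n. E1_dist2 D (fs n) f) \<longlonglongrightarrow> 0 \<longrightarrow>
        (\<forall>\<phi> \<in> fs_dom D \<inter> Cc (fs_top D).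
           (\<lambda>n. \<integral>x. \<phi> x \<partial>energy_bounded D (fs n)) \<longlonglongrightarrow> (\<integral>x. \<phi> x \<partial>\<mu>))))"

text \<open>Extension to the local domain by locality.\<close>

definition energy_measure :: "'a form_space \<Rightarrow> ('a \<Rightarrow> real) \<Rightarrow> 'a measure" where
  "energy_measure D f = (THE \<mu>. radon_measure (fs_top D) \<mu> \<and>
     (\<forall>U. compactly_inside (fs_top D) U (topspace (fs_top D)) \<longrightarrow>
        (\<forall>h \<in> fs_dom D. (AE x in fs_meas D. x \<in> U \<longrightarrow> f x = h x) \<longrightarrow>
           (\<forall>B \<in> sets \<mu>. B \<subseteq> U \<longrightarrow> emeasure \<mu> B = emeasure (energy_dom D h) B))))"

definition irreducible_space :: "'a form_space \<Rightarrow> bool" where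
  "irreducible_space D \<longleftrightarrow> (\<forall>f \<in> dom_loc D.
     emeasure (energy_measure D f) (topspace (fs_top D)) = 0 \<longrightarrow>
     (\<exists>c. AE x in fs_meas D. f x = c))"


section \<open>Locally smoothing spaces and locally shift defective functions\<close>

definition locally_smoothing :: "'a form_space \<Rightarrow> bool" where
  "locally_smoothing D \<longleftrightarrow> (\<forall>U. compactly_inside (fs_top D) U (topspace (fs_top D)) \<longrightarrow>
     ultracontractive (restrict_form_space D U) \<and>
     (\<exists>U'. openin (fs_top D) U' \<and> U \<subseteq> U' \<and> U' - fs_top D closure_of U \<noteq> {} \<and>
        doubly_feller (restrict_form_space D U') \<and> irreducible_space (restrict_form_space D U')))"

definition locally_shift_defective :: "'a form_space \<Rightarrow> real \<Rightarrow> ('a \<Rightarrow> real) \<Rightarrow> bool" where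
  "locally_shift_defective D lam f \<longleftrightarrow> f \<in> L1_loc D \<and>
     (\<forall>U. compactly_inside (fs_top D) U (topspace (fs_top D)) \<longrightarrow>
        (let DU = restrict_form_space D U in
           \<exists>g \<in> Cb (fs_top DU). weakly_harmonic DU lam g \<and>
             (\<forall>t>0. AE x in fs_meas DU.
                exp (- t * lam) * heat DU t (\<lambda>y. f y - g y) x \<ge> f x - g x)))"

end

theory Submission
  imports Defs "HOL-Library.Function_Algebras"
begin

text \<open>
  Let V be a relatively compact neighbourhood of the closure of U, and let g be weakly
  \<open>lam\<close>-harmonic with the shift inequality for f on V. By ultracontractivity \<open>k = C - (f - g)\<close>
  is nonnegative for some \<open>C \<ge> 0\<close> (with \<open>C = 0\<close> if \<open>lam > 0\<close>), and the shift inequality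
  makes k supermedian for \<open>e\<^sup>-\<^sup>l\<^sup>a\<^sup>m\<^sup>t P\<^sub>t\<close> on V. Supermedian functions are stable under
  sums, minima and shrinking V. Let \<open>v = lam (H + lam)\<^sup>-\<^sup>1 1\<close> on U, so that \<open>1 - v\<close> is weakly
  \<open>lam\<close>-harmonic on U with boundary value 1. By the maximum principle \<open>K (1 - v) - g\<close> is
  nonnegative and supermedian on U for all large K, hence so is \<open>K (1 - v) - f\<close>. Thus
  \<open>K (1 - v)\<close> is a harmonic function that works for all defective functions at the same time,
  and maxima of defective functions correspond to minima of supermedian functions.
  If \<open>f \<ge> 0\<close> and \<open>lam > 0\<close>, the maximum principle, applied to resolvent approximations of k,
  shows that \<open>K - f\<close> is supermedian for \<open>P\<^sub>t\<close>.

  The remaining point is the continuity of v. On a doubly Feller set W that contains the closure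
  of U, resolvents of bounded functions are continuous. Solving \<open>(H + b) v\<^sub>b = (b - lam) v + lam 1\<^sub>U\<close>
  on W gives continuous functions, and \<open>v\<^sub>b - v\<close> is b-harmonic on U and bounded by 1. A barrier
  built from resolvents shows that it is small near any given point of U if b is large.
\<close>

section \<open>Inner product spaces on a carrier\<close>

text \<open>Three objects in the statement are chosen by \<open>SOME\<close>: the semigroup on
  square integrable functions, its extension to integrable functions, and the value of the form on
  local functions. Before anything can be said about them, witnesses are needed. The semigroup is
  therefore constructed from resolvents by an implicit Euler scheme, and the Euler formula is then
  proved for every semigroup with the same generator, in particular for the chosen one. By this
  formula order properties pass from resolvents, to which the maximum principle applies, to
  semigroups.

  The definition of defectiveness allows a different harmonic function for each f, so two shift
  inequalities on the same set cannot simply be combined. Moreover, a harmonic g has no prescribed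
  behaviour at the boundary; only after shrinking V to U does it have a representative in the form
  domain. For \<open>lam > 0\<close> constants are not harmonic, which is why \<open>1 - v\<close>
  takes their place. The boundary of U is arbitrary, so v need not be continuous up to it.
  Continuity is shown at one point of U at a time, by a barrier that beats a fixed error at the
  boundary.\<close>

lemma nonneg_quadratic_discriminant:
  fixes a b c :: real
  assumes q: "\<And>t. 0 \<le> a + 2 * t * b + t\<^sup>2 * c" and c: "0 \<le> c"
  shows "b\<^sup>2 \<le> a * c"
proof (cases "c = 0")
  case True
  have "b = 0"
  proof (rule ccontr)
    assume "b \<noteq> 0"
    then show False using q[of "- (a + 1) / (2 * b)"] True by (simp add: field_simps)
  qed
  then show ?thesis using True by simp
next
  case False
  then have "0 < c" using c by simp
  then show ?thesis using q[of "- b / c"] by (simp add: field_simps power2_eq_square)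
qed

text \<open>The product is only semidefinite, and the vectors form a carrier instead of a type: on
  functions that are not identified a.e., neither \<open>ip2\<close> nor the form nor their sum is
  definite in general, and they are used side by side on different subspaces.\<close>

locale ip_space =
  fixes S :: "'v::real_vector set" and ip :: "'v \<Rightarrow> 'v \<Rightarrow> real"
  assumes subspace_S: "subspace S"
    and ip_add_left: "\<lbrakk>x \<in> S; y \<in> S; z \<in> S\<rbrakk> \<Longrightarrow> ip (x + y) z = ip x z + ip y z"
    and ip_scale_left: "\<lbrakk>x \<in> S; z \<in> S\<rbrakk> \<Longrightarrow> ip (c *\<^sub>R x) z = c * ip x z"
    and ip_sym: "\<lbrakk>x \<in> S; y \<in> S\<rbrakk> \<Longrightarrow> ip x y = ip y x"
    and ip_nonneg: "x \<in> S \<Longrightarrow> 0 \<le> ip x x"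
begin

definition nrm :: "'v \<Rightarrow> real" where "nrm x = sqrt (ip x x)"

lemma S_add [simp, intro]: "\<lbrakk>x \<in> S; y \<in> S\<rbrakk> \<Longrightarrow> x + y \<in> S"
  by (simp add: subspace_S subspace_add)

lemma S_scale [simp, intro]: "x \<in> S \<Longrightarrow> c *\<^sub>R x \<in> S"
  by (simp add: subspace_S subspace_mul)

lemma S_diff [simp, intro]: "\<lbrakk>x \<in> S; y \<in> S\<rbrakk> \<Longrightarrow> x - y \<in> S"
  by (simp add: subspace_S subspace_diff)

lemma S_uminus [simp, intro]: "x \<in> S \<Longrightarrow> - x \<in> S"
  by (simp add: subspace_S subspace_neg)

lemma S_0 [simp, intro]: "0 \<in> S"
  by (simp add: subspace_S subspace_0)

lemma ip_add_right: "\<lbrakk>x \<in> S; y \<in> S; z \<in> S\<rbrakk> \<Longrightarrow> ip z (x + y) = ip z x + ip z y"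
  by (simp add: ip_sym[of z] ip_add_left)

lemma ip_scale_right: "\<lbrakk>x \<in> S; z \<in> S\<rbrakk> \<Longrightarrow> ip z (c *\<^sub>R x) = c * ip z x"
  by (simp add: ip_sym[of z] ip_scale_left)

lemma ip_uminus_left: "\<lbrakk>x \<in> S; z \<in> S\<rbrakk> \<Longrightarrow> ip (- x) z = - ip x z"
  using ip_scale_left[of x z "-1"] by simp

lemma ip_uminus_right: "\<lbrakk>x \<in> S; z \<in> S\<rbrakk> \<Longrightarrow> ip z (- x) = - ip z x"
  using ip_scale_right[of x z "-1"] by simp

lemma ip_diff_left: "\<lbrakk>x \<in> S; y \<in> S; z \<in> S\<rbrakk> \<Longrightarrow> ip (x - y) z = ip x z - ip y z"
  using ip_add_left[of x "- y" z] by (simp add: ip_uminus_left)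

lemma ip_diff_right: "\<lbrakk>x \<in> S; y \<in> S; z \<in> S\<rbrakk> \<Longrightarrow> ip z (x - y) = ip z x - ip z y"
  using ip_add_right[of x "- y" z] by (simp add: ip_uminus_right)

lemma ip_0_left [simp]: "z \<in> S \<Longrightarrow> ip 0 z = 0"
  using ip_scale_left[of 0 z 0] by simp

lemma ip_0_right [simp]: "z \<in> S \<Longrightarrow> ip z 0 = 0"
  using ip_scale_right[of 0 z 0] by simp

lemmas ip_simps = ip_add_left ip_add_right ip_diff_left ip_diff_right ip_scale_left
  ip_scale_right ip_uminus_left ip_uminus_right

lemma nrm_ge_0 [simp]: "x \<in> S \<Longrightarrow> 0 \<le> nrm x"
  by (simp add: nrm_def ip_nonneg)

lemma nrm_0 [simp]: "nrm 0 = 0"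
  using ip_0_left[of 0] by (simp add: nrm_def)

lemma nrm_sq: "x \<in> S \<Longrightarrow> (nrm x)\<^sup>2 = ip x x"
  by (simp add: nrm_def ip_nonneg)

lemma nrm_scale: "x \<in> S \<Longrightarrow> nrm (c *\<^sub>R x) = \<bar>c\<bar> * nrm x"
  using real_sqrt_mult[of "c\<^sup>2" "ip x x"]
  by (simp add: nrm_def ip_simps power2_eq_square mult.assoc)

lemma nrm_uminus [simp]: "x \<in> S \<Longrightarrow> nrm (- x) = nrm x"
  using nrm_scale[of x "-1"] by simp

lemma nrm_minus_commute: "\<lbrakk>x \<in> S; y \<in> S\<rbrakk> \<Longrightarrow> nrm (x - y) = nrm (y - x)"
  using nrm_uminus[of "x - y"] by simp

lemma ip_expand: "\<lbrakk>x \<in> S; y \<in> S\<rbrakk> \<Longrightarrow>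
  ip (x + t *\<^sub>R y) (x + t *\<^sub>R y) = ip x x + 2 * t * ip x y + t\<^sup>2 * ip y y"
  by (simp add: ip_simps ip_sym[of y x] power2_eq_square algebra_simps)

lemma Cauchy_Schwarz: assumes "x \<in> S" "y \<in> S" shows "\<bar>ip x y\<bar> \<le> nrm x * nrm y"
proof -
  have q: "0 \<le> ip x x + 2 * t * ip x y + t\<^sup>2 * ip y y" for t
    using assms ip_nonneg[of "x + t *\<^sub>R y"] by (simp add: ip_expand)
  have "(ip x y)\<^sup>2 \<le> ip x x * ip y y"
    using nonneg_quadratic_discriminant[OF q ip_nonneg[OF assms(2)]] .
  then have "sqrt ((ip x y)\<^sup>2) \<le> sqrt (ip x x * ip y y)" by (rule real_sqrt_le_mono)
  then show ?thesis by (simp add: nrm_def real_sqrt_mult)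
qed

lemma nrm_triangle: assumes "x \<in> S" "y \<in> S" shows "nrm (x + y) \<le> nrm x + nrm y"
proof -
  have "(nrm (x + y))\<^sup>2 = (nrm x)\<^sup>2 + 2 * ip x y + (nrm y)\<^sup>2"
    using assms ip_expand[of x y 1] by (simp add: nrm_sq)
  also have "\<dots> \<le> (nrm x + nrm y)\<^sup>2"
    using Cauchy_Schwarz[OF assms] by (simp add: power2_eq_square algebra_simps)
  finally show ?thesis
    by (rule power2_le_imp_le) (use assms in simp)
qed

lemma nrm_triangle_diff: "\<lbrakk>x \<in> S; y \<in> S\<rbrakk> \<Longrightarrow> nrm (x - y) \<le> nrm x + nrm y"
  using nrm_triangle[of x "- y"] by simp

lemma nrm_triangle3: "\<lbrakk>x \<in> S; y \<in> S; z \<in> S\<rbrakk> \<Longrightarrow> nrm (x - z) \<le> nrm (x - y) + nrm (y - z)"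
  using nrm_triangle[of "x - y" "y - z"] by simp

lemma nrm_le_diff: "\<lbrakk>x \<in> S; y \<in> S\<rbrakk> \<Longrightarrow> nrm x \<le> nrm y + nrm (x - y)"
  using nrm_triangle[of y "x - y"] by simp

lemma parallelogram: "\<lbrakk>x \<in> S; y \<in> S\<rbrakk> \<Longrightarrow>
  ip (x - y) (x - y) = 2 * ip x x + 2 * ip y y
    - 4 * ip ((1/2) *\<^sub>R (x + y)) ((1/2) *\<^sub>R (x + y))"
  by (simp add: ip_simps ip_sym[of y x] field_simps)

definition lim_to :: "(nat \<Rightarrow> 'v) \<Rightarrow> 'v \<Rightarrow> bool" where
  "lim_to f l \<longleftrightarrow> (\<lambda>n. nrm (f n - l)) \<longlonglongrightarrow> 0"

definition cauchy :: "(nat \<Rightarrow> 'v) \<Rightarrow> bool" where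
  "cauchy f \<longleftrightarrow> (\<forall>e>0. \<exists>N. \<forall>m\<ge>N. \<forall>n\<ge>N. nrm (f m - f n) < e)"

lemma lim_to_add:
  assumes "\<And>n. f n \<in> S" "\<And>n. g n \<in> S" "l \<in> S" "k \<in> S" "lim_to f l" "lim_to g k"
  shows "lim_to (\<lambda>n. f n + g n) (l + k)"
  unfolding lim_to_def
proof (rule tendsto_sandwich[OF _ _ tendsto_const])
  show "(\<lambda>n. nrm (f n - l) + nrm (g n - k)) \<longlonglongrightarrow> 0"
    using assms(5,6) unfolding lim_to_def by (rule tendsto_add_zero)
  show "\<forall>\<^sub>F n in sequentially. nrm (f n + g n - (l + k)) \<le> nrm (f n - l) + nrm (g n - k)"
  proof (intro always_eventually allI)
    fix n
    show "nrm (f n + g n - (l + k)) \<le> nrm (f n - l) + nrm (g n - k)"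
      using nrm_triangle[of "f n - l" "g n - k"] assms(1-4) by (simp add: add_diff_add)
  qed
qed (use assms in simp)

lemma lim_to_scale:
  assumes "\<And>n. f n \<in> S" "l \<in> S" "lim_to f l"
  shows "lim_to (\<lambda>n. c *\<^sub>R f n) (c *\<^sub>R l)"
proof -
  have "nrm (c *\<^sub>R f n - c *\<^sub>R l) = \<bar>c\<bar> * nrm (f n - l)" for n
    using nrm_scale[of "f n - l" c] assms by (simp add: scaleR_diff_right)
  then show ?thesis using assms(3) unfolding lim_to_def by (auto intro: tendsto_mult_right_zero)
qed

lemma lim_to_ip:
  assumes "\<And>n. f n \<in> S" "l \<in> S" "lim_to f l" "a \<in> S"
  shows "(\<lambda>n. ip (f n) a) \<longlonglongrightarrow> ip l a"
proof (rule LIM_zero_cancel, rule Lim_null_comparison)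
  show "\<forall>\<^sub>F n in sequentially. norm (ip (f n) a - ip l a) \<le> nrm (f n - l) * nrm a"
    using Cauchy_Schwarz[OF _ assms(4)] assms
    by (intro always_eventually) (simp flip: ip_diff_left)
  show "(\<lambda>n. nrm (f n - l) * nrm a) \<longlonglongrightarrow> 0"
    using assms(3) unfolding lim_to_def by (rule tendsto_mult_left_zero)
qed

lemma lim_to_nrm:
  assumes "\<And>n. f n \<in> S" "l \<in> S" "lim_to f l"
  shows "(\<lambda>n. nrm (f n)) \<longlonglongrightarrow> nrm l"
proof (rule LIM_zero_cancel, rule Lim_null_comparison)
  show "\<forall>\<^sub>F n in sequentially. norm (nrm (f n) - nrm l) \<le> nrm (f n - l)"
  proof (intro always_eventually allI)
    fix n
    show "norm (nrm (f n) - nrm l) \<le> nrm (f n - l)"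
      using nrm_le_diff[of "f n" l] nrm_le_diff[of l "f n"] nrm_minus_commute[of l "f n"] assms(1,2)
      by (simp add: abs_le_iff)
  qed
  show "(\<lambda>n. nrm (f n - l)) \<longlonglongrightarrow> 0"
    using assms(3) unfolding lim_to_def .
qed

lemma lim_to_unique_nrm:
  assumes "\<And>n. f n \<in> S" "l \<in> S" "k \<in> S" "lim_to f l" "lim_to f k"
  shows "nrm (l - k) = 0"
proof -
  have "(\<lambda>n. nrm (f n - l) + nrm (f n - k)) \<longlonglongrightarrow> 0"
    using assms(4,5) unfolding lim_to_def by (rule tendsto_add_zero)
  moreover have "nrm (l - k) \<le> nrm (f n - l) + nrm (f n - k)" for n
    using nrm_triangle3[of l "f n" k] assms by (simp add: nrm_minus_commute[of l])
  ultimately have "nrm (l - k) \<le> 0"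
    by (meson LIMSEQ_le_const)
  then show ?thesis using nrm_ge_0[OF S_diff[OF assms(2,3)]] by simp
qed

lemma cauchy_from_sq:
  assumes "\<And>n. f n \<in> S" "\<And>m n. m \<le> n \<Longrightarrow> ip (f m - f n) (f m - f n) \<le> b m" "b \<longlonglongrightarrow> 0"
  shows "cauchy f"
  unfolding cauchy_def
proof (intro allI impI)
  fix e :: real assume e: "e > 0"
  then have "e\<^sup>2 > 0" by simp
  then obtain N where N: "\<And>n. n \<ge> N \<Longrightarrow> \<bar>b n\<bar> < e\<^sup>2"
    using LIMSEQ_D[OF assms(3), of "e\<^sup>2"] by auto
  have *: "nrm (f m - f n) < e" if "m \<ge> N" "m \<le> n" for m n
  proof -
    have "(nrm (f m - f n))\<^sup>2 < e\<^sup>2"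
      using assms(2)[OF that(2)] N[OF that(1)] assms(1) by (simp add: nrm_sq)
    then show ?thesis using e by (simp add: power_less_imp_less_base)
  qed
  have "nrm (f m - f n) < e" if "m \<ge> N" "n \<ge> N" for m n
    using *[of m n] *[of n m] that nrm_minus_commute[OF assms(1)[of m] assms(1)[of n]]
    by (cases "m \<le> n") auto
  then show "\<exists>N. \<forall>m\<ge>N. \<forall>n\<ge>N. nrm (f m - f n) < e" by blast
qed

end

locale complete_ip_space = ip_space +
  assumes complete_S: "\<lbrakk>\<And>n. f n \<in> S; cauchy f\<rbrakk> \<Longrightarrow> \<exists>l\<in>S. lim_to f l"
begin

text \<open>A minimising sequence of \<open>Q\<close> is Cauchy by the parallelogram law, and the
  first variation of \<open>Q\<close> at its limit is the equation. As \<open>ip\<close> is only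
  semidefinite, \<open>u\<close> is determined up to a vector of norm 0.\<close>

theorem Riesz_representation:
  assumes add: "\<And>x y. \<lbrakk>x \<in> S; y \<in> S\<rbrakk> \<Longrightarrow> l (x + y) = l x + l y"
    and scale: "\<And>c x. x \<in> S \<Longrightarrow> l (c *\<^sub>R x) = c * l x"
    and bound: "\<And>x. x \<in> S \<Longrightarrow> \<bar>l x\<bar> \<le> B * nrm x"
  obtains u where "u \<in> S" "\<And>v. v \<in> S \<Longrightarrow> ip u v = l v"
proof -
  define Q where "Q x = ip x x - 2 * l x" for x
  define d where "d = Inf (Q ` S)"
  have lower: "- B\<^sup>2 \<le> Q x" if "x \<in> S" for x
  proof -
    have "2 * l x \<le> 2 * (B * nrm x)" using bound[OF that] by simp
    also have "\<dots> \<le> B\<^sup>2 + (nrm x)\<^sup>2"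
      using sum_squares_bound[of B "nrm x"] by simp
    finally show ?thesis using that by (simp add: Q_def nrm_sq)
  qed
  have bdd: "bdd_below (Q ` S)" using lower by (intro bdd_belowI[of _ "- B\<^sup>2"]) auto
  have d_le: "d \<le> Q x" if "x \<in> S" for x
    unfolding d_def by (rule cINF_lower[OF bdd that])
  have "\<forall>n. \<exists>x. x \<in> S \<and> Q x < d + 1 / Suc n"
  proof
    fix n
    have "\<exists>y\<in>Q ` S. y < d + 1 / Suc n"
      unfolding d_def using S_0 by (intro cInf_lessD) (auto simp: add_pos_pos)
    then show "\<exists>x. x \<in> S \<and> Q x < d + 1 / Suc n" by auto
  qed
  from choice[OF this] obtain f where f: "\<And>n. f n \<in> S" "\<And>n. Q (f n) < d + 1 / Suc n" by blast
  have par: "ip (x - y) (x - y) \<le> 2 * (Q x - d) + 2 * (Q y - d)" if "x \<in> S" "y \<in> S" for x y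
  proof -
    have "ip (x - y) (x - y) = 2 * Q x + 2 * Q y - 4 * Q ((1/2) *\<^sub>R (x + y))"
      using that by (simp add: parallelogram Q_def add scale field_simps)
    then show ?thesis using d_le[of "(1/2) *\<^sub>R (x + y)"] that by simp
  qed
  have "cauchy f"
  proof (rule cauchy_from_sq[where b = "\<lambda>m. 4 / Suc m"])
    fix m n :: nat assume "m \<le> n"
    then have "1 / real (Suc n) \<le> 1 / Suc m" by (simp add: field_simps)
    then show "ip (f m - f n) (f m - f n) \<le> 4 / Suc m"
      using par[OF f(1)[of m] f(1)[of n]] f(2)[of m] f(2)[of n] by simp
  next
    show "(\<lambda>m. 4 / real (Suc m)) \<longlonglongrightarrow> 0"
      by (rule LIMSEQ_Suc) (rule lim_const_over_n)
  qed (use f in auto)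
  then obtain u where u: "u \<in> S" "lim_to f u" using complete_S f(1) by blast
  have "(\<lambda>n. Q (f n)) \<longlonglongrightarrow> Q u"
  proof -
    have "(\<lambda>n. (nrm (f n))\<^sup>2) \<longlonglongrightarrow> (nrm u)\<^sup>2"
      using lim_to_nrm[OF f(1) u] by (rule tendsto_power)
    moreover have "(\<lambda>n. l (f n)) \<longlonglongrightarrow> l u"
    proof (rule LIM_zero_cancel, rule Lim_null_comparison)
      have eq: "l (f n - u) = l (f n) - l u" for n
        using add[of "f n" "- u"] scale[of u "-1"] f(1) u(1) by simp
      show "\<forall>\<^sub>F n in sequentially. norm (l (f n) - l u) \<le> B * nrm (f n - u)"
        using bound f(1) u(1) by (simp flip: eq)
      show "(\<lambda>n. B * nrm (f n - u)) \<longlonglongrightarrow> 0"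
        using u(2) unfolding lim_to_def by (rule tendsto_mult_right_zero)
    qed
    ultimately show ?thesis
      unfolding Q_def using f(1) u(1) by (simp add: nrm_sq) (intro tendsto_intros)
  qed
  moreover have "(\<lambda>n. d + 1 / real (Suc n)) \<longlonglongrightarrow> d + 0"
    by (intro tendsto_intros LIMSEQ_Suc lim_const_over_n)
  ultimately have "Q u \<le> d + 0"
    using less_imp_le[OF f(2)] by (intro LIMSEQ_le[of "\<lambda>n. Q (f n)"]) blast+
  then have min: "Q u \<le> Q x" if "x \<in> S" for x using d_le[OF that] by simp
  have "ip u v = l v" if v: "v \<in> S" for v
  proof -
    define r where "r = ip u v - l v"
    have *: "0 \<le> 2 * t * r + t\<^sup>2 * ip v v" for t
      using min[of "u + t *\<^sub>R v"] u(1) v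
      by (simp add: Q_def ip_expand add scale r_def algebra_simps)
    have "r = 0"
    proof (rule ccontr)
      assume r: "r \<noteq> 0"
      \<comment> \<open>The 1 keeps \<open>k\<close> positive when \<open>ip v v = 0\<close>; with
        \<open>t = - r / k\<close> the linear term outweighs the quadratic one.\<close>
      define k where "k = 1 + ip v v"
      have k: "k > 0" using ip_nonneg[OF v] by (simp add: k_def)
      have "0 \<le> 2 * (- r / k) * r + (- r / k)\<^sup>2 * (k - 1)"
        using *[of "- r / k"] by (simp add: k_def)
      also have "\<dots> = - (r\<^sup>2 * (k + 1) / k\<^sup>2)"
        using k by (simp add: divide_simps power2_eq_square) (simp add: algebra_simps)
      also have "\<dots> < 0" using k r by simp
      finally show False by simp
    qed
    then show ?thesis by (simp add: r_def)
  qed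
  with u(1) show ?thesis by (rule that)
qed

text \<open>A Banach--Saks type substitute for weak compactness: the elements of almost minimal norm
  in decreasing convex sets form a Cauchy sequence.\<close>

lemma decreasing_convex_limit:
  fixes C :: "nat \<Rightarrow> 'a set"
  assumes C: "\<And>n. C n \<subseteq> S" "\<And>m n. m \<le> n \<Longrightarrow> C n \<subseteq> C m"
    and mid: "\<And>n x y. \<lbrakk>x \<in> C n; y \<in> C n\<rbrakk> \<Longrightarrow> (1/2) *\<^sub>R (x + y) \<in> C n"
    and bounded: "\<And>n. \<exists>x\<in>C n. ip x x \<le> B"
  obtains c f where "c \<in> S" "\<And>n. f n \<in> C n" "lim_to f c"
proof -
  define d where "d n = Inf ((\<lambda>x. ip x x) ` C n)" for n
  have bdd: "bdd_below ((\<lambda>x. ip x x) ` C n)" for n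
    using C(1)[of n] by (intro bdd_belowI[of _ 0]) (auto intro: ip_nonneg)
  have d_le: "d n \<le> ip x x" if "x \<in> C n" for x n
    unfolding d_def by (rule cINF_lower[OF bdd that])
  have "\<forall>n. \<exists>x. x \<in> C n \<and> ip x x < d n + 1 / Suc n"
  proof
    fix n
    have "\<exists>y\<in>(\<lambda>x. ip x x) ` C n. y < d n + 1 / Suc n"
      unfolding d_def using bounded by (intro cInf_lessD) (auto simp: add_pos_pos)
    then show "\<exists>x. x \<in> C n \<and> ip x x < d n + 1 / Suc n" by auto
  qed
  from choice[OF this] obtain f where f: "\<And>n. f n \<in> C n" "\<And>n. ip (f n) (f n) < d n + 1 / Suc n"
    by blast
  have mono: "d m \<le> d n" if "m \<le> n" for m n
    unfolding d_def using C(2)[OF that] bdd bounded by (intro cInf_superset_mono) auto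
  have "d n \<le> B" for n using bounded[of n] d_le[of _ n] by force
  then have "\<forall>i. d i \<le> B" by blast
  moreover have "incseq d" using mono by (simp add: incseq_def)
  ultimately obtain L where L: "d \<longlonglongrightarrow> L" "\<forall>i. d i \<le> L"
    using incseq_convergent by blast
  \<comment> \<open>The midpoint of \<open>f m\<close> and \<open>f n\<close> lies in
    \<open>C m\<close>, so its squared norm is at least \<open>d m\<close>. The parallelogram law
    then bounds the distance by the gap between \<open>d m\<close> and the limit
    \<open>L\<close>.\<close>
  have "cauchy f"
  proof (rule cauchy_from_sq[where b = "\<lambda>m. 2 * (L - d m) + 4 / Suc m"])
    fix m n :: nat assume mn: "m \<le> n"
    then have "1 / real (Suc n) \<le> 1 / Suc m" by (simp add: field_simps)
    moreover have "d m \<le> ip ((1/2) *\<^sub>R (f m + f n)) ((1/2) *\<^sub>R (f m + f n))"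
      using C(2)[OF mn] f(1) by (intro d_le mid) auto
    moreover have "f m \<in> S" "f n \<in> S" using C(1) f(1) by blast+
    ultimately show "ip (f m - f n) (f m - f n) \<le> 2 * (L - d m) + 4 / Suc m"
      using f(2)[of m] f(2)[of n] spec[OF L(2), of n] parallelogram[of "f m" "f n"] by simp
  next
    have "(\<lambda>m. 2 * (L - d m) + 4 / real (Suc m)) \<longlonglongrightarrow> 2 * (L - L) + 0"
      by (intro tendsto_intros L LIMSEQ_Suc lim_const_over_n)
    then show "(\<lambda>m. 2 * (L - d m) + 4 / real (Suc m)) \<longlonglongrightarrow> 0" by simp
  qed (use f C in auto)
  moreover have "f n \<in> S" for n using C(1) f(1) by blast
  ultimately obtain c where "c \<in> S" "lim_to f c" using complete_S by blast
  then show ?thesis using f(1) that by blast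
qed

end

section \<open>Closed forms and their semigroups\<close>

text \<open>Closedness of the form is completeness of its domain for \<open>E + ip\<close>. Unlike
  in \<open>ip_space\<close>, the base product is definite, so that resolvents and semigroups
  satisfy equations and not merely identities up to null vectors.\<close>

locale closed_form_space = complete_ip_space S ip
  for S :: "'v::real_vector set" and ip +
  fixes F :: "'v set" and E :: "'v \<Rightarrow> 'v \<Rightarrow> real"
  assumes definite: "\<lbrakk>x \<in> S; ip x x = 0\<rbrakk> \<Longrightarrow> x = 0"
    and F_sub: "subspace F" "F \<subseteq> S"
    and dense: "\<lbrakk>x \<in> S; 0 < e\<rbrakk> \<Longrightarrow> \<exists>u\<in>F. nrm (x - u) < e"
    and form: "ip_space F E"
    and closed: "complete_ip_space F (\<lambda>u v. E u v + ip u v)"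
begin

sublocale E: ip_space F E by (rule form)

lemma F_S [simp, intro]: "u \<in> F \<Longrightarrow> u \<in> S"
  using F_sub by auto

lemma nrm_eq_0: "x \<in> S \<Longrightarrow> nrm x = 0 \<Longrightarrow> x = 0"
  using definite by (simp add: nrm_def)

lemma eq_if_nrm: "\<lbrakk>x \<in> S; y \<in> S; nrm (x - y) \<le> 0\<rbrakk> \<Longrightarrow> x = y"
  using nrm_eq_0[of "x - y"] nrm_ge_0[of "x - y"] by fastforce

lemma lim_to_unique:
  "\<lbrakk>\<And>n. f n \<in> S; l \<in> S; k \<in> S; lim_to f l; lim_to f k\<rbrakk> \<Longrightarrow> l = k"
  using lim_to_unique_nrm[of f l k] by (simp add: eq_if_nrm)

text \<open>Riesz representation for \<open>ip + h * E\<close>. This product is complete because its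
  norm is equivalent to that of \<open>E + ip\<close>; \<open>c\<close> and \<open>c'\<close> are
  the constants of the equivalence.\<close>

lemma resolvent_exists:
  assumes f: "f \<in> S" and h: "0 < h"
  shows "\<exists>u\<in>F. \<forall>v\<in>F. ip u v + h * E u v = ip f v"
proof -
  interpret E1: complete_ip_space F "\<lambda>u v. E u v + ip u v" by (rule closed)
  have Eip: "ip_space F (\<lambda>u v. ip u v + h * E u v)"
    using h by unfold_locales
      (auto simp: F_sub(1) ip_simps E.ip_simps E.ip_sym ip_sym algebra_simps
        intro!: add_nonneg_nonneg mult_nonneg_nonneg E.ip_nonneg ip_nonneg)
  interpret Eh: ip_space F "\<lambda>u v. ip u v + h * E u v" by (rule Eip)
  define c where "c = min 1 h"
  have c: "0 < c" "c \<le> 1" "c \<le> h" using h by (auto simp: c_def)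
  have cmp: "E1.nrm x \<le> Eh.nrm x / sqrt c" if x: "x \<in> F" for x
  proof -
    have "c * (E x x + ip x x) \<le> ip x x + h * E x x"
      using c E.ip_nonneg[OF x] ip_nonneg[of x] x
        mult_right_mono[of c h "E x x"] mult_right_mono[of c 1 "ip x x"]
      by (simp add: algebra_simps)
    then have "sqrt (c * (E x x + ip x x)) \<le> sqrt (ip x x + h * E x x)" by (rule real_sqrt_le_mono)
    then have "sqrt c * E1.nrm x \<le> Eh.nrm x"
      by (simp add: E1.nrm_def Eh.nrm_def real_sqrt_mult)
    then show ?thesis using c by (simp add: pos_le_divide_eq mult.commute)
  qed
  define c' where "c' = max 1 h"
  have c': "1 \<le> c'" "h \<le> c'" by (auto simp: c'_def)
  have cmp': "Eh.nrm x \<le> sqrt c' * E1.nrm x" if x: "x \<in> F" for x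
  proof -
    have "ip x x + h * E x x \<le> c' * (E x x + ip x x)"
      using E.ip_nonneg[OF x] ip_nonneg[of x] x
        mult_right_mono[of h c' "E x x"] mult_right_mono[of 1 c' "ip x x"] c'
      by (simp add: algebra_simps)
    then have "sqrt (ip x x + h * E x x) \<le> sqrt (c' * (E x x + ip x x))" by (rule real_sqrt_le_mono)
    then show ?thesis
      by (simp add: E1.nrm_def Eh.nrm_def real_sqrt_mult)
  qed
  have "complete_ip_space F (\<lambda>u v. ip u v + h * E u v)"
  proof (intro complete_ip_space.intro[OF Eip] complete_ip_space_axioms.intro)
    fix g :: "nat \<Rightarrow> 'v" assume g: "\<And>n. g n \<in> F" "Eh.cauchy g"
    have "E1.cauchy g"
      unfolding E1.cauchy_def
    proof (intro allI impI)
      fix e :: real assume "0 < e"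
      then have "0 < sqrt c * e" using c by simp
      then obtain N where N: "\<And>m n. m \<ge> N \<Longrightarrow> n \<ge> N \<Longrightarrow> Eh.nrm (g m - g n) < sqrt c * e"
        using g(2) unfolding Eh.cauchy_def by meson
      have "E1.nrm (g m - g n) < e" if "m \<ge> N" "n \<ge> N" for m n
      proof -
        have "Eh.nrm (g m - g n) / sqrt c < e"
          using N[OF that] c by (simp add: pos_divide_less_eq mult.commute)
        then show ?thesis using cmp[of "g m - g n"] g(1) by simp
      qed
      then show "\<exists>N. \<forall>m\<ge>N. \<forall>n\<ge>N. E1.nrm (g m - g n) < e" by blast
    qed
    then obtain l where l: "l \<in> F" "E1.lim_to g l" using E1.complete_S g(1) by blast
    have "Eh.lim_to g l"
      unfolding Eh.lim_to_def
    proof (rule Lim_null_comparison)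
      show "\<forall>\<^sub>F n in sequentially. norm (Eh.nrm (g n - l)) \<le> sqrt c' * E1.nrm (g n - l)"
        using cmp' g(1) l(1) by (simp add: E.S_diff Eh.nrm_ge_0)
      show "(\<lambda>n. sqrt c' * E1.nrm (g n - l)) \<longlonglongrightarrow> 0"
        using l(2) unfolding E1.lim_to_def by (rule tendsto_mult_right_zero)
    qed
    with l(1) show "\<exists>l\<in>F. Eh.lim_to g l" by blast
  qed
  then interpret Eh: complete_ip_space F "\<lambda>u v. ip u v + h * E u v" .
  have "\<bar>ip f v\<bar> \<le> nrm f * Eh.nrm v" if v: "v \<in> F" for v
  proof -
    have "nrm v \<le> Eh.nrm v"
      using E.ip_nonneg[OF v] h by (simp add: nrm_def Eh.nrm_def)
    then show ?thesis
      using Cauchy_Schwarz[OF f, of v] v mult_left_mono[of "nrm v" "Eh.nrm v" "nrm f"] f by force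
  qed
  then obtain u where "u \<in> F" "\<And>v. v \<in> F \<Longrightarrow> ip u v + h * E u v = ip f v"
    using f by (rule_tac Eh.Riesz_representation[of "ip f" "nrm f"]) (auto simp: ip_simps)
  then show ?thesis by blast
qed

text \<open>\<open>J h = (1 + h H)\<^sup>-\<^sup>1\<close>, where H is the operator of the form.\<close>

definition J :: "real \<Rightarrow> 'v \<Rightarrow> 'v" where
  "J h f = (SOME u. u \<in> F \<and> (\<forall>v\<in>F. ip u v + h * E u v = ip f v))"

text \<open>The graph of the operator H of the form: \<open>w\<close> is the value of H at
  \<open>u\<close>.\<close>

definition op :: "'v \<Rightarrow> 'v \<Rightarrow> bool" where
  "op u w \<longleftrightarrow> u \<in> F \<and> w \<in> S \<and> (\<forall>v\<in>F. E u v = ip w v)"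

lemma J_spec:
  assumes "f \<in> S" "0 < h"
  shows J_F [simp]: "J h f \<in> F" and J_eq: "v \<in> F \<Longrightarrow> ip (J h f) v + h * E (J h f) v = ip f v"
  unfolding J_def using someI_ex[OF resolvent_exists[OF assms, unfolded Bex_def]] by auto

lemma J_S [simp]: "f \<in> S \<Longrightarrow> 0 < h \<Longrightarrow> J h f \<in> S"
  using F_S J_F by blast

lemma J_unique:
  assumes "f \<in> S" "0 < h" "u \<in> F" "\<And>v. v \<in> F \<Longrightarrow> ip u v + h * E u v = ip f v"
  shows "J h f = u"
proof -
  define d where "d = J h f - u"
  have d: "d \<in> F" using assms by (simp add: d_def E.S_diff)
  have "ip d d + h * E d d = 0"
    using J_eq[OF assms(1,2) d] assms(4)[OF d] assms(1-3) d
    by (simp add: d_def ip_diff_left E.ip_diff_left E.S_diff algebra_simps)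
  then have "ip d d = 0"
    using E.ip_nonneg[OF d] ip_nonneg[of d] d assms(2)
    by (smt (verit) F_S mult_nonneg_nonneg)
  then have "d = 0" using definite d by blast
  then show ?thesis by (simp add: d_def)
qed

lemma op_S: "op u w \<Longrightarrow> u \<in> S" and op_S': "op u w \<Longrightarrow> w \<in> S"
  by (auto simp: op_def)

lemma op_add: "op u w \<Longrightarrow> op u' w' \<Longrightarrow> op (u + u') (w + w')"
  by (auto simp: op_def ip_simps E.ip_simps)

lemma op_scale: "op u w \<Longrightarrow> op (c *\<^sub>R u) (c *\<^sub>R w)"
  by (auto simp: op_def ip_simps E.ip_simps)

lemma J_op_iff:
  assumes "f \<in> S" "0 < h"
  shows "J h f = u \<longleftrightarrow> op u ((1/h) *\<^sub>R (f - u))"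
proof
  assume "J h f = u"
  then show "op u ((1/h) *\<^sub>R (f - u))"
    using assms J_spec[OF assms] by (auto simp: op_def ip_simps field_simps)
next
  assume *: "op u ((1/h) *\<^sub>R (f - u))"
  then show "J h f = u"
    using assms by (intro J_unique) (auto simp: op_def ip_simps)
qed

lemma J_op: "\<lbrakk>f \<in> S; 0 < h\<rbrakk> \<Longrightarrow> op (J h f) ((1/h) *\<^sub>R (f - J h f))"
  using J_op_iff by blast

lemma J_of_op: "\<lbrakk>op u w; 0 < h\<rbrakk> \<Longrightarrow> J h (u + h *\<^sub>R w) = u"
  by (subst J_op_iff) (auto simp: op_S op_S')

lemma J_add: assumes "f \<in> S" "g \<in> S" "0 < h" shows "J h (f + g) = J h f + J h g"
proof (rule J_unique)
  fix v assume "v \<in> F"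
  then show "ip (J h f + J h g) v + h * E (J h f + J h g) v = ip (f + g) v"
    using J_eq[OF assms(1,3), of v] J_eq[OF assms(2,3), of v] assms
    by (simp add: ip_add_left E.ip_add_left distrib_left)
qed (use assms in auto)

lemma J_scale: assumes "f \<in> S" "0 < h" shows "J h (c *\<^sub>R f) = c *\<^sub>R J h f"
proof (rule J_unique)
  fix v assume v: "v \<in> F"
  have "ip (c *\<^sub>R J h f) v + h * E (c *\<^sub>R J h f) v = c * (ip (J h f) v + h * E (J h f) v)"
    using v assms by (simp add: ip_scale_left E.ip_scale_left distrib_left)
  then show "ip (c *\<^sub>R J h f) v + h * E (c *\<^sub>R J h f) v = ip (c *\<^sub>R f) v"
    using J_eq[OF assms v] v assms by (simp add: ip_scale_left)
qed (use assms in auto)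

lemma J_uminus: "\<lbrakk>f \<in> S; 0 < h\<rbrakk> \<Longrightarrow> J h (- f) = - J h f"
  using J_scale[of f h "-1"] by simp

lemma J_diff: "\<lbrakk>f \<in> S; g \<in> S; 0 < h\<rbrakk> \<Longrightarrow> J h (f - g) = J h f - J h g"
  using J_add[of f "- g" h] by (simp add: J_uminus)

lemma J_contraction: assumes "f \<in> S" "0 < h" shows "nrm (J h f) \<le> nrm f"
proof -
  let ?u = "J h f"
  have "(nrm ?u)\<^sup>2 + h * E ?u ?u = ip f ?u"
    using J_eq[OF assms J_F[OF assms]] assms by (simp add: nrm_sq)
  moreover have "0 \<le> h * E ?u ?u" using assms E.ip_nonneg[of ?u] by simp
  ultimately have "(nrm ?u)\<^sup>2 \<le> nrm f * nrm ?u"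
    using Cauchy_Schwarz[of f ?u] assms by simp
  then show ?thesis
    using nrm_ge_0[OF J_S[OF assms]] nrm_ge_0[OF assms(1)] mult_right_le_imp_le[of "nrm ?u" "nrm ?u" "nrm f"]
    by (cases "nrm ?u = 0") (auto simp: power2_eq_square)
qed

lemma J_symmetric: "\<lbrakk>f \<in> S; g \<in> S; 0 < h\<rbrakk> \<Longrightarrow> ip (J h f) g = ip f (J h g)"
  using J_eq[of f h "J h g"] J_eq[of g h "J h f"]
  by (simp add: ip_sym[of "J h f" g] ip_sym[of "J h g" "J h f"] E.ip_sym[of "J h g" "J h f"])

lemma J_op_commute: "\<lbrakk>op u w; 0 < h\<rbrakk> \<Longrightarrow> op (J h u) (J h w)"
proof -
  assume *: "op u w" "0 < h"
  have S: "u \<in> S" "w \<in> S" using op_S[OF *(1)] op_S'[OF *(1)] .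
  have "J h u + h *\<^sub>R J h w = u"
    using J_of_op[OF *] S *(2) by (simp add: J_add J_scale)
  then have "u - J h u = h *\<^sub>R J h w" by (metis add_diff_cancel_left')
  then have "J h w = (1/h) *\<^sub>R (u - J h u)" using *(2) by simp
  then show ?thesis using J_op[OF op_S[OF *(1)] *(2)] by simp
qed

lemma J_diff_le: assumes "op u w" "0 < h" shows "nrm (J h u - u) \<le> h * nrm w"
proof -
  have S: "u \<in> S" "w \<in> S" using assms op_S op_S' by auto
  have "J h u + h *\<^sub>R J h w = u"
    using J_of_op[OF assms] S assms(2) by (simp add: J_add J_scale)
  then have "J h u - u = - (h *\<^sub>R J h w)"
    by (metis add_diff_cancel_left' minus_diff_eq)
  then show ?thesis
    using J_contraction[OF S(2) assms(2)] S assms(2)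
    by (simp add: nrm_scale del: scaleR_minus_right flip: scaleR_minus_right)
qed

text \<open>For \<open>u\<close> in the form domain, the resolvent equation tested with
  \<open>u - J h u\<close> gives \<open>(nrm (J h u - u))^2 <= h * E u u\<close>. Density of the
  domain and contractivity of \<open>J h\<close> extend the convergence to \<open>S\<close>, though
  without a rate.\<close>

lemma J_approx:
  assumes f: "f \<in> S" and e: "0 < e"
  shows "\<exists>d>0. \<forall>h. 0 < h \<and> h < d \<longrightarrow> nrm (J h f - f) < e"
proof -
  obtain u where u: "u \<in> F" "nrm (f - u) < e / 4" using dense[OF f, of "e/4"] e by auto
  have small: "(nrm (J h u - u))\<^sup>2 \<le> h * E u u" if h: "0 < h" for h
  proof -
    define v where "v = J h u"
    have v: "v \<in> F" "u - v \<in> F" "v - u \<in> F" using u h by (auto simp: v_def E.S_diff)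
    have "ip v (u - v) + h * E v (u - v) = ip u (u - v)"
      unfolding v_def by (rule J_eq) (use u h v in \<open>auto simp: v_def\<close>)
    then have "ip (u - v) (u - v) = h * E v (u - v)"
      using u v by (simp add: ip_diff_left)
    also have "\<dots> = h * (E u (u - v) - E (u - v) (u - v))"
      using u v by (simp add: E.ip_diff_left)
    also have "\<dots> = h * (E u u - E u v - E (u - v) (u - v))"
      using u v by (simp add: E.ip_diff_right)
    also have "\<dots> \<le> h * E u u"
    proof -
      have "E (u - v) (u - v) = E u u - 2 * E u v + E v v"
        using u v by (simp add: E.ip_diff_left E.ip_diff_right E.ip_sym[of v u])
      then have "0 \<le> E u v + E (u - v) (u - v)"
        using E.ip_nonneg[OF u(1)] E.ip_nonneg[OF v(1)] E.ip_nonneg[OF v(2)] by simp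
      then show ?thesis using h by simp
    qed
    finally show ?thesis using u v nrm_minus_commute[of v u] by (simp add: v_def nrm_sq)
  qed
  define d where "d = (e/4)\<^sup>2 / (E u u + 1)"
  have Euu: "0 \<le> E u u" using E.ip_nonneg u by auto
  have d: "d > 0" using e Euu by (simp add: d_def)
  have "nrm (J h f - f) < e" if h: "0 < h" "h < d" for h
  proof -
    have "h * E u u \<le> d * (E u u + 1)" using h Euu by (intro mult_mono) auto
    also have "\<dots> = (e/4)\<^sup>2" using Euu by (simp add: d_def)
    finally have "(nrm (J h u - u))\<^sup>2 \<le> (e/4)\<^sup>2" using small[OF h(1)] by simp
    then have 1: "nrm (J h u - u) \<le> e/4" by (rule power2_le_imp_le) (use e in simp)
    have 2: "nrm (J h (f - u)) < e / 4"
      using J_contraction[of "f - u" h] u f h by simp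
    have "nrm (J h f - f) \<le> nrm (J h f - J h u) + (nrm (J h u - u) + nrm (u - f))"
      using nrm_triangle3[of "J h f" "J h u" f] nrm_triangle3[of "J h u" u f] f u h by simp
    moreover have "J h f - J h u = J h (f - u)" using f u h by (simp add: J_diff)
    ultimately show ?thesis using 1 2 u f nrm_minus_commute[of u f] e by simp
  qed
  then show ?thesis using d by blast
qed

lemma J_tendsto:
  assumes "f \<in> S" shows "((\<lambda>h. nrm (J h f - f)) \<longlongrightarrow> 0) (at_right 0)"
  unfolding tendsto_iff eventually_at_right_field
proof (intro allI impI)
  fix e :: real assume "0 < e"
  then obtain d where d: "d > 0" "\<forall>h. 0 < h \<and> h < d \<longrightarrow> nrm (J h f - f) < e"
    using J_approx[OF assms] by blast
  have "dist (nrm (J y f - f)) 0 < e" if "0 < y" "y < d" for y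
    using d(2) that nrm_ge_0[OF S_diff[OF J_S[OF assms that(1)] assms]] by simp
  with d(1) show "\<exists>b>0. \<forall>y>0. y < b \<longrightarrow> dist (nrm (J y f - f)) 0 < e" by blast
qed

lemma op_dense:
  assumes "f \<in> S" "0 < e" obtains u w where "op u w" "nrm (f - u) < e"
proof -
  obtain d where d: "d > 0" "\<And>h. 0 < h \<Longrightarrow> h < d \<Longrightarrow> nrm (J h f - f) < e"
    using J_approx[OF assms] by blast
  have h: "0 < d/2" "d/2 < d" using d(1) by auto
  show ?thesis
  proof (rule that[OF J_op[OF assms(1) h(1)]])
    show "nrm (f - J (d/2) f) < e"
      using d(2)[OF h] nrm_minus_commute[OF assms(1) J_S[OF assms(1) h(1)]] by linarith
  qed
qed

text \<open>Density of the domain of the square of H, obtained by applying \<open>J h\<close> to an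
  element of the domain of H. The comparison of Euler steps of different size is a second-order
  estimate and starts from such elements.\<close>

lemma op2_dense:
  assumes "f \<in> S" "0 < e" obtains u w z where "op u w" "op w z" "nrm (f - u) < e"
proof -
  obtain g y where g: "op g y" "nrm (f - g) < e/2"
    using op_dense[OF assms(1), of "e/2"] assms(2) by auto
  have gS: "g \<in> S" "y \<in> S" using g op_S op_S' by auto
  obtain d where d: "d > 0" "\<And>h. 0 < h \<Longrightarrow> h < d \<Longrightarrow> nrm (J h g - g) < e/2"
    using J_approx[OF gS(1), of "e/2"] assms(2) by auto
  define h where "h = d/2"
  have h: "0 < h" "h < d" using d(1) by (auto simp: h_def)
  have "op (J h g) (J h y)" using J_op_commute[OF g(1) h(1)] .
  moreover have "op (J h y) ((1/h) *\<^sub>R (y - J h y))" using J_op[OF gS(2) h(1)] .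
  moreover have "nrm (f - J h g) < e"
    using nrm_triangle3[of f g "J h g"] g d(2)[OF h] gS assms h
    by (simp add: nrm_minus_commute[of g])
  ultimately show ?thesis by (rule that)
qed

lemma Jn_S [simp]: "f \<in> S \<Longrightarrow> 0 < h \<Longrightarrow> (J h ^^ n) f \<in> S"
  by (induction n) auto

lemma Jn_add: "\<lbrakk>f \<in> S; g \<in> S; 0 < h\<rbrakk> \<Longrightarrow> (J h ^^ n) (f + g) = (J h ^^ n) f + (J h ^^ n) g"
  by (induction n) (auto simp: J_add)

lemma Jn_scale: "\<lbrakk>f \<in> S; 0 < h\<rbrakk> \<Longrightarrow> (J h ^^ n) (c *\<^sub>R f) = c *\<^sub>R (J h ^^ n) f"
  by (induction n) (auto simp: J_scale)

lemma Jn_diff: "\<lbrakk>f \<in> S; g \<in> S; 0 < h\<rbrakk> \<Longrightarrow> (J h ^^ n) (f - g) = (J h ^^ n) f - (J h ^^ n) g"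
  by (induction n) (auto simp: J_diff)

lemma Jn_contraction: "f \<in> S \<Longrightarrow> 0 < h \<Longrightarrow> nrm ((J h ^^ n) f) \<le> nrm f"
  by (induction n) (auto intro: order_trans[OF J_contraction])

lemma Jn_op: "op u w \<Longrightarrow> 0 < h \<Longrightarrow> op ((J h ^^ n) u) ((J h ^^ n) w)"
  by (induction n) (auto intro: J_op_commute)

lemma Jn_symmetric: "\<lbrakk>f \<in> S; g \<in> S; 0 < h\<rbrakk> \<Longrightarrow> ip ((J h ^^ n) f) g = ip f ((J h ^^ n) g)"
proof (induction n arbitrary: g)
  case (Suc n)
  have "ip ((J h ^^ Suc n) f) g = ip ((J h ^^ n) f) (J h g)"
    using Suc.prems by (simp add: J_symmetric)
  also have "\<dots> = ip f ((J h ^^ n) (J h g))" using Suc by simp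
  finally show ?case by (simp add: funpow_swap1)
qed auto

lemma Jn_diff_le: assumes "op u w" "0 < h" shows "nrm ((J h ^^ n) u - u) \<le> n * h * nrm w"
proof (induction n)
  case (Suc n)
  have S: "u \<in> S" "w \<in> S" using assms op_S op_S' by auto
  have "nrm ((J h ^^ Suc n) u - u) \<le> nrm (J h ((J h ^^ n) u) - J h u) + nrm (J h u - u)"
    using S assms nrm_triangle3[of "J h ((J h ^^ n) u)" "J h u" u] by simp
  also have "\<dots> \<le> nrm ((J h ^^ n) u - u) + h * nrm w"
    using J_contraction[of "(J h ^^ n) u - u" h] J_diff_le[OF assms] S assms by (simp add: J_diff)
  finally show ?case using Suc by (simp add: algebra_simps)
qed (use assms op_S in simp)

text \<open>The j-th Euler step moves the vector by \<open>- h\<close> times the j-th iterate of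
  \<open>w\<close>; replacing that iterate by \<open>w\<close> costs at most \<open>h * b\<close>
  per step.\<close>

lemma Jn_taylor:
  assumes "op u w" "0 < h" and b: "\<And>j. j \<le> n \<Longrightarrow> nrm ((J h ^^ j) w - w) \<le> b"
  shows "nrm ((J h ^^ n) u - u + (n * h) *\<^sub>R w) \<le> n * h * b"
  using b
proof (induction n)
  case (Suc n)
  have S: "u \<in> S" "w \<in> S" using assms op_S op_S' by auto
  define y where "y = (J h ^^ n) u"
  have y: "op y ((J h ^^ n) w)" unfolding y_def by (rule Jn_op[OF assms(1,2)])
  have yS: "y \<in> S" using y op_S by blast
  have "J h y + h *\<^sub>R J h ((J h ^^ n) w) = y"
    using J_of_op[OF y assms(2)] S assms yS by (simp add: J_add J_scale)
  then have "J h y - y = - (h *\<^sub>R (J h ^^ Suc n) w)"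
    by (simp add: algebra_simps)
  then have "(J h ^^ Suc n) u - u + (Suc n * h) *\<^sub>R w
      = (y - u + (n * h) *\<^sub>R w) - h *\<^sub>R ((J h ^^ Suc n) w - w)"
    by (simp add: y_def algebra_simps)
  also have "nrm \<dots> \<le> nrm (y - u + (n * h) *\<^sub>R w) + h * nrm ((J h ^^ Suc n) w - w)"
    using nrm_triangle_diff[of "y - u + (n * h) *\<^sub>R w" "h *\<^sub>R ((J h ^^ Suc n) w - w)"] S yS assms(2)
    by (simp add: nrm_scale)
  also have "\<dots> \<le> n * h * b + h * b"
    using Suc.IH Suc.prems[of "Suc n"] Suc.prems assms(2)
    by (intro add_mono mult_left_mono) (auto simp: y_def simp del: funpow.simps)
  finally show ?case by (simp add: algebra_simps)
qed (use assms op_S in simp)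

text \<open>With \<open>k = h/2\<close>, \<open>(1 + k H)^2 = (1 + h H) + k^2 H^2\<close>, so that
  \<open>J h - J k J k = k^2 J k J k J h H^2\<close> on the domain of \<open>H^2\<close>.\<close>

lemma J_half_step:
  assumes "op u w" "op w z" "0 < h"
  shows "nrm (J h u - J (h/2) (J (h/2) u)) \<le> h\<^sup>2 / 4 * nrm z"
proof -
  have S: "u \<in> S" "w \<in> S" "z \<in> S" using assms op_S op_S' by auto
  define k where "k = h/2"
  have k: "0 < k" using assms by (simp add: k_def)
  define v where "v = J h u"
  have v: "op v (J h w)" "op (J h w) (J h z)"
    unfolding v_def using J_op_commute assms by blast+
  have vS: "v \<in> S" "J h w \<in> S" "J h z \<in> S" using v op_S op_S' by auto
  have eq: "v + h *\<^sub>R J h w = u"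
    using J_of_op[OF assms(1,3)] S assms(3) by (simp add: v_def J_add J_scale)
  define y where "y = v + k *\<^sub>R J h w"
  have Jy: "J k y = v" unfolding y_def by (rule J_of_op[OF v(1) k])
  have "op y (J h w + k *\<^sub>R J h z)"
    unfolding y_def by (intro op_add op_scale v)
  then have "J k (y + k *\<^sub>R (J h w + k *\<^sub>R J h z)) = y"
    by (rule J_of_op[OF _ k])
  moreover have "y + k *\<^sub>R (J h w + k *\<^sub>R J h z) = u + k\<^sup>2 *\<^sub>R J h z"
    using eq by (simp add: y_def k_def algebra_simps power2_eq_square flip: scaleR_add_left)
  ultimately have y: "J k (u + k\<^sup>2 *\<^sub>R J h z) = y" by simp
  have "v = J k (J k (u + k\<^sup>2 *\<^sub>R J h z))" using Jy y by simp
  also have "\<dots> = J k (J k u) + k\<^sup>2 *\<^sub>R J k (J k (J h z))"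
    using S k vS by (simp add: J_add J_scale)
  finally have "v - J k (J k u) = k\<^sup>2 *\<^sub>R J k (J k (J h z))" by simp
  moreover have "nrm (J k (J k (J h z))) \<le> nrm z"
    using J_contraction[of "J k (J h z)" k] J_contraction[of "J h z" k] J_contraction[of z h] S k assms(3)
    by simp
  ultimately show ?thesis
    using S k assms(3) vS mult_left_mono[of _ "nrm z" "k\<^sup>2"]
    by (simp add: nrm_scale v_def k_def power_divide)
qed

end

text \<open>\<open>T\<close> is an arbitrary contraction semigroup with generator \<open>-H\<close>.
  Facts about semigroups are derived from these axioms and not from the construction that follows,
  because the semigroup in the statement is chosen by \<open>SOME\<close>.\<close>

locale form_semigroup = closed_form_space S ip F E
  for S :: "'v::real_vector set" and ip F E +
  fixes T :: "real \<Rightarrow> 'v \<Rightarrow> 'v"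
  assumes T_S [simp]: "\<lbrakk>0 \<le> t; f \<in> S\<rbrakk> \<Longrightarrow> T t f \<in> S"
    and T_contraction: "\<lbrakk>0 \<le> t; f \<in> S\<rbrakk> \<Longrightarrow> nrm (T t f) \<le> nrm f"
    and T_add: "\<lbrakk>0 \<le> t; f \<in> S; g \<in> S\<rbrakk> \<Longrightarrow> T t (f + g) = T t f + T t g"
    and T_scale: "\<lbrakk>0 \<le> t; f \<in> S\<rbrakk> \<Longrightarrow> T t (c *\<^sub>R f) = c *\<^sub>R T t f"
    and T_0: "f \<in> S \<Longrightarrow> T 0 f = f"
    and T_plus: "\<lbrakk>0 \<le> s; 0 \<le> t; f \<in> S\<rbrakk> \<Longrightarrow> T (s + t) f = T s (T t f)"
    and T_cont: "f \<in> S \<Longrightarrow> ((\<lambda>t. nrm (T t f - f)) \<longlongrightarrow> 0) (at_right 0)"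
    and T_generator: "\<lbrakk>u \<in> S; w \<in> S\<rbrakk> \<Longrightarrow>
      op u w \<longleftrightarrow> ((\<lambda>t. nrm ((1/t) *\<^sub>R (T t u - u) + w)) \<longlongrightarrow> 0) (at_right 0)"

context closed_form_space
begin

text \<open>The semigroup is constructed as the limit of the implicit Euler scheme with dyadic steps.\<close>

definition dyadic :: "nat \<Rightarrow> real \<Rightarrow> 'v \<Rightarrow> 'v" where
  "dyadic k t f = (J (1 / 2 ^ k) ^^ nat \<lfloor>t * 2 ^ k\<rfloor>) f"

lemma dyadic_S [simp]: "f \<in> S \<Longrightarrow> dyadic k t f \<in> S"
  by (simp add: dyadic_def)

lemma dyadic_contraction: "f \<in> S \<Longrightarrow> nrm (dyadic k t f) \<le> nrm f"
  by (simp add: dyadic_def Jn_contraction)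

lemma dyadic_diff: "f \<in> S \<Longrightarrow> g \<in> S \<Longrightarrow> dyadic k t (f - g) = dyadic k t f - dyadic k t g"
  by (simp add: dyadic_def Jn_diff)

lemma Jn_half_step:
  assumes "op u w" "op w z" "0 < h"
  shows "nrm ((J h ^^ n) u - (J (h/2) ^^ (2 * n)) u) \<le> n * (h\<^sup>2 / 4 * nrm z)"
proof (induction n)
  case (Suc n)
  have S: "u \<in> S" "w \<in> S" "z \<in> S" using assms op_S op_S' by auto
  define y where "y = (J (h/2) ^^ (2 * n)) u"
  have h2: "0 < h/2" using assms by simp
  have y: "op y ((J (h/2) ^^ (2 * n)) w)" unfolding y_def by (rule Jn_op[OF assms(1) h2])
  have yS: "y \<in> S" using y op_S by blast
  have 1: "nrm (J h y - J (h/2) (J (h/2) y)) \<le> h\<^sup>2 / 4 * nrm z"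
  proof -
    have "nrm (J h y - J (h/2) (J (h/2) y)) \<le> h\<^sup>2 / 4 * nrm ((J (h/2) ^^ (2 * n)) z)"
      by (rule J_half_step[OF y Jn_op[OF assms(2) h2] assms(3)])
    also have "\<dots> \<le> h\<^sup>2 / 4 * nrm z"
      using Jn_contraction[OF S(3) h2] by (intro mult_left_mono) auto
    finally show ?thesis .
  qed
  have eq: "(J (h/2) ^^ (2 * Suc n)) u = J (h/2) (J (h/2) y)"
    by (simp add: y_def)
  have "nrm ((J h ^^ Suc n) u - (J (h/2) ^^ (2 * Suc n)) u)
      \<le> nrm (J h ((J h ^^ n) u) - J h y) + nrm (J h y - J (h/2) (J (h/2) y))"
    unfolding eq funpow.simps o_apply
    using S yS assms(3) by (intro nrm_triangle3) auto
  also have "nrm (J h ((J h ^^ n) u) - J h y) \<le> nrm ((J h ^^ n) u - y)"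
    using J_contraction[of "(J h ^^ n) u - y" h] S yS assms(3) by (simp add: J_diff)
  finally show ?case using Suc 1 by (simp add: y_def algebra_simps)
qed (use assms op_S in simp)

lemma floor_double: "nat \<lfloor>2 * x\<rfloor> = 2 * nat \<lfloor>x\<rfloor> \<or> nat \<lfloor>2 * x\<rfloor> = Suc (2 * nat \<lfloor>x\<rfloor>)"
  if "0 \<le> x" for x :: real
proof -
  have "\<lfloor>2 * x\<rfloor> = 2 * \<lfloor>x\<rfloor> \<or> \<lfloor>2 * x\<rfloor> = 2 * \<lfloor>x\<rfloor> + 1" by linarith
  then show ?thesis
    by (elim disjE) (use that in \<open>simp_all add: nat_add_distrib nat_mult_distrib\<close>)
qed

lemma floor_plus: "nat \<lfloor>x + y\<rfloor> = nat \<lfloor>x\<rfloor> + nat \<lfloor>y\<rfloor> \<or> nat \<lfloor>x + y\<rfloor> = Suc (nat \<lfloor>x\<rfloor> + nat \<lfloor>y\<rfloor>)"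
  if "0 \<le> x" "0 \<le> y" for x y :: real
proof -
  have "\<lfloor>x + y\<rfloor> = \<lfloor>x\<rfloor> + \<lfloor>y\<rfloor> \<or> \<lfloor>x + y\<rfloor> = \<lfloor>x\<rfloor> + \<lfloor>y\<rfloor> + 1" by linarith
  then show ?thesis by (elim disjE) (use that in \<open>simp_all add: nat_add_distrib\<close>)
qed

lemma floor_step: "0 \<le> t \<Longrightarrow> real (nat \<lfloor>t * 2 ^ k\<rfloor>) * (1 / 2 ^ k) \<le> t"
  and floor_step': "0 \<le> t \<Longrightarrow> t - 1 / 2 ^ k \<le> real (nat \<lfloor>t * 2 ^ k\<rfloor>) * (1 / 2 ^ k)"
proof -
  assume t: "0 \<le> t"
  have "real (nat \<lfloor>t * 2 ^ k\<rfloor>) = of_int \<lfloor>t * 2 ^ k\<rfloor>" using t by simp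
  then have "real (nat \<lfloor>t * 2 ^ k\<rfloor>) \<le> t * 2 ^ k" "t * 2 ^ k - 1 \<le> real (nat \<lfloor>t * 2 ^ k\<rfloor>)"
    by linarith+
  then show "real (nat \<lfloor>t * 2 ^ k\<rfloor>) * (1 / 2 ^ k) \<le> t"
      "t - 1 / 2 ^ k \<le> real (nat \<lfloor>t * 2 ^ k\<rfloor>) * (1 / 2 ^ k)"
    by (simp_all add: pos_divide_le_eq pos_le_divide_eq left_diff_distrib)
qed

text \<open>Halving the step costs \<open>n\<close> errors of order \<open>h^2\<close>, together of
  order \<open>t * h\<close>. In addition the rounded number of half steps may be
  \<open>2 * n + 1\<close>; the extra step costs at most \<open>h * nrm w\<close>.\<close>

lemma dyadic_step:
  assumes "op u w" "op w z" "0 \<le> t"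
  shows "nrm (dyadic k t u - dyadic (Suc k) t u) \<le> (t * nrm z + nrm w) / 2 ^ k"
proof -
  have S: "u \<in> S" "w \<in> S" "z \<in> S" using assms op_S op_S' by auto
  define h :: real where "h = 1 / 2 ^ k"
  define n where "n = nat \<lfloor>t * 2 ^ k\<rfloor>"
  have h: "0 < h" "0 < h/2" "h \<le> 1" by (auto simp: h_def divide_le_eq_1)
  have nh: "n * h \<le> t" unfolding n_def h_def by (rule floor_step[OF assms(3)])
  let ?a = "(J h ^^ n) u" and ?b = "(J (h/2) ^^ (2 * n)) u"
  have "nrm (?a - ?b) \<le> n * (h\<^sup>2 / 4 * nrm z)"
    by (rule Jn_half_step[OF assms(1,2) h(1)])
  also have "\<dots> = (n * h) * (h / 4 * nrm z)" by (simp add: power2_eq_square)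
  also have "\<dots> \<le> t * (h * nrm z)"
    using nh h S assms(3) by (intro mult_mono) (auto simp: mult_right_mono)
  finally have 1: "nrm (?a - ?b) \<le> h * (t * nrm z)" by (simp add: mult_ac)
  have 2: "nrm (?b - dyadic (Suc k) t u) \<le> h * nrm w"
  proof -
    have eq: "J (1 / 2 ^ Suc k) = J (h/2)" by (simp add: h_def mult.commute)
    have "nat \<lfloor>t * 2 ^ Suc k\<rfloor> = 2 * n \<or> nat \<lfloor>t * 2 ^ Suc k\<rfloor> = Suc (2 * n)"
      using floor_double[of "t * 2 ^ k"] assms(3) by (simp add: n_def mult_ac)
    then show ?thesis
    proof
      assume "nat \<lfloor>t * 2 ^ Suc k\<rfloor> = 2 * n"
      then have "dyadic (Suc k) t u = ?b" unfolding dyadic_def eq by simp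
      then show ?thesis using S h by simp
    next
      assume *: "nat \<lfloor>t * 2 ^ Suc k\<rfloor> = Suc (2 * n)"
      have eq': "dyadic (Suc k) t u = J (h/2) ?b" unfolding dyadic_def eq * by simp
      have "nrm (J (h/2) ?b - ?b) \<le> h/2 * nrm ((J (h/2) ^^ (2 * n)) w)"
        by (rule J_diff_le[OF Jn_op[OF assms(1) h(2)] h(2)])
      moreover have "h/2 * nrm ((J (h/2) ^^ (2 * n)) w) \<le> h * nrm w"
        using Jn_contraction[OF S(2) h(2)] h S by (intro mult_mono) auto
      moreover have "nrm (?b - J (h/2) ?b) = nrm (J (h/2) ?b - ?b)"
        using S h by (intro nrm_minus_commute) auto
      ultimately show ?thesis unfolding eq' by linarith
    qed
  qed
  have "dyadic k t u = ?a" by (simp add: dyadic_def n_def h_def)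
  moreover have "nrm (?a - dyadic (Suc k) t u) \<le> nrm (?a - ?b) + nrm (?b - dyadic (Suc k) t u)"
    using S h by (intro nrm_triangle3) auto
  ultimately have "nrm (dyadic k t u - dyadic (Suc k) t u) \<le> h * (t * nrm z) + h * nrm w"
    using 1 2 by simp
  then show ?thesis by (simp add: h_def field_simps)
qed

lemma cauchy_geometric:
  assumes g: "\<And>k. g k \<in> S" and le: "\<And>k. nrm (g k - g (Suc k)) \<le> c / 2 ^ k"
  shows "cauchy g"
proof -
  have *: "nrm (g m - g (m + j)) \<le> 2 * c / 2 ^ m - 2 * c / 2 ^ (m + j)" for m j
  proof (induction j)
    case (Suc j)
    have "nrm (g m - g (m + Suc j)) \<le> nrm (g m - g (m + j)) + nrm (g (m + j) - g (Suc (m + j)))"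
      using nrm_triangle3[of "g m" "g (m + j)" "g (m + Suc j)"] g by simp
    moreover have "2 * c / 2 ^ (m + Suc j) = 2 * c / 2 ^ (m + j) - c / 2 ^ (m + j)"
      by (simp add: field_simps)
    ultimately show ?case using Suc le[of "m + j"] by linarith
  qed simp
  have c: "0 \<le> c" using le[of 0] nrm_ge_0[OF S_diff[OF g[of 0] g[of 1]]] by simp
  show ?thesis
  proof (rule cauchy_from_sq[OF g, where b = "\<lambda>m. (2 * c / 2 ^ m)\<^sup>2"])
    fix m n :: nat assume "m \<le> n"
    then obtain j where j: "n = m + j" using le_Suc_ex by blast
    have "0 \<le> 2 * c / 2 ^ (m + j)" using c by simp
    then have "nrm (g m - g n) \<le> 2 * c / 2 ^ m" using *[of m j] unfolding j by linarith
    then show "ip (g m - g n) (g m - g n) \<le> (2 * c / 2 ^ m)\<^sup>2"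
      using g by (subst nrm_sq[symmetric]) (auto intro!: power_mono)
  next
    have "(\<lambda>m. 2 * c * (1/2) ^ m) \<longlonglongrightarrow> 2 * c * 0"
      by (intro tendsto_intros LIMSEQ_realpow_zero) auto
    then have "(\<lambda>m. 2 * c / 2 ^ m) \<longlonglongrightarrow> 0" by (simp add: power_one_over)
    then show "(\<lambda>m. (2 * c / 2 ^ m)\<^sup>2) \<longlonglongrightarrow> 0"
      using tendsto_power[of _ 0 _ 2] by fastforce
  qed
qed

lemma dyadic_cauchy: assumes f: "f \<in> S" and t: "0 \<le> t" shows "cauchy (\<lambda>k. dyadic k t f)"
  unfolding cauchy_def
proof (intro allI impI)
  fix e :: real assume e: "0 < e"
  obtain u w z where u: "op u w" "op w z" "nrm (f - u) < e/3"
    using op2_dense[OF f, of "e/3"] e by auto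
  have uS: "u \<in> S" using u op_S by blast
  have e3: "0 < e/3" using e by simp
  have "cauchy (\<lambda>k. dyadic k t u)"
    using dyadic_step[OF u(1,2) t] uS by (intro cauchy_geometric) auto
  then obtain N where N: "\<And>m n. m \<ge> N \<Longrightarrow> n \<ge> N \<Longrightarrow> nrm (dyadic m t u - dyadic n t u) < e/3"
    unfolding cauchy_def using e3 by meson
  have d: "nrm (dyadic m t f - dyadic m t u) < e/3" for m
    using dyadic_contraction[OF S_diff[OF f uS], of m t] u(3) unfolding dyadic_diff[OF f uS] by linarith
  have "nrm (dyadic m t f - dyadic n t f) < e" if "m \<ge> N" "n \<ge> N" for m n
  proof -
    have "nrm (dyadic m t f - dyadic n t f) \<le> nrm (dyadic m t f - dyadic m t u)
      + (nrm (dyadic m t u - dyadic n t u) + nrm (dyadic n t u - dyadic n t f))"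
      using nrm_triangle3[of "dyadic m t f" "dyadic m t u" "dyadic n t f"]
        nrm_triangle3[of "dyadic m t u" "dyadic n t u" "dyadic n t f"] f uS by simp
    moreover have "nrm (dyadic n t u - dyadic n t f) < e/3"
      using d[of n] nrm_minus_commute[OF dyadic_S[OF uS] dyadic_S[OF f], of n t n t] by linarith
    ultimately show ?thesis using d[of m] N[OF that] by linarith
  qed
  then show "\<exists>N. \<forall>m\<ge>N. \<forall>n\<ge>N. nrm (dyadic m t f - dyadic n t f) < e" by blast
qed

definition sg :: "real \<Rightarrow> 'v \<Rightarrow> 'v" where
  "sg t f = (SOME l. l \<in> S \<and> lim_to (\<lambda>k. dyadic k t f) l)"

lemma
  assumes "0 \<le> t" "f \<in> S"
  shows sg_S [simp]: "sg t f \<in> S" and sg_lim: "lim_to (\<lambda>k. dyadic k t f) (sg t f)"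
proof -
  have "\<exists>l. l \<in> S \<and> lim_to (\<lambda>k. dyadic k t f) l"
    using complete_S[OF _ dyadic_cauchy[OF assms(2,1)]] assms by auto
  from someI_ex[OF this] show "sg t f \<in> S" "lim_to (\<lambda>k. dyadic k t f) (sg t f)"
    by (auto simp: sg_def)
qed

lemma sg_eqI: "\<lbrakk>0 \<le> t; f \<in> S; l \<in> S; lim_to (\<lambda>k. dyadic k t f) l\<rbrakk> \<Longrightarrow> sg t f = l"
  using lim_to_unique[OF _ sg_S _ sg_lim] by auto

lemma sg_contraction: assumes "0 \<le> t" "f \<in> S" shows "nrm (sg t f) \<le> nrm f"
  using lim_to_nrm[OF _ sg_S[OF assms] sg_lim[OF assms]] dyadic_contraction assms
  by (intro LIMSEQ_le_const2) auto

lemma sg_add: "\<lbrakk>0 \<le> t; f \<in> S; g \<in> S\<rbrakk> \<Longrightarrow> sg t (f + g) = sg t f + sg t g"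
proof (rule sg_eqI)
  assume *: "0 \<le> t" "f \<in> S" "g \<in> S"
  have "lim_to (\<lambda>k. dyadic k t f + dyadic k t g) (sg t f + sg t g)"
    by (rule lim_to_add) (use * sg_lim in auto)
  then show "lim_to (\<lambda>k. dyadic k t (f + g)) (sg t f + sg t g)"
    using * by (simp add: dyadic_def Jn_add)
qed auto

lemma sg_scale: "\<lbrakk>0 \<le> t; f \<in> S\<rbrakk> \<Longrightarrow> sg t (c *\<^sub>R f) = c *\<^sub>R sg t f"
proof (rule sg_eqI)
  assume *: "0 \<le> t" "f \<in> S"
  have "lim_to (\<lambda>k. c *\<^sub>R dyadic k t f) (c *\<^sub>R sg t f)"
    by (rule lim_to_scale) (use * sg_lim in auto)
  then show "lim_to (\<lambda>k. dyadic k t (c *\<^sub>R f)) (c *\<^sub>R sg t f)"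
    using * by (simp add: dyadic_def Jn_scale)
qed auto

lemma sg_diff: "\<lbrakk>0 \<le> t; f \<in> S; g \<in> S\<rbrakk> \<Longrightarrow> sg t (f - g) = sg t f - sg t g"
  using sg_add[of t f "- g"] sg_scale[of t g "-1"] by simp

lemma sg_0: "f \<in> S \<Longrightarrow> sg 0 f = f"
  by (rule sg_eqI) (auto simp: dyadic_def lim_to_def)

lemma lim_toI:
  assumes "\<And>n. f n \<in> S" "l \<in> S" "\<And>n. nrm (f n - l) \<le> b n" "b \<longlonglongrightarrow> 0"
  shows "lim_to f l"
  unfolding lim_to_def
  by (rule tendsto_sandwich[OF _ _ tendsto_const assms(4)]) (use assms in auto)

lemma half_power_tendsto: "(\<lambda>k. 1 / 2 ^ k :: real) \<longlonglongrightarrow> 0"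
  using LIMSEQ_realpow_zero[of "1/2 :: real"] by (simp add: power_one_over)

lemma J_half_power_tendsto: "f \<in> S \<Longrightarrow> (\<lambda>k. nrm (J (1 / 2 ^ k) f - f)) \<longlonglongrightarrow> 0"
  by (rule filterlim_compose[OF J_tendsto, of _ "\<lambda>k. 1 / 2 ^ k"])
    (auto simp: filterlim_at half_power_tendsto)

lemma sg_plus: assumes s: "0 \<le> s" and t: "0 \<le> t" and f: "f \<in> S" shows "sg (s + t) f = sg s (sg t f)"
proof (rule sg_eqI)
  let ?b = "\<lambda>k. nrm (J (1 / 2 ^ k) f - f) + (nrm (dyadic k t f - sg t f)
    + nrm (dyadic k s (sg t f) - sg s (sg t f)))"
  have "nrm (dyadic k (s + t) f - sg s (sg t f)) \<le> ?b k" for k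
  proof -
    define h :: real where "h = 1 / 2 ^ k"
    have h: "0 < h" by (simp add: h_def)
    define x where "x = dyadic k s (dyadic k t f)"
    have x: "x = (J h ^^ (nat \<lfloor>s * 2 ^ k\<rfloor> + nat \<lfloor>t * 2 ^ k\<rfloor>)) f"
      by (simp add: x_def dyadic_def h_def funpow_add)
    have xS: "x \<in> S" using f by (simp add: x_def)
    have "nat \<lfloor>(s + t) * 2 ^ k\<rfloor> = nat \<lfloor>s * 2 ^ k\<rfloor> + nat \<lfloor>t * 2 ^ k\<rfloor>
      \<or> nat \<lfloor>(s + t) * 2 ^ k\<rfloor> = Suc (nat \<lfloor>s * 2 ^ k\<rfloor> + nat \<lfloor>t * 2 ^ k\<rfloor>)"
      using floor_plus[of "s * 2 ^ k" "t * 2 ^ k"] s t by (simp add: distrib_right)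
    then have "dyadic k (s + t) f = x \<or> dyadic k (s + t) f = J h x"
      by (auto simp: dyadic_def x simp flip: h_def)
    moreover have "nrm (J h x - x) \<le> nrm (J h f - f)"
    proof -
      have "J h x - x = (J h ^^ (nat \<lfloor>s * 2 ^ k\<rfloor> + nat \<lfloor>t * 2 ^ k\<rfloor>)) (J h f - f)"
        using f h by (simp add: x Jn_diff funpow_swap1)
      then show ?thesis using Jn_contraction[of "J h f - f" h] f h by simp
    qed
    ultimately have 1: "nrm (dyadic k (s + t) f - x) \<le> nrm (J h f - f)"
      using nrm_ge_0[OF S_diff[OF J_S[OF f h] f]] by auto
    have 2: "nrm (x - dyadic k s (sg t f)) \<le> nrm (dyadic k t f - sg t f)"
      using dyadic_contraction[of "dyadic k t f - sg t f" k s] f t by (simp add: x_def dyadic_diff)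
    have "nrm (dyadic k (s + t) f - sg s (sg t f)) \<le> nrm (dyadic k (s + t) f - x)
      + (nrm (x - dyadic k s (sg t f)) + nrm (dyadic k s (sg t f) - sg s (sg t f)))"
      using nrm_triangle3[of "dyadic k (s + t) f" x "sg s (sg t f)"]
        nrm_triangle3[of x "dyadic k s (sg t f)" "sg s (sg t f)"] f s t xS by simp
    then show ?thesis using 1 2 by (simp add: h_def)
  qed
  moreover have "?b \<longlonglongrightarrow> 0"
    using J_half_power_tendsto[OF f] sg_lim[OF t f] sg_lim[OF s, of "sg t f"] f t
    unfolding lim_to_def by (intro tendsto_add_zero) auto
  ultimately show "lim_to (\<lambda>k. dyadic k (s + t) f) (sg s (sg t f))"
    using s t f by (intro lim_toI[of _ _ ?b]) auto
qed (use assms in auto)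

lemma nrm_add3: "\<lbrakk>x \<in> S; y \<in> S; z \<in> S\<rbrakk> \<Longrightarrow> nrm (x + (y + z)) \<le> nrm x + (nrm y + nrm z)"
  using nrm_triangle[of x "y + z"] nrm_triangle[of y z] by simp

text \<open>\<open>w\<close> need not lie in the domain of H, so there is no rate for the deviation
  of its iterates from it. It is replaced by \<open>w'\<close> from the domain once before and once
  after the iteration, which gives the factor 2.\<close>

lemma sg_taylor:
  assumes u: "op u w" and w': "op w' z" and t: "0 \<le> t"
  shows "nrm (sg t u - u + t *\<^sub>R w) \<le> t * (2 * nrm (w - w') + t * nrm z)"
proof -
  have S: "u \<in> S" "w \<in> S" "w' \<in> S" "z \<in> S" using u w' op_S op_S' by auto
  let ?c = "t * (2 * nrm (w - w') + t * nrm z)"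
  let ?d = "\<lambda>k. nrm (dyadic k t u - sg t u) + 1 / 2 ^ k * nrm w"
  have "nrm (sg t u - u + t *\<^sub>R w) \<le> ?c + ?d k" for k
  proof -
    define h :: real where "h = 1 / 2 ^ k"
    have h: "0 < h" by (simp add: h_def)
    define n where "n = nat \<lfloor>t * 2 ^ k\<rfloor>"
    have nh: "n * h \<le> t" "t - h \<le> n * h"
      using floor_step[OF t] floor_step'[OF t] by (auto simp: n_def h_def)
    have "nrm ((J h ^^ j) w - w) \<le> 2 * nrm (w - w') + t * nrm z" if j: "j \<le> n" for j
    proof -
      have eq: "(J h ^^ j) w - w = (J h ^^ j) (w - w') + (((J h ^^ j) w' - w') + (w' - w))"
        using S h by (simp add: Jn_diff)
      have "nrm ((J h ^^ j) (w - w') + (((J h ^^ j) w' - w') + (w' - w)))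
          \<le> nrm ((J h ^^ j) (w - w')) + (nrm ((J h ^^ j) w' - w') + nrm (w' - w))"
        using S h by (intro nrm_add3) auto
      moreover have "nrm ((J h ^^ j) w' - w') \<le> t * nrm z"
      proof -
        have "real j * h \<le> real n * h" using j h by (intro mult_right_mono) auto
        then have "real j * h \<le> t" using nh(1) by linarith
        then have "real j * h * nrm z \<le> t * nrm z" using S by (intro mult_right_mono) auto
        then show ?thesis using Jn_diff_le[OF w' h, of j] by linarith
      qed
      moreover have "nrm ((J h ^^ j) (w - w')) \<le> nrm (w - w')"
        using S h by (intro Jn_contraction) auto
      moreover have "nrm (w' - w) = nrm (w - w')" using S by (intro nrm_minus_commute)
      ultimately show ?thesis unfolding eq by linarith
    qed
    then have "nrm ((J h ^^ n) u - u + (n * h) *\<^sub>R w) \<le> n * h * (2 * nrm (w - w') + t * nrm z)"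
      by (intro Jn_taylor[OF u h]) auto
    also have "\<dots> \<le> ?c" using nh t S h by (intro mult_right_mono add_nonneg_nonneg) auto
    finally have 1: "nrm ((J h ^^ n) u - u + (n * h) *\<^sub>R w) \<le> ?c" .
    have eq: "dyadic k t u = (J h ^^ n) u" by (simp add: dyadic_def n_def h_def)
    let ?x = "sg t u - dyadic k t u" and ?y = "dyadic k t u - u + (n * h) *\<^sub>R w"
      and ?z = "(t - n * h) *\<^sub>R w"
    have "sg t u - u + t *\<^sub>R w = ?x + (?y + ?z)" by (simp add: algebra_simps)
    moreover have "nrm (?x + (?y + ?z)) \<le> nrm ?x + (nrm ?y + nrm ?z)"
      using S t by (intro nrm_add3) auto
    ultimately have "nrm (sg t u - u + t *\<^sub>R w) \<le> nrm ?x + (nrm ?y + nrm ?z)" by (simp only:)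
    moreover have "nrm ?z \<le> h * nrm w"
      using nh S by (simp add: nrm_scale mult_right_mono)
    moreover have "nrm ?x = nrm (dyadic k t u - sg t u)" using S t by (simp add: nrm_minus_commute)
    ultimately show ?thesis using 1 eq by (simp add: h_def)
  qed
  moreover have "(\<lambda>k. ?c + ?d k) \<longlonglongrightarrow> ?c + (0 + 0 * nrm w)"
    using sg_lim[OF t S(1)] half_power_tendsto unfolding lim_to_def by (intro tendsto_intros) auto
  ultimately have "nrm (sg t u - u + t *\<^sub>R w) \<le> ?c + (0 + 0 * nrm w)"
    by (intro LIMSEQ_le_const) auto
  then show ?thesis by simp
qed

lemma sg_diff_le: assumes "op u w" "0 \<le> t" shows "nrm (sg t u - u) \<le> t * nrm w"
proof -
  have S: "u \<in> S" "w \<in> S" using assms op_S op_S' by auto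
  have "nrm (dyadic k t u - u) \<le> t * nrm w" for k
  proof -
    have "nrm (dyadic k t u - u) \<le> nat \<lfloor>t * 2 ^ k\<rfloor> * (1 / 2 ^ k) * nrm w"
      unfolding dyadic_def by (rule Jn_diff_le[OF assms(1)]) simp
    also have "\<dots> \<le> t * nrm w" using floor_step[OF assms(2)] S by (intro mult_right_mono) auto
    finally show ?thesis .
  qed
  moreover have "lim_to (\<lambda>k. dyadic k t u - u) (sg t u - u)"
    using sg_lim[OF assms(2) S(1)] by (simp add: lim_to_def)
  then have "(\<lambda>k. nrm (dyadic k t u - u)) \<longlonglongrightarrow> nrm (sg t u - u)"
    using S assms by (intro lim_to_nrm) auto
  ultimately show ?thesis by (intro LIMSEQ_le_const2) auto
qed

lemma sg_cont: assumes f: "f \<in> S" shows "((\<lambda>t. nrm (sg t f - f)) \<longlongrightarrow> 0) (at_right 0)"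
  unfolding tendsto_iff eventually_at_right_field
proof (intro allI impI)
  fix e :: real assume e: "0 < e"
  obtain u w where u: "op u w" "nrm (f - u) < e/4" using op_dense[OF f, of "e/4"] e by auto
  have S: "u \<in> S" "w \<in> S" using u op_S op_S' by auto
  define d where "d = e / (4 * (nrm w + 1))"
  have "0 < 4 * (nrm w + 1)" using nrm_ge_0[OF S(2)] by simp
  with e have d: "0 < d" unfolding d_def by (rule divide_pos_pos)
  have "dist (nrm (sg y f - f)) 0 < e" if y: "0 < y" "y < d" for y
  proof -
    have "nrm (sg y u - u) \<le> y * nrm w" using sg_diff_le[OF u(1)] y by simp
    also have "\<dots> \<le> d * (nrm w + 1)" using y S by (intro mult_mono) auto
    also have "\<dots> = e/4" using nrm_ge_0[OF S(2)] by (simp add: d_def field_simps)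
    finally have 1: "nrm (sg y u - u) \<le> e/4" .
    have 2: "nrm (sg y f - sg y u) < e/4"
      using sg_contraction[of y "f - u"] sg_diff[of y f u] y f S u(2) by simp
    have "nrm (sg y f - f) \<le> nrm (sg y f - sg y u) + (nrm (sg y u - u) + nrm (u - f))"
      using nrm_triangle3[of "sg y f" "sg y u" f] nrm_triangle3[of "sg y u" u f] f S y by simp
    then have "nrm (sg y f - f) < e"
      using 1 2 u(2) nrm_minus_commute[OF S(1) f] e by simp
    then show ?thesis using y f by simp
  qed
  then show "\<exists>b>0. \<forall>y>0. y < b \<longrightarrow> dist (nrm (sg y f - f)) 0 < e" using d by blast
qed

lemma sg_generator1:
  assumes u: "op u w" shows "((\<lambda>t. nrm ((1/t) *\<^sub>R (sg t u - u) + w)) \<longlongrightarrow> 0) (at_right 0)"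
  unfolding tendsto_iff eventually_at_right_field
proof (intro allI impI)
  fix e :: real assume e: "0 < e"
  have S: "u \<in> S" "w \<in> S" using u op_S op_S' by auto
  obtain w' z where w': "op w' z" "nrm (w - w') < e/4" using op_dense[OF S(2), of "e/4"] e by auto
  have zS: "z \<in> S" using w' op_S' by auto
  define d where "d = e / (4 * (nrm z + 1))"
  have "0 < 4 * (nrm z + 1)" using nrm_ge_0[OF zS] by simp
  with e have d: "0 < d" unfolding d_def by (rule divide_pos_pos)
  have "dist (nrm ((1/y) *\<^sub>R (sg y u - u) + w)) 0 < e" if y: "0 < y" "y < d" for y
  proof -
    have yS: "sg y u - u \<in> S" using y S by auto
    have "y * nrm z \<le> d * (nrm z + 1)" using y zS by (intro mult_mono) auto
    also have "\<dots> = e/4" using nrm_ge_0[OF zS] by (simp add: d_def field_simps)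
    finally have 1: "y * nrm z \<le> e/4" .
    have "(1/y) *\<^sub>R (sg y u - u) + w = (1/y) *\<^sub>R (sg y u - u + y *\<^sub>R w)"
      using y by (simp add: scaleR_add_right)
    then have "nrm ((1/y) *\<^sub>R (sg y u - u) + w) = (1/y) * nrm (sg y u - u + y *\<^sub>R w)"
      using y S yS by (simp add: nrm_scale)
    also have "\<dots> \<le> (1/y) * (y * (2 * nrm (w - w') + y * nrm z))"
      using sg_taylor[OF u w'(1), of y] y by (intro mult_left_mono) auto
    also have "\<dots> = 2 * nrm (w - w') + y * nrm z" using y by simp
    also have "\<dots> < e" using 1 w'(2) e by simp
    finally show ?thesis using yS S by simp
  qed
  then show "\<exists>b>0. \<forall>y>0. y < b \<longrightarrow> dist (nrm ((1/y) *\<^sub>R (sg y u - u) + w)) 0 < e" using d by blast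
qed

text \<open>The generator has no proper extension beyond \<open>-H\<close>. The vector
  \<open>x = (1 + H)^-1 (u + w)\<close> lies in the domain of H, and for \<open>d = u - x\<close>
  the difference quotients of the semigroup tend to \<open>d\<close> itself. By contractivity their
  product with \<open>d\<close> is nonpositive, so \<open>d = 0\<close>.\<close>

lemma sg_generator2:
  assumes u: "u \<in> S" "w \<in> S"
    and lim: "((\<lambda>t. nrm ((1/t) *\<^sub>R (sg t u - u) + w)) \<longlongrightarrow> 0) (at_right 0)"
  shows "op u w"
proof -
  define x where "x = J 1 (u + w)"
  have x: "op x (u + w - x)" using J_op[of "u + w" 1] u by (simp add: x_def)
  have xS: "x \<in> S" using x op_S by blast
  define d where "d = u - x"
  have dS: "d \<in> S" using u xS by (simp add: d_def)
  have "((\<lambda>t. nrm ((1/t) *\<^sub>R (sg t u - u) + w) + nrm ((1/t) *\<^sub>R (sg t x - x) + (u + w - x)))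
      \<longlongrightarrow> 0) (at_right 0)"
    by (intro tendsto_add_zero lim sg_generator1 x)
  then have *: "((\<lambda>t. (nrm ((1/t) *\<^sub>R (sg t u - u) + w)
      + nrm ((1/t) *\<^sub>R (sg t x - x) + (u + w - x))) * nrm d) \<longlongrightarrow> 0) (at_right 0)"
    by (rule tendsto_mult_left_zero)
  have "ip d d \<le> (nrm ((1/t) *\<^sub>R (sg t u - u) + w)
      + nrm ((1/t) *\<^sub>R (sg t x - x) + (u + w - x))) * nrm d" if t: "0 < t" for t
  proof -
    define y where "y = (1/t) *\<^sub>R (sg t d - d)"
    let ?a = "(1/t) *\<^sub>R (sg t u - u) + w" and ?b = "(1/t) *\<^sub>R (sg t x - x) + (u + w - x)"
    have S: "?a \<in> S" "?b \<in> S" "y \<in> S" "sg t d \<in> S" using t u xS dS by (auto simp: y_def)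
    have "ip (sg t d) d \<le> nrm d * nrm d"
      using Cauchy_Schwarz[of "sg t d" d] sg_contraction[of t d] dS t
        mult_right_mono[of "nrm (sg t d)" "nrm d" "nrm d"] by simp
    then have "ip (sg t d - d) d \<le> 0"
      using dS S nrm_sq[OF dS] by (simp add: ip_diff_left power2_eq_square)
    then have neg: "ip y d \<le> 0"
      using t dS S(4) by (simp add: y_def ip_scale_left mult_nonneg_nonpos divide_nonpos_pos)
    have "y - d = ?a - ?b"
      using t u xS by (simp add: y_def d_def sg_diff algebra_simps)
    then have "nrm (y - d) \<le> nrm ?a + nrm ?b"
      using nrm_triangle_diff[OF S(1,2)] by simp
    then have "nrm (y - d) * nrm d \<le> (nrm ?a + nrm ?b) * nrm d"
      using dS by (intro mult_right_mono) auto
    moreover have "ip d d \<le> - ip (y - d) d" using neg dS S by (simp add: ip_diff_left)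
    ultimately show ?thesis using Cauchy_Schwarz[of "y - d" d] dS S by simp
  qed
  then have "\<forall>\<^sub>F t in at_right 0. ip d d \<le> (nrm ((1/t) *\<^sub>R (sg t u - u) + w)
      + nrm ((1/t) *\<^sub>R (sg t x - x) + (u + w - x))) * nrm d"
    unfolding eventually_at_right_field by (intro exI[of _ 1]) auto
  from tendsto_lowerbound[OF * this] have "ip d d \<le> 0" by simp
  then have "ip d d = 0" using ip_nonneg[OF dS] by simp
  then have "d = 0" using definite[OF dS] by simp
  then show ?thesis using x by (simp add: d_def)
qed

theorem semigroup_exists: "form_semigroup S ip F E sg"
  by unfold_locales
    (use sg_contraction sg_add sg_scale sg_0 sg_plus sg_cont sg_generator1 sg_generator2 in auto)

end

section \<open>Properties of all semigroups with generator \<open>-H\<close>: Euler formula,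
  symmetry, derivatives\<close>

context form_semigroup
begin

lemma T_diff: "\<lbrakk>0 \<le> t; f \<in> S; g \<in> S\<rbrakk> \<Longrightarrow> T t (f - g) = T t f - T t g"
  using T_add[of t f "- g"] T_scale[of t g "-1"] by simp

lemma T_commute: "\<lbrakk>0 \<le> s; 0 \<le> t; f \<in> S\<rbrakk> \<Longrightarrow> T s (T t f) = T t (T s f)"
  by (metis T_plus add.commute)

lemma T_op: assumes u: "op u w" and t: "0 \<le> t" shows "op (T t u) (T t w)"
proof -
  have S: "u \<in> S" "w \<in> S" using u op_S op_S' by auto
  have "((\<lambda>h. nrm ((1/h) *\<^sub>R (T h (T t u) - T t u) + T t w)) \<longlongrightarrow> 0) (at_right 0)"
  proof (rule tendsto_sandwich[OF _ _ tendsto_const])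
    show "((\<lambda>h. nrm ((1/h) *\<^sub>R (T h u - u) + w)) \<longlongrightarrow> 0) (at_right 0)"
      using T_generator[OF S] u by blast
    show "\<forall>\<^sub>F h in at_right 0. 0 \<le> nrm ((1/h) *\<^sub>R (T h (T t u) - T t u) + T t w)"
      unfolding eventually_at_right_field using S t by (intro exI[of _ 1]) auto
    show "\<forall>\<^sub>F h in at_right 0. nrm ((1/h) *\<^sub>R (T h (T t u) - T t u) + T t w)
        \<le> nrm ((1/h) *\<^sub>R (T h u - u) + w)"
      unfolding eventually_at_right_field
    proof (intro exI[of _ 1] conjI allI impI)
      fix h :: real assume h: "0 < h"
      have "(1/h) *\<^sub>R (T h (T t u) - T t u) + T t w = T t ((1/h) *\<^sub>R (T h u - u) + w)"
        using S t h by (simp add: T_add T_scale T_diff T_commute[of h t])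
      then show "nrm ((1/h) *\<^sub>R (T h (T t u) - T t u) + T t w) \<le> nrm ((1/h) *\<^sub>R (T h u - u) + w)"
        using S t h by (simp add: T_contraction)
    qed simp
  qed
  then show ?thesis using T_generator[OF T_S[OF t S(1)] T_S[OF t S(2)]] by blast
qed

text \<open>A bound for the error per unit of time of one implicit Euler step on the orbit of
  \<open>f\<close>, where \<open>w\<close> is the value of H at \<open>f\<close>.\<close>

definition err :: "'v \<Rightarrow> 'v \<Rightarrow> real \<Rightarrow> real" where
  "err f w h = nrm ((1/h) *\<^sub>R (T h f - f) + w) + nrm (T h w - w)"

lemma err_tendsto: "op f w \<Longrightarrow> (err f w \<longlongrightarrow> 0) (at_right 0)"
  unfolding err_def using T_generator[of f w] op_S[of f w] op_S'[of f w]
  by (intro tendsto_add_zero T_cont) blast+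

text \<open>As \<open>J h\<close> inverts \<open>1 + h H\<close>, it maps
  \<open>T (s + h) f + h T (s + h) w\<close> to \<open>T (s + h) f\<close>. The distance of the
  former vector from \<open>T s f\<close> is that of \<open>T h f + h T h w\<close> from
  \<open>f\<close>, up to the contraction \<open>T s\<close>.\<close>

lemma T_step:
  assumes f: "op f w" and s: "0 \<le> s" and h: "0 < h"
  shows "nrm (T (s + h) f - J h (T s f)) \<le> h * err f w h"
proof -
  have S: "f \<in> S" "w \<in> S" using f op_S op_S' by auto
  let ?r = "((1/h) *\<^sub>R (T h f - f) + w) + (T h w - w)"
  have rS: "?r \<in> S" using S h by simp
  have r: "nrm ?r \<le> err f w h" unfolding err_def using S h by (intro nrm_triangle) auto
  have Jy: "J h (T (s + h) f + h *\<^sub>R T (s + h) w) = T (s + h) f"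
    by (rule J_of_op[OF T_op[OF f] h]) (use s h in simp)
  have "T (s + h) f + h *\<^sub>R T (s + h) w - T s f = T s (T h f + h *\<^sub>R T h w - f)"
    using S s h by (simp add: T_plus T_add T_scale T_diff)
  also have "T h f + h *\<^sub>R T h w - f = h *\<^sub>R ?r"
    using h by (simp add: algebra_simps)
  finally have eq: "T (s + h) f + h *\<^sub>R T (s + h) w - T s f = T s (h *\<^sub>R ?r)" .
  have "T (s + h) f - J h (T s f) = J h (T (s + h) f + h *\<^sub>R T (s + h) w - T s f)"
    using S s h Jy by (subst J_diff) auto
  also have "\<dots> = J h (T s (h *\<^sub>R ?r))" unfolding eq ..
  also have "nrm \<dots> \<le> nrm (T s (h *\<^sub>R ?r))" by (rule J_contraction[OF T_S[OF s S_scale[OF rS]] h])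
  also have "\<dots> \<le> nrm (h *\<^sub>R ?r)" by (rule T_contraction[OF s S_scale[OF rS]])
  also have "\<dots> = h * nrm ?r" using nrm_scale[OF rS] h by simp
  also have "\<dots> \<le> h * err f w h" using r h by (intro mult_left_mono) auto
  finally show ?thesis .
qed

lemma T_steps:
  assumes f: "op f w" and h: "0 < h"
  shows "nrm (T (n * h) f - (J h ^^ n) f) \<le> n * h * err f w h"
proof (induction n)
  case 0
  then show ?case using f op_S by (simp add: T_0)
next
  case (Suc n)
  have S: "f \<in> S" using f op_S by auto
  let ?x = "T (n * h) f" and ?y = "(J h ^^ n) f"
  have xS: "?x \<in> S" using S h by simp
  have "nrm (T (n * h + h) f - J h ?y) \<le> nrm (T (n * h + h) f - J h ?x) + nrm (J h ?x - J h ?y)"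
    using S h by (intro nrm_triangle3) auto
  also have "nrm (J h ?x - J h ?y) \<le> nrm (?x - ?y)"
    using J_contraction[of "?x - ?y" h] S xS h by (simp add: J_diff)
  also have "nrm (T (n * h + h) f - J h ?x) \<le> h * err f w h"
    by (rule T_step[OF f _ h]) (use h in simp)
  finally show ?case using Suc by (simp add: algebra_simps)
qed

text \<open>The left-hand sequence depends on the form alone, so this determines \<open>T\<close>.
  It is also the route by which symmetry, positivity, bounds and comparison of domains pass from
  resolvents to semigroups. \<open>Suc n\<close> avoids a division by 0.\<close>

theorem Euler:
  assumes f: "f \<in> S" and t: "0 < t"
  shows "lim_to (\<lambda>n. (J (t / Suc n) ^^ Suc n) f) (T t f)"
  unfolding lim_to_def LIMSEQ_iff
proof (intro allI impI)
  fix e :: real assume e: "0 < e"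
  obtain u w where u: "op u w" "nrm (f - u) < e/3" using op_dense[OF f, of "e/3"] e by auto
  have S: "u \<in> S" using u op_S by auto
  have step0: "filterlim (\<lambda>n. t / Suc n) (at_right 0) sequentially"
    unfolding filterlim_at
    using t LIMSEQ_Suc[OF lim_const_over_n[of t]] by auto
  have "(\<lambda>n. t * err u w (t / Suc n)) \<longlonglongrightarrow> 0"
    by (intro tendsto_mult_right_zero filterlim_compose[OF err_tendsto[OF u(1)] step0])
  then obtain N where N: "\<And>n. n \<ge> N \<Longrightarrow> t * err u w (t / Suc n) < e/3"
    using LIMSEQ_D[of _ 0 "e/3"] e by fastforce
  have "norm (nrm ((J (t / Suc n) ^^ Suc n) f - T t f) - 0) < e" if n: "n \<ge> N" for n
  proof -
    define h where "h = t / Suc n"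
    have h: "0 < h" using t by (simp add: h_def)
    have t': "t = Suc n * h" by (simp add: h_def)
    let ?Jf = "(J h ^^ Suc n) f" and ?Ju = "(J h ^^ Suc n) u"
    have "t * err u w h < e/3" using N[OF n] by (simp add: h_def)
    then have 1: "nrm (T t u - ?Ju) < e/3"
      using T_steps[OF u(1) h, of "Suc n"] unfolding t'[symmetric] by linarith
    have 2: "nrm (?Jf - ?Ju) < e/3"
      using Jn_contraction[OF S_diff[OF f S] h, of "Suc n"] u(2) unfolding Jn_diff[OF f S h] by linarith
    have 3: "nrm (T t u - T t f) < e/3"
    proof -
      have "nrm (T t f - T t u) \<le> nrm (f - u)"
        using T_contraction[of t "f - u"] f S t by (simp add: T_diff)
      then show ?thesis using u(2) nrm_minus_commute[of "T t u" "T t f"] f S t by simp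
    qed
    have mem: "?Jf \<in> S" "?Ju \<in> S" "T t u \<in> S" "T t f \<in> S"
      using f S t h by (auto simp del: funpow.simps)
    have "nrm (?Jf - T t f) \<le> nrm (?Jf - ?Ju) + (nrm (?Ju - T t u) + nrm (T t u - T t f))"
      using nrm_triangle3[OF mem(1,2,4)] nrm_triangle3[OF mem(2,3,4)] by linarith
    then have "nrm (?Jf - T t f) < e"
      using 1 2 3 nrm_minus_commute[OF mem(2,3)] by linarith
    then show ?thesis using nrm_ge_0[OF S_diff[OF mem(1,4)]] by (simp add: h_def del: funpow.simps)
  qed
  then show "\<exists>no. \<forall>n\<ge>no. norm (nrm ((J (t / Suc n) ^^ Suc n) f - T t f) - 0) < e" by blast
qed

lemma T_symmetric:
  assumes "f \<in> S" "g \<in> S" "0 < t" shows "ip (T t f) g = ip f (T t g)"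
proof (rule LIMSEQ_unique)
  show "(\<lambda>n. ip ((J (t / Suc n) ^^ Suc n) f) g) \<longlonglongrightarrow> ip (T t f) g"
    using assms by (intro lim_to_ip Euler) (auto simp del: funpow.simps)
  have "(\<lambda>n. ip ((J (t / Suc n) ^^ Suc n) g) f) \<longlonglongrightarrow> ip (T t g) f"
    using assms by (intro lim_to_ip Euler) (auto simp del: funpow.simps)
  moreover have "ip ((J (t / Suc n) ^^ Suc n) g) f = ip ((J (t / Suc n) ^^ Suc n) f) g" for n
    using Jn_symmetric[OF assms(1,2), of "t / Suc n" "Suc n"] assms ip_sym[of f "(J (t / Suc n) ^^ Suc n) g"]
    by (simp del: funpow.simps)
  moreover have "ip (T t g) f = ip f (T t g)" using assms by (intro ip_sym) auto
  ultimately show "(\<lambda>n. ip ((J (t / Suc n) ^^ Suc n) f) g) \<longlonglongrightarrow> ip f (T t g)" by simp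
qed

lemma T_diff_le: assumes "f \<in> S" "0 \<le> s" "0 \<le> t" shows "nrm (T t f - T s f) \<le> nrm (T \<bar>t - s\<bar> f - f)"
proof -
  have *: "nrm (T b f - T a f) \<le> nrm (T (b - a) f - f)" if "0 \<le> a" "a \<le> b" for a b
  proof -
    have "T b f - T a f = T a (T (b - a) f - f)"
      using T_plus[of a "b - a" f] T_diff[of a "T (b - a) f" f] that assms(1) by simp
    then show ?thesis using T_contraction[of a "T (b - a) f - f"] that assms(1) by simp
  qed
  show ?thesis
  proof (cases "s \<le> t")
    case True then show ?thesis using *[of s t] assms by simp
  next
    case False
    then show ?thesis using *[of t s] assms nrm_minus_commute[of "T t f" "T s f"] by simp
  qed
qed

lemma abs_at_right: "filterlim (\<lambda>h::real. \<bar>h\<bar>) (at_right 0) (at 0)"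
  unfolding filterlim_at by (auto simp: eventually_at_filter intro!: tendsto_eq_intros)

text \<open>The generator gives only a derivative from the right at time 0. A difference quotient at
  \<open>t\<close> with negative increment is read as one with positive increment at the earlier
  time \<open>t + h\<close>; for this reason \<open>key\<close> allows \<open>t\<close> to be either
  end of the interval.\<close>

lemma T_deriv:
  assumes g: "op g w" and a: "a \<in> S" and t: "0 < t"
  shows "((\<lambda>t. ip a (T t g)) has_real_derivative - ip a (T t w)) (at t)"
  unfolding DERIV_def
proof (rule LIM_zero_cancel, rule Lim_null_comparison)
  have S: "g \<in> S" "w \<in> S" using g op_S op_S' by auto
  have "(err g w \<longlongrightarrow> 0) (at_right 0)" by (rule err_tendsto[OF g])
  then show "((\<lambda>h. nrm a * err g w \<bar>h\<bar>) \<longlongrightarrow> 0) (at 0)"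
    by (intro tendsto_mult_right_zero filterlim_compose[OF _ abs_at_right])
  have key: "nrm ((1/h) *\<^sub>R (T (s + h) g - T s g) + T t w) \<le> err g w h"
    if h: "0 < h" "0 \<le> s" "t = s \<or> t = s + h" for s h
  proof -
    have eq: "(1/h) *\<^sub>R (T (s + h) g - T s g) + T t w
        = T s ((1/h) *\<^sub>R (T h g - g) + w) + (T t w - T s w)"
      using S h by (simp add: T_plus T_add T_scale T_diff)
    have "nrm (T t w - T s w) \<le> nrm (T h w - w)"
    proof (cases "t = s")
      case True then show ?thesis using S h by simp
    next
      case False
      then have "t = s + h" using h(3) by simp
      then show ?thesis using T_diff_le[of w s t] S h by simp
    qed
    moreover have "nrm (T s ((1/h) *\<^sub>R (T h g - g) + w)) \<le> nrm ((1/h) *\<^sub>R (T h g - g) + w)"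
      using S h by (intro T_contraction) auto
    moreover have "nrm (T s ((1/h) *\<^sub>R (T h g - g) + w) + (T t w - T s w))
        \<le> nrm (T s ((1/h) *\<^sub>R (T h g - g) + w)) + nrm (T t w - T s w)"
      using S h t by (intro nrm_triangle) auto
    ultimately show ?thesis unfolding eq err_def by linarith
  qed
  have ev: "\<forall>\<^sub>F h in at 0. h \<noteq> 0 \<and> \<bar>h\<bar> < t"
    unfolding eventually_at using t by (intro exI[of _ t]) (auto simp: dist_real_def)
  show "\<forall>\<^sub>F h in at 0. norm ((ip a (T (t + h) g) - ip a (T t g)) / h - - ip a (T t w))
      \<le> nrm a * err g w \<bar>h\<bar>"
    using ev
  proof (rule eventually_mono)
    fix h :: real assume h: "h \<noteq> 0 \<and> \<bar>h\<bar> < t"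
    define y where "y = (1/h) *\<^sub>R (T (t + h) g - T t g) + T t w"
    have th: "0 \<le> t + h" using h by linarith
    have yS: "y \<in> S" using S t th by (simp add: y_def)
    have "nrm y \<le> err g w \<bar>h\<bar>"
    proof (cases "0 < h")
      case True
      then show ?thesis using key[of h t] t by (simp add: y_def)
    next
      case False
      then have "y = (1/-h) *\<^sub>R (T (t + h + -h) g - T (t + h) g) + T t w"
        by (simp add: y_def scaleR_diff_right)
      then show ?thesis using key[of "-h" "t + h"] False h th by simp
    qed
    moreover have "(ip a (T (t + h) g) - ip a (T t g)) / h - - ip a (T t w) = ip a y"
      using S t th a by (simp add: y_def ip_simps)
    ultimately show "norm ((ip a (T (t + h) g) - ip a (T t g)) / h - - ip a (T t w))
      \<le> nrm a * err g w \<bar>h\<bar>"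
      using Cauchy_Schwarz[OF a yS] mult_left_mono[of "nrm y" _ "nrm a"] a by force
  qed
qed

lemma ip_T_cont:
  assumes f: "f \<in> S" and a: "a \<in> S"
  shows "continuous_on {0..} (\<lambda>t. ip a (T t f))"
  unfolding continuous_on_iff
proof (intro ballI allI impI)
  fix s e :: real assume s: "s \<in> {0..}" and e: "0 < e"
  have "((\<lambda>t. nrm a * nrm (T t f - f)) \<longlongrightarrow> 0) (at_right 0)"
    by (intro tendsto_mult_right_zero T_cont f)
  then have "\<forall>\<^sub>F t in at_right 0. dist (nrm a * nrm (T t f - f)) 0 < e"
    using e by (rule tendstoD)
  then obtain d where d: "0 < d" "\<And>t. 0 < t \<Longrightarrow> t < d \<Longrightarrow> \<bar>nrm a * nrm (T t f - f)\<bar> < e"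
    unfolding eventually_at_right_field by auto
  have "dist (ip a (T t f)) (ip a (T s f)) < e" if t: "t \<in> {0..}" "dist t s < d" for t
  proof (cases "t = s")
    case False
    have "ip a (T t f) - ip a (T s f) = ip a (T t f - T s f)"
      using f a s t by (simp add: ip_diff_right)
    then have "\<bar>ip a (T t f) - ip a (T s f)\<bar> \<le> nrm a * nrm (T t f - T s f)"
      using Cauchy_Schwarz[of a "T t f - T s f"] f a s t by simp
    also have "\<dots> \<le> nrm a * nrm (T \<bar>t - s\<bar> f - f)"
      using T_diff_le[OF f, of s t] s t a by (intro mult_left_mono) auto
    also have "\<dots> < e" using d(2)[of "\<bar>t - s\<bar>"] False t(2) by (simp add: dist_real_def)
    finally show ?thesis by (simp add: dist_real_def)
  qed (use e in simp)
  then show "\<exists>d>0. \<forall>x'\<in>{0..}. dist x' s < d \<longrightarrow> dist (ip a (T x' f)) (ip a (T s f)) < e"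
    using d(1) by blast
qed

text \<open>The derivative of \<open>e\<^sup>-\<^sup>b\<^sup>t P\<^sub>t (H + b)\<^sup>-\<^sup>1 k\<close> is \<open>- e\<^sup>-\<^sup>b\<^sup>t P\<^sub>t k\<close>.\<close>

lemma resolvent_deriv:
  assumes k: "k \<in> S" and b: "0 < b" and a: "a \<in> S" and t: "0 < t" and g: "g = (1/b) *\<^sub>R J (1/b) k"
  shows "((\<lambda>t. exp (- b * t) * ip a (T t g)) has_real_derivative
    - exp (- b * t) * ip a (T t k)) (at t)"
proof -
  have JS: "J (1/b) k \<in> S" using k b by simp
  have gS: "g \<in> S" using JS by (simp add: g)
  have "op (J (1/b) k) (b *\<^sub>R (k - J (1/b) k))" using J_op[OF k, of "1/b"] b by simp
  from op_scale[OF this, of "1/b"] have op: "op g (k - b *\<^sub>R g)"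
    using b by (simp add: g)
  have "((\<lambda>t. exp (- b * t) * ip a (T t g)) has_real_derivative
     exp (- b * t) * - ip a (T t (k - b *\<^sub>R g)) + (exp (- b * t) * - b) * ip a (T t g)) (at t)"
    by (intro DERIV_mult' T_deriv[OF op a t] derivative_eq_intros) auto
  moreover have "ip a (T t (k - b *\<^sub>R g)) = ip a (T t k) - b * ip a (T t g)"
    using k gS t a by (simp add: T_diff T_scale ip_simps)
  ultimately show ?thesis by (simp add: algebra_simps)
qed

end

section \<open>Square integrable functions\<close>

instantiation "fun" :: (type, real_vector) real_vector
begin

definition scaleR_fun :: "real \<Rightarrow> ('a \<Rightarrow> 'b) \<Rightarrow> 'a \<Rightarrow> 'b" where
  "scaleR_fun c f = (\<lambda>x. c *\<^sub>R f x)"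

instance
  by standard (auto simp: scaleR_fun_def fun_eq_iff scaleR_add_right scaleR_add_left)

end

lemma scaleR_fun_apply [simp]: "(c *\<^sub>R f) x = c *\<^sub>R f x"
  by (simp add: scaleR_fun_def)

lemma minus_fun_apply' [simp]: "(f - g) x = f x - (g x :: real)"
  by (simp add: fun_diff_def)

definition ip2 :: "'a measure \<Rightarrow> ('a \<Rightarrow> real) \<Rightarrow> ('a \<Rightarrow> real) \<Rightarrow> real" where
  "ip2 M f g = (\<integral>x. f x * g x \<partial>M)"

lemma L2_measurable [measurable_dest]: "f \<in> L2 M \<Longrightarrow> f \<in> borel_measurable M"
  by (simp add: L2_def)

lemma L2_sq: "f \<in> L2 M \<Longrightarrow> integrable M (\<lambda>x. (f x)\<^sup>2)"
  by (simp add: L2_def)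

lemma L2_mult: assumes "f \<in> L2 M" "g \<in> L2 M" shows "integrable M (\<lambda>x. f x * g x)"
proof (rule Bochner_Integration.integrable_bound)
  show "integrable M (\<lambda>x. (f x)\<^sup>2 + (g x)\<^sup>2)" using assms by (auto intro: L2_sq)
  have "\<bar>a * b\<bar> \<le> a\<^sup>2 + b\<^sup>2" for a b :: real
    using sum_squares_bound[of "\<bar>a\<bar>" "\<bar>b\<bar>"] mult_nonneg_nonneg[of "\<bar>a\<bar>" "\<bar>b\<bar>"]
    by (simp only: abs_mult mult.assoc power2_abs) linarith
  then show "AE x in M. norm (f x * g x) \<le> norm ((f x)\<^sup>2 + (g x)\<^sup>2)" by simp
qed (use assms in measurable)

lemma L2_dominated:
  assumes "f \<in> borel_measurable M" "g \<in> L2 M" "AE x in M. \<bar>f x\<bar> \<le> \<bar>g x\<bar>"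
  shows "f \<in> L2 M"
  unfolding L2_def
proof (intro CollectI conjI assms(1))
  show "integrable M (\<lambda>x. (f x)\<^sup>2)"
  proof (rule Bochner_Integration.integrable_bound[OF L2_sq[OF assms(2)]])
    show "AE x in M. norm ((f x)\<^sup>2) \<le> norm ((g x)\<^sup>2)"
      using assms(3) by eventually_elim (simp add: abs_le_square_iff)
  qed (use assms(1) in measurable)
qed

lemma L2_cong_AE: "\<lbrakk>f \<in> L2 M; g \<in> borel_measurable M; AE x in M. g x = f x\<rbrakk> \<Longrightarrow> g \<in> L2 M"
  by (rule L2_dominated[of g M f]) auto

lemma L2_subspace: "subspace (L2 M)"
proof (rule subspaceI)
  show "0 \<in> L2 M" by (simp add: L2_def zero_fun_def)
  fix f g :: "'a \<Rightarrow> real" and c :: real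
  assume f: "f \<in> L2 M"
  show "c *\<^sub>R f \<in> L2 M"
    using f by (auto simp: L2_def scaleR_fun_def power_mult_distrib)
  assume g: "g \<in> L2 M"
  have "integrable M (\<lambda>x. (f x)\<^sup>2 + 2 * (f x * g x) + (g x)\<^sup>2)"
    by (rule Bochner_Integration.integrable_add[OF Bochner_Integration.integrable_add])
      (use f g in \<open>simp_all add: L2_sq L2_mult\<close>)
  moreover have "(\<lambda>x. (f x + g x)\<^sup>2) = (\<lambda>x. (f x)\<^sup>2 + 2 * (f x * g x) + (g x)\<^sup>2)"
    by (simp add: power2_sum fun_eq_iff)
  ultimately have "integrable M (\<lambda>x. (f x + g x)\<^sup>2)" by simp
  then show "f + g \<in> L2 M" using f g by (auto simp: L2_def plus_fun_def)
qed

lemma ip2_ip_space: "ip_space (L2 M) (ip2 M)"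
proof
  show "subspace (L2 M)" by (rule L2_subspace)
  fix f g h :: "'a \<Rightarrow> real" and c :: real
  assume *: "f \<in> L2 M" "g \<in> L2 M" "h \<in> L2 M"
  then show "ip2 M (f + g) h = ip2 M f h + ip2 M g h"
    by (simp add: ip2_def distrib_right L2_mult)
next
  fix f h :: "'a \<Rightarrow> real" and c :: real
  show "ip2 M (c *\<^sub>R f) h = c * ip2 M f h"
    by (simp add: ip2_def mult.assoc)
  show "ip2 M f h = ip2 M h f" by (simp add: ip2_def mult.commute)
  show "0 \<le> ip2 M f f" by (simp add: ip2_def)
qed

interpretation L2: ip_space "L2 M" "ip2 M" for M
  by (rule ip2_ip_space)

abbreviation "nrm2 \<equiv> L2.nrm"

lemma nrm2_sq: "f \<in> L2 M \<Longrightarrow> (nrm2 M f)\<^sup>2 = (\<integral>x. (f x)\<^sup>2 \<partial>M)"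
  unfolding L2.nrm_sq by (simp add: ip2_def power2_eq_square)

lemma nrm2_eq_0_iff: "f \<in> L2 M \<Longrightarrow> nrm2 M f = 0 \<longleftrightarrow> (AE x in M. f x = 0)"
  using integral_nonneg_eq_0_iff_AE[OF L2_sq[of f M]] nrm2_sq[of f M] by auto

lemma ip2_cong_AE:
  "\<lbrakk>f \<in> borel_measurable M; f' \<in> borel_measurable M; g \<in> borel_measurable M; g' \<in> borel_measurable M;
    AE x in M. f x = f' x; AE x in M. g x = g' x\<rbrakk> \<Longrightarrow> ip2 M f g = ip2 M f' g'"
  unfolding ip2_def by (intro integral_cong_AE) auto

lemma nrm2_cong_AE: "\<lbrakk>f \<in> L2 M; g \<in> L2 M; AE x in M. f x = g x\<rbrakk> \<Longrightarrow> nrm2 M f = nrm2 M g"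
  unfolding L2.nrm_def by (subst ip2_cong_AE[of f M g f g]) auto

lemma nrm2_mono: assumes "f \<in> L2 M" "g \<in> L2 M" "AE x in M. \<bar>f x\<bar> \<le> \<bar>g x\<bar>" shows "nrm2 M f \<le> nrm2 M g"
proof -
  have "(\<integral>x. (f x)\<^sup>2 \<partial>M) \<le> (\<integral>x. (g x)\<^sup>2 \<partial>M)"
    using assms by (intro integral_mono_AE L2_sq) (auto simp: abs_le_square_iff)
  then show ?thesis using nrm2_sq[OF assms(1)] nrm2_sq[OF assms(2)]
    by (intro power2_le_imp_le[OF _ L2.nrm_ge_0[OF assms(2)]]) simp
qed

lemma nrm2_diff_eq_0: "\<lbrakk>f \<in> L2 M; g \<in> L2 M\<rbrakk> \<Longrightarrow> nrm2 M (f - g) = 0 \<longleftrightarrow> (AE x in M. f x = g x)"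
  using nrm2_eq_0_iff[of "f - g" M] by auto

lemma real_cauchy_geometric:
  fixes a :: "nat \<Rightarrow> real"
  assumes "\<And>k. \<bar>a (Suc k) - a k\<bar> \<le> c * (1/2) ^ k"
  shows "convergent a"
proof -
  have "summable (\<lambda>k. a (Suc k) - a k)"
    using assms by (intro summable_comparison_test[OF _ summable_mult[OF summable_geometric]]) auto
  then have "convergent (\<lambda>n. \<Sum>k<n. a (Suc k) - a k)" by (simp add: summable_iff_convergent)
  then have "convergent (\<lambda>n. (a n - a 0) + a 0)"
    unfolding sum_lessThan_telescope by (intro convergent_add convergent_const)
  then show ?thesis by simp
qed

text \<open>Riesz-Fischer. Along the subsequence \<open>g\<close> the squared increments have
  integral at most \<open>(1/9)^k\<close>, so they remain summable after multiplication by
  \<open>4^k\<close>. Hence a.e. the increments are at most a constant times \<open>(1/2)^k\<close>,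
  and \<open>g\<close> converges. Fatou's lemma then gives convergence in norm of the whole
  sequence.\<close>

theorem L2_complete: "complete_ip_space (L2 M) (ip2 M)"
proof (intro complete_ip_space.intro ip2_ip_space complete_ip_space_axioms.intro)
  fix f :: "nat \<Rightarrow> 'a \<Rightarrow> real"
  assume f: "\<And>n. f n \<in> L2 M" and "L2.cauchy M f"
  then have C: "\<And>e. e > 0 \<Longrightarrow> \<exists>N. \<forall>m\<ge>N. \<forall>n\<ge>N. nrm2 M (f m - f n) < e"
    unfolding L2.cauchy_def by blast
  have "\<forall>k. \<exists>N. \<forall>m\<ge>N. \<forall>n\<ge>N. nrm2 M (f m - f n) < (1/3) ^ k"
    by (intro allI C) simp
  from choice[OF this] obtain N where
    N: "\<And>k m n. m \<ge> N k \<Longrightarrow> n \<ge> N k \<Longrightarrow> nrm2 M (f m - f n) < (1/3) ^ k" by blast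
  \<comment> \<open>A sum instead of \<open>N k\<close> itself: it is monotone in \<open>k\<close>
    and still at least \<open>N k\<close>.\<close>
  define r where "r k = (\<Sum>i\<le>k. N i)" for k
  have rN: "N k \<le> r k" for k unfolding r_def by (rule member_le_sum) auto
  have r_mono: "mono r" unfolding r_def by (intro monoI sum_mono2) auto
  define g where "g k = f (r k)" for k
  have g: "g k \<in> L2 M" for k by (simp add: g_def f)
  have gm [measurable]: "g k \<in> borel_measurable M" for k using g by auto
  have dg: "(\<integral>x. (g (Suc k) x - g k x)\<^sup>2 \<partial>M) \<le> (1/9) ^ k" for k
  proof -
    have "nrm2 M (g (Suc k) - g k) < (1/3) ^ k"
      unfolding g_def using rN[of k] monoD[OF r_mono, of k "Suc k"] by (intro N) auto
    then have "(nrm2 M (g (Suc k) - g k))\<^sup>2 \<le> ((1/3) ^ k)\<^sup>2"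
      using g by (intro power_mono) auto
    moreover have "((1/3 :: real) ^ k)\<^sup>2 = (1/9) ^ k"
      unfolding power2_eq_square power_mult_distrib[symmetric] by simp
    ultimately show ?thesis
      using nrm2_sq[OF L2.S_diff[OF g[of "Suc k"] g[of k]]] by simp
  qed
  have "(\<integral>\<^sup>+x. (\<Sum>k. ennreal (4 ^ k * (g (Suc k) x - g k x)\<^sup>2)) \<partial>M)
      = (\<Sum>k. \<integral>\<^sup>+x. ennreal (4 ^ k * (g (Suc k) x - g k x)\<^sup>2) \<partial>M)"
    by (rule nn_integral_suminf) simp
  also have "\<dots> \<le> (\<Sum>k. ennreal ((4/9) ^ k))"
  proof (intro suminf_le summableI)
    fix k
    have int: "integrable M (\<lambda>x. 4 ^ k * (g (Suc k) x - g k x)\<^sup>2)"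
      using L2_sq[OF L2.S_diff[OF g[of "Suc k"] g[of k]]] by simp
    have "(\<integral>\<^sup>+x. ennreal (4 ^ k * (g (Suc k) x - g k x)\<^sup>2) \<partial>M)
        = ennreal (\<integral>x. 4 ^ k * (g (Suc k) x - g k x)\<^sup>2 \<partial>M)"
      by (rule nn_integral_eq_integral[OF int]) simp
    also have "\<dots> \<le> ennreal (4 ^ k * (1/9) ^ k)"
      using dg[of k] by (intro ennreal_leI) (simp add: mult_left_mono)
    also have "4 ^ k * (1/9) ^ k = (4/9 :: real) ^ k" by (simp add: power_mult_distrib[symmetric])
    finally show "(\<integral>\<^sup>+x. ennreal (4 ^ k * (g (Suc k) x - g k x)\<^sup>2) \<partial>M) \<le> ennreal ((4/9) ^ k)" .
  qed
  also have "\<dots> = ennreal (\<Sum>k. (4/9) ^ k)"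
    by (rule suminf_ennreal2) (auto intro: summable_geometric)
  also have "\<dots> < \<infinity>" by simp
  finally have fin: "(\<integral>\<^sup>+x. (\<Sum>k. ennreal (4 ^ k * (g (Suc k) x - g k x)\<^sup>2)) \<partial>M) < \<infinity>" .
  then have "AE x in M. (\<Sum>k. ennreal (4 ^ k * (g (Suc k) x - g k x)\<^sup>2)) \<noteq> \<infinity>"
    by (intro nn_integral_PInf_AE) auto
  then have conv: "AE x in M. convergent (\<lambda>k. g k x)"
  proof eventually_elim
    case (elim x)
    define \<phi> where "\<phi> k = ennreal (4 ^ k * (g (Suc k) x - g k x)\<^sup>2)" for k
    define c where "c = enn2real (\<Sum>k. \<phi> k)"
    have "(\<Sum>k. \<phi> k) \<noteq> \<infinity>" using elim unfolding \<phi>_def .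
    then have cS: "(\<Sum>k. \<phi> k) = ennreal c" by (simp add: c_def less_top)
    have c0: "0 \<le> c" by (simp add: c_def)
    have le_c: "4 ^ k * (g (Suc k) x - g k x)\<^sup>2 \<le> c" for k
    proof -
      have "\<phi> k \<le> ennreal c"
        using sum_le_suminf[OF summableI, of "{k}" \<phi>] cS by simp
      then show ?thesis unfolding \<phi>_def ennreal_le_iff[OF c0] .
    qed
    have "\<bar>g (Suc k) x - g k x\<bar> \<le> sqrt c * (1/2) ^ k" for k
    proof -
      have "(2 ^ k)\<^sup>2 = (4 :: real) ^ k"
        unfolding power2_eq_square power_mult_distrib[symmetric] by simp
      then have "(2 ^ k * \<bar>g (Suc k) x - g k x\<bar>)\<^sup>2 = 4 ^ k * (g (Suc k) x - g k x)\<^sup>2"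
        by (simp add: power_mult_distrib)
      then have "(2 ^ k * \<bar>g (Suc k) x - g k x\<bar>)\<^sup>2 \<le> c"
        using le_c[of k] by simp
      then have "2 ^ k * \<bar>g (Suc k) x - g k x\<bar> \<le> sqrt c" by (rule real_le_rsqrt)
      then show ?thesis by (simp add: power_one_over field_simps)
    qed
    then show ?case by (rule real_cauchy_geometric)
  qed
  define l where "l x = lim (\<lambda>k. g k x)" for x
  have lm [measurable]: "l \<in> borel_measurable M"
    unfolding l_def by (rule borel_measurable_lim_metric) simp
  have lim: "AE x in M. (\<lambda>k. g k x) \<longlonglongrightarrow> l x"
    using conv by eventually_elim (simp add: l_def convergent_LIMSEQ_iff)
  have main: "(\<integral>\<^sup>+x. ennreal ((f m x - l x)\<^sup>2) \<partial>M) \<le> ennreal (((1/3) ^ k)\<^sup>2)" if m: "m \<ge> N k" for m k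
  proof -
    have [measurable]: "f m \<in> borel_measurable M" using f by auto
    have "(\<integral>\<^sup>+x. ennreal ((f m x - l x)\<^sup>2) \<partial>M)
        = (\<integral>\<^sup>+x. liminf (\<lambda>j. ennreal ((f m x - g j x)\<^sup>2)) \<partial>M)"
    proof (rule nn_integral_cong_AE, use lim in eventually_elim)
      case (elim x)
      have "(\<lambda>j. ennreal ((f m x - g j x)\<^sup>2)) \<longlonglongrightarrow> ennreal ((f m x - l x)\<^sup>2)"
        by (intro tendsto_intros elim)
      then show ?case using lim_imp_Liminf sequentially_bot by metis
    qed
    also have "\<dots> \<le> liminf (\<lambda>j. \<integral>\<^sup>+x. ennreal ((f m x - g j x)\<^sup>2) \<partial>M)"
      by (rule nn_integral_liminf) simp
    also have "\<dots> \<le> ennreal (((1/3) ^ k)\<^sup>2)"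
    proof (rule Liminf_le, simp, rule eventually_sequentiallyI[of k])
      fix j assume "k \<le> j"
      then have "N k \<le> r j" using rN[of k] monoD[OF r_mono] order_trans by blast
      then have "nrm2 M (f m - g j) \<le> (1/3) ^ k"
        unfolding g_def using N[OF m] less_imp_le by blast
      then have "(nrm2 M (f m - g j))\<^sup>2 \<le> ((1/3) ^ k)\<^sup>2" using f g by (intro power_mono) auto
      then have "(\<integral>x. (f m x - g j x)\<^sup>2 \<partial>M) \<le> ((1/3) ^ k)\<^sup>2"
        using nrm2_sq[OF L2.S_diff[OF f[of m] g[of j]]] by simp
      moreover have "integrable M (\<lambda>x. (f m x - g j x)\<^sup>2)"
        using L2_sq[OF L2.S_diff[OF f[of m] g[of j]]] by simp
      then have "(\<integral>\<^sup>+x. ennreal ((f m x - g j x)\<^sup>2) \<partial>M) = ennreal (\<integral>x. (f m x - g j x)\<^sup>2 \<partial>M)"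
        by (rule nn_integral_eq_integral) simp
      ultimately show "(\<integral>\<^sup>+x. ennreal ((f m x - g j x)\<^sup>2) \<partial>M) \<le> ennreal (((1/3) ^ k)\<^sup>2)"
        by (simp add: ennreal_leI)
    qed
    finally show ?thesis .
  qed
  have dL2: "f m - l \<in> L2 M" if "m \<ge> N k" for m k
  proof -
    have [measurable]: "f m \<in> borel_measurable M" using f by auto
    have "integrable M (\<lambda>x. (f m x - l x)\<^sup>2)"
      using main[OF that] by (intro integrableI_bounded) (auto intro: le_less_trans)
    then show ?thesis by (auto simp: L2_def fun_diff_def)
  qed
  have l: "l \<in> L2 M"
    using L2.S_diff[OF f[of "N 0"] dL2[of 0 "N 0"]] by simp
  have "nrm2 M (f m - l) \<le> (1/3) ^ k" if m: "m \<ge> N k" for m k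
  proof (rule power2_le_imp_le)
    have "integrable M (\<lambda>x. (f m x - l x)\<^sup>2)" using L2_sq[OF dL2[OF m]] by simp
    then have "ennreal (\<integral>x. (f m x - l x)\<^sup>2 \<partial>M) \<le> ennreal (((1/3) ^ k)\<^sup>2)"
      using main[OF m] by (subst (asm) nn_integral_eq_integral) auto
    then have "(\<integral>x. (f m x - l x)\<^sup>2 \<partial>M) \<le> ((1/3) ^ k)\<^sup>2" by (subst (asm) ennreal_le_iff) auto
    then show "(nrm2 M (f m - l))\<^sup>2 \<le> ((1/3) ^ k)\<^sup>2"
      using nrm2_sq[OF L2.S_diff[OF f[of m] l]] by simp
  qed simp
  note bnd = this
  have "L2.lim_to M f l"
    unfolding L2.lim_to_def LIMSEQ_iff
  proof (intro allI impI)
    fix e :: real assume "0 < e"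
    then obtain k where k: "(1/3 :: real) ^ k < e"
      using real_arch_pow_inv[of e "1/3"] by auto
    have "norm (nrm2 M (f m - l) - 0) < e" if "m \<ge> N k" for m
      using bnd[OF that] k L2.nrm_ge_0[OF L2.S_diff[OF f[of m] l]] by simp
    then show "\<exists>no. \<forall>n\<ge>no. norm (nrm2 M (f n - l) - 0) < e" by blast
  qed
  with l show "\<exists>l\<in>L2 M. L2.lim_to M f l" by blast
qed

text \<open>A linear choice of representatives modulo a subspace. It turns the semidefinite space of
  square integrable functions into a definite one.\<close>

lemma linear_section:
  fixes N :: "'v::real_vector set"
  assumes N: "subspace N"
  obtains p where "linear p" "\<And>x. x \<in> N \<Longrightarrow> p x = 0" "\<And>x. p x - x \<in> N"
proof -
  obtain B where B: "B \<subseteq> N" "independent B" "N \<subseteq> span B"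
    by (rule maximal_independent_subset[of N])
  obtain C where C: "B \<subseteq> C" "C \<subseteq> UNIV" "independent C" "UNIV \<subseteq> span C"
    by (rule maximal_independent_subset_extend[OF subset_UNIV B(2)])
  obtain p where p: "linear p" "\<And>x. x \<in> C \<Longrightarrow> p x = (if x \<in> B then 0 else x)"
    using linear_independent_extend[OF C(3), of "\<lambda>x. if x \<in> B then 0 else x"] by blast
  have 1: "p x = 0" if x: "x \<in> N" for x
  proof -
    have "x \<in> span B" using x B by auto
    then show ?thesis
    proof (induction rule: span_induct)
      show "subspace {x. p x = 0}"
        by (auto intro!: subspaceI simp: linear_0[OF p(1)] linear_add[OF p(1)] linear_scale[OF p(1)])
    qed (use p(2) C(1) in auto)
  qed
  have 2: "p x - x \<in> N" for x
  proof -
    have "x \<in> span C" using C by auto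
    then show ?thesis
    proof (induction rule: span_induct)
      show "subspace {x. p x - x \<in> N}"
      proof (rule subspaceI)
        show "0 \<in> {x. p x - x \<in> N}" using subspace_0[OF N] by (simp add: linear_0[OF p(1)])
        show "x + y \<in> {x. p x - x \<in> N}" if "x \<in> {x. p x - x \<in> N}" "y \<in> {x. p x - x \<in> N}" for x y
          using subspace_add[OF N, of "p x - x" "p y - y"] that
          by (simp add: linear_add[OF p(1)] algebra_simps)
        show "c *\<^sub>R x \<in> {x. p x - x \<in> N}" if "x \<in> {x. p x - x \<in> N}" for c x
          using subspace_mul[OF N, of "p x - x" c] that
          by (simp add: linear_scale[OF p(1)] scaleR_diff_right)
      qed
      fix x assume "x \<in> C"
      then show "p x - x \<in> N"
        using p(2)[of x] B(1) subspace_neg[OF N, of x] subspace_0[OF N] by auto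
    qed
  qed
  from p(1) 1 2 show ?thesis by (rule that)
qed

section \<open>The heat semigroup on square integrable functions\<close>

declare L2_measurable [simp]

lemma (in ip_space) tendsto_nrm_iff_sq:
  assumes "\<forall>\<^sub>F t in G. f t \<in> S"
  shows "((\<lambda>t. nrm (f t)) \<longlongrightarrow> 0) G \<longleftrightarrow> ((\<lambda>t. ip (f t) (f t)) \<longlongrightarrow> 0) G"
proof
  assume "((\<lambda>t. nrm (f t)) \<longlongrightarrow> 0) G"
  then have "((\<lambda>t. (nrm (f t))\<^sup>2) \<longlongrightarrow> 0\<^sup>2) G" by (rule tendsto_power)
  moreover have "\<forall>\<^sub>F t in G. (nrm (f t))\<^sup>2 = ip (f t) (f t)"
    using assms by eventually_elim (rule nrm_sq)
  ultimately show "((\<lambda>t. ip (f t) (f t)) \<longlongrightarrow> 0) G" by (simp add: tendsto_cong)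
next
  assume "((\<lambda>t. ip (f t) (f t)) \<longlongrightarrow> 0) G"
  from tendsto_real_sqrt[OF this] show "((\<lambda>t. nrm (f t)) \<longlongrightarrow> 0) G" by (simp add: nrm_def)
qed

text \<open>The part of the axioms that is established also for the restrictions to open sets. Order
  properties of the restrictions come from the maximum principle in the ambient space.\<close>

locale dform =
  fixes D :: "'a form_space"
  assumes sym: "symmetric_nonneg_form D" and dens: "densely_defined_form D" and clos: "closed_form D"
begin

abbreviation "M \<equiv> fs_meas D"
abbreviation "F \<equiv> fs_dom D"
abbreviation "E \<equiv> fs_form D"

lemmas sym_unfolded = sym[unfolded symmetric_nonneg_form_def Let_def]

lemma F_L2 [simp, intro]: "u \<in> F \<Longrightarrow> u \<in> L2 M"
  using sym_unfolded[THEN conjunct1] by auto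

lemmas F_rest = sym_unfolded[THEN conjunct2]

lemma F_cong: "\<lbrakk>u \<in> F; u' \<in> borel_measurable M; AE x in M. u x = u' x\<rbrakk> \<Longrightarrow> u' \<in> F"
  using F_rest[THEN conjunct1] by blast

lemmas E_rest = F_rest[THEN conjunct2]

lemma E_cong_left: "\<lbrakk>u \<in> F; u' \<in> F; v \<in> F; AE x in M. u x = u' x\<rbrakk> \<Longrightarrow> E u v = E u' v"
  using E_rest[THEN conjunct1] by blast

lemmas E_alg = E_rest[THEN conjunct2]

lemma E_ip: "ip_space F E"
proof
  show "subspace F"
    unfolding subspace_def zero_fun_def plus_fun_def scaleR_fun_def real_scaleR_def
    using E_alg by (elim conjE) (intro conjI; assumption)
next
  fix x y z :: "'a \<Rightarrow> real" and c :: real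
  assume "x \<in> F" "y \<in> F" "z \<in> F"
  then show "E (x + y) z = E x z + E y z"
    unfolding plus_fun_def using E_alg[THEN conjunct2, THEN conjunct2, THEN conjunct2, THEN conjunct1] by blast
next
  fix x z :: "'a \<Rightarrow> real" and c :: real
  assume "x \<in> F" "z \<in> F"
  then show "E (c *\<^sub>R x) z = c * E x z"
    unfolding scaleR_fun_def real_scaleR_def
    using E_alg[THEN conjunct2, THEN conjunct2, THEN conjunct2, THEN conjunct2, THEN conjunct1] by blast
next
  fix x y :: "'a \<Rightarrow> real"
  assume "x \<in> F" "y \<in> F"
  then show "E x y = E y x"
    using E_alg[THEN conjunct2, THEN conjunct2, THEN conjunct2, THEN conjunct2, THEN conjunct2, THEN conjunct1] by blast
next
  fix x :: "'a \<Rightarrow> real"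
  assume "x \<in> F"
  then show "0 \<le> E x x"
    using E_alg[THEN conjunct2, THEN conjunct2, THEN conjunct2, THEN conjunct2, THEN conjunct2, THEN conjunct2] by blast
qed

sublocale E: ip_space F E by (rule E_ip)

lemma E_cong:
  assumes "u \<in> F" "u' \<in> F" "v \<in> F" "v' \<in> F" "AE x in M. u x = u' x" "AE x in M. v x = v' x"
  shows "E u v = E u' v'"
proof -
  have "E u v = E u' v" using assms by (intro E_cong_left)
  also have "\<dots> = E v u'" using assms by (intro E.ip_sym)
  also have "\<dots> = E v' u'" using assms by (intro E_cong_left)
  also have "\<dots> = E u' v'" using assms by (intro E.ip_sym)
  finally show ?thesis .
qed

definition E1 :: "('a \<Rightarrow> real) \<Rightarrow> ('a \<Rightarrow> real) \<Rightarrow> real" where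
  "E1 u v = E u v + ip2 M u v"

lemma E1_ip: "ip_space F E1"
  by standard (auto simp: E.subspace_S E1_def E.ip_simps L2.ip_simps E.ip_sym L2.ip_sym[of _ M]
    E.ip_nonneg L2.ip_nonneg algebra_simps)

sublocale E1: ip_space F E1 by (rule E1_ip)

lemma E1_nrm: assumes "u \<in> F" shows "nrm2 M u \<le> E1.nrm u"
  using E.ip_nonneg[OF assms] by (simp add: L2.nrm_def E1.nrm_def E1_def)

lemma E1_dist2: assumes "u \<in> F" "v \<in> F" shows "E1_dist2 D u v = E1 (u - v) (u - v)"
  by (simp add: E1_dist2_def form_shift_def E1_def ip2_def fun_diff_def)

lemma E1_complete: "complete_ip_space F E1"
proof (intro complete_ip_space.intro E1_ip complete_ip_space_axioms.intro)
  fix f :: "nat \<Rightarrow> 'a \<Rightarrow> real"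
  assume f: "\<And>n. f n \<in> F" and C: "E1.cauchy f"
  have C2: "L2.cauchy M f"
    unfolding L2.cauchy_def
  proof (intro allI impI)
    fix e :: real assume "0 < e"
    then obtain N where N: "\<forall>m\<ge>N. \<forall>n\<ge>N. E1.nrm (f m - f n) < e"
      using C unfolding E1.cauchy_def by blast
    have "nrm2 M (f m - f n) < e" if "m \<ge> N" "n \<ge> N" for m n
      using E1_nrm[OF E.S_diff[OF f[of m] f[of n]]] N that by force
    then show "\<exists>N. \<forall>m\<ge>N. \<forall>n\<ge>N. nrm2 M (f m - f n) < e" by blast
  qed
  interpret L2c: complete_ip_space "L2 M" "ip2 M" by (rule L2_complete)
  obtain l where l: "l \<in> L2 M" "L2.lim_to M f l"
    using L2c.complete_S[OF _ C2] f by auto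
  have sq: "(\<lambda>n. ip2 M (f n - l) (f n - l)) \<longlonglongrightarrow> 0"
    using l f unfolding L2.lim_to_def by (subst (asm) L2.tendsto_nrm_iff_sq) auto
  have EC: "\<exists>N. \<forall>m\<ge>N. \<forall>n\<ge>N. E (f m - f n) (f m - f n) < e" if e: "0 < e" for e
  proof -
    obtain N where N: "\<forall>m\<ge>N. \<forall>n\<ge>N. E1.nrm (f m - f n) < sqrt e"
      using C e unfolding E1.cauchy_def by (meson real_sqrt_gt_zero)
    have "E (f m - f n) (f m - f n) < e" if "m \<ge> N" "n \<ge> N" for m n
    proof -
      have "E1 (f m - f n) (f m - f n) < e"
        using N that by (simp add: E1.nrm_def)
      then show ?thesis
        using L2.ip_nonneg[of "f m - f n" M] f unfolding E1_def by fastforce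
    qed
    then show ?thesis by blast
  qed
  have "l \<in> F \<and> (\<lambda>n. E (\<lambda>x. f n x - l x) (\<lambda>x. f n x - l x)) \<longlonglongrightarrow> 0"
    using clos[unfolded closed_form_def, rule_format, of f l] f l(1) sq EC
    by (simp add: ip2_def power2_eq_square fun_diff_def)
  then have lF: "l \<in> F" and lE: "(\<lambda>n. E (f n - l) (f n - l)) \<longlonglongrightarrow> 0"
    by (auto simp: fun_diff_def)
  have "(\<lambda>n. E1 (f n - l) (f n - l)) \<longlonglongrightarrow> 0"
    unfolding E1_def by (intro tendsto_add_zero lE sq)
  then have "E1.lim_to f l"
    unfolding E1.lim_to_def using f lF by (subst E1.tendsto_nrm_iff_sq) auto
  with lF show "\<exists>l\<in>F. E1.lim_to f l" by blast
qed

sublocale E1: complete_ip_space F E1 by (rule E1_complete)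

definition null :: "('a \<Rightarrow> real) set" where
  "null = {f \<in> L2 M. AE x in M. f x = 0}"

lemma null_subspace: "subspace null"
  by (rule subspaceI) (auto simp: null_def)

definition sec :: "('a \<Rightarrow> real) \<Rightarrow> 'a \<Rightarrow> real" where
  "sec = (SOME p. linear p \<and> (\<forall>x\<in>null. p x = 0) \<and> (\<forall>x. p x - x \<in> null))"

lemma sec: "linear sec" "f \<in> null \<Longrightarrow> sec f = 0" "sec f - f \<in> null"
proof -
  have "\<exists>p. linear p \<and> (\<forall>x\<in>null. p x = 0) \<and> (\<forall>x. p x - x \<in> null)"
    using linear_section[OF null_subspace] by metis
  from someI_ex[OF this] show "linear sec" "f \<in> null \<Longrightarrow> sec f = 0" "sec f - f \<in> null"
    unfolding sec_def by blast+
qed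

lemmas sec_add = linear_add[OF sec(1)] and sec_scale = linear_scale[OF sec(1)]
  and sec_diff = linear_diff[OF sec(1)] and sec_zero [simp] = linear_0[OF sec(1)]

lemma sec_AE: "AE x in M. sec f x = f x"
  using sec(3)[of f] by (auto simp: null_def)

lemma sec_L2 [simp]: "f \<in> L2 M \<Longrightarrow> sec f \<in> L2 M"
  using L2.S_add[of "sec f - f" M f] sec(3)[of f] by (auto simp: null_def)

lemma sec_sec [simp]: "sec (sec f) = sec f"
  using sec_diff[of "sec f" f] sec(2)[OF sec(3)] by simp

lemma sec_cong: assumes "f \<in> L2 M" "g \<in> L2 M" "AE x in M. f x = g x" shows "sec f = sec g"
proof -
  have "f - g \<in> null" using assms by (auto simp: null_def)
  from sec(2)[OF this] show ?thesis by (simp add: sec_diff)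
qed

lemma sec_F [simp]: "f \<in> F \<Longrightarrow> sec f \<in> F"
proof -
  assume f: "f \<in> F"
  have AE: "AE x in M. f x = sec f x" using sec_AE[of f] by eventually_elim simp
  show ?thesis by (rule F_cong[OF f _ AE]) (use f in simp)
qed

lemma ip2_sec [simp]:
  "\<lbrakk>f \<in> L2 M; g \<in> L2 M\<rbrakk> \<Longrightarrow> ip2 M (sec f) g = ip2 M f g"
  "\<lbrakk>f \<in> L2 M; g \<in> L2 M\<rbrakk> \<Longrightarrow> ip2 M g (sec f) = ip2 M g f"
  by (rule ip2_cong_AE; use sec_AE[of f] sec_L2[of f] in auto)+

lemma nrm2_sec [simp]: "f \<in> L2 M \<Longrightarrow> nrm2 M (sec f) = nrm2 M f"
  by (simp add: L2.nrm_def)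

lemma E_sec [simp]: "\<lbrakk>u \<in> F; v \<in> F\<rbrakk> \<Longrightarrow> E (sec u) v = E u v"
  "\<lbrakk>u \<in> F; v \<in> F\<rbrakk> \<Longrightarrow> E v (sec u) = E v u"
  by (rule E_cong; use sec_AE[of u] in auto)+

text \<open>One representative of each a.e. class, chosen linearly. Between these, a.e. equality is
  equality, which makes \<open>ip2\<close> definite.\<close>

definition S0 where "S0 = {f \<in> L2 M. sec f = f}"
definition F0 where "F0 = {f \<in> F. sec f = f}"

lemma sec_S0 [simp]: "f \<in> L2 M \<Longrightarrow> sec f \<in> S0"
  by (simp add: S0_def)

lemma S0_L2: "f \<in> S0 \<Longrightarrow> f \<in> L2 M" by (simp add: S0_def)

lemma S0_iff: "f \<in> S0 \<longleftrightarrow> f \<in> L2 M \<and> sec f = f"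
  and F0_iff: "f \<in> F0 \<longleftrightarrow> f \<in> F \<and> sec f = f"
  by (auto simp: S0_def F0_def)

lemma sec_fix_complete:
  assumes c: "complete_ip_space W b" and W: "W \<subseteq> L2 M" "\<And>f. f \<in> W \<Longrightarrow> sec f \<in> W"
    and b: "\<And>f. f \<in> W \<Longrightarrow> b (sec f) (sec f) = b f f"
  shows "complete_ip_space {f \<in> W. sec f = f} b"
proof -
  interpret c: complete_ip_space W b by (rule c)
  show ?thesis
  proof
    show "subspace {f \<in> W. sec f = f}"
      by (rule subspaceI) (auto simp: sec_add sec_scale)
    fix f :: "nat \<Rightarrow> 'a \<Rightarrow> real"
    assume f: "\<And>n. f n \<in> {f \<in> W. sec f = f}" and C: "c.cauchy f"
    obtain l where l: "l \<in> W" "c.lim_to f l" using c.complete_S[OF _ C] f by auto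
    have "c.nrm (f n - sec l) = c.nrm (f n - l)" for n
    proof -
      have "f n - sec l = sec (f n - l)" using f by (simp add: sec_diff)
      then show ?thesis using b[of "f n - l"] f l by (simp add: c.nrm_def)
    qed
    then have "c.lim_to f (sec l)" using l(2) by (simp add: c.lim_to_def)
    then show "\<exists>l\<in>{f \<in> W. sec f = f}. c.lim_to f l" using l W by (intro bexI[of _ "sec l"]) auto
  qed (auto simp: c.ip_simps c.ip_nonneg intro: c.ip_sym)
qed

sublocale cf: closed_form_space S0 "ip2 M" F0 E
proof -
  have 1: "complete_ip_space S0 (ip2 M)"
    unfolding S0_def by (rule sec_fix_complete[OF L2_complete]) auto
  interpret s: complete_ip_space S0 "ip2 M" by (rule 1)
  have 2: "complete_ip_space F0 E1"
    unfolding F0_def by (rule sec_fix_complete[OF E1_complete]) (auto simp: E1_def)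
  show "closed_form_space S0 (ip2 M) F0 E"
  proof (intro closed_form_space.intro closed_form_space_axioms.intro 1)
    show "subspace F0" using complete_ip_space.axioms(1)[OF 2] by (rule ip_space.subspace_S)
    show "F0 \<subseteq> S0" by (auto simp: F0_def S0_def)
    fix f assume f: "f \<in> S0" "ip2 M f f = 0"
    then have "f \<in> null"
      using nrm2_eq_0_iff[of f M] by (auto simp: null_def S0_def L2.nrm_def)
    then show "f = 0" using sec(2)[of f] f(1) by (simp add: S0_def)
  next
    fix f and e :: real assume f: "f \<in> S0" and e: "0 < e"
    obtain u where u: "u \<in> F" "(\<integral>x. (f x - u x)\<^sup>2 \<partial>M) < e\<^sup>2"
      using dens[unfolded densely_defined_form_def, rule_format, of f "e\<^sup>2"] f e by (auto simp: S0_def)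
    have "(nrm2 M (f - u))\<^sup>2 < e\<^sup>2"
      using u nrm2_sq[of "f - u" M] S0_L2[OF f] by simp
    then have "nrm2 M (f - u) < e" using e by (simp add: power_less_imp_less_base)
    moreover have "f - sec u = sec (f - u)" using f by (simp add: sec_diff S0_def)
    ultimately have "nrm2 M (f - sec u) < e" using u(1) S0_L2[OF f] by simp
    then show "\<exists>u\<in>F0. nrm2 M (f - u) < e" using u(1) by (intro bexI[of _ "sec u"]) (auto simp: F0_def)
  next
    show "ip_space F0 E"
      using complete_ip_space.axioms(1)[OF 2] unfolding ip_space_def
      by (auto simp: F0_def E.ip_simps E.ip_nonneg intro: E.ip_sym)
    show "complete_ip_space F0 (\<lambda>u v. E u v + ip2 M u v)"
      using 2 unfolding E1_def .
  qed
qed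

lemma form_operator_iff:
  assumes "u \<in> L2 M" "w \<in> L2 M" shows "form_operator D u w \<longleftrightarrow> cf.op (sec u) (sec w)"
proof
  assume *: "form_operator D u w"
  then have "u \<in> F" by (simp add: form_operator_def)
  with * show "cf.op (sec u) (sec w)"
    using assms by (auto simp: form_operator_def cf.op_def F0_iff ip2_def[symmetric])
next
  assume *: "cf.op (sec u) (sec w)"
  then have "sec u \<in> F" by (simp add: cf.op_def F0_iff)
  from F_cong[OF this _ sec_AE] have u: "u \<in> F" using assms by auto
  have "E u v = ip2 M w v" if v: "v \<in> F" for v
  proof -
    have "sec v \<in> F0" using v by (simp add: F0_iff)
    then have "E (sec u) (sec v) = ip2 M (sec w) (sec v)" using * unfolding cf.op_def by blast
    then show ?thesis using u v assms by simp
  qed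
  then show "form_operator D u w" using u assms by (simp add: form_operator_def ip2_def)
qed

lemma gen_tendsto_iff:
  assumes "u \<in> L2 M" "w \<in> L2 M" and y: "\<And>t. 0 < t \<Longrightarrow> y t \<in> L2 M"
  shows "((\<lambda>t. \<integral>x. ((y t x - u x) / t + w x)\<^sup>2 \<partial>M) \<longlongrightarrow> 0) (at_right 0) \<longleftrightarrow>
    ((\<lambda>t. nrm2 M ((1/t) *\<^sub>R (sec (y t) - sec u) + sec w)) \<longlongrightarrow> 0) (at_right 0)"
proof -
  have pos: "\<forall>\<^sub>F t in at_right 0. (0::real) < t" by (simp add: eventually_at_right_less)
  let ?z = "\<lambda>t. (1/t) *\<^sub>R (y t - u) + w"
  have z: "?z t \<in> L2 M" if "0 < t" for t using assms(1,2) y[OF that] by simp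
  have "((\<lambda>t. nrm2 M ((1/t) *\<^sub>R (sec (y t) - sec u) + sec w)) \<longlongrightarrow> 0) (at_right 0) \<longleftrightarrow>
    ((\<lambda>t. nrm2 M (?z t)) \<longlongrightarrow> 0) (at_right 0)"
  proof (rule tendsto_cong)
    show "\<forall>\<^sub>F t in at_right 0. nrm2 M ((1/t) *\<^sub>R (sec (y t) - sec u) + sec w) = nrm2 M (?z t)"
      using pos
    proof eventually_elim
      case (elim t)
      have "(1/t) *\<^sub>R (sec (y t) - sec u) + sec w = sec (?z t)"
        by (simp add: sec_add sec_scale sec_diff)
      then show ?case using z[OF elim] by simp
    qed
  qed
  also have "\<dots> \<longleftrightarrow> ((\<lambda>t. ip2 M (?z t) (?z t)) \<longlongrightarrow> 0) (at_right 0)"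
    by (rule L2.tendsto_nrm_iff_sq) (use pos z in \<open>auto elim: eventually_mono\<close>)
  also have "(\<lambda>t. ip2 M (?z t) (?z t)) = (\<lambda>t. \<integral>x. ((y t x - u x) / t + w x)\<^sup>2 \<partial>M)"
    by (simp add: ip2_def power2_eq_square)
  finally show ?thesis by (rule HOL.sym)
qed

lemma L2_tendsto_iff:
  fixes y :: "real \<Rightarrow> 'a \<Rightarrow> real"
  assumes "u \<in> L2 M" and y: "\<And>t. 0 < t \<Longrightarrow> y t \<in> L2 M"
  shows "((\<lambda>t. \<integral>x. (y t x - u x)\<^sup>2 \<partial>M) \<longlongrightarrow> 0) (at_right 0) \<longleftrightarrow>
    ((\<lambda>t. nrm2 M (sec (y t) - sec u)) \<longlongrightarrow> 0) (at_right 0)"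
proof -
  have pos: "\<forall>\<^sub>F t in at_right 0. (0::real) < t" by (simp add: eventually_at_right_less)
  have "((\<lambda>t. nrm2 M (sec (y t) - sec u)) \<longlongrightarrow> 0) (at_right 0) \<longleftrightarrow>
    ((\<lambda>t. nrm2 M (y t - u)) \<longlongrightarrow> 0) (at_right 0)"
  proof (rule tendsto_cong)
    show "\<forall>\<^sub>F t in at_right 0. nrm2 M (sec (y t) - sec u) = nrm2 M (y t - u)"
      using pos
    proof eventually_elim
      case (elim t)
      have "sec (y t) - sec u = sec (y t - u)" by (simp add: sec_diff)
      then show ?case using y[OF elim] assms(1) by simp
    qed
  qed
  also have "\<dots> \<longleftrightarrow> ((\<lambda>t. ip2 M (y t - u) (y t - u)) \<longlongrightarrow> 0) (at_right 0)"
    by (rule L2.tendsto_nrm_iff_sq, rule eventually_mono[OF pos]) (use assms in auto)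
  also have "(\<lambda>t. ip2 M (y t - u) (y t - u)) = (\<lambda>t. \<integral>x. (y t x - u x)\<^sup>2 \<partial>M)"
    by (simp add: ip2_def power2_eq_square)
  finally show ?thesis by (rule HOL.sym)
qed

text \<open>The witness for the \<open>SOME\<close> in \<open>L2_semigroup\<close>. Applying
  \<open>sec\<close> first makes it respect a.e. equality.\<close>

lemma L2_semigroup_exists: "is_L2_semigroup D (\<lambda>t f. cf.sg t (sec f))"
proof -
  interpret T: form_semigroup S0 "ip2 M" F0 E cf.sg by (rule cf.semigroup_exists)
  have S: "cf.sg t (sec f) \<in> L2 M" if "0 \<le> t" "f \<in> L2 M" for t f
    using T.T_S[of t "sec f"] that by (auto simp: S0_iff)
  have sS: "sec (cf.sg t (sec f)) = cf.sg t (sec f)" if "0 \<le> t" "f \<in> L2 M" for t f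
    using T.T_S[of t "sec f"] that by (auto simp: S0_iff)
  have contr: "(\<integral>x. (cf.sg t (sec f) x)\<^sup>2 \<partial>M) \<le> (\<integral>x. (f x)\<^sup>2 \<partial>M)" if "0 \<le> t" "f \<in> L2 M" for t f
  proof -
    have "nrm2 M (cf.sg t (sec f)) \<le> nrm2 M f" using T.T_contraction[of t "sec f"] that by simp
    then have "(nrm2 M (cf.sg t (sec f)))\<^sup>2 \<le> (nrm2 M f)\<^sup>2" using S[OF that] by (intro power_mono) auto
    then show ?thesis using nrm2_sq[OF S[OF that]] nrm2_sq[OF that(2)] by simp
  qed
  have lin: "cf.sg t (sec (\<lambda>y. a * f y + b * g y)) = (\<lambda>x. a * cf.sg t (sec f) x + b * cf.sg t (sec g) x)"
    if "0 \<le> t" "f \<in> L2 M" "g \<in> L2 M" for t f g a b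
  proof -
    have "(\<lambda>y. a * f y + b * g y) = a *\<^sub>R f + b *\<^sub>R g" by (simp add: fun_eq_iff)
    then have "cf.sg t (sec (\<lambda>y. a * f y + b * g y)) = a *\<^sub>R cf.sg t (sec f) + b *\<^sub>R cf.sg t (sec g)"
      using that by (simp add: sec_add sec_scale T.T_add T.T_scale cf.S_scale)
    then show ?thesis by (simp add: fun_eq_iff)
  qed
  show ?thesis
    unfolding is_L2_semigroup_def Let_def
  proof (intro conjI allI impI ballI)
    fix f assume f: "f \<in> L2 M"
    show "AE x in M. cf.sg 0 (sec f) x = f x"
      using sec_AE[of f] f by (simp add: T.T_0)
    show "((\<lambda>t. \<integral>x. (cf.sg t (sec f) x - f x)\<^sup>2 \<partial>M) \<longlongrightarrow> 0) (at_right 0)"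
    proof (subst L2_tendsto_iff)
      have "\<forall>\<^sub>F t in at_right 0. nrm2 M (sec (cf.sg t (sec f)) - sec f) = nrm2 M (cf.sg t (sec f) - sec f)"
        using eventually_at_right_less[of "0::real"] by eventually_elim (simp add: sS f)
      then show "((\<lambda>t. nrm2 M (sec (cf.sg t (sec f)) - sec f)) \<longlongrightarrow> 0) (at_right 0)"
        using T.T_cont[of "sec f"] f by (simp add: tendsto_cong)
    qed (use f S in auto)
  next
    fix u w assume uw: "u \<in> L2 M" "w \<in> L2 M"
    have "form_operator D u w \<longleftrightarrow> ((\<lambda>t. nrm2 M ((1/t) *\<^sub>R (cf.sg t (sec u) - sec u) + sec w)) \<longlongrightarrow> 0) (at_right 0)"
      using T.T_generator[of "sec u" "sec w"] uw by (simp add: form_operator_iff)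
    also have "\<dots> \<longleftrightarrow> ((\<lambda>t. nrm2 M ((1/t) *\<^sub>R (sec (cf.sg t (sec u)) - sec u) + sec w)) \<longlongrightarrow> 0) (at_right 0)"
      by (rule tendsto_cong) (use eventually_at_right_less[of "0::real"] in eventually_elim, simp add: sS uw)
    also have "\<dots> \<longleftrightarrow> ((\<lambda>t. \<integral>x. ((cf.sg t (sec u) x - u x) / t + w x)\<^sup>2 \<partial>M) \<longlongrightarrow> 0) (at_right 0)"
      by (rule gen_tendsto_iff[symmetric]) (use uw S in auto)
    finally show "form_operator D u w \<longleftrightarrow> ((\<lambda>t. \<integral>x. ((cf.sg t (sec u) x - u x) / t + w x)\<^sup>2 \<partial>M) \<longlongrightarrow> 0) (at_right 0)" .
  qed (use S contr lin T.T_plus sS in auto)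
qed

definition P :: "real \<Rightarrow> ('a \<Rightarrow> real) \<Rightarrow> 'a \<Rightarrow> real" where "P = L2_semigroup D"

lemma P_semigroup: "is_L2_semigroup D P"
  unfolding P_def L2_semigroup_def
  by (rule someI[of "is_L2_semigroup D"], rule L2_semigroup_exists)

lemma
  shows P_L2 [simp]: "\<lbrakk>0 \<le> t; f \<in> L2 M\<rbrakk> \<Longrightarrow> P t f \<in> L2 M"
    and P_contr_sq: "\<lbrakk>0 \<le> t; f \<in> L2 M\<rbrakk> \<Longrightarrow> (\<integral>x. (P t f x)\<^sup>2 \<partial>M) \<le> (\<integral>x. (f x)\<^sup>2 \<partial>M)"
    and P_lin': "\<lbrakk>0 \<le> t; f \<in> L2 M; g \<in> L2 M\<rbrakk> \<Longrightarrow>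
      AE x in M. P t (\<lambda>y. a * f y + b * g y) x = a * P t f x + b * P t g x"
    and P_0: "f \<in> L2 M \<Longrightarrow> AE x in M. P 0 f x = f x"
    and P_plus: "\<lbrakk>0 \<le> s; 0 \<le> t; f \<in> L2 M\<rbrakk> \<Longrightarrow> AE x in M. P (s + t) f x = P s (P t f) x"
    and P_cont: "f \<in> L2 M \<Longrightarrow> ((\<lambda>t. \<integral>x. (P t f x - f x)\<^sup>2 \<partial>M) \<longlongrightarrow> 0) (at_right 0)"
    and P_gen: "\<lbrakk>u \<in> L2 M; w \<in> L2 M\<rbrakk> \<Longrightarrow> form_operator D u w \<longleftrightarrow>
        ((\<lambda>t. \<integral>x. ((P t u x - u x) / t + w x)\<^sup>2 \<partial>M) \<longlongrightarrow> 0) (at_right 0)"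
  using P_semigroup unfolding is_L2_semigroup_def Let_def by blast+

lemma P_lin: "\<lbrakk>0 \<le> t; f \<in> L2 M; g \<in> L2 M\<rbrakk> \<Longrightarrow>
    AE x in M. P t (a *\<^sub>R f + b *\<^sub>R g) x = a * P t f x + b * P t g x"
  using P_lin'[of t f g a b] by (simp add: plus_fun_def scaleR_fun_def)

lemma P_add: "\<lbrakk>0 \<le> t; f \<in> L2 M; g \<in> L2 M\<rbrakk> \<Longrightarrow> AE x in M. P t (f + g) x = P t f x + P t g x"
  using P_lin[of t f g 1 1] by simp

lemma P_diff: "\<lbrakk>0 \<le> t; f \<in> L2 M; g \<in> L2 M\<rbrakk> \<Longrightarrow> AE x in M. P t (f - g) x = P t f x - P t g x"
  using P_lin[of t f g 1 "-1"] by simp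

lemma P_contraction: assumes "0 \<le> t" "f \<in> L2 M" shows "nrm2 M (P t f) \<le> nrm2 M f"
  using P_contr_sq[OF assms] nrm2_sq[OF assms(2)] nrm2_sq[OF P_L2[OF assms]]
  by (intro power2_le_imp_le[OF _ L2.nrm_ge_0[OF assms(2)]]) simp

lemma P_cong: assumes t: "0 \<le> t" and "f \<in> L2 M" "g \<in> L2 M" "AE x in M. f x = g x"
  shows "AE x in M. P t f x = P t g x"
proof -
  have "nrm2 M (f - g) = 0" using assms by (simp add: nrm2_diff_eq_0)
  then have "nrm2 M (P t (f - g)) \<le> 0"
    using P_contraction[OF t, of "f - g"] assms by simp
  then have "nrm2 M (P t (f - g)) = 0"
    by (rule antisym) (use assms in simp)
  then have "AE x in M. P t (f - g) x = 0" using nrm2_eq_0_iff[of "P t (f - g)" M] assms by simp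
  then show ?thesis using P_diff[OF assms(1-3)] by eventually_elim simp
qed

text \<open>The chosen semigroup satisfies its laws only a.e. and may return any representative.
  Composed with \<open>sec\<close> it satisfies them as equations on \<open>S0\<close>, so the
  abstract theory applies to it.\<close>

sublocale fs: form_semigroup S0 "ip2 M" F0 E "\<lambda>t f. sec (P t f)"
proof
  fix t :: real and f assume *: "0 \<le> t" "f \<in> S0"
  then show "sec (P t f) \<in> S0" "nrm2 M (sec (P t f)) \<le> nrm2 M f"
    using S0_L2[of f] P_contraction by auto
  have "AE x in M. P t (c *\<^sub>R f) x = (c *\<^sub>R P t f) x" for c
    using P_lin[of t f f c 0] * S0_L2[of f] by simp
  then show "sec (P t (c *\<^sub>R f)) = c *\<^sub>R sec (P t f)" for c
    using * S0_L2[of f] by (subst sec_scale[symmetric], intro sec_cong) auto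
  fix g assume g: "g \<in> S0"
  show "sec (P t (f + g)) = sec (P t f) + sec (P t g)"
    using * g S0_L2 P_add[of t f g] by (subst sec_add[symmetric], intro sec_cong) auto
next
  fix f assume f: "f \<in> S0"
  have "sec (P 0 f) = sec f" using f S0_L2 P_0 by (intro sec_cong) auto
  then show "sec (P 0 f) = f" using f by (simp add: S0_iff)
  have "((\<lambda>t. nrm2 M (sec (P t f) - sec f)) \<longlongrightarrow> 0) (at_right 0)"
    using P_cont[OF S0_L2[OF f]] S0_L2[OF f] by (subst (asm) L2_tendsto_iff) auto
  then show "((\<lambda>t. nrm2 M (sec (P t f) - f)) \<longlongrightarrow> 0) (at_right 0)"
    using f by (simp add: S0_iff)
next
  fix s t :: real and f assume *: "0 \<le> s" "0 \<le> t" "f \<in> S0"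
  have "AE x in M. P s (P t f) x = P s (sec (P t f)) x"
    using * S0_L2[of f] sec_AE[of "P t f"] by (intro P_cong) auto
  then have "AE x in M. P (s + t) f x = P s (sec (P t f)) x"
    using P_plus[of s t f] * S0_L2[of f] by auto
  then show "sec (P (s + t) f) = sec (P s (sec (P t f)))"
    using * S0_L2[of f] by (intro sec_cong) auto
next
  fix u w assume uw: "u \<in> S0" "w \<in> S0"
  have "cf.op (sec u) (sec w) \<longleftrightarrow> ((\<lambda>t. \<integral>x. ((P t u x - u x) / t + w x)\<^sup>2 \<partial>M) \<longlongrightarrow> 0) (at_right 0)"
    unfolding form_operator_iff[OF S0_L2[OF uw(1)] S0_L2[OF uw(2)], symmetric]
    by (rule P_gen[OF S0_L2[OF uw(1)] S0_L2[OF uw(2)]])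
  also have "\<dots> \<longleftrightarrow> ((\<lambda>t. nrm2 M ((1/t) *\<^sub>R (sec (P t u) - sec u) + sec w)) \<longlongrightarrow> 0) (at_right 0)"
    by (rule gen_tendsto_iff[OF S0_L2[OF uw(1)] S0_L2[OF uw(2)]])
      (rule P_L2[OF less_imp_le S0_L2[OF uw(1)]])
  finally show "cf.op u w \<longleftrightarrow> ((\<lambda>t. nrm2 M ((1/t) *\<^sub>R (sec (P t u) - u) + w)) \<longlongrightarrow> 0) (at_right 0)"
    using uw by (simp add: S0_iff)
qed

text \<open>\<open>res b = b (H + b)\<^sup>-\<^sup>1\<close>, as \<open>cf.J h = (1 + h H)\<^sup>-\<^sup>1\<close>.\<close>

definition res :: "real \<Rightarrow> ('a \<Rightarrow> real) \<Rightarrow> 'a \<Rightarrow> real" where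
  "res b f = cf.J (1/b) (sec f)"

context
  fixes b :: real assumes b: "0 < b"
begin

lemma res_S0: "f \<in> L2 M \<Longrightarrow> res b f \<in> S0"
  using cf.J_S[of "sec f" "1/b"] b by (simp add: res_def)

lemma res_L2 [simp]: "f \<in> L2 M \<Longrightarrow> res b f \<in> L2 M"
  using res_S0 S0_L2 by blast

lemma res_F [simp]: "f \<in> L2 M \<Longrightarrow> res b f \<in> F"
  using cf.J_F[of "sec f" "1/b"] b by (simp add: res_def F0_iff)

lemma res_eq: assumes f: "f \<in> L2 M" and v: "v \<in> F"
  shows "E (res b f) v + b * ip2 M (res b f) v = b * ip2 M f v"
proof -
  have "ip2 M (res b f) (sec v) + (1/b) * E (res b f) (sec v) = ip2 M (sec f) (sec v)"
    unfolding res_def using f v b by (intro cf.J_eq) (auto simp: F0_iff)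
  then show ?thesis using f v b by (simp add: field_simps)
qed

lemma res_unique:
  assumes f: "f \<in> L2 M" and u: "u \<in> F" and eq: "\<And>v. v \<in> F \<Longrightarrow> E u v + b * ip2 M u v = b * ip2 M f v"
  shows "AE x in M. res b f x = u x"
proof -
  have "cf.J (1/b) (sec f) = sec u"
  proof (rule cf.J_unique)
    fix v assume "v \<in> F0"
    then have v: "v \<in> F" by (simp add: F0_iff)
    show "ip2 M (sec u) v + 1 / b * E (sec u) v = ip2 M (sec f) v"
      using eq[OF v] f u v b by (simp add: field_simps)
  qed (use f u b in \<open>auto simp: F0_iff\<close>)
  then show ?thesis using sec_AE[of u] by (simp add: res_def)
qed

lemma res_cong: "\<lbrakk>f \<in> L2 M; g \<in> L2 M; AE x in M. f x = g x\<rbrakk> \<Longrightarrow> res b f = res b g"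
  using sec_cong[of f g] by (simp add: res_def)

lemma res_add: "\<lbrakk>f \<in> L2 M; g \<in> L2 M\<rbrakk> \<Longrightarrow> res b (f + g) = res b f + res b g"
  using b by (simp add: res_def sec_add cf.J_add)

lemma res_diff: "\<lbrakk>f \<in> L2 M; g \<in> L2 M\<rbrakk> \<Longrightarrow> res b (f - g) = res b f - res b g"
  using b by (simp add: res_def sec_diff cf.J_diff)

lemma res_scale: "f \<in> L2 M \<Longrightarrow> res b (c *\<^sub>R f) = c *\<^sub>R res b f"
  using b by (simp add: res_def sec_scale cf.J_scale)

lemma res_contraction: "f \<in> L2 M \<Longrightarrow> nrm2 M (res b f) \<le> nrm2 M f"
  using cf.J_contraction[of "sec f" "1/b"] b by (simp add: res_def)

lemma res_deriv:
  assumes "k \<in> L2 M" "a \<in> L2 M" "0 < t"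
  shows "((\<lambda>t. exp (- b * t) * ip2 M a (P t (res b k))) has_real_derivative
    - b * exp (- b * t) * ip2 M a (P t k)) (at t)"
proof -
  define g where "g = (1/b) *\<^sub>R cf.J (1/b) (sec k)"
  have res: "res b k = b *\<^sub>R g" using b by (simp add: g_def res_def)
  have gL: "g \<in> L2 M" using res_L2[OF assms(1)] unfolding g_def res_def by (rule L2.S_scale)
  have d: "((\<lambda>t. b * (exp (- b * t) * ip2 M (sec a) (sec (P t g)))) has_real_derivative
    b * (- exp (- b * t) * ip2 M (sec a) (sec (P t (sec k))))) (at t)"
    by (intro DERIV_cmult fs.resolvent_deriv[OF _ b _ assms(3) g_def]) (use assms in auto)
  have eq: "ip2 M a (P s (res b k)) = b * ip2 M a (P s g)" if "0 < s" for s
  proof -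
    have "AE x in M. P s (b *\<^sub>R g) x = (b *\<^sub>R P s g) x"
      using P_lin[of s g g b 0] that gL by simp
    then have "ip2 M a (P s (b *\<^sub>R g)) = ip2 M a (b *\<^sub>R P s g)"
      using assms gL that by (intro ip2_cong_AE) (auto simp del: scaleR_fun_apply)
    then show ?thesis using res assms gL that by (simp add: L2.ip_scale_right)
  qed
  have ev: "\<forall>\<^sub>F s in nhds t. b * (exp (- b * s) * ip2 M (sec a) (sec (P s g)))
      = exp (- b * s) * ip2 M a (P s (res b k))"
    using eventually_nhds_in_open[of "{0<..}" t] assms(3) eq gL assms
    by (auto elim!: eventually_mono)
  have "ip2 M a (P t (sec k)) = ip2 M a (P t k)"
    using assms P_cong[of t "sec k" k] sec_AE[of k] by (intro ip2_cong_AE) auto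
  then have "b * (- exp (- b * t) * ip2 M (sec a) (sec (P t (sec k)))) = - b * exp (- b * t) * ip2 M a (P t k)"
    using assms by simp
  note eq' = this
  show ?thesis
    using d unfolding eq' by (subst (asm) DERIV_cong_ev[OF refl ev refl])
qed

end

lemma res_tendsto:
  fixes b :: "nat \<Rightarrow> real"
  assumes f: "f \<in> L2 M" and b: "filterlim b at_top sequentially"
  shows "(\<lambda>n. nrm2 M (res (b n) f - f)) \<longlonglongrightarrow> 0"
proof -
  have "filterlim (\<lambda>n. 1 / b n) (at_right 0) sequentially"
    using filterlim_compose[OF filterlim_inverse_at_right_top b] by (simp add: inverse_eq_divide)
  from filterlim_compose[OF cf.J_tendsto this, of "sec f"] f
  have 1: "(\<lambda>n. nrm2 M (res (b n) f - sec f)) \<longlonglongrightarrow> 0" by (simp add: res_def)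
  have "\<forall>\<^sub>F n in sequentially. 0 < b n"
    by (rule eventually_compose_filterlim[OF eventually_gt_at_top b])
  then have "\<forall>\<^sub>F n in sequentially. nrm2 M (res (b n) f - sec f) = nrm2 M (res (b n) f - f)"
  proof eventually_elim
    case (elim n)
    show ?case using sec_AE[of f] f elim by (intro nrm2_cong_AE) auto
  qed
  with 1 show ?thesis by (simp add: tendsto_cong)
qed

lemma Euler:
  assumes f: "f \<in> L2 M" and t: "0 < t"
  shows "(\<lambda>n. nrm2 M ((res (Suc n / t) ^^ Suc n) f - P t f)) \<longlonglongrightarrow> 0"
proof -
  have res: "(res (1/h) ^^ Suc n) f = (cf.J h ^^ Suc n) (sec f)" if h: "0 < h" for h n
  proof (induction n)
    case (Suc n)
    have "(cf.J h ^^ Suc n) (sec f) \<in> S0" using f h by (intro cf.Jn_S) auto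
    then have "sec ((cf.J h ^^ Suc n) (sec f)) = (cf.J h ^^ Suc n) (sec f)" by (simp add: S0_iff)
    moreover have "(res (1/h) ^^ Suc (Suc n)) f = cf.J h (sec ((res (1/h) ^^ Suc n) f))"
      by (simp add: res_def)
    ultimately show ?case using Suc by simp
  qed (simp add: res_def)
  have AE: "nrm2 M ((res (Suc n / t) ^^ Suc n) f - P t f) = nrm2 M ((cf.J (t / Suc n) ^^ Suc n) (sec f) - sec (P t (sec f)))" for n
  proof -
    have "(cf.J (t / Suc n) ^^ Suc n) (sec f) \<in> L2 M"
      using f t by (intro S0_L2 cf.Jn_S) auto
    moreover have "AE x in M. P t f x = sec (P t (sec f)) x"
      using P_cong[of t "sec f" f] sec_AE[of f] sec_AE[of "P t (sec f)"] f t by auto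
    moreover have "(res (Suc n / t) ^^ Suc n) f = (cf.J (t / Suc n) ^^ Suc n) (sec f)"
      using res[of "t / Suc n" n] t by simp
    ultimately show ?thesis
      using f t by (intro nrm2_cong_AE) (auto simp del: funpow.simps)
  qed
  show ?thesis
    using fs.Euler[of "sec f" t] f t unfolding AE L2.lim_to_def by simp
qed

lemma P_symmetric: "\<lbrakk>f \<in> L2 M; g \<in> L2 M; 0 < t\<rbrakk> \<Longrightarrow> ip2 M (P t f) g = ip2 M f (P t g)"
proof -
  assume *: "f \<in> L2 M" "g \<in> L2 M" "0 < t"
  have eq: "ip2 M u (P t (sec h)) = ip2 M u (P t h)" if "u \<in> L2 M" "h \<in> L2 M" for u h
    using that * P_cong[of t "sec h" h] sec_AE[of h] by (intro ip2_cong_AE) auto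
  have "ip2 M (sec (P t (sec f))) (sec g) = ip2 M (sec f) (sec (P t (sec g)))"
    by (rule fs.T_symmetric) (use * in auto)
  then show ?thesis
    using * eq[of g f] eq[of f g] by (simp add: L2.ip_sym[of _ M g])
qed

lemma ip2_P_cont:
  assumes "f \<in> L2 M" "a \<in> L2 M"
  shows "continuous_on {0..} (\<lambda>t. ip2 M a (P t f))"
proof -
  have "continuous_on {0..} (\<lambda>t. ip2 M (sec a) (sec (P t (sec f))))"
    by (rule fs.ip_T_cont) (use assms in auto)
  moreover have "ip2 M (sec a) (sec (P t (sec f))) = ip2 M a (P t f)" if "0 \<le> t" for t
  proof -
    have "ip2 M a (P t (sec f)) = ip2 M a (P t f)"
      using that assms P_cong[of t "sec f" f] sec_AE[of f] by (intro ip2_cong_AE) auto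
    then show ?thesis using that assms by simp
  qed
  ultimately show ?thesis by (subst (asm) continuous_on_cong[OF refl]) auto
qed

end

section \<open>Dirichlet spaces\<close>

text \<open>The positive part of \<open>f' - g'\<close> is dominated by
  \<open>|f n - f'| + |g n - g'|\<close> for every \<open>n\<close>, so its norm is 0.\<close>

lemma limit_le_AE:
  assumes L: "\<And>n. f n \<in> L2 M" "\<And>n. g n \<in> L2 M" "f' \<in> L2 M" "g' \<in> L2 M"
    and le: "\<And>n. AE x in M. f n x \<le> g n x"
    and lim: "(\<lambda>n. nrm2 M (f n - f')) \<longlonglongrightarrow> 0" "(\<lambda>n. nrm2 M (g n - g')) \<longlonglongrightarrow> 0"
  shows "AE x in M. f' x \<le> g' x"
proof -
  define z where "z x = max (f' x - g' x) 0" for x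
  have zm: "z \<in> borel_measurable M" unfolding z_def using L by simp
  have z: "z \<in> L2 M"
    by (rule L2_dominated[OF zm, of "f' - g'"]) (use L in \<open>auto simp: z_def\<close>)
  have bnd: "nrm2 M z \<le> nrm2 M (f n - f') + nrm2 M (g n - g')" for n
  proof -
    let ?a = "\<lambda>x. \<bar>f n x - f' x\<bar>" and ?b = "\<lambda>x. \<bar>g n x - g' x\<bar>"
    have a: "?a \<in> L2 M" by (rule L2_dominated[of _ _ "f n - f'"]) (use L in auto)
    have b: "?b \<in> L2 M" by (rule L2_dominated[of _ _ "g n - g'"]) (use L in auto)
    have 1: "nrm2 M z \<le> nrm2 M (?a + ?b)"
    proof (rule nrm2_mono[OF z L2.S_add[OF a b]], use le[of n] in eventually_elim)
      case (elim x)
      then show ?case by (auto simp: z_def)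
    qed
    have 2: "nrm2 M (?a + ?b) \<le> nrm2 M ?a + nrm2 M ?b" using a b by (rule L2.nrm_triangle)
    have 3: "nrm2 M ?a \<le> nrm2 M (f n - f')" using a L by (intro nrm2_mono) auto
    have 4: "nrm2 M ?b \<le> nrm2 M (g n - g')" using b L by (intro nrm2_mono) auto
    from 1 2 3 4 show ?thesis by linarith
  qed
  have "(\<lambda>n. nrm2 M (f n - f') + nrm2 M (g n - g')) \<longlonglongrightarrow> 0"
    by (rule tendsto_add_zero[OF lim])
  then have "nrm2 M z \<le> 0" using bnd by (intro LIMSEQ_le_const) auto
  then have "nrm2 M z = 0" using L2.nrm_ge_0[OF z] by (rule antisym)
  then have "AE x in M. z x = 0" using nrm2_eq_0_iff[OF z] by simp
  then show ?thesis by eventually_elim (auto simp: z_def max_def split: if_splits)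
qed

lemma zero_ext_simps [simp]: "zero_ext U (f + g) = zero_ext U f + zero_ext U g"
  "zero_ext U (f - g) = zero_ext U f - zero_ext U g" "zero_ext U (c *\<^sub>R f) = c *\<^sub>R zero_ext U f"
  "zero_ext U (\<lambda>x. 0) = (\<lambda>x. 0)" "zero_ext U 0 = 0"
  by (auto simp: zero_ext_def fun_eq_iff)

lemma zero_ext_indicator: "zero_ext U f = (\<lambda>x. indicator U x *\<^sub>R f x)"
  by (auto simp: zero_ext_def indicator_def fun_eq_iff)

context
  fixes M :: "'a measure" and U assumes U: "U \<in> sets M"
begin

lemma measurable_restrict_iff:
  "f \<in> borel_measurable (restrict_space M U) \<longleftrightarrow> zero_ext U f \<in> borel_measurable M"
  using U by (subst borel_measurable_restrict_space_iff) (auto simp: zero_ext_indicator)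

lemma L2_restrict_iff: "f \<in> L2 (restrict_space M U) \<longleftrightarrow> zero_ext U f \<in> L2 M"
proof -
  have eq: "(zero_ext U f x)\<^sup>2 = indicator U x *\<^sub>R (f x)\<^sup>2" for x
    by (auto simp: zero_ext_def)
  show ?thesis
  proof -
    have "integrable (restrict_space M U) (\<lambda>x. (f x)\<^sup>2) \<longleftrightarrow> integrable M (\<lambda>x. (zero_ext U f x)\<^sup>2)"
      unfolding eq using U by (simp add: integrable_restrict_space)
    then show ?thesis unfolding L2_def using measurable_restrict_iff by blast
  qed
qed

lemma integral_restrict: "(\<integral>x. f x \<partial>restrict_space M U) = (\<integral>x. zero_ext U f x \<partial>M)"
  using U by (simp add: integral_restrict_space zero_ext_indicator)

lemma ip2_restrict: "ip2 (restrict_space M U) f g = ip2 M (zero_ext U f) (zero_ext U g)"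
proof -
  have "zero_ext U (\<lambda>x. f x * g x) = (\<lambda>x. zero_ext U f x * zero_ext U g x)"
    by (auto simp: zero_ext_def)
  then show ?thesis unfolding ip2_def by (simp add: integral_restrict)
qed

lemma nrm2_restrict: "nrm2 (restrict_space M U) f = nrm2 M (zero_ext U f)"
  by (simp add: L2.nrm_def ip2_restrict)

lemma AE_restrict_iff: "(AE x in restrict_space M U. Q x) \<longleftrightarrow> (AE x in M. x \<in> U \<longrightarrow> Q x)"
  using U by (subst AE_restrict_space_iff) (auto simp: sets.sets_into_space Int_absorb2)

lemma AE_zero_ext_iff:
  "(AE x in M. zero_ext U f x = zero_ext U g x) \<longleftrightarrow> (AE x in restrict_space M U. f x = g x)"
  unfolding AE_restrict_iff by (intro AE_cong) (simp add: zero_ext_def)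

lemma zero_ext_measurable: "f \<in> borel_measurable M \<Longrightarrow> zero_ext U f \<in> borel_measurable M"
  unfolding zero_ext_indicator using U by simp

lemma L2_zero_ext: assumes "f \<in> L2 M" shows "zero_ext U f \<in> L2 M"
  by (rule L2_dominated[OF zero_ext_measurable assms]) (use assms in \<open>simp_all add: zero_ext_def\<close>)

end

locale dirichlet =
  fixes D :: "'a form_space"
  assumes D: "strongly_local_dirichlet_space D"
begin

abbreviation "X \<equiv> fs_top D"

lemma lc: "locally_compact_space X" and metr: "metrizable_space X"
  and radon: "radon_measure X (fs_meas D)" and full: "full_support X (fs_meas D)"
  and markov: "markov_form D" and regular: "regular_form D" and local: "strongly_local_form D"
  and dform: "dform D"
  using D by (auto simp: strongly_local_dirichlet_space_def dform_def)

sublocale dform D by (rule dform)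

lemma hausdorff: "Hausdorff_space X"
  using metr by (rule metrizable_imp_Hausdorff_space)

lemma space_M [simp]: "space M = topspace X"
  and open_sets [simp]: "openin X U \<Longrightarrow> U \<in> sets M"
proof -
  have s: "sets M = sets (sigma (topspace X) {U. openin X U})"
    using radon by (simp add: radon_measure_def)
  from sets_eq_imp_space_eq[OF s] show "space M = topspace X"
    using openin_subset[of X] by (simp add: space_measure_of subset_iff PowI Pow_def)
  show "U \<in> sets M" if "openin X U"
    unfolding s using that openin_subset[of X] by (subst sets_measure_of) auto
qed

lemma closed_sets: "closedin X S \<Longrightarrow> S \<in> sets M"
proof -
  assume S: "closedin X S"
  have "openin X (topspace X - S)" using S by (simp add: closedin_def)
  then have "topspace X - (topspace X - S) \<in> sets M"
    using sets.compl_sets[OF open_sets] by simp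
  then show ?thesis using closedin_subset[OF S] by (simp add: double_diff)
qed

lemma compact_closed: "compactin X K \<Longrightarrow> closedin X K"
  using hausdorff by (rule compactin_imp_closedin)

lemma compact_sets: "compactin X K \<Longrightarrow> K \<in> sets M"
  by (simp add: closed_sets compact_closed)

lemma compact_finite: "compactin X K \<Longrightarrow> emeasure M K < \<infinity>"
  using radon by (simp add: radon_measure_def)

lemma AE_space_M: "AE x in M. x \<in> topspace X"
  using AE_space[of M] by simp

lemma compact_nbhd:
  assumes K: "compactin X K" and U: "openin X U" "K \<subseteq> U"
  obtains V where "openin X V" "K \<subseteq> V" "X closure_of V \<subseteq> U" "compactin X (X closure_of V)"
proof -
  have nb: "neighbourhood_base_of (\<lambda>C. compactin X C \<and> closedin X C) X"
    using lc hausdorff by (simp add: locally_compact_space_neighbourhood_base_closedin)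
  have "\<forall>x\<in>K. \<exists>V C. openin X V \<and> compactin X C \<and> closedin X C \<and> x \<in> V \<and> V \<subseteq> C \<and> C \<subseteq> U"
  proof
    fix x assume "x \<in> K"
    then have "openin X U \<and> x \<in> U" using U by auto
    from nb[unfolded neighbourhood_base_of, THEN spec, THEN spec, THEN mp, OF this]
    show "\<exists>V C. openin X V \<and> compactin X C \<and> closedin X C \<and> x \<in> V \<and> V \<subseteq> C \<and> C \<subseteq> U"
      by (elim exE conjE) (intro exI conjI; assumption)
  qed
  from bchoice[OF this] obtain V where
    "\<forall>x\<in>K. \<exists>C. openin X (V x) \<and> compactin X C \<and> closedin X C \<and> x \<in> V x \<and> V x \<subseteq> C \<and> C \<subseteq> U" ..
  from bchoice[OF this] obtain C where VC:
    "\<forall>x\<in>K. openin X (V x) \<and> compactin X (C x) \<and> closedin X (C x) \<and> x \<in> V x \<and> V x \<subseteq> C x \<and> C x \<subseteq> U" ..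
  have "\<exists>\<F>. finite \<F> \<and> \<F> \<subseteq> V ` K \<and> K \<subseteq> \<Union>\<F>"
    by (rule compactinD[OF K]) (use VC in blast)+
  then obtain \<F> where \<F>: "finite \<F>" "\<F> \<subseteq> V ` K" "K \<subseteq> \<Union>\<F>" by blast
  from finite_subset_image[OF \<F>(1,2)] obtain J where J': "J \<subseteq> K" "finite J" "\<F> = V ` J" by blast
  then have J: "finite J" "J \<subseteq> K" "K \<subseteq> (\<Union>x\<in>J. V x)" using \<F>(3) by auto
  let ?V = "\<Union>x\<in>J. V x" and ?C = "\<Union>x\<in>J. C x"
  have C: "compactin X ?C" using J VC by (intro compactin_Union) auto
  have cl: "X closure_of ?V \<subseteq> ?C"
    using J VC by (intro closure_of_minimal compact_closed[OF C]) blast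
  show ?thesis
  proof (rule that[of ?V])
    show "openin X ?V" using J VC by blast
    show "X closure_of ?V \<subseteq> U" using cl J VC by blast
    show "compactin X (X closure_of ?V)"
      using closed_compactin[OF C cl] by simp
  qed (use J in auto)
qed

text \<open>\<open>dom_on D U\<close> is the closure of this set in the \<open>E1\<close> norm, see
  \<open>FU_iff\<close>.\<close>

definition core :: "'a set \<Rightarrow> ('a \<Rightarrow> real) set" where
  "core U = {v \<in> F \<inter> Cc X. top_support X v \<subseteq> U}"

lemma Cc_subset:
  assumes f: "f \<in> Cont X" and K: "compactin X K" and "K \<subseteq> U" and 0: "\<And>x. x \<in> topspace X \<Longrightarrow> x \<notin> K \<Longrightarrow> f x = 0"
  shows "f \<in> Cc X" "top_support X f \<subseteq> U"
proof -
  have "top_support X f \<subseteq> K"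
    unfolding top_support_def using 0 by (intro closure_of_minimal compact_closed[OF K]) blast
  then show "f \<in> Cc X" "top_support X f \<subseteq> U"
    using f closed_compactin[OF K, of "top_support X f"] assms(3)
    by (auto simp: Cc_def top_support_def)
qed

lemma core_zero: "v \<in> core U \<Longrightarrow> x \<in> topspace X \<Longrightarrow> x \<notin> top_support X v \<Longrightarrow> v x = 0"
  using closure_of_subset[of "{x \<in> topspace X. v x \<noteq> 0}" X] by (auto simp: top_support_def)

lemma coreI:
  assumes "f \<in> F" "f \<in> Cont X" "compactin X K" "K \<subseteq> U" "\<And>x. x \<in> topspace X \<Longrightarrow> x \<notin> K \<Longrightarrow> f x = 0"
  shows "f \<in> core U"
  using Cc_subset[OF assms(2-5)] assms(1) by (auto simp: core_def)

lemma core_dest: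
  assumes "v \<in> core U"
  shows "v \<in> F" "v \<in> Cont X" "compactin X (top_support X v)" "top_support X v \<subseteq> U"
  using assms by (auto simp: core_def Cc_def)

lemma core_add: assumes "u \<in> core U" "v \<in> core U" shows "u + v \<in> core U"
proof (rule coreI)
  show "u + v \<in> Cont X" using core_dest[OF assms(1)] core_dest[OF assms(2)]
    by (auto simp: Cont_def plus_fun_def intro: continuous_map_add)
  show "compactin X (top_support X u \<union> top_support X v)"
    using assms by (auto intro: compactin_Un dest: core_dest)
  show "u + v \<in> F" using assms by (auto dest: core_dest)
qed (use assms in \<open>auto dest: core_dest simp: core_zero\<close>)

lemma core_scale: assumes "u \<in> core U" shows "c *\<^sub>R u \<in> core U"
proof (rule coreI)
  show "c *\<^sub>R u \<in> Cont X" using core_dest[OF assms]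
    by (auto simp: Cont_def scaleR_fun_def intro: continuous_map_real_mult)
  show "compactin X (top_support X u)" using core_dest[OF assms] by simp
  show "c *\<^sub>R u \<in> F" using core_dest[OF assms] by simp
qed (use assms in \<open>auto dest: core_dest simp: core_zero\<close>)

lemma core_0: "0 \<in> core U"
  by (rule coreI[OF E.S_0, of "{}"]) (auto simp: Cont_def zero_fun_def)

lemma contraction_F:
  assumes "u \<in> F" "\<And>a b. \<bar>T a - T b\<bar> \<le> \<bar>a - b\<bar>" "T 0 = 0"
  shows "(\<lambda>x. T (u x)) \<in> F" "E (\<lambda>x. T (u x)) (\<lambda>x. T (u x)) \<le> E u u"
  using markov[unfolded markov_form_def, rule_format, of T u] assms by (auto simp: o_def)

lemma contraction_E1:
  assumes u: "u \<in> F" and T: "\<And>a b. \<bar>T a - T b\<bar> \<le> \<bar>a - b\<bar>" "T 0 = 0"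
  shows "E1.nrm (\<lambda>x. T (u x)) \<le> E1.nrm u"
proof -
  have F: "(\<lambda>x. T (u x)) \<in> F" by (rule contraction_F[OF u T])
  have "AE x in M. \<bar>T (u x)\<bar> \<le> \<bar>u x\<bar>" using T(1)[of _ 0] T(2) by simp
  then have "nrm2 M (\<lambda>x. T (u x)) \<le> nrm2 M u" using u F by (intro nrm2_mono) auto
  then have "(nrm2 M (\<lambda>x. T (u x)))\<^sup>2 \<le> (nrm2 M u)\<^sup>2" using F by (intro power_mono) auto
  then have "ip2 M (\<lambda>x. T (u x)) (\<lambda>x. T (u x)) \<le> ip2 M u u"
    using u F by (simp add: L2.nrm_sq)
  then show ?thesis
    using contraction_F(2)[OF u T] by (simp add: E1.nrm_def E1_def)
qed

lemma pos_F: "u \<in> F \<Longrightarrow> (\<lambda>x. max (u x) 0) \<in> F"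
  and pos_E1: "u \<in> F \<Longrightarrow> E1.nrm (\<lambda>x. max (u x) 0) \<le> E1.nrm u"
  and abs_F: "u \<in> F \<Longrightarrow> (\<lambda>x. \<bar>u x\<bar>) \<in> F"
  and abs_E1: "u \<in> F \<Longrightarrow> E1.nrm (\<lambda>x. \<bar>u x\<bar>) \<le> E1.nrm u"
  and min_const_F: "u \<in> F \<Longrightarrow> 0 \<le> c \<Longrightarrow> (\<lambda>x. min (u x) c) \<in> F"
  by (rule contraction_F[of u "\<lambda>a. max a 0"] contraction_E1[of u "\<lambda>a. max a 0"]
    contraction_F[of u abs] contraction_E1[of u abs] contraction_F[of u "\<lambda>a. min a c"]; force)+

lemma min_F:
  assumes u: "u \<in> F" and v: "v \<in> F"
  shows "(\<lambda>x. min (u x) (v x)) \<in> F" "E1.nrm (\<lambda>x. min (u x) (v x)) \<le> E1.nrm u + E1.nrm v"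
proof -
  have eq: "(\<lambda>x. min (u x) (v x)) = (1/2) *\<^sub>R ((u + v) - (\<lambda>x. \<bar>(u - v) x\<bar>))"
    by (auto simp: fun_eq_iff min_def)
  have a: "(\<lambda>x. \<bar>(u - v) x\<bar>) \<in> F" by (rule abs_F[OF E.S_diff[OF u v]])
  show "(\<lambda>x. min (u x) (v x)) \<in> F" unfolding eq using u v a by simp
  have "E1.nrm ((u + v) - (\<lambda>x. \<bar>(u - v) x\<bar>)) \<le> E1.nrm (u + v) + E1.nrm (\<lambda>x. \<bar>(u - v) x\<bar>)"
    using u v a by (intro E1.nrm_triangle_diff) auto
  also have "\<dots> \<le> (E1.nrm u + E1.nrm v) + (E1.nrm u + E1.nrm v)"
    using u v order_trans[OF abs_E1[of "u - v"] E1.nrm_triangle_diff[OF u v]]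
    by (intro add_mono E1.nrm_triangle) auto
  finally show "E1.nrm (\<lambda>x. min (u x) (v x)) \<le> E1.nrm u + E1.nrm v"
    unfolding eq using u v a by (subst E1.nrm_scale) auto
qed

section \<open>Form domains of open subsets\<close>

abbreviation FU :: "'a set \<Rightarrow> ('a \<Rightarrow> real) set" where "FU U \<equiv> dom_on D U"

lemma FU_F [simp]: "u \<in> FU U \<Longrightarrow> u \<in> F"
  by (simp add: dom_on_def)

lemma FU_iff: "u \<in> FU U \<longleftrightarrow> u \<in> F \<and> (\<forall>e>0. \<exists>v\<in>core U. E1.nrm (u - v) < e)"
proof -
  have eq: "E1_dist2 D u v = (E1.nrm (u - v))\<^sup>2" if "u \<in> F" "v \<in> F" for v
    using that by (simp add: E1_dist2 E1.nrm_sq)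
  have "(\<forall>e>0. \<exists>v\<in>core U. E1.nrm (u - v) < e) \<longleftrightarrow> (\<forall>e>0. \<exists>v\<in>core U. (E1.nrm (u - v))\<^sup>2 < e)"
    if u: "u \<in> F"
  proof safe
    fix e :: real assume *: "\<forall>e>0. \<exists>v\<in>core U. E1.nrm (u - v) < e" and e: "0 < e"
    obtain v where v: "v \<in> core U" "E1.nrm (u - v) < sqrt e" using * e by (meson real_sqrt_gt_zero)
    have "(E1.nrm (u - v))\<^sup>2 < (sqrt e)\<^sup>2"
      using v u core_dest(1)[OF v(1)] by (intro power_strict_mono) auto
    then show "\<exists>v\<in>core U. (E1.nrm (u - v))\<^sup>2 < e" using v(1) e by auto
  next
    fix e :: real assume *: "\<forall>e>0. \<exists>v\<in>core U. (E1.nrm (u - v))\<^sup>2 < e" and e: "0 < e"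
    obtain v where v: "v \<in> core U" "(E1.nrm (u - v))\<^sup>2 < e\<^sup>2"
      using * e by (meson zero_less_power)
    then have "E1.nrm (u - v) < e" using e by (simp add: power_less_imp_less_base)
    then show "\<exists>v\<in>core U. E1.nrm (u - v) < e" using v(1) by blast
  qed
  moreover have "(\<exists>v\<in>F \<inter> Cc X. top_support X v \<subseteq> U \<and> E1_dist2 D u v < e)
      \<longleftrightarrow> (\<exists>v\<in>core U. (E1.nrm (u - v))\<^sup>2 < e)" if "u \<in> F" for e
    unfolding core_def using eq[OF that] by auto
  ultimately show ?thesis unfolding dom_on_def by auto
qed

lemma core_FU: "v \<in> core U \<Longrightarrow> v \<in> FU U"
  unfolding FU_iff using core_dest(1) by (auto intro!: bexI[of _ v])

lemma FU_closed:
  assumes u: "u \<in> F" and *: "\<And>e. 0 < e \<Longrightarrow> \<exists>v\<in>FU U. E1.nrm (u - v) < e"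
  shows "u \<in> FU U"
  unfolding FU_iff
proof (intro conjI u allI impI)
  fix e :: real assume e: "0 < e"
  obtain v where v: "v \<in> FU U" "E1.nrm (u - v) < e/2" using *[of "e/2"] e by auto
  obtain w where w: "w \<in> core U" "E1.nrm (v - w) < e/2"
    using v(1) e unfolding FU_iff by (meson half_gt_zero)
  have "E1.nrm (u - w) \<le> E1.nrm (u - v) + E1.nrm (v - w)"
    using u v w core_dest(1) by (intro E1.nrm_triangle3) auto
  then show "\<exists>v\<in>core U. E1.nrm (u - v) < e" using v w by (intro bexI[of _ w]) auto
qed

lemma FU_subspace: "subspace (FU U)"
proof (rule subspaceI)
  show "0 \<in> FU U" by (rule core_FU[OF core_0])
  fix u v assume u: "u \<in> FU U" and v: "v \<in> FU U"
  show "u + v \<in> FU U"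
    unfolding FU_iff
  proof (intro conjI allI impI)
    fix e :: real assume e: "0 < e"
    obtain u' where u': "u' \<in> core U" "E1.nrm (u - u') < e/2"
      using u e unfolding FU_iff by (meson half_gt_zero)
    obtain v' where v': "v' \<in> core U" "E1.nrm (v - v') < e/2"
      using v e unfolding FU_iff by (meson half_gt_zero)
    have "E1.nrm ((u - u') + (v - v')) \<le> E1.nrm (u - u') + E1.nrm (v - v')"
      using u v u' v' core_dest(1) by (intro E1.nrm_triangle) auto
    then have "E1.nrm ((u + v) - (u' + v')) < e"
      using u'(2) v'(2) by (simp add: add_diff_add)
    then show "\<exists>w\<in>core U. E1.nrm ((u + v) - w) < e" using core_add u' v' by blast
  qed (use u v in auto)
next
  fix u and c :: real assume u: "u \<in> FU U"
  show "c *\<^sub>R u \<in> FU U"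
    unfolding FU_iff
  proof (intro conjI allI impI)
    fix e :: real assume e: "0 < e"
    have "0 < e / (\<bar>c\<bar> + 1)" using e by simp
    then obtain u' where u': "u' \<in> core U" "E1.nrm (u - u') < e / (\<bar>c\<bar> + 1)"
      using u unfolding FU_iff by meson
    have F: "u - u' \<in> F" using u u' core_dest(1) by auto
    have "E1.nrm (c *\<^sub>R u - c *\<^sub>R u') = \<bar>c\<bar> * E1.nrm (u - u')"
      using E1.nrm_scale[OF F, of c] by (simp add: scaleR_diff_right)
    also have "\<dots> \<le> (\<bar>c\<bar> + 1) * E1.nrm (u - u')" using F by (intro mult_right_mono) auto
    also have "\<dots> < e" using u'(2) by (simp add: pos_less_divide_eq mult.commute)
    finally show "\<exists>w\<in>core U. E1.nrm (c *\<^sub>R u - w) < e" using core_scale[OF u'(1)] by blast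
  qed (use u in auto)
qed

text \<open>The Markov property shows that truncations of an \<open>E1\<close>-convergent sequence
  are bounded in \<open>E1\<close>, but not that they converge there; convergence in
  \<open>L2\<close> is easy. This lemma makes do with both. Elements of almost minimal norm in the
  sets \<open>C n\<close> form an \<open>E1\<close>-Cauchy sequence, whose limit can only be
  \<open>u\<close> a.e.\<close>

lemma FU_weak_closed:
  assumes u: "u \<in> L2 M"
    and *: "\<And>e. 0 < e \<Longrightarrow> \<exists>w\<in>FU U. nrm2 M (w - u) < e \<and> E1.nrm w \<le> B"
  shows "u \<in> FU U"
proof -
  define C where "C n = {w \<in> FU U. nrm2 M (w - u) \<le> 1 / Suc n}" for n
  obtain c f where c: "c \<in> F" "\<And>n. f n \<in> C n" "E1.lim_to f c"
  proof (rule E1.decreasing_convex_limit[of C "B\<^sup>2"])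
    show "C n \<subseteq> F" for n by (auto simp: C_def)
    show "C n \<subseteq> C m" if "m \<le> n" for m n :: nat
    proof -
      have "1 / real (Suc n) \<le> 1 / Suc m" using that by (simp add: field_simps)
      then show ?thesis by (auto simp: C_def)
    qed
    fix n
    show "\<exists>x\<in>C n. E1 x x \<le> B\<^sup>2"
    proof -
      obtain w where w: "w \<in> FU U" "nrm2 M (w - u) < 1 / Suc n" "E1.nrm w \<le> B"
        using *[of "1 / Suc n"] by auto
      have "(E1.nrm w)\<^sup>2 \<le> B\<^sup>2" using w by (intro power_mono) auto
      then show ?thesis using w by (intro bexI[of _ w]) (auto simp: C_def E1.nrm_sq)
    qed
    fix x y assume x: "x \<in> C n" and y: "y \<in> C n"
    have L: "x - u \<in> L2 M" "y - u \<in> L2 M" using x y u by (auto simp: C_def)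
    have "(1/2) *\<^sub>R (x + y) - u = (1/2) *\<^sub>R ((x - u) + (y - u))"
      by (simp add: fun_eq_iff)
    then have "nrm2 M ((1/2) *\<^sub>R (x + y) - u) \<le> (1/2) * (nrm2 M (x - u) + nrm2 M (y - u))"
      using L2.nrm_triangle[OF L] L2.nrm_scale[OF L2.S_add[OF L], of "1/2"] by simp
    then show "(1/2) *\<^sub>R (x + y) \<in> C n"
      using x y subspace_add[OF FU_subspace] subspace_mul[OF FU_subspace] by (auto simp: C_def)
  qed blast
  have cFU: "c \<in> FU U"
  proof (rule FU_closed[OF c(1)])
    fix e :: real assume e: "0 < e"
    obtain n where "norm (E1.nrm (f n - c) - 0) < e"
      using LIMSEQ_D[OF c(3)[unfolded E1.lim_to_def] e] by blast
    moreover have "f n \<in> FU U" using c(2)[of n] by (simp add: C_def)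
    ultimately show "\<exists>v\<in>FU U. E1.nrm (c - v) < e"
      using E1.nrm_minus_commute[of c "f n"] c(1) by (intro bexI[of _ "f n"]) auto
  qed
  have fF: "f n \<in> F" for n using c(2)[of n] FU_F[of "f n" U] by (simp add: C_def)
  have "nrm2 M (c - u) \<le> E1.nrm (f n - c) + 1 / Suc n" for n
  proof -
    have "nrm2 M (c - u) \<le> nrm2 M (c - f n) + nrm2 M (f n - u)"
      using c(1) fF[of n] u by (intro L2.nrm_triangle3) auto
    moreover have "nrm2 M (c - f n) \<le> E1.nrm (f n - c)"
      using E1_nrm[of "c - f n"] E1.nrm_minus_commute[of c "f n"] c(1) fF[of n] by simp
    moreover have "nrm2 M (f n - u) \<le> 1 / Suc n" using c(2)[of n] by (simp add: C_def)
    ultimately show ?thesis by linarith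
  qed
  moreover have "(\<lambda>n. E1.nrm (f n - c) + 1 / Suc n) \<longlonglongrightarrow> 0 + 0"
    using c(3) unfolding E1.lim_to_def by (intro tendsto_add LIMSEQ_Suc lim_const_over_n)
  ultimately have "nrm2 M (c - u) \<le> 0"
    using LIMSEQ_le_const[of "\<lambda>n. E1.nrm (f n - c) + 1 / Suc n" "0 + 0" "nrm2 M (c - u)"] by auto
  then have "nrm2 M (c - u) = 0" by (rule antisym) (use c(1) u in simp)
  then have AE: "AE x in M. c x = u x" using c(1) u by (simp add: nrm2_diff_eq_0)
  have uF: "u \<in> F" by (rule F_cong[OF c(1) _ AE]) (use u in simp)
  have "AE x in M. (c - u) x = 0" using AE by eventually_elim simp
  then have "E (c - u) (c - u) = E 0 0"
    using c(1) uF by (intro E_cong) auto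
  moreover have "ip2 M (c - u) (c - u) = 0"
    using \<open>nrm2 M (c - u) = 0\<close> L2.nrm_sq[of "c - u" M] c(1) uF by simp
  ultimately have "E1.nrm (u - c) = 0"
    using E1.nrm_minus_commute[of u c] c(1) uF by (simp add: E1.nrm_def E1_def)
  then show ?thesis using cFU by (intro FU_closed[OF uF] bexI[of _ c]) auto
qed

lemma FU_cong: assumes u: "u \<in> FU U" and "u' \<in> borel_measurable M" "AE x in M. u x = u' x"
  shows "u' \<in> FU U"
proof (rule FU_weak_closed[where B = "E1.nrm u"])
  have uF: "u \<in> F" using u by (rule FU_F)
  have u'F: "u' \<in> F" by (rule F_cong[OF uF assms(2,3)])
  then show "u' \<in> L2 M" by (rule F_L2)
  have "nrm2 M (u - u') = 0" using nrm2_diff_eq_0[OF F_L2[OF uF] F_L2[OF u'F]] assms(3) by simp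
  then show "\<exists>w\<in>FU U. nrm2 M (w - u') < e \<and> E1.nrm w \<le> E1.nrm u" if "0 < e" for e
    using that by (intro bexI[OF _ u]) simp
qed

lemma core_min:
  assumes f: "f \<in> F" "f \<in> Cont X" and v: "v \<in> core U"
  shows "(\<lambda>x. min (max (f x) 0) (max (v x) 0)) \<in> core U"
proof (rule coreI)
  note v' = core_dest[OF v]
  show "(\<lambda>x. min (max (f x) 0) (max (v x) 0)) \<in> F"
    using f v' by (intro min_F pos_F) auto
  show "(\<lambda>x. min (max (f x) 0) (max (v x) 0)) \<in> Cont X"
    using f v' unfolding Cont_def
    by (auto intro!: continuous_map_real_min continuous_map_real_max)
  show "min (max (f x) 0) (max (v x) 0) = 0" if "x \<in> topspace X" "x \<notin> top_support X v" for x
    using core_zero[OF v that] by simp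
qed (use core_dest[OF v] in auto)

text \<open>For continuous \<open>f\<close> close to \<open>u\<close> and for \<open>v'\<close> in
  \<open>core U\<close> close to \<open>v\<close>, the minimum of their positive parts is in
  \<open>core U\<close>, bounded in \<open>E1\<close> and close to \<open>u\<close> in
  \<open>L2\<close>. The lemma serves to show that a function vanishes at the boundary of
  \<open>U\<close> in the sense of the form.\<close>

lemma FU_sandwich:
  assumes u: "u \<in> F" and v: "v \<in> FU U" and le: "AE x in M. 0 \<le> u x" "AE x in M. u x \<le> v x"
  shows "u \<in> FU U"
proof (rule FU_weak_closed[where B = "E1.nrm u + E1.nrm v + 2"])
  show "u \<in> L2 M" using u by simp
  fix e :: real assume e: "0 < e"
  define d where "d = min 1 (e/2)"
  have d: "0 < d" "d \<le> 1" "d \<le> e/2" using e by (auto simp: d_def)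
  have "0 < d\<^sup>2" using d by simp
  then obtain f where "f \<in> F \<inter> Cc X" "E1_dist2 D u f < d\<^sup>2"
    using regular u unfolding regular_form_def by meson
  then have f: "f \<in> F" "f \<in> Cont X" "E1 (u - f) (u - f) < d\<^sup>2"
    using u by (auto simp: Cc_def E1_dist2)
  have "(E1.nrm (u - f))\<^sup>2 < d\<^sup>2" using f u by (simp add: E1.nrm_sq)
  then have uf: "E1.nrm (u - f) < d" using d by (simp add: power_less_imp_less_base)
  obtain v' where v': "v' \<in> core U" "E1.nrm (v - v') < d"
    using v d(1) unfolding FU_iff by meson
  note cv = core_dest[OF v'(1)]
  let ?w = "\<lambda>x. min (max (f x) 0) (max (v' x) 0)"
  have w: "?w \<in> core U" by (rule core_min[OF f(1,2) v'(1)])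
  have wF: "?w \<in> F" using core_dest(1)[OF w] .
  have n1: "nrm2 M (?w - u) \<le> nrm2 M (u - f) + nrm2 M (v - v')"
  proof -
    let ?a = "\<lambda>x. \<bar>(u - f) x\<bar>" and ?b = "\<lambda>x. \<bar>(v - v') x\<bar>"
    have F: "?a \<in> F" "?b \<in> F"
      by (rule abs_F[OF E.S_diff]; use u f v cv FU_F in blast)+
    have 1: "nrm2 M (?w - u) \<le> nrm2 M (?a + ?b)"
    proof (rule nrm2_mono)
      show "AE x in M. \<bar>(?w - u) x\<bar> \<le> \<bar>(?a + ?b) x\<bar>"
        using le by eventually_elim auto
    qed (use F wF u in auto)
    have 2: "nrm2 M (?a + ?b) \<le> nrm2 M ?a + nrm2 M ?b" using F by (intro L2.nrm_triangle) auto
    have 3: "nrm2 M ?a \<le> nrm2 M (u - f)" using F u f by (intro nrm2_mono) auto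
    have 4: "nrm2 M ?b \<le> nrm2 M (v - v')" using F v cv by (intro nrm2_mono) auto
    from 1 2 3 4 show ?thesis by linarith
  qed
  have "nrm2 M (u - f) < d" "nrm2 M (v - v') < d"
    using E1_nrm[of "u - f"] E1_nrm[of "v - v'"] uf v'(2) u f v cv by auto
  then have 1: "nrm2 M (?w - u) < e" using n1 d by simp
  have "E1.nrm ?w \<le> E1.nrm (\<lambda>x. max (f x) 0) + E1.nrm (\<lambda>x. max (v' x) 0)"
    using f cv by (intro min_F pos_F) auto
  moreover have "E1.nrm (\<lambda>x. max (f x) 0) \<le> E1.nrm f" "E1.nrm (\<lambda>x. max (v' x) 0) \<le> E1.nrm v'"
    using f cv by (auto intro: pos_E1)
  moreover have "E1.nrm f \<le> E1.nrm u + E1.nrm (f - u)" using f u by (intro E1.nrm_le_diff) auto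
  moreover have "E1.nrm v' \<le> E1.nrm v + E1.nrm (v' - v)" using v cv by (intro E1.nrm_le_diff) auto
  moreover have "E1.nrm (f - u) = E1.nrm (u - f)" using f u by (intro E1.nrm_minus_commute)
  moreover have "E1.nrm (v' - v) = E1.nrm (v - v')" using v cv by (intro E1.nrm_minus_commute) auto
  ultimately have "E1.nrm ?w \<le> E1.nrm u + E1.nrm v + 2"
    using uf v'(2) d by linarith
  with 1 show "\<exists>w\<in>FU U. nrm2 M (w - u) < e \<and> E1.nrm w \<le> E1.nrm u + E1.nrm v + 2"
    by (intro bexI[OF _ core_FU[OF w]] conjI)
qed

lemma FU_mono: "U \<subseteq> V \<Longrightarrow> u \<in> FU U \<Longrightarrow> u \<in> FU V"
  unfolding FU_iff core_def by fast

lemma core_pos: assumes v: "v \<in> core U" shows "(\<lambda>x. max (v x) 0) \<in> core U"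
proof (rule coreI)
  show "(\<lambda>x. max (v x) 0) \<in> Cont X"
    using core_dest[OF v] unfolding Cont_def by (auto intro!: continuous_map_real_max)
qed (use core_dest[OF v] in \<open>auto intro: pos_F simp: core_zero[OF v]\<close>)

lemma FU_pos: assumes u: "u \<in> FU U" shows "(\<lambda>x. max (u x) 0) \<in> FU U"
proof (rule FU_weak_closed[where B = "E1.nrm u + 1"])
  have uF: "u \<in> F" using u by simp
  show "(\<lambda>x. max (u x) 0) \<in> L2 M" using pos_F[OF uF] by simp
  fix e :: real assume "0 < e"
  then have "0 < min e 1" by simp
  then obtain v where v: "v \<in> core U" "E1.nrm (u - v) < min e 1"
    using u unfolding FU_iff by meson
  have vF: "v \<in> F" using core_dest(1)[OF v(1)] .
  have "nrm2 M ((\<lambda>x. max (v x) 0) - (\<lambda>x. max (u x) 0)) \<le> nrm2 M (u - v)"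
    using pos_F[OF uF] pos_F[OF vF] uF vF by (intro nrm2_mono) auto
  also have "\<dots> < e" using E1_nrm[of "u - v"] v(2) uF vF by simp
  finally have "nrm2 M ((\<lambda>x. max (v x) 0) - (\<lambda>x. max (u x) 0)) < e" .
  moreover have "E1.nrm (\<lambda>x. max (v x) 0) \<le> E1.nrm u + 1"
    using pos_E1[OF vF] E1.nrm_le_diff[OF vF uF] E1.nrm_minus_commute[OF uF vF] v(2) by linarith
  ultimately show "\<exists>w\<in>FU U. nrm2 M (w - (\<lambda>x. max (u x) 0)) < e \<and> E1.nrm w \<le> E1.nrm u + 1"
    by (intro bexI[OF _ core_FU[OF core_pos[OF v(1)]]] conjI)
qed

text \<open>Cutting \<open>u\<close> off at \<open>C\<close> does not increase the form. For
  \<open>z = (u - C)^+\<close>, expanding \<open>E (u - z) (u - z) <= E u u\<close> gives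
  \<open>E z z <= 2 * E u z\<close>.\<close>

lemma E_trunc_nonneg:
  assumes u: "u \<in> F" and C: "0 \<le> C"
  shows "(\<lambda>x. max (u x - C) 0) \<in> F" "0 \<le> E u (\<lambda>x. max (u x - C) 0)"
proof -
  have eq: "(\<lambda>x. max (u x - C) 0) = u - (\<lambda>x. min (u x) C)"
    by (auto simp: fun_eq_iff max_def min_def)
  have m: "(\<lambda>x. min (u x) C) \<in> F" by (rule min_const_F[OF u C])
  show F: "(\<lambda>x. max (u x - C) 0) \<in> F" unfolding eq by (rule E.S_diff[OF u m])
  have "E (\<lambda>x. min (u x) C) (\<lambda>x. min (u x) C) \<le> E u u"
    by (rule contraction_F(2)[of u "\<lambda>a. min a C"]) (use u C in auto)
  moreover have "(\<lambda>x. min (u x) C) = u - (\<lambda>x. max (u x - C) 0)"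
    by (auto simp: fun_eq_iff max_def min_def)
  ultimately have "E (\<lambda>x. max (u x - C) 0) (\<lambda>x. max (u x - C) 0) \<le> 2 * E u (\<lambda>x. max (u x - C) 0)"
    using u F E.ip_sym[OF F u] by (simp add: E.ip_diff_left E.ip_diff_right)
  then show "0 \<le> E u (\<lambda>x. max (u x - C) 0)" using E.ip_nonneg[OF F] by linarith
qed

text \<open>The test function is \<open>(u - C)\<^sup>+\<close>.\<close>

lemma max_principle:
  assumes u: "u \<in> F" and C: "0 \<le> C" and b: "0 < b" and w: "w \<in> FU U" and uw: "AE x in M. u x \<le> C + w x"
    and w0: "AE x in M. 0 \<le> w x" and r: "r \<in> L2 M" "AE x in M. r x \<le> b * C"
    and sub: "\<And>\<phi>. \<lbrakk>\<phi> \<in> FU U; AE x in M. 0 \<le> \<phi> x\<rbrakk> \<Longrightarrow> E u \<phi> + b * ip2 M u \<phi> \<le> ip2 M r \<phi>"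
  shows "AE x in M. u x \<le> C"
proof -
  define z where "z x = max (u x - C) 0" for x
  have z: "z \<in> F" "0 \<le> E u z"
    using E_trunc_nonneg[OF u C] unfolding z_def by auto
  \<comment> \<open>This is the role of \<open>w\<close>: as it vanishes at the boundary in the
    sense of the form, \<open>u <= C + w\<close> is the boundary condition
    \<open>u <= C\<close>.\<close>
  have "z \<in> FU U"
  proof (rule FU_sandwich[OF z(1) w])
    show "AE x in M. z x \<le> w x" using uw w0 by eventually_elim (simp add: z_def)
  qed (simp add: z_def)
  then have "E u z + b * ip2 M u z \<le> ip2 M r z" by (rule sub) (simp add: z_def)
  then have "0 \<le> ip2 M r z - b * ip2 M u z" using z(2) by linarith
  also have "\<dots> = ip2 M (r - b *\<^sub>R u) z"
    using r u z by (simp add: L2.ip_diff_left L2.ip_scale_left)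
  also have "\<dots> \<le> ip2 M ((- b) *\<^sub>R z) z"
    unfolding ip2_def
  proof (rule integral_mono_AE)
    show "integrable M (\<lambda>x. (r - b *\<^sub>R u) x * z x)"
      by (rule L2_mult[OF L2.S_diff[OF r(1) L2.S_scale[OF F_L2[OF u]]] F_L2[OF z(1)]])
    show "integrable M (\<lambda>x. ((- b) *\<^sub>R z) x * z x)"
      by (rule L2_mult[OF L2.S_scale[OF F_L2[OF z(1)]] F_L2[OF z(1)]])
    show "AE x in M. (r - b *\<^sub>R u) x * z x \<le> ((- b) *\<^sub>R z) x * z x"
      using r(2)
    proof eventually_elim
      case (elim x)
      show ?case
      proof (cases "u x \<le> C")
        case False
        then have "r x - b * u x \<le> - b * z x" using elim by (simp add: z_def algebra_simps)
        then have "(r x - b * u x) * z x \<le> (- b * z x) * z x"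
          by (rule mult_right_mono) (simp add: z_def)
        then show ?thesis by simp
      qed (simp add: z_def)
    qed
  qed
  also have "\<dots> = - b * (nrm2 M z)\<^sup>2" using z by (simp add: L2.nrm_sq L2.ip_uminus_left L2.ip_scale_left)
  finally have "b * (nrm2 M z)\<^sup>2 \<le> 0" by simp
  then have "nrm2 M z = 0" using b by (simp add: mult_le_0_iff)
  then have "AE x in M. z x = 0" using z by (simp add: nrm2_eq_0_iff)
  then show ?thesis by eventually_elim (auto simp: z_def max_def split: if_splits)
qed

lemma FU_dense_zero:
  assumes diff: "\<And>u v. \<lbrakk>u \<in> F; v \<in> F\<rbrakk> \<Longrightarrow> l (u - v) = l u - l v"
    and bound: "\<And>u. u \<in> F \<Longrightarrow> \<bar>l u\<bar> \<le> B * E1.nrm u"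
    and zero: "\<And>v. v \<in> core U \<Longrightarrow> l v = 0" and u: "u \<in> FU U"
  shows "l u = (0::real)"
proof -
  have "\<bar>l u\<bar> \<le> 0 + e" if e: "0 < e" for e
  proof -
    have "0 < e / (\<bar>B\<bar> + 1)" using e by simp
    then obtain v where v: "v \<in> core U" "E1.nrm (u - v) < e / (\<bar>B\<bar> + 1)"
      using u unfolding FU_iff by meson
    have F: "u \<in> F" "v \<in> F" "u - v \<in> F" using u core_dest(1)[OF v(1)] by auto
    have "\<bar>l u\<bar> = \<bar>l (u - v)\<bar>" using diff[OF F(1,2)] zero[OF v(1)] by simp
    also have "\<dots> \<le> B * E1.nrm (u - v)" by (rule bound[OF F(3)])
    also have "\<dots> \<le> (\<bar>B\<bar> + 1) * E1.nrm (u - v)" using F by (intro mult_right_mono) auto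
    also have "\<dots> < e" using v(2) by (simp add: pos_less_divide_eq mult.commute)
    finally show ?thesis by simp
  qed
  then have "\<bar>l u\<bar> \<le> 0" by (rule field_le_epsilon)
  then show ?thesis by simp
qed

lemma E_bound: assumes "u \<in> F" "v \<in> F" shows "\<bar>E u v\<bar> \<le> E.nrm u * E1.nrm v"
proof -
  have "E.nrm v \<le> E1.nrm v"
    using L2.ip_nonneg[of v M] assms by (simp add: E.nrm_def E1.nrm_def E1_def)
  then show ?thesis
    using E.Cauchy_Schwarz[OF assms] mult_left_mono[of "E.nrm v" "E1.nrm v" "E.nrm u"] assms by force
qed

lemma ip2_bound: assumes "r \<in> L2 M" "v \<in> F" shows "\<bar>ip2 M r v\<bar> \<le> nrm2 M r * E1.nrm v"
proof -
  have "\<bar>ip2 M r v\<bar> \<le> nrm2 M r * nrm2 M v" using assms by (intro L2.Cauchy_Schwarz) auto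
  also have "\<dots> \<le> nrm2 M r * E1.nrm v" using assms E1_nrm by (intro mult_left_mono) auto
  finally show ?thesis .
qed

lemma FU_weak_eq:
  assumes u: "u \<in> F" and r: "r \<in> L2 M" and eq: "\<And>v. v \<in> core U \<Longrightarrow> E u v = ip2 M r v" and v: "v \<in> FU U"
  shows "E u v = ip2 M r v"
proof -
  have "E u v - ip2 M r v = 0"
  proof (rule FU_dense_zero[where l = "\<lambda>v. E u v - ip2 M r v" and B = "E.nrm u + nrm2 M r", OF _ _ _ v])
    show "\<bar>E u v - ip2 M r v\<bar> \<le> (E.nrm u + nrm2 M r) * E1.nrm v" if "v \<in> F" for v
      using E_bound[OF u that] ip2_bound[OF r that] by (simp add: distrib_right abs_le_iff)
  qed (use u r eq in \<open>auto simp: E.ip_diff_right L2.ip_diff_right\<close>)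
  then show ?thesis by simp
qed

lemma meas_support_core: "v \<in> core U \<Longrightarrow> meas_support D v \<subseteq> top_support X v"
proof -
  assume v: "v \<in> core U"
  have "openin X (topspace X - top_support X v)"
    by (simp add: top_support_def openin_diff)
  moreover have "AE x in M. x \<in> topspace X - top_support X v \<longrightarrow> v x = 0"
    using core_zero[OF v] by auto
  ultimately show ?thesis by (auto simp: meas_support_def)
qed

text \<open>The support of an element of \<open>FU U\<close> may reach the boundary of
  \<open>U\<close>, where nothing is known about \<open>u\<close>. Strong locality is therefore
  applied to \<open>core U\<close> and extended by density.\<close>

lemma E_local:
  assumes u: "u \<in> F" and c: "AE x in M. x \<in> U \<longrightarrow> u x = c" and v: "v \<in> FU U"
  shows "E u v = 0"
proof -
  have "E u w = ip2 M 0 w" if w: "w \<in> core U" for w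
  proof -
    have "\<exists>c. AE x in M. x \<in> meas_support D w \<longrightarrow> u x = c"
      using c meas_support_core[OF w] core_dest(4)[OF w] by (intro exI[of _ c]) (auto elim: eventually_mono)
    then have "E u w = 0"
      using local u core_dest(1)[OF w] unfolding strongly_local_form_def by blast
    then show ?thesis using core_dest(1)[OF w] by simp
  qed
  from FU_weak_eq[OF u L2.S_0 this v] show ?thesis using v by simp
qed

lemma FU_zero: assumes U: "U \<in> sets M" and u: "u \<in> FU U" shows "AE x in M. x \<notin> U \<longrightarrow> u x = 0"
proof -
  have uF: "u \<in> F" using u by (rule FU_F)
  let ?z = "u - zero_ext U u"
  have z: "?z \<in> L2 M" using L2_zero_ext[OF U] uF by auto
  have "nrm2 M ?z \<le> 0 + e" if e: "0 < e" for e
  proof -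
    obtain v where v: "v \<in> core U" "E1.nrm (u - v) < e" using u e unfolding FU_iff by meson
    have vF: "v \<in> F" by (rule core_dest(1)[OF v(1)])
    have "nrm2 M ?z \<le> nrm2 M (u - v)"
    proof (rule nrm2_mono[OF z])
      show "AE x in M. \<bar>?z x\<bar> \<le> \<bar>(u - v) x\<bar>"
        using AE_space_M
      proof eventually_elim
        case (elim x)
        have "v x = 0" if "x \<notin> U" using core_zero[OF v(1) elim] core_dest(4)[OF v(1)] that by blast
        then show ?case by (auto simp: zero_ext_def)
      qed
    qed (use uF vF in auto)
    also have "\<dots> \<le> E1.nrm (u - v)" by (rule E1_nrm[OF E.S_diff[OF uF vF]])
    finally show ?thesis using v(2) by simp
  qed
  then have "nrm2 M ?z \<le> 0" by (rule field_le_epsilon)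
  then have "nrm2 M ?z = 0" using L2.nrm_ge_0[OF z] by (rule antisym)
  then have "AE x in M. ?z x = 0" using nrm2_eq_0_iff[OF z] by blast
  then show ?thesis by eventually_elim (auto simp: zero_ext_def)
qed

lemma FU_zero_ext: assumes "U \<in> sets M" "u \<in> FU U" shows "AE x in M. zero_ext U u x = u x"
  using FU_zero[OF assms] by eventually_elim (auto simp: zero_ext_def)

section \<open>Cutoff functions in the form domain\<close>

lemma Urysohn_cutoff:
  assumes K: "compactin X K" and U: "openin X U" "K \<subseteq> U"
  obtains f V where "f \<in> Cont X" "\<forall>x\<in>topspace X. 0 \<le> f x \<and> f x \<le> 1" "\<forall>x\<in>K. f x = 1"
    "openin X V" "compactin X (X closure_of V)" "X closure_of V \<subseteq> U" "\<forall>x\<in>topspace X - V. f x = 0"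
proof -
  obtain V where V: "openin X V" "K \<subseteq> V" "X closure_of V \<subseteq> U" "compactin X (X closure_of V)"
    by (rule compact_nbhd[OF K U])
  have cr: "completely_regular_space X" using metr by (rule metrizable_imp_completely_regular_space)
  have cl: "closedin X (topspace X - V)" using V by blast
  have dj: "disjnt K (topspace X - V)" using V by (auto simp: disjnt_def)
  obtain f where f: "continuous_map X (subtopology euclidean {0..1::real}) f"
    "f ` (topspace X - V) \<subseteq> {0}" "f ` K \<subseteq> {1}"
    using Urysohn_completely_regular_compact_closed[OF zero_le_one cr K cl dj] by blast
  show ?thesis
  proof (rule that[of f V])
    show "f \<in> Cont X" using f(1) by (auto simp: Cont_def continuous_map_in_subtopology)
    show "\<forall>x\<in>topspace X. 0 \<le> f x \<and> f x \<le> 1"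
      using f(1) by (auto simp: continuous_map_in_subtopology)
  qed (use f V in auto)
qed

text \<open>A Urysohn function \<open>f\<close> need not lie in the form domain, but there is an
  approximation \<open>g\<close> of \<open>2 * f\<close> in it with uniform error below 1/2. It
  exceeds 3/2 on \<open>K\<close> and is below 1/2 in modulus where \<open>f\<close> vanishes, so
  the contraction \<open>T\<close> restores the exact values 1 and 0.\<close>

lemma cutoff:
  assumes K: "compactin X K" and U: "openin X U" "K \<subseteq> U"
  obtains p where "p \<in> core U" "\<forall>x\<in>topspace X. 0 \<le> p x \<and> p x \<le> 1" "\<forall>x\<in>K. p x = 1"
proof -
  obtain f V where f: "f \<in> Cont X" "\<forall>x\<in>topspace X. 0 \<le> f x \<and> f x \<le> 1" "\<forall>x\<in>K. f x = 1"
    "openin X V" "compactin X (X closure_of V)" "X closure_of V \<subseteq> U" "\<forall>x\<in>topspace X - V. f x = 0"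
    by (rule Urysohn_cutoff[OF K U])
  have Vcl: "V \<subseteq> X closure_of V" using closure_of_subset[OF openin_subset[OF f(4)]] .
  define f2 where "f2 x = 2 * f x" for x
  have "f2 \<in> Cont X" using f(1) unfolding f2_def Cont_def by (auto intro: continuous_map_real_mult_left)
  moreover have "f2 x = 0" if "x \<in> topspace X" "x \<notin> X closure_of V" for x
    using f(7) that Vcl by (auto simp: f2_def)
  ultimately have "f2 \<in> Cc X" using Cc_subset[OF _ f(5,6), of f2] by blast
  then have "\<exists>g\<in>F \<inter> Cc X. \<forall>x\<in>topspace X. \<bar>f2 x - g x\<bar> < 1/2"
    using regular[unfolded regular_form_def, THEN conjunct1, THEN bspec, of f2, THEN spec, of "1/2"] by simp
  then obtain g where g: "g \<in> F \<inter> Cc X" "\<And>x. x \<in> topspace X \<Longrightarrow> \<bar>f2 x - g x\<bar> < 1/2" by blast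
  define T where "T a = min (max (a - 1/2) 0) (1::real)" for a
  have T: "\<bar>T a - T b\<bar> \<le> \<bar>a - b\<bar>" "T 0 = 0" for a b
    unfolding T_def by linarith+
  show ?thesis
  proof (rule that[of "\<lambda>x. T (g x)"])
    show "\<forall>x\<in>topspace X. 0 \<le> T (g x) \<and> T (g x) \<le> 1" by (simp add: T_def)
    show "\<forall>x\<in>K. T (g x) = 1"
    proof
      fix x assume x: "x \<in> K"
      then have "x \<in> topspace X" using K compactin_subset_topspace by blast
      then have "\<bar>2 - g x\<bar> < 1/2" using g(2)[of x] bspec[OF f(3) x] by (simp add: f2_def)
      then have "3/2 < g x" by linarith
      then show "T (g x) = 1" by (simp add: T_def)
    qed
    show "(\<lambda>x. T (g x)) \<in> core U"
    proof (rule coreI[OF _ _ f(5,6)])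
      show "(\<lambda>x. T (g x)) \<in> F" by (rule contraction_F[OF _ T]) (use g in auto)
      show "(\<lambda>x. T (g x)) \<in> Cont X"
        using g unfolding T_def Cont_def Cc_def
        by (auto intro!: continuous_map_real_min continuous_map_real_max continuous_map_diff)
      fix x assume "x \<in> topspace X" "x \<notin> X closure_of V"
      moreover from this have "f x = 0" using f(7) Vcl by auto
      ultimately have "\<bar>g x\<bar> < 1/2" using g(2)[of x] by (simp add: f2_def)
      then show "T (g x) = 0" unfolding T_def by linarith
    qed
  qed
qed

section \<open>Restriction of the form to an open subset\<close>

abbreviation "R \<equiv> restrict_form_space D"

lemma R_simps [simp]: "fs_top (R U) = subtopology X U" "fs_meas (R U) = restrict_space M U"
  "fs_form (R U) u v = E (zero_ext U u) (zero_ext U v)" "u \<in> fs_dom (R U) \<longleftrightarrow> zero_ext U u \<in> FU U"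
  by (auto simp: restrict_form_space_def)

lemma zero_ext_lam: "zero_ext U (\<lambda>x. u x + v x) = zero_ext U u + zero_ext U v"
  "zero_ext U (\<lambda>x. c * u x) = c *\<^sub>R zero_ext U u"
  "zero_ext U (\<lambda>x. u x - v x) = zero_ext U u - zero_ext U v"
  by (auto simp: zero_ext_def fun_eq_iff)

lemma restrict_symmetric:
  assumes U: "openin X U" shows "symmetric_nonneg_form (R U)"
proof -
  have Um: "U \<in> sets M" using U by simp
  have sub: "fs_dom (R U) \<subseteq> L2 (fs_meas (R U))"
  proof
    fix u assume "u \<in> fs_dom (R U)"
    then have "zero_ext U u \<in> L2 M" using F_L2[OF FU_F] by simp
    then show "u \<in> L2 (fs_meas (R U))" using L2_restrict_iff[OF Um] by simp
  qed
  have dom: "zero_ext U u' \<in> FU U"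
    if "zero_ext U u \<in> FU U" "u' \<in> borel_measurable (restrict_space M U)" "AE x in restrict_space M U. u x = u' x" for u u'
  proof (rule FU_cong[OF that(1)])
    show "zero_ext U u' \<in> borel_measurable M"
      using that(2) unfolding measurable_restrict_iff[OF Um] .
    show "AE x in M. zero_ext U u x = zero_ext U u' x" using that(3) AE_zero_ext_iff[OF Um] by blast
  qed
  have E: "E (zero_ext U u) (zero_ext U v) = E (zero_ext U u') (zero_ext U v)"
    if "zero_ext U u \<in> FU U" "zero_ext U u' \<in> FU U" "zero_ext U v \<in> FU U" "AE x in restrict_space M U. u x = u' x" for u u' v
  proof (rule E_cong_left)
    show "AE x in M. zero_ext U u x = zero_ext U u' x" using that(4) AE_zero_ext_iff[OF Um] by blast
  qed (use that FU_F in blast)+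
  show ?thesis
    unfolding symmetric_nonneg_form_def Let_def R_simps(2)
  proof (intro conjI ballI allI impI, goal_cases)
    case 1 show ?case using sub by simp
  next
    case (2 u u') then show ?case using dom[of u u'] by simp
  next
    case (3 u u' v) then show ?case using E[of u u' v] by simp
  next
    case 4 show ?case using subspace_0[OF FU_subspace] by (simp add: zero_fun_def)
  next
    case (5 u v) then show ?case using subspace_add[OF FU_subspace] by (simp add: zero_ext_lam)
  next
    case (6 c u) then show ?case using subspace_scale[OF FU_subspace] by (simp add: zero_ext_lam)
  next
    case (7 u v w)
    then have "zero_ext U u \<in> F" "zero_ext U v \<in> F" "zero_ext U w \<in> F" using FU_F by auto
    then show ?case by (simp add: zero_ext_lam E.ip_add_left)
  next
    case (8 c u v)
    then have "zero_ext U u \<in> F" "zero_ext U v \<in> F" using FU_F by auto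
    then show ?case by (simp add: zero_ext_lam E.ip_scale_left)
  next
    case (9 u v)
    then have "zero_ext U u \<in> F" "zero_ext U v \<in> F" using FU_F by auto
    then show ?case by (simp add: E.ip_sym)
  next
    case (10 u)
    then have "zero_ext U u \<in> F" using FU_F by auto
    then show ?case by (simp add: E.ip_nonneg)
  qed
qed

lemma restrict_closed:
  assumes U: "openin X U" shows "closed_form (R U)"
  unfolding closed_form_def
proof (intro allI impI, elim conjE)
  have Um: "U \<in> sets M" using U by simp
  fix us u
  assume us: "\<forall>n::nat. us n \<in> fs_dom (R U)" and u: "u \<in> L2 (fs_meas (R U))"
    and lim: "(\<lambda>n. \<integral>x. (us n x - u x)\<^sup>2 \<partial>fs_meas (R U)) \<longlonglongrightarrow> 0"
    and C: "\<forall>e>0. \<exists>N. \<forall>m\<ge>N. \<forall>n\<ge>N. fs_form (R U) (\<lambda>x. us m x - us n x) (\<lambda>x. us m x - us n x) < e"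
  let ?us = "\<lambda>n. zero_ext U (us n)" and ?u = "zero_ext U u"
  have FUn: "?us n \<in> FU U" for n using us by auto
  have F: "?us n \<in> F" for n by (rule FU_F[OF FUn])
  have L: "?u \<in> L2 M" using u L2_restrict_iff[OF Um] by simp
  have sq: "(\<integral>x. (us n x - u x)\<^sup>2 \<partial>fs_meas (R U)) = (\<integral>x. (?us n x - ?u x)\<^sup>2 \<partial>M)" for n
  proof -
    have "zero_ext U (\<lambda>x. (us n x - u x)\<^sup>2) = (\<lambda>x. (?us n x - ?u x)\<^sup>2)"
      by (auto simp: zero_ext_def fun_eq_iff)
    then show ?thesis using integral_restrict[OF Um] by simp
  qed
  have "?u \<in> F \<and> (\<lambda>n. E (\<lambda>x. ?us n x - ?u x) (\<lambda>x. ?us n x - ?u x)) \<longlonglongrightarrow> 0"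
    by (rule clos[unfolded closed_form_def, rule_format, of ?us ?u])
      (use F L lim C sq in \<open>simp add: zero_ext_lam fun_diff_def\<close>)
  then have uF: "?u \<in> F" and lE: "(\<lambda>n. E (?us n - ?u) (?us n - ?u)) \<longlonglongrightarrow> 0"
    by (auto simp: fun_diff_def)
  have "(\<lambda>n. ip2 M (?us n - ?u) (?us n - ?u)) \<longlonglongrightarrow> 0"
    using lim unfolding sq by (simp add: ip2_def power2_eq_square)
  from tendsto_add_zero[OF lE this] have "(\<lambda>n. E1 (?us n - ?u) (?us n - ?u)) \<longlonglongrightarrow> 0"
    unfolding E1_def .
  then have l1: "(\<lambda>n. E1.nrm (?us n - ?u)) \<longlonglongrightarrow> 0"
    using F uF by (subst E1.tendsto_nrm_iff_sq) auto
  have "?u \<in> FU U"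
  proof (rule FU_closed[OF uF])
    fix e :: real assume "0 < e"
    from LIMSEQ_D[OF l1 this] obtain n where "norm (E1.nrm (?us n - ?u) - 0) < e" by blast
    then have "E1.nrm (?u - ?us n) < e" using E1.nrm_minus_commute[OF uF F[of n]] by simp
    then show "\<exists>v\<in>FU U. E1.nrm (?u - v) < e" using us by (intro bexI[of _ "?us n"]) auto
  qed
  then show "u \<in> fs_dom (R U) \<and> (\<lambda>n. fs_form (R U) (\<lambda>x. us n x - u x) (\<lambda>x. us n x - u x)) \<longlonglongrightarrow> 0"
    using lE by (simp add: zero_ext_lam)
qed

lemma FU_truncate:
  assumes u: "u \<in> F" and p: "p \<in> FU U"
  shows "(\<lambda>x. min (max (u x) 0) (max (p x) 0)) \<in> FU U"
proof (rule FU_sandwich[OF _ FU_pos[OF p]])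
  show "(\<lambda>x. min (max (u x) 0) (max (p x) 0)) \<in> F"
    by (rule min_F[OF pos_F[OF u] FU_F[OF FU_pos[OF p]]])
qed auto

text \<open>The layers \<open>A n\<close> have finite measure by Chebyshev's inequality and exhaust
  \<open>g\<close> in \<open>L2\<close> by dominated convergence. Inner regularity then replaces a
  layer by a compact subset.\<close>

lemma compact_approx:
  assumes g: "g \<in> L2 M" and U: "openin X U" and 0: "\<And>x. x \<notin> U \<Longrightarrow> g x = 0" and e: "0 < e"
  obtains K c where "compactin X K" "K \<subseteq> U" "nrm2 M (g - zero_ext K g) < e" "\<forall>x\<in>K. \<bar>g x\<bar> \<le> c" "0 \<le> c"
proof -
  define A where "A n = {x \<in> space M. 1 / Suc n \<le> \<bar>g x\<bar> \<and> \<bar>g x\<bar> \<le> Suc n}" for n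
  have A: "A n \<in> sets M" for n unfolding A_def using g by measurable
  have "(\<lambda>n. \<integral>x. (g x - zero_ext (A n) g x)\<^sup>2 \<partial>M) \<longlonglongrightarrow> (\<integral>x. 0 \<partial>M)"
  proof (rule integral_dominated_convergence[where w = "\<lambda>x. (g x)\<^sup>2"])
    show "integrable M (\<lambda>x. (g x)\<^sup>2)" using g by (rule L2_sq)
    show "(\<lambda>x. (g x - zero_ext (A n) g x)\<^sup>2) \<in> borel_measurable M" for n
      using g zero_ext_measurable[OF A] by measurable
    show "AE x in M. (\<lambda>n. (g x - zero_ext (A n) g x)\<^sup>2) \<longlonglongrightarrow> 0"
    proof (rule AE_I2)
      fix x assume x: "x \<in> space M"
      show "(\<lambda>n. (g x - zero_ext (A n) g x)\<^sup>2) \<longlonglongrightarrow> 0"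
      proof (cases "g x = 0")
        case False
        obtain n1 where n1: "1 / Suc n1 < \<bar>g x\<bar>" using reals_Archimedean[of "\<bar>g x\<bar>"] False by (auto simp: inverse_eq_divide)
        obtain n2 :: nat where n2: "\<bar>g x\<bar> < n2" using reals_Archimedean2 by blast
        have "x \<in> A n" if "n \<ge> max n1 n2" for n
        proof -
          have "1 / real (Suc n) \<le> 1 / Suc n1" using that by (simp add: field_simps)
          then show ?thesis using x n1 n2 that by (simp add: A_def)
        qed
        then have "\<forall>\<^sub>F n in sequentially. (g x - zero_ext (A n) g x)\<^sup>2 = 0"
          unfolding eventually_sequentially by (intro exI[of _ "max n1 n2"]) (auto simp: zero_ext_def)
        then show ?thesis by (rule tendsto_eventually)
      next
        case True
        then have "(\<lambda>n. (g x - zero_ext (A n) g x)\<^sup>2) = (\<lambda>n. 0)" by (auto simp: zero_ext_def)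
        then show ?thesis by simp
      qed
    qed
    show "AE x in M. norm ((g x - zero_ext (A n) g x)\<^sup>2) \<le> (g x)\<^sup>2" for n
      by (simp add: zero_ext_def)
  qed simp
  then have lim: "(\<lambda>n. \<integral>x. (g x - zero_ext (A n) g x)\<^sup>2 \<partial>M) \<longlonglongrightarrow> 0" by simp
  have "0 < (e/2)\<^sup>2" using e by simp
  from LIMSEQ_D[OF lim this] obtain n where "norm ((\<integral>x. (g x - zero_ext (A n) g x)\<^sup>2 \<partial>M) - 0) < (e/2)\<^sup>2"
    by blast
  then have n: "(\<integral>x. (g x - zero_ext (A n) g x)\<^sup>2 \<partial>M) < (e/2)\<^sup>2" by simp
  have zA: "zero_ext (A n) g \<in> L2 M" by (rule L2_zero_ext[OF A g])
  have "(nrm2 M (g - zero_ext (A n) g))\<^sup>2 < (e/2)\<^sup>2"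
    using n nrm2_sq[OF L2.S_diff[OF g zA]] by simp
  then have 1: "nrm2 M (g - zero_ext (A n) g) < e/2" by (rule power_less_imp_less_base) (use e in simp)
  have AU: "A n \<subseteq> U"
  proof
    fix x assume "x \<in> A n"
    then have "0 < \<bar>g x\<bar>" unfolding A_def using less_le_trans[of 0 "1 / Suc n"] by auto
    then show "x \<in> U" using 0[of x] by auto
  qed
  have fin: "emeasure M (A n) < \<infinity>"
  proof -
    have "integrable M (\<lambda>x. (real (Suc n))\<^sup>2 * (g x)\<^sup>2)" using L2_sq[OF g] by simp
    then have "integrable M (indicat_real (A n))"
    proof (rule Bochner_Integration.integrable_bound)
      show "AE x in M. norm (indicat_real (A n) x) \<le> norm ((real (Suc n))\<^sup>2 * (g x)\<^sup>2)"
      proof (intro AE_I2)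
        fix x
        show "norm (indicat_real (A n) x) \<le> norm ((real (Suc n))\<^sup>2 * (g x)\<^sup>2)"
        proof (cases "x \<in> A n")
          case True
          then have "1 \<le> real (Suc n) * \<bar>g x\<bar>" by (simp add: A_def field_simps)
          then have "1\<^sup>2 \<le> (real (Suc n) * \<bar>g x\<bar>)\<^sup>2" by (intro power_mono) auto
          then show ?thesis using True by (simp add: power_mult_distrib)
        qed simp
      qed
    qed (use A in simp)
    moreover have "A n \<inter> topspace X = A n" by (auto simp: A_def)
    ultimately show ?thesis by (simp add: integrable_indicator_iff)
  qed
  \<comment> \<open>Chosen such that \<open>(n + 1)^2 * (2 * d) = (e/2)^2\<close>; on the removed
    part \<open>A n - K\<close> the modulus of \<open>g\<close> is at most
    \<open>n + 1\<close>.\<close>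
  define d where "d = (e / (2 * real (Suc n)))\<^sup>2 / 2"
  have d: "0 < d" using e by (simp add: d_def del: of_nat_Suc)
  obtain K where K: "compactin X K" "K \<subseteq> A n" "emeasure M (A n) < emeasure M K + ennreal d"
  proof -
    have eq: "emeasure M (A n) = (SUP K \<in> {K. compactin X K \<and> K \<subseteq> A n}. emeasure M K)"
      using radon A unfolding radon_measure_def by blast
    show ?thesis
    proof (cases "emeasure M (A n) = 0")
      case True
      then show ?thesis using that[of "{}"] d by simp
    next
      case False
      have lt: "emeasure M (A n) - ennreal d < emeasure M (A n)"
        using False fin d by (intro ennreal_between) (auto simp: zero_less_iff_neq_zero)
      have "emeasure M (A n) - ennreal d < (SUP K \<in> {K. compactin X K \<and> K \<subseteq> A n}. emeasure M K)"
        unfolding eq[symmetric] by (rule lt)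
      then obtain K where "compactin X K" "K \<subseteq> A n" "emeasure M (A n) - ennreal d < emeasure M K"
        unfolding less_SUP_iff by blast
      moreover from this have "emeasure M (A n) < emeasure M K + ennreal d"
      proof -
        have "\<not> emeasure M K + ennreal d \<le> emeasure M (A n)"
        proof
          assume "emeasure M K + ennreal d \<le> emeasure M (A n)"
          then have "(emeasure M K + ennreal d) - ennreal d \<le> emeasure M (A n) - ennreal d"
            by (intro ennreal_minus_mono) auto
          then show False using \<open>emeasure M (A n) - ennreal d < emeasure M K\<close> by simp
        qed
        then show ?thesis by simp
      qed
      ultimately show ?thesis using that by blast
    qed
  qed
  have Km: "K \<in> sets M" using compact_sets[OF K(1)] .
  have "emeasure M (A n) = emeasure M K + emeasure M (A n - K)"
    using plus_emeasure[OF Km, of "A n - K"] A Km K(2) by (simp add: Un_absorb1 Un_Diff_cancel)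
  then have "emeasure M (A n - K) < ennreal d"
    using K(3) compact_finite[OF K(1)] by simp
  then have md: "measure M (A n - K) < d" "emeasure M (A n - K) < \<infinity>"
    using d by (auto simp: measure_def enn2real_less_iff less_trans[OF _ ennreal_less_top])
  have zK: "zero_ext K g \<in> L2 M" by (rule L2_zero_ext[OF Km g])
  have "(nrm2 M (zero_ext (A n) g - zero_ext K g))\<^sup>2 = (\<integral>x. (zero_ext (A n) g x - zero_ext K g x)\<^sup>2 \<partial>M)"
    using nrm2_sq[OF L2.S_diff[OF zA zK]] by simp
  also have "\<dots> \<le> (\<integral>x. (real (Suc n))\<^sup>2 * indicat_real (A n - K) x \<partial>M)"
  proof (rule integral_mono)
    show "integrable M (\<lambda>x. (zero_ext (A n) g x - zero_ext K g x)\<^sup>2)"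
      using L2_sq[OF L2.S_diff[OF zA zK]] by simp
    show "integrable M (\<lambda>x. (real (Suc n))\<^sup>2 * indicat_real (A n - K) x)"
      by (intro integrable_mult_right integrable_real_indicator) (use md(2) A Km in auto)
    show "(zero_ext (A n) g x - zero_ext K g x)\<^sup>2 \<le> (real (Suc n))\<^sup>2 * indicat_real (A n - K) x" for x
    proof (cases "x \<in> A n - K")
      case True
      then have "\<bar>g x\<bar> \<le> Suc n" by (simp add: A_def)
      then have "\<bar>g x\<bar>\<^sup>2 \<le> (real (Suc n))\<^sup>2" by (intro power_mono) auto
      then show ?thesis using True by (simp add: zero_ext_def)
    next
      case False
      then show ?thesis using K(2) by (auto simp: zero_ext_def)
    qed
  qed
  also have "\<dots> = (real (Suc n))\<^sup>2 * measure M (A n - K)"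
  proof -
    have "(A n - K) \<inter> topspace X = A n - K" by (auto simp: A_def)
    then show ?thesis by simp
  qed
  also have "\<dots> < (real (Suc n))\<^sup>2 * (2 * d)" using md d by (intro mult_strict_left_mono) auto
  also have "\<dots> = (e/2)\<^sup>2" by (simp add: d_def power_divide power_mult_distrib del: of_nat_Suc)
  finally have 2: "nrm2 M (zero_ext (A n) g - zero_ext K g) < e/2"
    by (rule power_less_imp_less_base) (use e in simp)
  have "nrm2 M (g - zero_ext K g) \<le> nrm2 M (g - zero_ext (A n) g) + nrm2 M (zero_ext (A n) g - zero_ext K g)"
    by (rule L2.nrm_triangle3[OF g zA zK])
  then have 3: "nrm2 M (g - zero_ext K g) < e" using 1 2 by linarith
  show ?thesis
  proof (rule that[OF K(1) _ 3])
    show "\<forall>x\<in>K. \<bar>g x\<bar> \<le> Suc n" using K(2) by (auto simp: A_def)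
  qed (use K(2) AU in auto)
qed

text \<open>The positive and the negative part of \<open>g\<close> on a compact \<open>K\<close> lie
  between 0 and \<open>c * p\<close>, where \<open>p\<close> is a cutoff in \<open>core U\<close>.
  Truncating an approximation from the ambient domain to this range does not increase its distance
  and puts it into \<open>FU U\<close>. The error splits as \<open>e/2 + e/4 + e/4\<close>.\<close>

lemma FU_dense:
  assumes g: "g \<in> L2 M" and U: "openin X U" and 0: "\<And>x. x \<notin> U \<Longrightarrow> g x = 0" and e: "0 < e"
  obtains u where "u \<in> FU U" "nrm2 M (g - u) < e"
proof -
  have e2: "0 < e/2" "0 < e/4" using e by auto
  obtain K c where K: "compactin X K" "K \<subseteq> U" "nrm2 M (g - zero_ext K g) < e/2" "\<forall>x\<in>K. \<bar>g x\<bar> \<le> c" "0 \<le> c"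
    by (rule compact_approx[OF g U 0 e2(1)])
  obtain p where p: "p \<in> core U" "\<forall>x\<in>topspace X. 0 \<le> p x \<and> p x \<le> 1" "\<forall>x\<in>K. p x = 1"
    by (rule cutoff[OF K(1) U K(2)])
  have cp: "c *\<^sub>R p \<in> FU U" using core_FU[OF p(1)] subspace_scale[OF FU_subspace] by blast
  have zK: "zero_ext K g \<in> L2 M" by (rule L2_zero_ext[OF compact_sets[OF K(1)] g])
  have *: "\<exists>w\<in>FU U. nrm2 M (h - w) < e/4"
    if h: "h \<in> L2 M" "\<And>x. x \<in> topspace X \<Longrightarrow> 0 \<le> h x \<and> h x \<le> c * p x" for h
  proof -
    have "0 < (e/4)\<^sup>2" using e by simp
    then obtain u where u: "u \<in> F" "(\<integral>x. (h x - u x)\<^sup>2 \<partial>M) < (e/4)\<^sup>2"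
      using dens h(1) unfolding densely_defined_form_def by meson
    let ?w = "\<lambda>x. min (max (u x) 0) (max ((c *\<^sub>R p) x) 0)"
    have w: "?w \<in> FU U" by (rule FU_truncate[OF u(1) cp])
    have L: "h - u \<in> L2 M" "h - ?w \<in> L2 M" using h u FU_F[OF w] by auto
    have "nrm2 M (h - ?w) \<le> nrm2 M (h - u)"
    proof (rule nrm2_mono[OF L(2,1)])
      show "AE x in M. \<bar>(h - ?w) x\<bar> \<le> \<bar>(h - u) x\<bar>"
        using AE_space_M
      proof eventually_elim
        case (elim x)
        have "\<bar>a - min (max b 0) (max c' 0)\<bar> \<le> \<bar>a - b\<bar>" if "0 \<le> a" "a \<le> c'" for a b c' :: real
          using that by linarith
        from this[of "h x" "c * p x" "u x"] h(2)[OF elim] show ?case by simp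
      qed
    qed
    moreover have "(nrm2 M (h - u))\<^sup>2 < (e/4)\<^sup>2" using u nrm2_sq[OF L(1)] by simp
    then have "nrm2 M (h - u) < e/4" by (rule power_less_imp_less_base) (use e in simp)
    ultimately show ?thesis by (intro bexI[OF _ w]) linarith
  qed
  define h1 where "h1 x = max (zero_ext K g x) 0" for x
  define h2 where "h2 x = max (- zero_ext K g x) 0" for x
  have h1L: "h1 \<in> L2 M"
  proof (rule L2_dominated[OF _ zK])
    show "h1 \<in> borel_measurable M" unfolding h1_def[abs_def] using zK by simp
  qed (simp add: h1_def)
  have h2L: "h2 \<in> L2 M"
  proof (rule L2_dominated[OF _ zK])
    show "h2 \<in> borel_measurable M" unfolding h2_def[abs_def] using zK by simp
  qed (simp add: h2_def)
  have bnd: "0 \<le> h1 x \<and> h1 x \<le> c * p x" "0 \<le> h2 x \<and> h2 x \<le> c * p x" if x: "x \<in> topspace X" for x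
  proof -
    have "(0 \<le> h1 x \<and> h1 x \<le> c * p x) \<and> 0 \<le> h2 x \<and> h2 x \<le> c * p x"
    proof (cases "x \<in> K")
      case True
      then have "p x = 1" "\<bar>g x\<bar> \<le> c" using p(3) K(4) by auto
      then show ?thesis using True K(5) unfolding h1_def h2_def zero_ext_def by auto
    next
      case False
      have "0 \<le> c * p x" using p(2) x K(5) by simp
      then show ?thesis using False by (simp add: h1_def h2_def zero_ext_def)
    qed
    then show "0 \<le> h1 x \<and> h1 x \<le> c * p x" "0 \<le> h2 x \<and> h2 x \<le> c * p x" by auto
  qed
  obtain w1 where w1: "w1 \<in> FU U" "nrm2 M (h1 - w1) < e/4"
  proof -
    have "\<exists>w\<in>FU U. nrm2 M (h1 - w) < e/4"
      by (rule *[OF h1L bnd(1)])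
    then show ?thesis by (elim bexE) (rule that)
  qed
  obtain w2 where w2: "w2 \<in> FU U" "nrm2 M (h2 - w2) < e/4"
  proof -
    have "\<exists>w\<in>FU U. nrm2 M (h2 - w) < e/4"
      by (rule *[OF h2L bnd(2)])
    then show ?thesis by (elim bexE) (rule that)
  qed
  have wL: "w1 \<in> L2 M" "w2 \<in> L2 M" using w1 w2 FU_F F_L2 by blast+
  have eq: "zero_ext K g - (w1 - w2) = (h1 - w1) - (h2 - w2)"
    by (rule ext) (simp add: h1_def h2_def max_def)
  have "nrm2 M (zero_ext K g - (w1 - w2)) \<le> nrm2 M (h1 - w1) + nrm2 M (h2 - w2)"
    unfolding eq using h1L h2L wL by (intro L2.nrm_triangle_diff) auto
  moreover have "nrm2 M (g - (w1 - w2)) \<le> nrm2 M (g - zero_ext K g) + nrm2 M (zero_ext K g - (w1 - w2))"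
    using g zK wL by (intro L2.nrm_triangle3) auto
  ultimately have "nrm2 M (g - (w1 - w2)) < e" using K(3) w1(2) w2(2) by linarith
  then show ?thesis using that subspace_diff[OF FU_subspace w1(1) w2(1)] by blast
qed

lemma dform_R: assumes U: "openin X U" shows "dform (R U)"
proof
  have Um: "U \<in> sets M" using U by simp
  show "densely_defined_form (R U)"
    unfolding densely_defined_form_def
  proof (intro ballI allI impI)
    fix f and e :: real assume f: "f \<in> L2 (fs_meas (R U))" and e: "0 < e"
    let ?g = "zero_ext U f"
    have g: "?g \<in> L2 M" using f L2_restrict_iff[OF Um] by simp
    have se: "0 < sqrt e" using e by simp
    obtain u where u: "u \<in> FU U" "nrm2 M (?g - u) < sqrt e"
      by (rule FU_dense[OF g U _ se]) (auto simp: zero_ext_def)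
    have uL: "u \<in> L2 M" using u(1) FU_F F_L2 by blast
    have zu: "zero_ext U u \<in> FU U"
      by (rule FU_cong[OF u(1)])
        (use zero_ext_measurable[OF Um] uL FU_zero_ext[OF Um u(1)] in \<open>auto elim: eventually_mono\<close>)
    have "(\<integral>x. (f x - u x)\<^sup>2 \<partial>fs_meas (R U)) = (\<integral>x. (?g x - zero_ext U u x)\<^sup>2 \<partial>M)"
    proof -
      have "zero_ext U (\<lambda>x. (f x - u x)\<^sup>2) = (\<lambda>x. (?g x - zero_ext U u x)\<^sup>2)"
        by (auto simp: zero_ext_def fun_eq_iff)
      then show ?thesis using integral_restrict[OF Um] by simp
    qed
    also have "\<dots> = (\<integral>x. (?g x - u x)\<^sup>2 \<partial>M)"
    proof (rule integral_cong_AE)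
      show "AE x in M. (?g x - zero_ext U u x)\<^sup>2 = (?g x - u x)\<^sup>2"
        using FU_zero_ext[OF Um u(1)] by eventually_elim simp
    qed (use g uL zero_ext_measurable[OF Um, of u] in measurable)
    also have "\<dots> = (nrm2 M (?g - u))\<^sup>2" using nrm2_sq[OF L2.S_diff[OF g uL]] by simp
    also have "\<dots> < (sqrt e)\<^sup>2" using u(2) g uL by (intro power_strict_mono) auto
    finally have "(\<integral>x. (f x - u x)\<^sup>2 \<partial>fs_meas (R U)) < e" using e by simp
    then show "\<exists>u\<in>fs_dom (R U). (\<integral>x. (f x - u x)\<^sup>2 \<partial>fs_meas (R U)) < e"
      using zu by (intro bexI[of _ u]) auto
  qed
qed (use restrict_symmetric[OF U] restrict_closed[OF U] in auto)

end

text \<open>In contrast to \<open>limit_le_AE\<close> the bound is fixed and need not be square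
  integrable. Constants on sets of infinite measure and images of integrable functions under the
  semigroup are such bounds.\<close>

lemma limit_le_measurable:
  assumes L: "\<And>n. f n \<in> L2 M" "f' \<in> L2 M" and h: "h \<in> borel_measurable M"
    and le: "\<And>n. AE x in M. f n x \<le> h x" and lim: "(\<lambda>n. nrm2 M (f n - f')) \<longlonglongrightarrow> 0"
  shows "AE x in M. f' x \<le> h x"
proof -
  define z where "z = (\<lambda>x. max (f' x - h x) 0)"
  have zm: "z \<in> borel_measurable M" unfolding z_def using L(2) h by simp
  have zle: "AE x in M. \<bar>z x\<bar> \<le> \<bar>(f n - f') x\<bar>" for n
    using le[of n] by eventually_elim (simp add: z_def)
  have z: "z \<in> L2 M"
    by (rule L2_dominated[OF zm L2.S_diff[OF L(1)[of 0] L(2)] zle])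
  have "nrm2 M z \<le> nrm2 M (f n - f')" for n
    by (rule nrm2_mono[OF z L2.S_diff[OF L(1)[of n] L(2)] zle])
  then have "nrm2 M z \<le> 0" using lim by (intro LIMSEQ_le_const[OF lim]) auto
  then have "nrm2 M z = 0" using L2.nrm_ge_0[OF z] by (rule antisym)
  then have "AE x in M. z x = 0" using nrm2_eq_0_iff[OF z] by simp
  then show ?thesis by eventually_elim (auto simp: z_def max_def split: if_splits)
qed

lemma AE_le_if_ip2_nonpos:
  assumes z: "z \<in> L2 M" and le: "ip2 M (\<lambda>x. max (z x) 0) z \<le> 0"
  shows "AE x in M. z x \<le> 0"
proof -
  let ?a = "\<lambda>x. max (z x) 0"
  have a: "?a \<in> L2 M" by (rule L2_dominated[OF _ z]) (use z in auto)
  have "ip2 M ?a z = ip2 M ?a ?a"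
    unfolding ip2_def by (intro Bochner_Integration.integral_cong) (auto simp: max_def)
  then have "(nrm2 M ?a)\<^sup>2 \<le> 0" using le L2.nrm_sq[OF a] by simp
  then have "nrm2 M ?a = 0" by simp
  then have "AE x in M. ?a x = 0" using nrm2_eq_0_iff[OF a] by simp
  then show ?thesis by eventually_elim (auto simp: max_def split: if_splits)
qed

text \<open>Formally \<open>res b k\<close> is the integral of \<open>b e^(-b t) P t k\<close>, and
  \<open>P t k <= e^(lam t) k\<close> gives the bound. Integrals of vector-valued functions are
  avoided by pairing with the positive part \<open>a\<close> of \<open>res b k - c k\<close>: the
  function \<open>\<phi>\<close> is nondecreasing and has an upper bound that tends to 0, and
  \<open>\<phi> 0 <= 0\<close> forces \<open>a = 0\<close> a.e.\<close>

lemma (in dform) res_le_of_P: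
  assumes k: "k \<in> L2 M" and lam: "0 \<le> lam" "lam < b"
    and P: "\<And>t. 0 < t \<Longrightarrow> AE x in M. exp (- lam * t) * P t k x \<le> k x"
  shows "AE x in M. res b k x \<le> b / (b - lam) * k x"
proof -
  have b: "0 < b" using lam by simp
  define c where "c = b / (b - lam)"
  have c: "c * (b - lam) = b" using lam by (simp add: c_def)
  have rk: "res b k \<in> L2 M" using res_L2[OF b k] .
  define z where "z = res b k - c *\<^sub>R k"
  have z: "z \<in> L2 M" using rk k by (simp add: z_def)
  define a where "a = (\<lambda>x. max (z x) 0)"
  have a: "a \<in> L2 M" by (rule L2_dominated[OF _ z]) (use z in \<open>auto simp: a_def\<close>)
  define \<phi> where "\<phi> t = exp (- b * t) * ip2 M a (P t (res b k)) - c * exp (- (b - lam) * t) * ip2 M a k" for t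
  have mono: "\<phi> 0 \<le> \<phi> T" if T: "0 < T" for T
  proof -
    have der: "(\<phi> has_real_derivative - b * exp (- b * t) * ip2 M a (P t k) + b * exp (- (b - lam) * t) * ip2 M a k) (at t)"
      if t: "0 < t" for t
    proof -
      have 1: "((\<lambda>t. exp (- (b - lam) * t)) has_real_derivative exp (- (b - lam) * t) * - (b - lam)) (at t)"
        by (auto intro!: derivative_eq_intros)
      have "((\<lambda>t. c * exp (- (b - lam) * t) * ip2 M a k) has_real_derivative
          c * (exp (- (b - lam) * t) * - (b - lam)) * ip2 M a k) (at t)"
        by (intro DERIV_cmult DERIV_cmult_right 1)
      moreover have "c * (exp (- (b - lam) * t) * - (b - lam)) * ip2 M a k
          = - (c * (b - lam) * exp (- (b - lam) * t) * ip2 M a k)"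
        by (rule trans[OF _ minus_mult_left[symmetric]]) (simp only: mult_minus_right mult_minus_left mult_ac)
      then have "c * (exp (- (b - lam) * t) * - (b - lam)) * ip2 M a k
          = - (b * exp (- (b - lam) * t) * ip2 M a k)"
        unfolding c .
      ultimately have "((\<lambda>t. c * exp (- (b - lam) * t) * ip2 M a k) has_real_derivative
          - (b * exp (- (b - lam) * t) * ip2 M a k)) (at t)" by simp
      from DERIV_diff[OF res_deriv[OF b k a t] this] show ?thesis
        unfolding \<phi>_def by simp
    qed
    have nonneg: "0 \<le> - b * exp (- b * t) * ip2 M a (P t k) + b * exp (- (b - lam) * t) * ip2 M a k"
      if t: "0 < t" for t
    proof -
      have "exp (- lam * t) * ip2 M a (P t k) = ip2 M a (exp (- lam * t) *\<^sub>R P t k)"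
        using a k t by (simp add: L2.ip_scale_right)
      also have "\<dots> \<le> ip2 M a k"
        unfolding ip2_def
      proof (rule integral_mono_AE)
        show "integrable M (\<lambda>x. a x * (exp (- lam * t) *\<^sub>R P t k) x)"
          by (rule L2_mult[OF a L2.S_scale[OF P_L2[OF less_imp_le[OF t] k]]])
        show "integrable M (\<lambda>x. a x * k x)" by (rule L2_mult[OF a k])
        show "AE x in M. a x * (exp (- lam * t) *\<^sub>R P t k) x \<le> a x * k x"
          using P[OF t] by eventually_elim (simp add: a_def mult_left_mono)
      qed
      finally have "b * exp (- (b - lam) * t) * (exp (- lam * t) * ip2 M a (P t k))
          \<le> b * exp (- (b - lam) * t) * ip2 M a k"
        using b by (intro mult_left_mono) auto
      moreover have "exp (- (b - lam) * t) * exp (- lam * t) = exp (- b * t)"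
        by (simp add: algebra_simps flip: exp_add)
      then have "b * exp (- (b - lam) * t) * (exp (- lam * t) * ip2 M a (P t k)) = b * exp (- b * t) * ip2 M a (P t k)"
        by (simp only: mult.assoc flip: \<open>_ = exp (- b * t)\<close>)
      ultimately show ?thesis by linarith
    qed
    have "continuous_on {0..} (\<lambda>t. ip2 M a (P t (res b k)))" by (rule ip2_P_cont[OF rk a])
    then have "continuous_on {0..T} (\<lambda>t. ip2 M a (P t (res b k)))"
      by (rule continuous_on_subset) auto
    then have cont: "continuous_on {0..T} \<phi>"
      unfolding \<phi>_def by (intro continuous_intros)
    have dif: "\<phi> differentiable (at x)" if "0 < x" "x < T" for x
      unfolding real_differentiable_def by (rule exI, rule der[OF that(1)])
    from MVT[OF T cont dif] obtain l z where lz: "0 < z" "z < T" "(\<phi> has_real_derivative l) (at z)" "\<phi> T - \<phi> 0 = (T - 0) * l"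
      by blast
    have "0 \<le> l" using DERIV_unique[OF lz(3) der[OF lz(1)]] nonneg[OF lz(1)] by simp
    then have "0 \<le> (T - 0) * l" using T by simp
    then show ?thesis using lz(4) by linarith
  qed
  define B where "B = nrm2 M a * nrm2 M (res b k)"
  have lim: "(\<lambda>n. exp (- b * real n) * B + \<bar>c * ip2 M a k\<bar> * exp (- (b - lam) * real n)) \<longlonglongrightarrow> 0 * B + \<bar>c * ip2 M a k\<bar> * 0"
  proof (intro tendsto_intros)
    have "(\<lambda>n. exp (- e * real n)) \<longlonglongrightarrow> 0" if "0 < e" for e
    proof -
      have "filterlim (\<lambda>n. - e * real n) at_bot sequentially"
        using that by (intro filterlim_tendsto_neg_mult_at_bot[OF tendsto_const _ filterlim_real_sequentially]) auto
      then show ?thesis by (rule filterlim_compose[OF exp_at_bot])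
    qed
    from this[OF b] this[of "b - lam"]
    show "(\<lambda>n. exp (- b * real n)) \<longlonglongrightarrow> 0" "(\<lambda>n. exp (- (b - lam) * real n)) \<longlonglongrightarrow> 0"
      using lam by (simp_all del: minus_diff_eq)
  qed
  have "\<phi> (real n) \<le> exp (- b * real n) * B + \<bar>c * ip2 M a k\<bar> * exp (- (b - lam) * real n)" for n
  proof -
    have "\<bar>ip2 M a (P n (res b k))\<bar> \<le> nrm2 M a * nrm2 M (P n (res b k))"
      by (rule L2.Cauchy_Schwarz[OF a P_L2[OF _ rk]]) simp
    also have "\<dots> \<le> B" unfolding B_def using a rk by (intro mult_left_mono P_contraction) auto
    finally have "exp (- b * real n) * ip2 M a (P n (res b k)) \<le> exp (- b * real n) * B"
      by (intro mult_left_mono) auto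
    moreover have "- (c * ip2 M a k) * exp (- (b - lam) * real n) \<le> \<bar>c * ip2 M a k\<bar> * exp (- (b - lam) * real n)"
      by (intro mult_right_mono) auto
    moreover have "- (c * ip2 M a k) * exp (- (b - lam) * real n) = - (c * exp (- (b - lam) * real n) * ip2 M a k)"
      by simp
    ultimately show ?thesis unfolding \<phi>_def by linarith
  qed
  note le = this
  have "\<phi> 0 \<le> exp (- b * real n) * B + \<bar>c * ip2 M a k\<bar> * exp (- (b - lam) * real n)" if "1 \<le> n" for n
    by (rule order_trans[OF mono le]) (use that in simp)
  then have "\<phi> 0 \<le> 0 * B + \<bar>c * ip2 M a k\<bar> * 0"
    by (intro LIMSEQ_le_const[OF lim] exI[of _ 1] allI impI)
  then have "ip2 M a (P 0 (res b k)) - c * ip2 M a k \<le> 0" by (simp add: \<phi>_def)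
  moreover have "ip2 M a (P 0 (res b k)) = ip2 M a (res b k)"
    using P_0[OF rk] a rk by (intro ip2_cong_AE) auto
  moreover have "ip2 M a z = ip2 M a (res b k) - c * ip2 M a k"
    using a rk k by (simp add: z_def L2.ip_diff_right L2.ip_scale_right)
  ultimately have "ip2 M a z \<le> 0" by simp
  from AE_le_if_ip2_nonpos[OF z this[unfolded a_def]] show ?thesis
    by eventually_elim (simp add: z_def c_def)
qed

context dirichlet
begin

section \<open>Order properties of the resolvents and semigroups of open subsets\<close>

abbreviation "RM \<equiv> restrict_space M"

definition rs :: "'a set \<Rightarrow> real \<Rightarrow> ('a \<Rightarrow> real) \<Rightarrow> 'a \<Rightarrow> real" where
  "rs U = dform.res (R U)"

definition Pt :: "'a set \<Rightarrow> real \<Rightarrow> ('a \<Rightarrow> real) \<Rightarrow> 'a \<Rightarrow> real" where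
  "Pt U = dform.P (R U)"

context
  fixes U assumes U: "openin X U"
begin

interpretation r: dform "R U" by (rule dform_R[OF U])

lemma Um: "U \<in> sets M" using U by simp

lemma L2R: "f \<in> L2 (RM U) \<longleftrightarrow> zero_ext U f \<in> L2 M"
  by (rule L2_restrict_iff[OF Um])

lemma L2R_of_L2: "f \<in> L2 M \<Longrightarrow> f \<in> L2 (RM U)"
  unfolding L2R by (rule L2_zero_ext[OF Um])

lemmas rs_L2 = r.res_L2[folded rs_def, unfolded R_simps]
  and rs_cong = r.res_cong[folded rs_def, unfolded R_simps]
  and rs_diff = r.res_diff[folded rs_def, unfolded R_simps]
  and rs_scale = r.res_scale[folded rs_def, unfolded R_simps]
  and rs_contraction = r.res_contraction[folded rs_def, unfolded R_simps]
  and rs_tendsto = r.res_tendsto[folded rs_def, unfolded R_simps]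
  and rs_le_of_Pt = r.res_le_of_P[folded rs_def Pt_def, unfolded R_simps]
  and rs_deriv = r.res_deriv[folded rs_def Pt_def, unfolded R_simps]
  and Pt_L2 = r.P_L2[folded Pt_def, unfolded R_simps]
  and Pt_0 = r.P_0[folded Pt_def, unfolded R_simps]
  and Pt_add = r.P_add[folded Pt_def, unfolded R_simps]
  and Pt_lin = r.P_lin[folded Pt_def, unfolded R_simps]
  and Pt_diff = r.P_diff[folded Pt_def, unfolded R_simps]
  and Pt_cong = r.P_cong[folded Pt_def, unfolded R_simps]
  and Pt_contraction = r.P_contraction[folded Pt_def, unfolded R_simps]
  and Pt_symmetric = r.P_symmetric[folded Pt_def, unfolded R_simps]
  and Pt_Euler = r.Euler[folded rs_def Pt_def, unfolded R_simps]
  and Pt_cont = r.ip2_P_cont[folded Pt_def, unfolded R_simps]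

lemma rs_FU: "0 < b \<Longrightarrow> f \<in> L2 (RM U) \<Longrightarrow> zero_ext U (rs U b f) \<in> FU U"
  using r.res_F[of b f] by (simp add: rs_def)

text \<open>The resolvent equation of the restricted space, moved to the ambient space, where the
  maximum principle is available.\<close>

lemma rs_eq:
  assumes b: "0 < b" and f: "f \<in> L2 (RM U)" and v: "v \<in> FU U"
  shows "E (zero_ext U (rs U b f)) v + b * ip2 M (zero_ext U (rs U b f)) v = b * ip2 M (zero_ext U f) v"
proof -
  let ?u = "zero_ext U (rs U b f)"
  have vF: "v \<in> F" using v by (rule FU_F)
  have zv: "zero_ext U v \<in> FU U"
    by (rule FU_cong[OF v zero_ext_measurable[OF Um]])
      (use vF FU_zero_ext[OF Um v] in \<open>auto elim: eventually_mono\<close>)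
  have AE: "AE x in M. zero_ext U v x = v x" by (rule FU_zero_ext[OF Um v])
  have uF: "?u \<in> F" by (rule FU_F[OF rs_FU[OF b f]])
  have "E ?u (zero_ext U v) + b * ip2 (RM U) (rs U b f) v = b * ip2 (RM U) f v"
    using r.res_eq[OF b, of f v] f zv by (simp add: rs_def)
  then have "E ?u (zero_ext U v) + b * ip2 M ?u (zero_ext U v) = b * ip2 M (zero_ext U f) (zero_ext U v)"
    unfolding ip2_restrict[OF Um] .
  moreover have "E ?u (zero_ext U v) = E ?u v"
    using uF vF FU_F[OF zv] AE by (intro E_cong) auto
  moreover have "ip2 M ?u (zero_ext U v) = ip2 M ?u v"
    using uF vF FU_F[OF zv] AE by (intro ip2_cong_AE) auto
  moreover have "ip2 M (zero_ext U f) (zero_ext U v) = ip2 M (zero_ext U f) v"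
    using f[unfolded L2R] vF FU_F[OF zv] AE by (intro ip2_cong_AE) auto
  ultimately show ?thesis by simp
qed

text \<open>The solution lies in \<open>FU U\<close>, so its own positive part can serve as the
  boundary function \<open>w\<close> of the maximum principle.\<close>

lemma rs_max:
  assumes b: "0 < b" and f: "f \<in> L2 (RM U)" and C: "0 \<le> C" and le: "AE x in RM U. f x \<le> C"
  shows "AE x in RM U. rs U b f x \<le> C"
proof -
  let ?u = "zero_ext U (rs U b f)"
  have "AE x in M. ?u x \<le> C"
  proof (rule max_principle[OF FU_F[OF rs_FU[OF b f]] C b FU_pos[OF rs_FU[OF b f]]])
    show "AE x in M. ?u x \<le> C + max (?u x) 0" using C by (intro AE_I2) simp
    show "b *\<^sub>R zero_ext U f \<in> L2 M" using f L2R by simp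
    show "AE x in M. (b *\<^sub>R zero_ext U f) x \<le> b * C"
      using le unfolding AE_restrict_iff[OF Um]
      by eventually_elim (use b C in \<open>auto simp: zero_ext_def\<close>)
    show "E ?u v + b * ip2 M ?u v \<le> ip2 M (b *\<^sub>R zero_ext U f) v" if "v \<in> FU U" for v
      using rs_eq[OF b f that] f L2R FU_F[OF that] by (simp add: L2.ip_scale_left)
  qed simp
  then show ?thesis unfolding AE_restrict_iff[OF Um] by eventually_elim (auto simp: zero_ext_def split: if_splits)
qed

lemma rs_mono:
  assumes b: "0 < b" and f: "f \<in> L2 (RM U)" "g \<in> L2 (RM U)" and le: "AE x in RM U. f x \<le> g x"
  shows "AE x in RM U. rs U b f x \<le> rs U b g x"
proof -
  have "AE x in RM U. (f - g) x \<le> 0" using le by eventually_elim simp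
  from rs_max[OF b L2.S_diff[OF f] order_refl this] show ?thesis
    unfolding rs_diff[OF b f] by eventually_elim simp
qed

lemma rs_0: "0 < b \<Longrightarrow> rs U b 0 = 0"
  using rs_scale[of b 0 0] L2.S_0 by simp

lemma rs_pos:
  assumes b: "0 < b" and f: "f \<in> L2 (RM U)" and le: "AE x in RM U. 0 \<le> f x"
  shows "AE x in RM U. 0 \<le> rs U b f x"
  using rs_mono[OF b L2.S_0 f] le rs_0[OF b] by simp

lemma rsn_L2: "0 < b \<Longrightarrow> f \<in> L2 (RM U) \<Longrightarrow> (rs U b ^^ n) f \<in> L2 (RM U)"
  by (induction n) (auto intro: rs_L2)

lemma rsn_mono:
  assumes b: "0 < b" and f: "f \<in> L2 (RM U)" "g \<in> L2 (RM U)" and le: "AE x in RM U. f x \<le> g x"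
  shows "AE x in RM U. (rs U b ^^ n) f x \<le> (rs U b ^^ n) g x"
proof (induction n)
  case (Suc n)
  from rs_mono[OF b rsn_L2[OF b f(1)] rsn_L2[OF b f(2)] this] show ?case by simp
qed (use le in simp)

lemma rsn_pos:
  assumes b: "0 < b" and f: "f \<in> L2 (RM U)" and le: "AE x in RM U. 0 \<le> f x"
  shows "AE x in RM U. 0 \<le> (rs U b ^^ n) f x"
proof (induction n)
  case (Suc n)
  from rs_pos[OF b rsn_L2[OF b f] this] show ?case by simp
qed (use le in simp)

lemma rsn_max:
  assumes b: "0 < b" and f: "f \<in> L2 (RM U)" and C: "0 \<le> C" and le: "AE x in RM U. f x \<le> C"
  shows "AE x in RM U. (rs U b ^^ n) f x \<le> C"
proof (induction n)
  case (Suc n)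
  from rs_max[OF b rsn_L2[OF b f] C this] show ?case by simp
qed (use le in simp)

lemma Pt_mono:
  assumes t: "0 < t" and f: "f \<in> L2 (RM U)" "g \<in> L2 (RM U)" and le: "AE x in RM U. f x \<le> g x"
  shows "AE x in RM U. Pt U t f x \<le> Pt U t g x"
  by (rule limit_le_AE[OF _ _ _ _ rsn_mono[OF _ f le] Pt_Euler[OF f(1) t] Pt_Euler[OF f(2) t]])
    (use t f in \<open>auto intro!: rsn_L2 Pt_L2 simp del: funpow.simps\<close>)

lemma Pt_pos:
  assumes t: "0 < t" and f: "f \<in> L2 (RM U)" and le: "AE x in RM U. 0 \<le> f x"
  shows "AE x in RM U. 0 \<le> Pt U t f x"
proof -
  have "AE x in RM U. (0 :: 'a \<Rightarrow> real) x \<le> Pt U t f x"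
  proof (rule limit_le_AE[OF L2.S_0 rsn_L2 L2.S_0 Pt_L2 _ _ Pt_Euler[OF f t]])
    show "AE x in RM U. (0 :: 'a \<Rightarrow> real) x \<le> (rs U (Suc n / t) ^^ Suc n) f x" for n
      using rsn_pos[OF _ f le, of "Suc n / t" "Suc n"] t by (simp del: funpow.simps)
  qed (use t f in auto)
  then show ?thesis by simp
qed

lemma Pt_max:
  assumes t: "0 < t" and f: "f \<in> L2 (RM U)" and C: "0 \<le> C" and le: "AE x in RM U. f x \<le> C"
  shows "AE x in RM U. Pt U t f x \<le> C"
  by (rule limit_le_measurable[OF _ _ _ rsn_max[OF _ f C le] Pt_Euler[OF f t]])
    (use t f in \<open>auto intro!: rsn_L2 Pt_L2 simp del: funpow.simps\<close>)

text \<open>The converse of \<open>rs_le_of_Pt\<close>. Iterating the resolvent bound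
  \<open>n\<close> times with \<open>b = n / t\<close> gives the factor
  \<open>(b / (b - lam))^n\<close>, which tends to \<open>e^(lam t)\<close>, while the iterates tend
  to \<open>Pt U t q\<close>.\<close>

lemma Pt_supermedian:
  assumes t: "0 < t" and lam: "0 \<le> lam" and q: "q \<in> L2 (RM U)"
    and sm: "\<And>b. lam < b \<Longrightarrow> AE x in RM U. rs U b q x \<le> b / (b - lam) * q x"
  shows "AE x in RM U. exp (- lam * t) * Pt U t q x \<le> q x"
proof -
  have iter: "AE x in RM U. (rs U b ^^ n) q x \<le> (b / (b - lam)) ^ n * q x" if b: "lam < b" for b n
  proof (induction n)
    case (Suc n)
    have b0: "0 < b" using b lam by simp
    let ?c = "b / (b - lam)"
    have c: "0 \<le> ?c" using b b0 by simp
    have "AE x in RM U. (rs U b ^^ n) q x \<le> (?c ^ n *\<^sub>R q) x" using Suc by simp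
    from rs_mono[OF b0 rsn_L2[OF b0 q] L2.S_scale[OF q] this]
    have "AE x in RM U. rs U b ((rs U b ^^ n) q) x \<le> ?c ^ n * rs U b q x"
      unfolding rs_scale[OF b0 q] by simp
    then show ?case using sm[OF b]
    proof eventually_elim
      case (elim x)
      have "?c ^ n * rs U b q x \<le> ?c ^ n * (?c * q x)"
        using elim(2) c by (intro mult_left_mono) auto
      then show ?case using elim(1) by (simp add: mult_ac)
    qed
  qed simp
  \<comment> \<open>The shift by \<open>N\<close> makes all parameters \<open>b n\<close> larger
    than \<open>lam\<close>, also the first ones.\<close>
  obtain N :: nat where N: "lam * t < N" using reals_Archimedean2 by blast
  define b where "b n = Suc (n + N) / t" for n
  have b: "lam < b n" for n
    using N t unfolding b_def by (simp add: pos_less_divide_eq)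
  define c where "c n = (b n / (b n - lam)) ^ Suc (n + N)" for n
  have lim_c: "c \<longlonglongrightarrow> exp (lam * t)"
  proof -
    have "(\<lambda>n. (1 + (- (lam * t)) / real n) ^ n) \<longlonglongrightarrow> exp (- (lam * t))"
      by (rule tendsto_exp_limit_sequentially)
    from LIMSEQ_ignore_initial_segment[OF this, of "Suc N"]
    have "(\<lambda>n. inverse ((1 + (- (lam * t)) / real (n + Suc N)) ^ (n + Suc N))) \<longlonglongrightarrow> inverse (exp (- (lam * t)))"
      by (intro tendsto_inverse) auto
    moreover have "inverse ((1 + (- (lam * t)) / real (n + Suc N)) ^ (n + Suc N)) = c n" for n
    proof -
      have "(- (lam * t)) / real (n + Suc N) = - (lam / b n)" using t by (simp add: b_def)
      moreover have "b n / (b n - lam) = inverse (1 + - (lam / b n))"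
        using b[of n] lam by (simp add: field_simps)
      ultimately have "b n / (b n - lam) = inverse (1 + (- (lam * t)) / real (n + Suc N))" by simp
      then show ?thesis by (simp add: c_def power_inverse)
    qed
    ultimately show ?thesis by (simp add: exp_minus)
  qed
  have bpos: "0 < b n" for n using b[of n] lam by simp
  have "AE x in RM U. Pt U t q x \<le> (exp (lam * t) *\<^sub>R q) x"
  proof (rule limit_le_AE[of "\<lambda>n. (rs U (b n) ^^ Suc (n + N)) q" _ "\<lambda>n. c n *\<^sub>R q"])
    show "(rs U (b n) ^^ Suc (n + N)) q \<in> L2 (RM U)" for n by (rule rsn_L2[OF bpos q])
    show "c n *\<^sub>R q \<in> L2 (RM U)" for n by (rule L2.S_scale[OF q])
    show "Pt U t q \<in> L2 (RM U)" using Pt_L2 t q by simp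
    show "exp (lam * t) *\<^sub>R q \<in> L2 (RM U)" by (rule L2.S_scale[OF q])
    show "AE x in RM U. (rs U (b n) ^^ Suc (n + N)) q x \<le> (c n *\<^sub>R q) x" for n
      using iter[OF b[of n], of "Suc (n + N)"] by (simp add: c_def del: funpow.simps power_Suc)
    show "(\<lambda>n. nrm2 (RM U) ((rs U (b n) ^^ Suc (n + N)) q - Pt U t q)) \<longlonglongrightarrow> 0"
      unfolding b_def by (rule LIMSEQ_ignore_initial_segment[OF Pt_Euler[OF q t], of N])
    have "nrm2 (RM U) (c n *\<^sub>R q - exp (lam * t) *\<^sub>R q) = \<bar>c n - exp (lam * t)\<bar> * nrm2 (RM U) q" for n
      using L2.nrm_scale[OF q, of "c n - exp (lam * t)"] by (simp add: scaleR_diff_left)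
    moreover have "(\<lambda>n. \<bar>c n - exp (lam * t)\<bar> * nrm2 (RM U) q) \<longlonglongrightarrow> 0"
      by (intro tendsto_mult_left_zero tendsto_rabs_zero LIM_zero lim_c)
    ultimately show "(\<lambda>n. nrm2 (RM U) (c n *\<^sub>R q - exp (lam * t) *\<^sub>R q)) \<longlonglongrightarrow> 0" by simp
  qed
  then show ?thesis
  proof eventually_elim
    case (elim x)
    then have "exp (- lam * t) * Pt U t q x \<le> exp (- lam * t) * (exp (lam * t) * q x)"
      by (intro mult_left_mono) auto
    also have "\<dots> = q x" by (simp add: mult.assoc[symmetric] exp_add[symmetric])
    finally show ?case .
  qed
qed

end

lemma L2R_mono:
  assumes U: "openin X U" and V: "openin X V" and UV: "U \<subseteq> V" and f: "f \<in> L2 (RM V)"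
  shows "f \<in> L2 (RM U)" "nrm2 (RM U) f \<le> nrm2 (RM V) f"
proof -
  have fV: "zero_ext V f \<in> L2 M" using f L2R[OF V] by simp
  have "zero_ext U (zero_ext V f) = zero_ext U f" using UV by (auto simp: zero_ext_def fun_eq_iff)
  with L2_zero_ext[OF Um[OF U] fV] have fU: "zero_ext U f \<in> L2 M" by simp
  then show "f \<in> L2 (RM U)" using L2R[OF U] by simp
  show "nrm2 (RM U) f \<le> nrm2 (RM V) f"
    unfolding nrm2_restrict[OF Um[OF U]] nrm2_restrict[OF Um[OF V]]
    by (rule nrm2_mono[OF fU fV]) (use UV in \<open>auto simp: zero_ext_def\<close>)
qed

lemma AE_RM_mono:
  assumes "openin X U" "openin X V" "U \<subseteq> V" "AE x in RM V. Q x" shows "AE x in RM U. Q x"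
  using assms(4) unfolding AE_restrict_iff[OF Um[OF assms(1)]] AE_restrict_iff[OF Um[OF assms(2)]]
  by eventually_elim (use assms(3) in auto)

text \<open>On \<open>U\<close> the difference of the two resolvents solves the homogeneous
  equation, and it is at most \<open>rs U b f\<close>, which vanishes at the boundary of
  \<open>U\<close>. The maximum principle applies with \<open>C = 0\<close>.\<close>

lemma rs_domain:
  assumes U: "openin X U" and V: "openin X V" and UV: "U \<subseteq> V" and b: "0 < b"
    and f: "f \<in> L2 (RM V)" and pos: "AE x in RM V. 0 \<le> f x"
  shows "AE x in RM U. rs U b f x \<le> rs V b f x"
proof -
  have fU: "f \<in> L2 (RM U)" by (rule L2R_mono(1)[OF U V UV f])
  let ?u = "zero_ext U (rs U b f)" and ?v = "zero_ext V (rs V b f)"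
  have uFU: "?u \<in> FU U" and vFV: "?v \<in> FU V" using rs_FU[OF U b fU] rs_FU[OF V b f] .
  have uF: "?u \<in> F" and vF: "?v \<in> F" using FU_F[OF uFU] FU_F[OF vFV] .
  have "AE x in M. 0 \<le> ?v x"
    using rs_pos[OF V b f pos] unfolding AE_restrict_iff[OF Um[OF V]]
    by eventually_elim (auto simp: zero_ext_def split: if_splits)
  moreover have u0: "AE x in M. 0 \<le> ?u x"
    using rs_pos[OF U b fU AE_RM_mono[OF U V UV pos]] unfolding AE_restrict_iff[OF Um[OF U]]
    by eventually_elim (auto simp: zero_ext_def split: if_splits)
  ultimately have le: "AE x in M. (?u - ?v) x \<le> 0 + ?u x" by eventually_elim simp
  have "AE x in M. (?u - ?v) x \<le> 0"
  proof (rule max_principle[OF E.S_diff[OF uF vF] order_refl b uFU le u0 L2.S_0])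
    fix w assume w: "w \<in> FU U"
    have wF: "w \<in> F" using FU_F[OF w] .
    have "E (?u - ?v) w + b * ip2 M (?u - ?v) w
        = (E ?u w + b * ip2 M ?u w) - (E ?v w + b * ip2 M ?v w)"
      using uF vF wF by (simp add: E.ip_diff_left L2.ip_diff_left algebra_simps)
    moreover have "(E ?u w + b * ip2 M ?u w) - (E ?v w + b * ip2 M ?v w)
        = b * (ip2 M (zero_ext U f) w - ip2 M (zero_ext V f) w)"
      using rs_eq[OF U b fU w] rs_eq[OF V b f FU_mono[OF UV w]] by (simp add: algebra_simps)
    moreover have "ip2 M (zero_ext U f) w = ip2 M (zero_ext V f) w"
      unfolding ip2_def
    proof (rule integral_cong_AE)
      show "AE x in M. zero_ext U f x * w x = zero_ext V f x * w x"
        using FU_zero[OF Um[OF U] w] by eventually_elim (use UV in \<open>auto simp: zero_ext_def\<close>)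
    qed (use fU[unfolded L2R[OF U]] f[unfolded L2R[OF V]] F_L2[OF wF] in
        \<open>auto intro!: borel_measurable_times\<close>)
    ultimately have "E (?u - ?v) w + b * ip2 M (?u - ?v) w = 0"
      by (simp only: diff_self mult_zero_right)
    then show "E (?u - ?v) w + b * ip2 M (?u - ?v) w \<le> ip2 M 0 w"
      using L2.ip_0_left F_L2[OF wF] by auto
  qed simp
  then show ?thesis unfolding AE_restrict_iff[OF Um[OF U]]
    by eventually_elim (use UV in \<open>auto simp: zero_ext_def\<close>)
qed

lemma rsn_domain:
  assumes U: "openin X U" and V: "openin X V" and UV: "U \<subseteq> V" and b: "0 < b"
    and f: "f \<in> L2 (RM V)" and pos: "AE x in RM V. 0 \<le> f x"
  shows "AE x in RM U. (rs U b ^^ n) f x \<le> (rs V b ^^ n) f x"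
proof (induction n)
  case (Suc n)
  have fU: "f \<in> L2 (RM U)" by (rule L2R_mono(1)[OF U V UV f])
  have fn: "(rs V b ^^ n) f \<in> L2 (RM V)" by (rule rsn_L2[OF V b f])
  have "AE x in RM U. rs U b ((rs U b ^^ n) f) x \<le> rs U b ((rs V b ^^ n) f) x"
    by (rule rs_mono[OF U b rsn_L2[OF U b fU] L2R_mono(1)[OF U V UV fn] Suc])
  moreover have "AE x in RM U. rs U b ((rs V b ^^ n) f) x \<le> rs V b ((rs V b ^^ n) f) x"
    by (rule rs_domain[OF U V UV b fn rsn_pos[OF V b f pos]])
  ultimately show ?case by eventually_elim simp
qed simp

lemma Pt_domain:
  assumes U: "openin X U" and V: "openin X V" and UV: "U \<subseteq> V" and t: "0 < t"
    and f: "f \<in> L2 (RM V)" and pos: "AE x in RM V. 0 \<le> f x"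
  shows "AE x in RM U. Pt U t f x \<le> Pt V t f x"
proof -
  have fU: "f \<in> L2 (RM U)" by (rule L2R_mono(1)[OF U V UV f])
  have b: "0 < Suc n / t" for n using t by simp
  have VL: "(rs V (Suc n / t) ^^ Suc n) f \<in> L2 (RM V)" for n by (rule rsn_L2[OF V b f])
  have PV: "Pt V t f \<in> L2 (RM V)" using Pt_L2[OF V] t f by simp
  have limV: "(\<lambda>n. nrm2 (RM U) ((rs V (Suc n / t) ^^ Suc n) f - Pt V t f)) \<longlonglongrightarrow> 0"
  proof (rule tendsto_sandwich[OF _ _ tendsto_const Pt_Euler[OF V f t]])
    show "\<forall>\<^sub>F n in sequentially. nrm2 (RM U) ((rs V (Suc n / t) ^^ Suc n) f - Pt V t f)
      \<le> nrm2 (RM V) ((rs V (Suc n / t) ^^ Suc n) f - Pt V t f)"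
      using L2R_mono(2)[OF U V UV L2.S_diff[OF VL PV]] by (intro always_eventually allI)
    show "\<forall>\<^sub>F n in sequentially. 0 \<le> nrm2 (RM U) ((rs V (Suc n / t) ^^ Suc n) f - Pt V t f)"
      using L2R_mono(1)[OF U V UV L2.S_diff[OF VL PV]] by (intro always_eventually allI L2.nrm_ge_0)
  qed
  show ?thesis
    by (rule limit_le_AE[OF rsn_L2[OF U b fU] L2R_mono(1)[OF U V UV VL] _ L2R_mono(1)[OF U V UV PV]
      rsn_domain[OF U V UV b f pos] Pt_Euler[OF U fU t] limV]) (use Pt_L2[OF U] t fU in simp)
qed

end

section \<open>Supermedian functions and the heat semigroup on integrable functions\<close>

lemma nrm2_dominated_convergence:
  assumes f: "\<And>n. f n \<in> L2 M" and g: "g \<in> L2 M" and w: "w \<in> L2 M"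
    and le: "\<And>n. AE x in M. \<bar>f n x - g x\<bar> \<le> \<bar>w x\<bar>" and lim: "AE x in M. (\<lambda>n. f n x) \<longlonglongrightarrow> g x"
  shows "(\<lambda>n. nrm2 M (f n - g)) \<longlonglongrightarrow> 0"
proof -
  have "(\<lambda>n. \<integral>x. ((f n - g) x)\<^sup>2 \<partial>M) \<longlonglongrightarrow> (\<integral>x. 0 \<partial>M)"
  proof (rule integral_dominated_convergence[OF _ _ L2_sq[OF w]])
    show "(\<lambda>x. ((f n - g) x)\<^sup>2) \<in> borel_measurable M" for n using f[of n] g by simp
    show "AE x in M. norm (((f n - g) x)\<^sup>2) \<le> (w x)\<^sup>2" for n
      using le[of n] by eventually_elim (simp add: abs_le_square_iff)
    show "AE x in M. (\<lambda>n. ((f n - g) x)\<^sup>2) \<longlonglongrightarrow> 0"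
      using lim
    proof eventually_elim
      case (elim x)
      from tendsto_power[OF LIM_zero[OF elim], of 2] show ?case by simp
    qed
  qed simp
  then have "(\<lambda>n. (nrm2 M (f n - g))\<^sup>2) \<longlonglongrightarrow> 0"
    unfolding nrm2_sq[OF L2.S_diff[OF f g]] by simp
  from tendsto_real_sqrt[OF this] show ?thesis
    using L2.nrm_ge_0[OF L2.S_diff[OF f g]] by simp
qed

lemma nrm2_sandwich:
  assumes "\<And>n. f n \<in> L2 M" "g \<in> L2 M" "h \<longlonglongrightarrow> 0" "\<And>n. nrm2 M (f n - g) \<le> h n"
  shows "(\<lambda>n. nrm2 M (f n - g)) \<longlonglongrightarrow> 0"
  by (rule tendsto_sandwich[OF _ _ tendsto_const assms(3)])
    (intro always_eventually allI assms(4) L2.nrm_ge_0 L2.S_diff assms(1,2))+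

lemma (in finite_measure) L2_bounded:
  assumes "f \<in> borel_measurable M" "AE x in M. \<bar>f x\<bar> \<le> C" shows "f \<in> L2 M"
proof (rule L2_dominated[OF assms(1)])
  show "(\<lambda>x. C) \<in> L2 M" unfolding L2_def by simp
  show "AE x in M. \<bar>f x\<bar> \<le> \<bar>C\<bar>" using assms(2) by eventually_elim simp
qed

context dirichlet
begin

text \<open>The condition under the \<open>SOME\<close> of \<open>heat_nonneg\<close>, with the
  approximating sequence as a parameter.\<close>

definition heat_limit where
  "heat_limit U t p u fs \<longleftrightarrow> u \<in> borel_measurable (RM U) \<and> (\<forall>n::nat. fs n \<in> L2 (RM U)) \<and>
     (AE x in RM U. (\<forall>n. 0 \<le> fs n x) \<and> incseq (\<lambda>n. fs n x) \<and> (\<lambda>n. fs n x) \<longlonglongrightarrow> p x) \<and>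
     (AE x in RM U. (\<lambda>n. Pt U t (fs n) x) \<longlonglongrightarrow> u x)"

abbreviation "hn U \<equiv> heat_nonneg (R U)"

text \<open>Supermedian for \<open>e\<^sup>-\<^sup>l\<^sup>a\<^sup>m\<^sup>t P\<^sub>t\<close>, tested from below by square integrable functions so
  that p itself need only be measurable.\<close>

definition smed :: "'a set \<Rightarrow> real \<Rightarrow> ('a \<Rightarrow> real) \<Rightarrow> bool" where
  "smed U lam p \<longleftrightarrow> (\<forall>t>0. \<forall>f\<in>L2 (RM U). (AE x in RM U. 0 \<le> f x) \<longrightarrow> (AE x in RM U. f x \<le> p x) \<longrightarrow>
     (AE x in RM U. exp (- lam * t) * Pt U t f x \<le> p x))"

context
  fixes U assumes U: "openin X U"
begin

text \<open>The choice need not return the given \<open>u\<close>, and it may come with another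
  sequence. This is why \<open>heat_limit_ge\<close> and \<open>heat_limit_le\<close> are about
  arbitrary limits.\<close>

lemma heat_limit_some:
  assumes "heat_limit U t p u fs" obtains fs' where "heat_limit U t p (hn U t p) fs'"
proof -
  let ?Q = "\<lambda>u. u \<in> borel_measurable (RM U) \<and> (\<exists>fs. (\<forall>n::nat. fs n \<in> L2 (RM U)) \<and>
     (AE x in RM U. (\<forall>n. 0 \<le> fs n x) \<and> incseq (\<lambda>n. fs n x) \<and> (\<lambda>n. fs n x) \<longlonglongrightarrow> p x) \<and>
     (AE x in RM U. (\<lambda>n. L2_semigroup (R U) t (fs n) x) \<longlonglongrightarrow> u x))"
  have *: "?Q u \<longleftrightarrow> (\<exists>fs. heat_limit U t p u fs)" for u
    unfolding heat_limit_def Pt_def dform.P_def[OF dform_R[OF U]] by blast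
  have "?Q u" unfolding * by (rule exI[of _ fs]) (rule assms)
  then have "?Q (Eps ?Q)" by (rule someI[of ?Q])
  moreover have "Eps ?Q = hn U t p" unfolding heat_nonneg_def R_simps(2) ..
  ultimately have "?Q (hn U t p)" by (simp only:)
  then show ?thesis unfolding * by (elim exE) (rule that)
qed

lemma Pt_dist_le:
  assumes t: "0 < t" and f: "f \<in> L2 (RM U)" and g: "g \<in> L2 (RM U)"
  shows "nrm2 (RM U) (Pt U t f - Pt U t g) \<le> nrm2 (RM U) (f - g)"
proof -
  have "nrm2 (RM U) (Pt U t f - Pt U t g) = nrm2 (RM U) (Pt U t (f - g))"
    by (rule nrm2_cong_AE[OF L2.S_diff[OF Pt_L2[OF U _ f] Pt_L2[OF U _ g]] Pt_L2[OF U _ L2.S_diff[OF f g]]])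
      (use t Pt_diff[OF U _ f g, of t] in \<open>auto elim: eventually_mono\<close>)
  also have "\<dots> \<le> nrm2 (RM U) (f - g)" using Pt_contraction[OF U _ L2.S_diff[OF f g]] t by simp
  finally show ?thesis .
qed

text \<open>\<open>min g (fs n)\<close> tends to \<open>g\<close> in \<open>L2\<close>, so
  \<open>Pt U t g\<close> is a limit of functions below \<open>u\<close>. Together with
  \<open>heat_limit_le\<close> this makes \<open>u\<close> the least upper bound, up to null sets,
  of all \<open>Pt U t g\<close> with square integrable \<open>0 <= g <= p\<close>.\<close>

lemma heat_limit_ge:
  assumes t: "0 < t" and H: "heat_limit U t p u fs" and g: "g \<in> L2 (RM U)"
    and g0: "AE x in RM U. 0 \<le> g x" and gp: "AE x in RM U. g x \<le> p x"
  shows "AE x in RM U. Pt U t g x \<le> u x"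
proof -
  have um: "u \<in> borel_measurable (RM U)" and fs: "\<And>n. fs n \<in> L2 (RM U)"
    and AE1: "AE x in RM U. (\<forall>n. 0 \<le> fs n x) \<and> incseq (\<lambda>n. fs n x) \<and> (\<lambda>n. fs n x) \<longlonglongrightarrow> p x"
    and AE2: "AE x in RM U. (\<lambda>n. Pt U t (fs n) x) \<longlonglongrightarrow> u x"
    using H unfolding heat_limit_def by auto
  have inc: "AE x in RM U. Pt U t (fs n) x \<le> Pt U t (fs (Suc n)) x" for n
  proof (rule Pt_mono[OF U t fs fs])
    show "AE x in RM U. fs n x \<le> fs (Suc n) x" using AE1 by eventually_elim (simp add: incseq_Suc_iff)
  qed
  then have "AE x in RM U. \<forall>n. Pt U t (fs n) x \<le> Pt U t (fs (Suc n)) x"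
    unfolding AE_all_countable by blast
  then have Pu: "AE x in RM U. \<forall>n. Pt U t (fs n) x \<le> u x" using AE2
    by eventually_elim (auto intro: incseq_le simp: incseq_Suc_iff)
  define g' where "g' n = (\<lambda>x. min (g x) (fs n x))" for n
  have g'm: "g' n \<in> borel_measurable (RM U)" for n unfolding g'_def using g fs[of n] by simp
  have g'_le: "AE x in RM U. \<bar>g' n x\<bar> \<le> \<bar>g x\<bar>" for n
    using g0 AE1 by eventually_elim (auto simp: g'_def min_def)
  have g': "g' n \<in> L2 (RM U)" for n by (rule L2_dominated[OF g'm g g'_le])
  have "(\<lambda>n. nrm2 (RM U) (g' n - g)) \<longlonglongrightarrow> 0"
  proof (rule nrm2_dominated_convergence[OF g' g g])
    show "AE x in RM U. \<bar>g' n x - g x\<bar> \<le> \<bar>g x\<bar>" for n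
      using g0 AE1 by eventually_elim (simp add: g'_def min_def)
    show "AE x in RM U. (\<lambda>n. g' n x) \<longlonglongrightarrow> g x" using AE1 gp
    proof eventually_elim
      case (elim x)
      from elim have "(\<lambda>n. min (g x) (fs n x)) \<longlonglongrightarrow> min (g x) (p x)" by (intro tendsto_min) auto
      then show ?case using elim(2) by (simp add: g'_def)
    qed
  qed
  moreover have "nrm2 (RM U) (Pt U t (g' n) - Pt U t g) \<le> nrm2 (RM U) (g' n - g)" for n
    by (rule Pt_dist_le[OF t g' g])
  ultimately have lim: "(\<lambda>n. nrm2 (RM U) (Pt U t (g' n) - Pt U t g)) \<longlonglongrightarrow> 0"
    by (rule nrm2_sandwich[rotated 2]) (use Pt_L2[OF U _ g'] Pt_L2[OF U _ g] t in auto)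
  show ?thesis
  proof (rule limit_le_measurable[OF Pt_L2[OF U _ g'] Pt_L2[OF U _ g] um _ lim])
    fix n
    have "AE x in RM U. Pt U t (g' n) x \<le> Pt U t (fs n) x"
      by (rule Pt_mono[OF U t g' fs]) (simp add: g'_def)
    then show "AE x in RM U. Pt U t (g' n) x \<le> u x" using Pu by eventually_elim (meson order_trans)
  qed (use t in auto)
qed

lemma heat_limit_le:
  assumes t: "0 < t" and H: "heat_limit U t p u fs"
    and *: "\<And>g. \<lbrakk>g \<in> L2 (RM U); AE x in RM U. 0 \<le> g x; AE x in RM U. g x \<le> p x\<rbrakk>
      \<Longrightarrow> AE x in RM U. Pt U t g x \<le> q x"
  shows "AE x in RM U. u x \<le> q x"
proof -
  have fs: "\<And>n. fs n \<in> L2 (RM U)"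
    and AE1: "AE x in RM U. (\<forall>n. 0 \<le> fs n x) \<and> incseq (\<lambda>n. fs n x) \<and> (\<lambda>n. fs n x) \<longlonglongrightarrow> p x"
    and AE2: "AE x in RM U. (\<lambda>n. Pt U t (fs n) x) \<longlonglongrightarrow> u x"
    using H unfolding heat_limit_def by auto
  have "AE x in RM U. Pt U t (fs n) x \<le> q x" for n
  proof (rule *[OF fs])
    show "AE x in RM U. 0 \<le> fs n x" using AE1 by eventually_elim simp
    show "AE x in RM U. fs n x \<le> p x" using AE1 by eventually_elim (rule incseq_le[of "\<lambda>n. fs n _"], simp_all)
  qed
  then have "AE x in RM U. \<forall>n. Pt U t (fs n) x \<le> q x" unfolding AE_all_countable by blast
  then show ?thesis using AE2
    by eventually_elim (rule LIMSEQ_le_const2, auto)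
qed

lemma hn_L2:
  assumes t: "0 < t" and f: "f \<in> L2 (RM U)" and f0: "AE x in RM U. 0 \<le> f x"
  shows "AE x in RM U. hn U t f x = Pt U t f x"
proof -
  have "Pt U t f \<in> L2 (RM U)" using Pt_L2[OF U _ f] t by simp
  then have "heat_limit U t f (Pt U t f) (\<lambda>_. f)"
    unfolding heat_limit_def using f f0 by (auto simp: incseq_const)
  then obtain fs where H: "heat_limit U t f (hn U t f) fs" by (rule heat_limit_some)
  have "AE x in RM U. Pt U t f x \<le> hn U t f x" by (rule heat_limit_ge[OF t H f f0]) simp
  moreover have "AE x in RM U. hn U t f x \<le> Pt U t f x"
    by (rule heat_limit_le[OF t H]) (rule Pt_mono[OF U t _ f])
  ultimately show ?thesis by eventually_elim simp
qed

text \<open>By symmetry this is the bound \<open>Pt U t 1 <= 1\<close>, integrated against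
  \<open>f\<close>.\<close>

lemma Pt_integral_le:
  assumes fin: "finite_measure (RM U)" and t: "0 < t" and f: "f \<in> L2 (RM U)" and f0: "AE x in RM U. 0 \<le> f x"
  shows "(\<integral>x. Pt U t f x \<partial>RM U) \<le> (\<integral>x. f x \<partial>RM U)"
proof -
  interpret finite_measure "RM U" by fact
  let ?one = "\<lambda>x::'a. 1 :: real"
  have 1: "?one \<in> L2 (RM U)" by (rule L2_bounded[of _ 1]) auto
  have P1: "Pt U t ?one \<in> L2 (RM U)" using Pt_L2[OF U _ 1] t by simp
  have "(\<integral>x. Pt U t f x \<partial>RM U) = ip2 (RM U) (Pt U t f) ?one" by (simp add: ip2_def)
  also have "\<dots> = ip2 (RM U) f (Pt U t ?one)" by (rule Pt_symmetric[OF U f 1 t])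
  also have "\<dots> \<le> ip2 (RM U) f ?one"
    unfolding ip2_def
  proof (rule integral_mono_AE[OF L2_mult[OF f P1] L2_mult[OF f 1]])
    have "AE x in RM U. Pt U t ?one x \<le> 1" by (rule Pt_max[OF U t 1]) auto
    then show "AE x in RM U. f x * Pt U t ?one x \<le> f x * 1" using f0
      by eventually_elim (rule mult_left_mono)
  qed
  finally show ?thesis by (simp add: ip2_def)
qed

text \<open>Truncations of \<open>p\<close> are square integrable because the measure is finite.
  Contractivity in \<open>L1\<close> bounds the integrals of their images, so the monotone limit is
  finite a.e.\<close>

lemma heat_limit_exists:
  assumes fin: "finite_measure (RM U)" and t: "0 < t" and p: "integrable (RM U) p" and p0: "AE x in RM U. 0 \<le> p x"
  obtains fs where "heat_limit U t p (hn U t p) fs"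
proof -
  interpret finite_measure "RM U" by fact
  define fs where "fs n = (\<lambda>x. min (p x) (real n))" for n
  have fs0: "AE x in RM U. 0 \<le> fs n x" for n using p0 by eventually_elim (simp add: fs_def)
  have fsm: "fs n \<in> borel_measurable (RM U)" for n unfolding fs_def using p by simp
  have "AE x in RM U. \<bar>fs n x\<bar> \<le> real n" for n using p0 by eventually_elim (simp add: fs_def)
  then have fs: "fs n \<in> L2 (RM U)" for n by (rule L2_bounded[OF fsm])
  have PL: "Pt U t (fs n) \<in> L2 (RM U)" for n using Pt_L2[OF U _ fs] t by simp
  then have Pm [measurable]: "Pt U t (fs n) \<in> borel_measurable (RM U)" for n by simp
  have P0: "AE x in RM U. 0 \<le> Pt U t (fs n) x" for n by (rule Pt_pos[OF U t fs fs0])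
  have one: "(\<lambda>x::'a. 1::real) \<in> L2 (RM U)" by (rule L2_bounded[of _ 1]) auto
  have Pint: "integrable (RM U) (Pt U t (fs n))" for n
    using L2_mult[OF PL[of n] one] by simp
  have fint: "integrable (RM U) (fs n)" for n
    using L2_mult[OF fs[of n] one] by simp
  have le: "(\<integral>\<^sup>+x. ennreal (Pt U t (fs n) x) \<partial>RM U) \<le> ennreal (\<integral>x. p x \<partial>RM U)" for n
  proof -
    have "(\<integral>x. fs n x \<partial>RM U) \<le> (\<integral>x. p x \<partial>RM U)"
      by (rule integral_mono[OF fint p]) (simp add: fs_def)
    with Pt_integral_le[OF fin t fs fs0] have "(\<integral>x. Pt U t (fs n) x \<partial>RM U) \<le> (\<integral>x. p x \<partial>RM U)"
      by (rule order_trans)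
    then show ?thesis using nn_integral_eq_integral[OF Pint P0] by (simp add: ennreal_leI)
  qed
  have inc: "AE x in RM U. Pt U t (fs n) x \<le> Pt U t (fs (Suc n)) x" for n
    by (rule Pt_mono[OF U t fs fs]) (simp add: fs_def)
  have "AE x in RM U. ennreal (Pt U t (fs n) x) \<le> ennreal (Pt U t (fs (Suc n)) x)" for n
    using inc[of n] by eventually_elim (rule ennreal_leI)
  then have "(\<integral>\<^sup>+x. (SUP n. ennreal (Pt U t (fs n) x)) \<partial>RM U) = (SUP n. \<integral>\<^sup>+x. ennreal (Pt U t (fs n) x) \<partial>RM U)"
    by (intro nn_integral_monotone_convergence_SUP_AE[of "\<lambda>n x. ennreal (Pt U t (fs n) x)"]) auto
  also have "\<dots> \<le> ennreal (\<integral>x. p x \<partial>RM U)" by (intro SUP_least le)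
  finally have "(\<integral>\<^sup>+x. (SUP n. ennreal (Pt U t (fs n) x)) \<partial>RM U) \<noteq> \<infinity>"
    by (auto simp: top_unique)
  then have fin: "AE x in RM U. (SUP n. ennreal (Pt U t (fs n) x)) \<noteq> \<infinity>"
    by (intro nn_integral_noteq_infinite) auto
  define u where "u x = enn2real (SUP n. ennreal (Pt U t (fs n) x))" for x
  have um: "u \<in> borel_measurable (RM U)" unfolding u_def by measurable
  have "AE x in RM U. \<forall>n. 0 \<le> Pt U t (fs n) x \<and> Pt U t (fs n) x \<le> Pt U t (fs (Suc n)) x"
    unfolding AE_all_countable using P0 inc by (intro allI AE_conjI)
  then have lim: "AE x in RM U. (\<lambda>n. Pt U t (fs n) x) \<longlonglongrightarrow> u x" using fin
  proof eventually_elim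
    case (elim x)
    let ?s = "SUP n. ennreal (Pt U t (fs n) x)"
    have "(\<lambda>n. ennreal (Pt U t (fs n) x)) \<longlonglongrightarrow> ?s"
      using elim(1) by (intro LIMSEQ_SUP) (auto simp: incseq_Suc_iff intro: ennreal_leI)
    moreover have "?s = ennreal (u x)" using elim(2)
      by (simp only: u_def ennreal_enn2real less_top infinity_ennreal_def)
    ultimately have "(\<lambda>n. ennreal (Pt U t (fs n) x)) \<longlonglongrightarrow> ennreal (u x)" by (simp only:)
    then show ?case
      by (rule tendsto_ennrealD) (use elim(1) in \<open>auto simp: u_def\<close>)
  qed
  have "heat_limit U t p u fs"
    unfolding heat_limit_def
  proof (intro conjI allI um fs lim)
    show "AE x in RM U. (\<forall>n. 0 \<le> fs n x) \<and> incseq (\<lambda>n. fs n x) \<and> (\<lambda>n. fs n x) \<longlonglongrightarrow> p x"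
      using p0
    proof eventually_elim
      case (elim x)
      obtain N :: nat where N: "p x \<le> real N" using real_arch_simple[of "p x"] ..
      have "\<forall>\<^sub>F n in sequentially. p x = fs n x"
        using eventually_ge_at_top[of N]
      proof eventually_elim
        case (elim n)
        have "p x \<le> real n" using N elim by (meson of_nat_mono order_trans)
        then show ?case by (simp add: fs_def)
      qed
      then have "(\<lambda>n. fs n x) \<longlonglongrightarrow> p x" by (rule Lim_transform_eventually[OF tendsto_const])
      then show ?case using elim by (auto simp: fs_def incseq_Suc_iff)
    qed
  qed
  then show ?thesis by (rule heat_limit_some) (rule that)
qed

text \<open>The negative part of \<open>w\<close> is only integrable, so it cannot be treated by
  linearity in \<open>L2\<close>. For \<open>0 <= f <= C - w\<close> the function
  \<open>h = f + w^+\<close> is at most \<open>C + w^-\<close>. Its part up to \<open>C\<close> is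
  mapped below \<open>C\<close>, and its excess over \<open>C\<close> is square integrable and at
  most \<open>w^-\<close>.\<close>

lemma smed_of_heat:
  assumes fin: "finite_measure (RM U)" and w: "integrable (RM U) w" and lam: "0 \<le> lam" and M: "0 \<le> C" "AE x in RM U. w x \<le> C"
    and heat: "\<And>t. 0 < t \<Longrightarrow> AE x in RM U. w x \<le> exp (- t * lam) * heat (R U) t w x"
  shows "smed U lam (\<lambda>x. C - w x)"
  unfolding smed_def
proof (intro allI ballI impI)
  fix t :: real and f assume t: "0 < t" and f: "f \<in> L2 (RM U)" and f0: "AE x in RM U. 0 \<le> f x"
    and fle: "AE x in RM U. f x \<le> C - w x"
  interpret finite_measure "RM U" by fact
  define wp wm where "wp = (\<lambda>x. max (w x) 0)" and "wm = (\<lambda>x. max (- w x) 0)"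
  have wp: "wp \<in> L2 (RM U)"
    by (rule L2_bounded[of _ C]) (use w M in \<open>auto simp: wp_def elim!: eventually_mono\<close>)
  have "integrable (RM U) wm" unfolding wm_def using w by auto
  then obtain fs where H: "heat_limit U t wm (hn U t wm) fs"
    by (rule heat_limit_exists[OF fin t]) (auto simp: wm_def)
  define h a b where "h = f + wp" and "a = (\<lambda>x. min (h x) C)" and "b = (\<lambda>x. max (h x - C) 0)"
  have h: "h \<in> L2 (RM U)" unfolding h_def by (rule L2.S_add[OF f wp])
  have h0: "AE x in RM U. 0 \<le> h x" using f0 by eventually_elim (simp add: h_def wp_def)
  have a: "a \<in> L2 (RM U)" using h0 h M(1)
    by (intro L2_dominated[OF _ h]) (auto simp: a_def elim!: eventually_mono)
  have b: "b \<in> L2 (RM U)" using h0 h M(1)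
    by (intro L2_dominated[OF _ h]) (auto simp: b_def elim!: eventually_mono)
  have "h = a + b" by (auto simp: a_def b_def fun_eq_iff)
  then have "AE x in RM U. Pt U t h x = Pt U t a x + Pt U t b x" using Pt_add[OF U _ a b] t by simp
  moreover have "AE x in RM U. Pt U t h x = Pt U t f x + Pt U t wp x"
    using Pt_add[OF U _ f wp] t by (simp add: h_def)
  moreover have "AE x in RM U. Pt U t a x \<le> C"
    by (rule Pt_max[OF U t a M(1)]) (simp add: a_def)
  moreover have "AE x in RM U. b x \<le> wm x" using fle
    by eventually_elim (auto simp: b_def h_def wm_def wp_def)
  then have "AE x in RM U. Pt U t b x \<le> hn U t wm x"
    by (intro heat_limit_ge[OF t H b]) (auto simp: b_def)
  moreover have "AE x in RM U. hn U t wp x = Pt U t wp x"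
    by (rule hn_L2[OF t wp]) (simp add: wp_def)
  ultimately show "AE x in RM U. exp (- lam * t) * Pt U t f x \<le> C - w x" using heat[OF t]
  proof eventually_elim
    case (elim x)
    have "heat (R U) t w x = hn U t wp x - hn U t wm x" by (simp add: heat_def wp_def wm_def)
    then have "Pt U t f x \<le> C - heat (R U) t w x" using elim by linarith
    then have "exp (- lam * t) * Pt U t f x \<le> exp (- lam * t) * (C - heat (R U) t w x)"
      by (intro mult_left_mono) auto
    moreover have "exp (- lam * t) * C \<le> C" using M(1) lam t by (intro mult_left_le_one_le) auto
    ultimately show ?case using elim(6) by (simp add: right_diff_distrib mult.commute)
  qed
qed

text \<open>Riesz decomposition: \<open>f <= p1 + p2\<close> splits into \<open>min f p1\<close> and
  the excess \<open>(f - p1)^+ <= p2\<close>. Both are square integrable even if \<open>p1\<close>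
  and \<open>p2\<close> are not.\<close>

lemma smed_add:
  assumes p1: "p1 \<in> borel_measurable (RM U)" "AE x in RM U. 0 \<le> p1 x" and "AE x in RM U. 0 \<le> p2 x"
    and s: "smed U lam p1" "smed U lam p2"
  shows "smed U lam (\<lambda>x. p1 x + p2 x)"
  unfolding smed_def
proof (intro allI ballI impI)
  fix t :: real and f assume t: "0 < t" and f: "f \<in> L2 (RM U)" and f0: "AE x in RM U. 0 \<le> f x"
    and fle: "AE x in RM U. f x \<le> p1 x + p2 x"
  define a b where "a = (\<lambda>x. min (f x) (p1 x))" and "b = (\<lambda>x. max (f x - p1 x) 0)"
  have am: "a \<in> borel_measurable (RM U)" "b \<in> borel_measurable (RM U)"
    unfolding a_def b_def using f p1(1) by auto
  have a: "a \<in> L2 (RM U)" by (rule L2_dominated[OF am(1) f])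
    (use f0 p1(2) in \<open>auto simp: a_def elim!: eventually_elim2\<close>)
  have b: "b \<in> L2 (RM U)" by (rule L2_dominated[OF am(2) f])
    (use f0 p1(2) in \<open>auto simp: b_def elim!: eventually_elim2\<close>)
  have "AE x in RM U. 0 \<le> a x" using f0 p1(2) by eventually_elim (simp add: a_def)
  then have "AE x in RM U. exp (- lam * t) * Pt U t a x \<le> p1 x"
    using s(1) t a unfolding smed_def by (auto simp: a_def)
  moreover have "AE x in RM U. b x \<le> p2 x" using fle assms(3) by eventually_elim (simp add: b_def)
  then have "AE x in RM U. exp (- lam * t) * Pt U t b x \<le> p2 x"
    using s(2) t b unfolding smed_def by (auto simp: b_def)
  moreover have "f = a + b" by (auto simp: a_def b_def fun_eq_iff)
  then have "AE x in RM U. Pt U t f x = Pt U t a x + Pt U t b x" using Pt_add[OF U _ a b] t by simp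
  ultimately show "AE x in RM U. exp (- lam * t) * Pt U t f x \<le> p1 x + p2 x"
    by eventually_elim (simp add: distrib_left)
qed

lemma smed_min:
  assumes s: "smed U lam p1" "smed U lam p2" shows "smed U lam (\<lambda>x. min (p1 x) (p2 x))"
  unfolding smed_def
proof (intro allI ballI impI)
  fix t :: real and f assume t: "0 < t" and f: "f \<in> L2 (RM U)" and f0: "AE x in RM U. 0 \<le> f x"
    and fle: "AE x in RM U. f x \<le> min (p1 x) (p2 x)"
  have le: "AE x in RM U. f x \<le> p1 x" "AE x in RM U. f x \<le> p2 x" using fle by auto
  have "AE x in RM U. exp (- lam * t) * Pt U t f x \<le> p1 x"
    "AE x in RM U. exp (- lam * t) * Pt U t f x \<le> p2 x"
    using s t f f0 le unfolding smed_def by blast+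
  then show "AE x in RM U. exp (- lam * t) * Pt U t f x \<le> min (p1 x) (p2 x)"
    by eventually_elim simp
qed

lemma smed_L2:
  assumes q: "q \<in> L2 (RM U)" and s: "\<And>t. 0 < t \<Longrightarrow> AE x in RM U. exp (- lam * t) * Pt U t q x \<le> q x"
  shows "smed U lam q"
  unfolding smed_def
proof (intro allI ballI impI)
  fix t :: real and f assume t: "0 < t" and f: "f \<in> L2 (RM U)" and fle: "AE x in RM U. f x \<le> q x"
  from Pt_mono[OF U t f q fle] s[OF t] show "AE x in RM U. exp (- lam * t) * Pt U t f x \<le> q x"
    by eventually_elim (meson mult_left_mono exp_ge_zero order_trans)
qed

text \<open>The way back from supermedian functions to the inequality in the definition of
  defectiveness. \<open>m\<close> and \<open>q\<close> are the two parts into which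
  \<open>heat\<close> splits \<open>- p\<close>; they agree with 0 and \<open>p\<close> only
  a.e.\<close>

lemma smed_heat:
  assumes fin: "finite_measure (RM U)" and p: "integrable (RM U) p" and p0: "AE x in RM U. 0 \<le> p x"
    and s: "smed U lam p" and t: "0 < t"
  shows "AE x in RM U. - p x \<le> exp (- t * lam) * heat (R U) t (\<lambda>x. - p x) x"
proof -
  define m q where "m = (\<lambda>x. max (- p x) 0)" and "q = (\<lambda>x. max (- (- p x)) 0)"
  have m0: "AE x in RM U. m x = 0" using p0 by eventually_elim (simp add: m_def)
  have m: "m \<in> L2 (RM U)" by (rule L2_cong_AE[OF L2.S_0]) (use m0 p in \<open>auto simp: m_def zero_fun_def\<close>)
  have "AE x in RM U. 0 \<le> Pt U t m x"
    by (rule Pt_pos[OF U t m]) (simp add: m_def)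
  moreover have "AE x in RM U. hn U t m x = Pt U t m x"
    by (rule hn_L2[OF t m]) (simp add: m_def)
  moreover have qp: "AE x in RM U. q x = p x" using p0 by eventually_elim (simp add: q_def)
  have qi: "integrable (RM U) q" unfolding q_def using p by auto
  obtain fs where H: "heat_limit U t q (hn U t q) fs"
    by (rule heat_limit_exists[OF fin t qi]) (auto simp: q_def)
  have "AE x in RM U. hn U t q x \<le> exp (lam * t) * p x"
  proof (rule heat_limit_le[OF t H])
    fix g assume g: "g \<in> L2 (RM U)" "AE x in RM U. 0 \<le> g x" "AE x in RM U. g x \<le> q x"
    have "AE x in RM U. g x \<le> p x" using g(3) qp by eventually_elim simp
    with s t g have "AE x in RM U. exp (- lam * t) * Pt U t g x \<le> p x" unfolding smed_def by blast
    then show "AE x in RM U. Pt U t g x \<le> exp (lam * t) * p x"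
    proof eventually_elim
      case (elim x)
      from mult_left_mono[OF this, of "exp (lam * t)"] show ?case
        by (simp add: mult.assoc[symmetric] exp_add[symmetric])
    qed
  qed
  ultimately show ?thesis
  proof eventually_elim
    case (elim x)
    have "heat (R U) t (\<lambda>x. - p x) x = hn U t m x - hn U t q x" by (simp add: heat_def m_def q_def)
    then have "- (exp (lam * t) * p x) \<le> heat (R U) t (\<lambda>x. - p x) x" using elim by linarith
    then have "exp (- t * lam) * - (exp (lam * t) * p x) \<le> exp (- t * lam) * heat (R U) t (\<lambda>x. - p x) x"
      by (intro mult_left_mono) auto
    moreover have "exp (- t * lam) * exp (lam * t) = 1" unfolding exp_add[symmetric] by simp
    then have "exp (- t * lam) * (exp (lam * t) * p x) = p x" unfolding mult.assoc[symmetric] by simp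
    ultimately show ?case unfolding mult_minus_right by linarith
  qed
qed

end

text \<open>The extension of \<open>f\<close> by 0 stays below \<open>p\<close> on \<open>V\<close>
  because \<open>p\<close> is nonnegative there, and the semigroup of \<open>U\<close> is dominated
  by that of \<open>V\<close>.\<close>

lemma smed_domain:
  assumes U: "openin X U" and V: "openin X V" and UV: "U \<subseteq> V" and p0: "AE x in RM V. 0 \<le> p x"
    and s: "smed V lam p"
  shows "smed U lam p"
  unfolding smed_def
proof (intro allI ballI impI)
  fix t :: real and f assume t: "0 < t" and f: "f \<in> L2 (RM U)" and f0: "AE x in RM U. 0 \<le> f x"
    and fle: "AE x in RM U. f x \<le> p x"
  let ?f = "zero_ext U f"
  have fM: "?f \<in> L2 M" using f L2R[OF U] by simp
  have fV: "?f \<in> L2 (RM V)" by (rule L2R_of_L2[OF V fM])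
  have fU: "?f \<in> L2 (RM U)" by (rule L2R_of_L2[OF U fM])
  have pos: "AE x in RM V. 0 \<le> ?f x"
    using f0 unfolding AE_restrict_iff[OF Um[OF U]] AE_restrict_iff[OF Um[OF V]]
    by eventually_elim (auto simp: zero_ext_def)
  have "AE x in RM V. ?f x \<le> p x"
    using fle p0 unfolding AE_restrict_iff[OF Um[OF U]] AE_restrict_iff[OF Um[OF V]]
    by eventually_elim (auto simp: zero_ext_def)
  with s t fV pos have "AE x in RM V. exp (- lam * t) * Pt V t ?f x \<le> p x"
    unfolding smed_def by blast
  from AE_RM_mono[OF U V UV this]
  have "AE x in RM U. exp (- lam * t) * Pt V t ?f x \<le> p x" .
  moreover have "AE x in RM U. Pt U t ?f x \<le> Pt V t ?f x" by (rule Pt_domain[OF U V UV t fV pos])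
  moreover have "AE x in RM U. f x = ?f x"
    unfolding AE_restrict_iff[OF Um[OF U]] by (simp add: zero_ext_def)
  then have "AE x in RM U. Pt U t f x = Pt U t ?f x" using Pt_cong[OF U _ f fU] t by simp
  ultimately show "AE x in RM U. exp (- lam * t) * Pt U t f x \<le> p x"
  proof eventually_elim
    case (elim x)
    then have "exp (- lam * t) * Pt U t f x \<le> exp (- lam * t) * Pt V t ?f x"
      by (intro mult_left_mono) auto
    then show ?case using elim(1) by linarith
  qed
qed

section \<open>Weakly harmonic functions\<close>

abbreviation rc :: "'a set \<Rightarrow> bool" where "rc U \<equiv> compactly_inside X U (topspace X)"

lemma rc_open: "rc U \<Longrightarrow> openin X U" and rc_compact: "rc U \<Longrightarrow> compactin X (X closure_of U)"
  by (auto simp: compactly_inside_def)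

lemma rc_finite: assumes "rc U" shows "emeasure M U < \<infinity>"
proof -
  have "U \<subseteq> X closure_of U" using rc_open[OF assms] by (simp add: closure_of_subset openin_subset)
  then have "emeasure M U \<le> emeasure M (X closure_of U)"
    by (rule emeasure_mono) (rule compact_sets[OF rc_compact[OF assms]])
  then show ?thesis using compact_finite[OF rc_compact[OF assms]] by (rule le_less_trans)
qed

lemma rc_finite_measure: "rc U \<Longrightarrow> finite_measure (RM U)"
  by (rule finite_measureI)
    (use rc_finite[of U] rc_open[of U] in \<open>auto simp: emeasure_restrict_space space_restrict_space
      Int_absorb2 openin_subset\<close>)

lemma rc_nbhd: assumes "rc U" obtains V where "rc V" "X closure_of U \<subseteq> V" "U \<subseteq> V"
proof -
  obtain V where V: "openin X V" "X closure_of U \<subseteq> V" "compactin X (X closure_of V)"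
    by (rule compact_nbhd[OF rc_compact[OF assms] openin_topspace closure_of_subset_topspace]) blast
  have "U \<subseteq> X closure_of U" using rc_open[OF assms] by (simp add: closure_of_subset openin_subset)
  with V show ?thesis by (intro that[of V]) (auto simp: compactly_inside_def closure_of_subset_topspace)
qed

lemma one_L2: assumes "rc U" shows "zero_ext U (\<lambda>_. c) \<in> L2 M" "(\<lambda>_. c) \<in> L2 (RM U)"
proof -
  interpret finite_measure "RM U" by (rule rc_finite_measure[OF assms])
  show "(\<lambda>_. c) \<in> L2 (RM U)" by (rule L2_bounded[of _ "\<bar>c\<bar>"]) auto
  then show "zero_ext U (\<lambda>_. c) \<in> L2 M" using L2R[OF rc_open[OF assms]] by simp
qed

lemma FU_AE_mult:
  assumes U: "openin X U" and p: "p \<in> FU U" and ab: "AE x in M. x \<in> U \<longrightarrow> a x = b x"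
  shows "AE x in M. a x * p x = b x * p x"
  using FU_zero[OF Um[OF U] p] ab by eventually_elim auto

lemma ip2_FU_cong:
  assumes U: "openin X U" and p: "p \<in> FU U" and L: "a \<in> L2 M" "b \<in> L2 M"
    and ab: "AE x in M. x \<in> U \<longrightarrow> a x = b x"
  shows "ip2 M a p = ip2 M b p"
  unfolding ip2_def
  by (rule integral_cong_AE[OF _ _ FU_AE_mult[OF U p ab]])
    (use L F_L2[OF FU_F[OF p]] in \<open>auto intro!: borel_measurable_times\<close>)

lemma ip2_FU_mono:
  assumes U: "openin X U" and p: "p \<in> FU U" "AE x in M. 0 \<le> p x" and L: "a \<in> L2 M" "b \<in> L2 M"
    and ab: "AE x in M. x \<in> U \<longrightarrow> a x \<le> b x"
  shows "ip2 M a p \<le> ip2 M b p"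
  unfolding ip2_def
proof (rule integral_mono_AE)
  have pL: "p \<in> L2 M" by (rule F_L2[OF FU_F[OF p(1)]])
  show "integrable M (\<lambda>x. a x * p x)" "integrable M (\<lambda>x. b x * p x)" using L2_mult L pL by blast+
  show "AE x in M. a x * p x \<le> b x * p x"
    using FU_zero[OF Um[OF U] p(1)] p(2) ab by eventually_elim (auto intro: mult_right_mono)
qed

text \<open>Probabilistically, v is the expectation of \<open>1 - e\<^sup>-\<^sup>l\<^sup>a\<^sup>m\<^sup>\<tau>\<close>, where \<open>\<tau>\<close> is the exit time from U;
  equivalently \<open>v = lam (H + lam)\<^sup>-\<^sup>1 1\<close> on U. For \<open>lam = 0\<close>, \<open>v = 0\<close> is used.\<close>

definition defect :: "'a set \<Rightarrow> real \<Rightarrow> ('a \<Rightarrow> real) \<Rightarrow> bool" where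
  "defect U lam v \<longleftrightarrow> v \<in> FU U \<and> (AE x in M. 0 \<le> v x) \<and> (AE x in M. v x \<le> 1) \<and>
     (\<forall>p\<in>FU U. E v p + lam * ip2 M v p = lam * ip2 M (zero_ext U (\<lambda>_. 1)) p)"

lemma defect_0: "defect U 0 (\<lambda>_. 0)"
proof -
  have "0 \<in> FU U" by (rule subspace_0[OF FU_subspace])
  then show ?thesis unfolding defect_def using E.ip_0_left FU_F[of _ U] by (auto simp: zero_fun_def)
qed

lemma defect_rs:
  assumes U: "rc U" and lam: "0 < lam"
  shows "defect U lam (zero_ext U (rs U lam (\<lambda>_. 1)))"
proof -
  note oU = rc_open[OF U]
  have one: "(\<lambda>_. 1) \<in> L2 (RM U)" by (rule one_L2(2)[OF U])
  have "AE x in RM U. rs U lam (\<lambda>_. 1) x \<le> 1" by (rule rs_max[OF oU lam one]) auto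
  then have "AE x in M. zero_ext U (rs U lam (\<lambda>_. 1)) x \<le> 1"
    unfolding AE_restrict_iff[OF Um[OF oU]] by eventually_elim (auto simp: zero_ext_def)
  moreover have "AE x in RM U. 0 \<le> rs U lam (\<lambda>_. 1) x" by (rule rs_pos[OF oU lam one]) auto
  then have "AE x in M. 0 \<le> zero_ext U (rs U lam (\<lambda>_. 1)) x"
    unfolding AE_restrict_iff[OF Um[OF oU]] by eventually_elim (auto simp: zero_ext_def)
  ultimately show ?thesis
    unfolding defect_def using rs_FU[OF oU lam one] rs_eq[OF oU lam one] by blast
qed

text \<open>By inner regularity it suffices that the compact subsets of the exceptional set are
  null, and each of these is covered by finitely many of the neighbourhoods.\<close>

lemma AE_local:
  assumes U: "openin X U" and Q: "{x \<in> U. \<not> Q x} \<in> sets M"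
    and loc: "\<And>x. x \<in> U \<Longrightarrow> \<exists>W. openin X W \<and> x \<in> W \<and> (AE y in M. y \<in> W \<longrightarrow> y \<in> U \<longrightarrow> Q y)"
  shows "AE x in M. x \<in> U \<longrightarrow> Q x"
proof -
  define N where "N = {x \<in> U. \<not> Q x}"
  have Nm: "N \<in> sets M" unfolding N_def by (rule Q)
  define \<W> where "\<W> = {W. openin X W \<and> (AE y in M. y \<in> W \<longrightarrow> y \<in> U \<longrightarrow> Q y)}"
  have "emeasure M K = 0" if K: "compactin X K" "K \<subseteq> N" for K
  proof -
    have "K \<subseteq> \<Union>\<W>" using loc K(2) by (fastforce simp: N_def \<W>_def)
    with compactinD[OF K(1), of \<W>] obtain \<F> where \<F>: "finite \<F>" "\<F> \<subseteq> \<W>" "K \<subseteq> \<Union>\<F>"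
      by (auto simp: \<W>_def)
    have "AE x in M. \<forall>W\<in>\<F>. x \<in> W \<longrightarrow> x \<in> U \<longrightarrow> Q x"
      by (rule AE_finite_allI[OF \<F>(1)]) (use \<F>(2) in \<open>auto simp: \<W>_def\<close>)
    then have "AE x in M. x \<notin> K"
      by eventually_elim (use \<F>(3) K(2) in \<open>auto simp: N_def\<close>)
    then show ?thesis using AE_iff_measurable[OF compact_sets[OF K(1)], of "\<lambda>x. x \<notin> K"]
      compactin_subset_topspace[OF K(1)] by auto
  qed
  then have "emeasure M N = 0"
    using radon Nm unfolding radon_measure_def by (auto intro!: SUP_eq_const)
  then have "AE x in M. x \<notin> N" using Nm by (intro AE_not_in) (simp add: null_sets_def)
  then show ?thesis by eventually_elim (simp add: N_def)
qed

text \<open>The complement of the support is a union of possibly uncountably many open sets on which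
  \<open>p\<close> vanishes a.e.; \<open>AE_local\<close> shows that \<open>p\<close> vanishes a.e.
  on the union.\<close>

lemma AE_meas_support_R:
  assumes U: "openin X U" and p: "zero_ext U p \<in> borel_measurable M"
  shows "AE x in M. x \<in> U - meas_support (R U) p \<longrightarrow> p x = 0"
proof -
  define Z where "Z = \<Union>{W. openin (subtopology X U) W \<and> (AE x in RM U. x \<in> W \<longrightarrow> p x = 0)}"
  have S: "meas_support (R U) p = U - Z"
    unfolding Z_def meas_support_def R_simps using openin_subset[OF U] by (simp add: Int_absorb1)
  have "openin (subtopology X U) Z" unfolding Z_def by (rule openin_Union) simp
  then have Z: "openin X Z" "Z \<subseteq> U" using U by (auto simp: openin_open_subtopology)
  have "AE x in M. x \<in> Z \<longrightarrow> p x = 0"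
  proof (rule AE_local[OF Z(1)])
    have "{x \<in> space M. zero_ext U p x \<noteq> 0} \<in> sets M" using p by measurable
    from sets.Int[OF this open_sets[OF Z(1)]]
    show "{x \<in> Z. p x \<noteq> 0} \<in> sets M"
      by (rule back_subst[of "\<lambda>A. A \<in> sets M"]) (use Z openin_subset[OF Z(1)] in \<open>auto simp: zero_ext_def\<close>)
    fix x assume "x \<in> Z"
    then obtain W where "openin (subtopology X U) W" "AE x in RM U. x \<in> W \<longrightarrow> p x = 0" "x \<in> W"
      unfolding Z_def by blast
    then show "\<exists>W. openin X W \<and> x \<in> W \<and> (AE y in M. y \<in> W \<longrightarrow> y \<in> Z \<longrightarrow> p y = 0)"
      using U unfolding AE_restrict_iff[OF Um[OF U]]
      by (intro exI[of _ W]) (auto simp: openin_open_subtopology elim!: eventually_mono)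
  qed
  then show ?thesis by eventually_elim (simp add: S)
qed

lemma meas_support_R_zero_ext:
  assumes U: "openin X U" and p: "zero_ext U p \<in> borel_measurable M"
    and c: "compactin (subtopology X U) (meas_support (R U) p)"
  shows "meas_support D (zero_ext U p) \<subseteq> meas_support (R U) p"
proof -
  let ?S = "meas_support (R U) p"
  have "closedin X ?S" using c by (intro compact_closed) (simp add: compactin_subtopology)
  then have o: "openin X (topspace X - ?S)" by blast
  have "AE x in M. x \<in> topspace X - ?S \<longrightarrow> zero_ext U p x = 0"
    using AE_meas_support_R[OF U p] by eventually_elim (auto simp: zero_ext_def)
  then show ?thesis using o unfolding meas_support_def[of D] by blast
qed

lemma FU_zero_ext_FU: assumes U: "openin X U" and h: "h \<in> FU U" shows "zero_ext U h \<in> FU U"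
  by (rule FU_cong[OF h zero_ext_measurable[OF Um[OF U]]])
    (use F_L2[OF FU_F[OF h]] FU_zero_ext[OF Um[OF U] h] in \<open>auto elim: eventually_mono\<close>)

text \<open>The function chosen by \<open>form_loc\<close> and the given \<open>h\<close> agree a.e.
  near the support of \<open>p\<close>, so strong locality gives them the same value. The form can
  thus be computed with any explicit candidate.\<close>

lemma form_loc_eq:
  assumes U: "openin X U" and p: "p \<in> dom_c (R U)" and hU: "h \<in> FU U"
    and V: "openin X V" "V \<subseteq> U" "meas_support (R U) p \<subseteq> V" and hg: "AE x in M. x \<in> V \<longrightarrow> h x = g x"
  shows "form_loc (R U) g p = E h (zero_ext U p)"
proof -
  let ?S = "meas_support (R U) p" and ?p = "zero_ext U p"
  have pU: "?p \<in> FU U" and S: "compactin X ?S" "?S \<subseteq> U" and Sc: "compactin (subtopology X U) ?S"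
    using p unfolding dom_c_def by (auto simp: compactin_subtopology)
  have pF: "?p \<in> F" by (rule FU_F[OF pU])
  have pm: "?p \<in> borel_measurable M" using F_L2[OF pF] by simp
  note supp = meas_support_R_zero_ext[OF U pm Sc]
  have hF: "h \<in> F" by (rule FU_F[OF hU])
  let ?Q = "\<lambda>h. h \<in> fs_dom (R U) \<and> (\<exists>V. openin (fs_top (R U)) V \<and> ?S \<subseteq> V \<and>
        (AE x in fs_meas (R U). x \<in> V \<longrightarrow> h x = g x))"
  have "?Q h"
  proof (intro conjI exI[of _ V] V)
    show "h \<in> fs_dom (R U)" using FU_zero_ext_FU[OF U hU] by simp
    show "openin (fs_top (R U)) V" using V U by (auto simp: openin_open_subtopology)
    show "AE x in fs_meas (R U). x \<in> V \<longrightarrow> h x = g x"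
      unfolding R_simps AE_restrict_iff[OF Um[OF U]] using hg by eventually_elim simp
  qed
  then have "?Q (Eps ?Q)" by (rule someI[of ?Q])
  moreover define k where "k = Eps ?Q"
  ultimately have "?Q k" by (simp only:)
  then obtain W where k: "zero_ext U k \<in> FU U" and W: "openin (subtopology X U) W" "?S \<subseteq> W"
    and AEk: "AE x in M. x \<in> U \<longrightarrow> x \<in> W \<longrightarrow> k x = g x"
    unfolding R_simps AE_restrict_iff[OF Um[OF U]] by (elim conjE exE) (rule that)
  have kF: "zero_ext U k \<in> F" by (rule FU_F[OF k])
  have "AE x in M. x \<in> meas_support D ?p \<longrightarrow> (zero_ext U k - h) x = 0"
    using AEk hg by eventually_elim (use supp S(2) W(2) V in \<open>auto simp: zero_ext_def subset_iff\<close>)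
  then have "E (zero_ext U k - h) ?p = 0"
    using local E.S_diff[OF kF hF] pF unfolding strongly_local_form_def by blast
  then have "E (zero_ext U k) ?p = E h ?p" using kF hF pF by (simp add: E.ip_diff_left)
  then show ?thesis unfolding form_loc_def R_simps(3) k_def .
qed

text \<open>In general \<open>1 - v\<close> is not in \<open>FU U\<close>, as it does not vanish at
  the boundary. Near the support of \<open>p\<close> it equals \<open>\<psi> - v\<close> with a
  cutoff \<open>\<psi>\<close> that is 1 there and contributes nothing by strong locality.\<close>

lemma form_loc_defect:
  assumes U: "rc U" and v: "defect U lam v" and p: "p \<in> dom_c (R U)"
  shows "form_loc_shift (R U) lam (\<lambda>x. K * (1 - v x)) p = 0"
proof -
  note oU = rc_open[OF U]
  let ?S = "meas_support (R U) p" and ?g = "\<lambda>x. K * (1 - v x)" and ?p = "zero_ext U p"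
  have pU: "?p \<in> FU U" and S: "compactin X ?S" "?S \<subseteq> U" and Sc: "compactin (subtopology X U) ?S"
    using p unfolding dom_c_def by (auto simp: compactin_subtopology)
  have pF: "?p \<in> F" by (rule FU_F[OF pU])
  have pm: "?p \<in> borel_measurable M" using F_L2[OF pF] by simp
  have vU: "v \<in> FU U" and veq: "E v ?p + lam * ip2 M v ?p = lam * ip2 M (zero_ext U (\<lambda>_. 1)) ?p"
    using v pU unfolding defect_def by auto
  have vF: "v \<in> F" by (rule FU_F[OF vU])
  obtain V where V: "openin X V" "?S \<subseteq> V" "X closure_of V \<subseteq> U" "compactin X (X closure_of V)"
    by (rule compact_nbhd[OF S(1) oU S(2)])
  obtain \<psi> where \<psi>: "\<psi> \<in> core U" "\<forall>x\<in>X closure_of V. \<psi> x = 1"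
    by (rule cutoff[OF V(4) oU V(3)]) blast
  have VU: "V \<subseteq> X closure_of V" using V(1) by (simp add: closure_of_subset openin_subset)
  have \<psi>U: "\<psi> \<in> FU U" by (rule core_FU[OF \<psi>(1)])
  have \<psi>F: "\<psi> \<in> F" by (rule FU_F[OF \<psi>U])
  have "form_loc (R U) ?g p = E (K *\<^sub>R (\<psi> - v)) ?p"
  proof (rule form_loc_eq[OF oU p _ V(1) _ V(2)])
    show "K *\<^sub>R (\<psi> - v) \<in> FU U"
      by (intro subspace_scale[OF FU_subspace] subspace_diff[OF FU_subspace] \<psi>U vU)
    show "V \<subseteq> U" using VU V(3) by blast
    show "AE x in M. x \<in> V \<longrightarrow> (K *\<^sub>R (\<psi> - v)) x = ?g x"
      by (rule AE_I2) (use \<psi>(2) VU in auto)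
  qed
  moreover have "AE x in M. x \<in> meas_support D ?p \<longrightarrow> \<psi> x = 1"
    by (rule AE_I2) (use meas_support_R_zero_ext[OF oU pm Sc] V(2) VU \<psi>(2) in blast)
  then have "E \<psi> ?p = 0" using local \<psi>F pF unfolding strongly_local_form_def by blast
  ultimately have "form_loc (R U) ?g p = - K * E v ?p"
    using pF vF \<psi>F by (simp add: E.ip_diff_left E.ip_scale_left E.S_diff)
  moreover have "(\<integral>x. ?g x * p x \<partial>RM U) = K * ip2 M (zero_ext U (\<lambda>_. 1)) ?p - K * ip2 M v ?p"
  proof -
    have "(\<integral>x. ?g x * p x \<partial>RM U) = (\<integral>x. zero_ext U (\<lambda>x. ?g x * p x) x \<partial>M)"
      by (rule integral_restrict[OF Um[OF oU]])
    also have "\<dots> = (\<integral>x. K * (zero_ext U (\<lambda>_. 1) x * ?p x) - K * (v x * ?p x) \<partial>M)"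
      by (intro Bochner_Integration.integral_cong) (auto simp: zero_ext_def algebra_simps)
    also have "\<dots> = K * ip2 M (zero_ext U (\<lambda>_. 1)) ?p - K * ip2 M v ?p"
      using L2_mult[OF one_L2(1)[OF U] F_L2[OF pF]] L2_mult[OF F_L2[OF vF] F_L2[OF pF]]
      unfolding ip2_def by (simp add: Bochner_Integration.integral_diff)
    finally show ?thesis .
  qed
  ultimately have "form_loc_shift (R U) lam ?g p
      = - K * (E v ?p + lam * ip2 M v ?p - lam * ip2 M (zero_ext U (\<lambda>_. 1)) ?p)"
    unfolding form_loc_shift_def R_simps(2) by (simp only:) (simp add: algebra_simps)
  then show ?thesis unfolding veq by simp
qed

lemma weakly_harmonic_defect:
  assumes U: "rc U" and v: "defect U lam v" and b: "\<forall>x\<in>U. \<bar>v x\<bar> \<le> 1"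
  shows "weakly_harmonic (R U) lam (\<lambda>x. K * (1 - v x))"
  unfolding weakly_harmonic_def
proof (intro conjI ballI impI)
  note oU = rc_open[OF U]
  interpret finite_measure "RM U" by (rule rc_finite_measure[OF U])
  let ?g = "\<lambda>x. K * (1 - v x)"
  have vU: "v \<in> FU U" using v unfolding defect_def by simp
  have vL: "v \<in> L2 (RM U)" by (rule L2R_of_L2[OF oU F_L2[OF FU_F[OF vU]]])
  have gm: "?g \<in> borel_measurable (RM U)" using vL by simp
  have g: "?g \<in> L2 (RM U)"
  proof (rule L2_bounded[OF gm AE_I2])
    show "\<bar>?g x\<bar> \<le> \<bar>K\<bar> * 2" if "x \<in> space (RM U)" for x
      using b that unfolding abs_mult by (intro mult_left_mono) (auto simp: space_restrict_space abs_le_iff)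
  qed
  show "?g \<in> dom_loc (R U)"
    unfolding dom_loc_def L2_loc_def R_simps
  proof (intro CollectI conjI allI impI gm)
    fix Q assume Q: "compactin (subtopology X U) Q"
    then have "Q \<in> sets (RM U)" using compact_sets[of Q]
      by (auto simp: compactin_subtopology sets_restrict_space intro!: image_eqI[of _ _ Q])
    then show "set_integrable (RM U) Q (\<lambda>x. (?g x)\<^sup>2)"
      unfolding set_integrable_def by (intro integrable_mult_indicator L2_sq[OF g])
  next
    fix W assume "compactly_inside (subtopology X U) W (topspace (subtopology X U))"
    then have cW: "compactin X (subtopology X U closure_of W)" "subtopology X U closure_of W \<subseteq> U"
      and W: "openin (subtopology X U) W"
      by (auto simp: compactly_inside_def compactin_subtopology)
    have WW: "W \<subseteq> subtopology X U closure_of W" by (rule closure_of_subset[OF openin_subset[OF W]])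
    obtain \<psi> where \<psi>: "\<psi> \<in> core U" "\<forall>x\<in>subtopology X U closure_of W. \<psi> x = 1"
      by (rule cutoff[OF cW(1) oU cW(2)]) blast
    define h where "h = K *\<^sub>R (\<psi> - v)"
    have hU: "h \<in> FU U" unfolding h_def
      by (intro subspace_scale[OF FU_subspace] subspace_diff[OF FU_subspace] core_FU[OF \<psi>(1)] vU)
    have zh: "zero_ext U h \<in> FU U" by (rule FU_zero_ext_FU[OF oU hU])
    show "\<exists>h\<in>fs_dom (R U). AE x in RM U. x \<in> W \<longrightarrow> ?g x = h x"
    proof (intro bexI AE_I2)
      show "x \<in> W \<longrightarrow> ?g x = h x" for x using \<psi>(2) WW by (auto simp: h_def)
      show "h \<in> fs_dom (R U)" using zh by simp
    qed
  qed
  fix p assume p: "p \<in> dom_c (R U)"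
  show "form_loc_shift (R U) lam ?g p \<le> 0" using form_loc_defect[OF U v p] by simp
  have "(\<lambda>x. - (K * (1 - v x))) = (\<lambda>x. (- K) * (1 - v x))" by simp
  then show "form_loc_shift (R U) lam (\<lambda>x. - (K * (1 - v x))) p \<le> 0"
    using form_loc_defect[OF U v p, of "- K"] by simp
qed

lemma Cont_measurable_R:
  assumes U: "openin X U" and f: "f \<in> Cont (subtopology X U)" shows "f \<in> borel_measurable (RM U)"
proof (rule borel_measurableI)
  fix S :: "real set" assume S: "open S"
  define T where "T = {x \<in> topspace (subtopology X U). f x \<in> S}"
  have "openin (subtopology X U) T"
    unfolding T_def by (rule openin_continuous_map_preimage[of _ euclideanreal])
      (use f S in \<open>simp_all add: Cont_def del: topspace_subtopology\<close>)
  then have "T \<in> sets M" using openin_open_subtopology[OF U] by simp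
  moreover have "f -` S \<inter> space (RM U) = U \<inter> T"
    by (auto simp: space_restrict_space T_def)
  ultimately show "f -` S \<inter> space (RM U) \<in> sets (RM U)" by (auto simp: sets_restrict_space)
qed

lemma L1_loc_integrable:
  assumes U: "rc U" and f: "f \<in> L1_loc D" shows "integrable (RM U) f"
proof -
  have "U \<subseteq> X closure_of U" using rc_open[OF U] by (simp add: closure_of_subset openin_subset)
  moreover have "set_integrable M (X closure_of U) f"
    using f rc_compact[OF U] unfolding L1_loc_def by blast
  ultimately have "set_integrable M U f"
    using set_integrable_subset Um[OF rc_open[OF U]] by blast
  then show ?thesis using integrable_restrict_space[of U M f] Um[OF rc_open[OF U]]
    openin_subset[OF rc_open[OF U]] by (simp add: Int_absorb2 set_integrable_def)
qed

lemma Cb_bound: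
  assumes U: "openin X U" and "g \<in> Cb (subtopology X U)"
  obtains B where "0 \<le> B" "\<forall>x\<in>U. \<bar>g x\<bar> \<le> B"
proof -
  have "bounded (g ` U)" using assms openin_subset[OF U] by (simp add: Cb_def Int_absorb1)
  then obtain B where "\<forall>y\<in>g ` U. norm y \<le> B" unfolding bounded_iff by blast
  then have "\<forall>x\<in>U. \<bar>g x\<bar> \<le> \<bar>B\<bar>" by fastforce
  then show ?thesis by (rule that[rotated]) simp
qed

text \<open>As the semigroup preserves positivity, the shift inequality for \<open>w = f - g\<close>
  implies \<open>w <= e^(-lam t) P t w^+\<close>. Ultracontractivity at \<open>t = 1\<close> bounds
  the right-hand side, so \<open>w^+\<close> is bounded although \<open>f\<close> is only
  integrable.\<close>

lemma shift_defective_smed: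
  assumes V: "rc V" and lam: "0 \<le> lam" and f: "locally_shift_defective D lam f"
    and ultra: "ultracontractive (R V)"
  obtains g C B where "g \<in> borel_measurable (RM V)" "weakly_harmonic (R V) lam g" "0 \<le> B" "\<forall>x\<in>V. \<bar>g x\<bar> \<le> B"
    "0 \<le> C" "0 < lam \<longrightarrow> C = 0" "AE x in RM V. f x - g x \<le> C" "smed V lam (\<lambda>x. C - (f x - g x))"
proof -
  note oV = rc_open[OF V]
  interpret finite_measure "RM V" by (rule rc_finite_measure[OF V])
  have fL: "f \<in> L1_loc D" using f by (simp add: locally_shift_defective_def)
  obtain g where g: "g \<in> Cb (subtopology X V)" "weakly_harmonic (R V) lam g"
    and "\<forall>t>0. AE x in RM V. f x - g x \<le> exp (- t * lam) * heat (R V) t (\<lambda>y. f y - g y) x"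
    using f V unfolding locally_shift_defective_def Let_def R_simps by blast
  then have heat: "AE x in RM V. f x - g x \<le> exp (- t * lam) * heat (R V) t (\<lambda>y. f y - g y) x"
    if "0 < t" for t using that by blast
  obtain B where B: "0 \<le> B" "\<forall>x\<in>V. \<bar>g x\<bar> \<le> B" by (rule Cb_bound[OF oV g(1)])
  have gm: "g \<in> borel_measurable (RM V)"
    by (rule Cont_measurable_R[OF oV]) (use g(1) in \<open>simp add: Cb_def\<close>)
  have gi: "integrable (RM V) g"
    by (rule integrable_const_bound[of _ B]) (use B(2) gm in \<open>auto simp: space_restrict_space intro!: AE_I2\<close>)
  define w where "w = (\<lambda>x. f x - g x)"
  have wi: "integrable (RM V) w" unfolding w_def by (intro Bochner_Integration.integrable_diff L1_loc_integrable[OF V fL] gi)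
  have hw: "AE x in RM V. w x \<le> exp (- t * lam) * heat (R V) t w x" if "0 < t" for t
    using heat[OF that] unfolding w_def .
  define wp where "wp = (\<lambda>x. max (w x) 0)"
  have wpi: "integrable (RM V) wp" unfolding wp_def using wi by auto
  obtain c where c: "AE x in RM V. \<bar>heat (R V) 1 wp x\<bar> \<le> c"
    using ultra wpi unfolding ultracontractive_def L1_def Linf_def R_simps by fastforce
  have hn_pos: "AE x in RM V. 0 \<le> hn V t p x" if t: "0 < t" and p: "integrable (RM V) p" "AE x in RM V. 0 \<le> p x" for p t
  proof -
    obtain fs where H: "heat_limit V t p (hn V t p) fs"
      by (rule heat_limit_exists[OF oV finite_measure_axioms t p])
    have "AE x in RM V. Pt V t 0 x \<le> hn V t p x"
      by (rule heat_limit_ge[OF oV t H L2.S_0]) (use p(2) in auto)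
    moreover have "AE x in RM V. 0 \<le> Pt V t 0 x" by (rule Pt_pos[OF oV t L2.S_0]) simp
    ultimately show ?thesis by eventually_elim simp
  qed
  have hw2: "AE x in RM V. w x \<le> exp (- t * lam) * hn V t wp x" if t: "0 < t" for t
  proof -
    have "AE x in RM V. 0 \<le> hn V t (\<lambda>y. max (- w y) 0) x"
      by (rule hn_pos[OF t]) (use wi in auto)
    then show ?thesis using hw[OF t]
    proof eventually_elim
      case (elim x)
      have "heat (R V) t w x \<le> hn V t wp x" using elim(1) by (simp add: heat_def wp_def)
      then have "exp (- t * lam) * heat (R V) t w x \<le> exp (- t * lam) * hn V t wp x"
        by (intro mult_left_mono) auto
      then show ?case using elim(2) by linarith
    qed
  qed
  have c': "AE x in RM V. hn V 1 wp x \<le> c"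
  proof -
    have "(\<lambda>y. max (wp y) 0) = wp" "(\<lambda>y. max (- wp y) 0) = 0" by (auto simp: wp_def fun_eq_iff)
    then have "heat (R V) 1 wp x = hn V 1 wp x - hn V 1 0 x" for x by (simp add: heat_def)
    moreover have "AE x in RM V. hn V 1 0 x = Pt V 1 0 x" by (rule hn_L2[OF oV _ L2.S_0]) auto
    moreover have "AE x in RM V. Pt V 1 0 x \<le> 0" by (rule Pt_max[OF oV _ L2.S_0]) auto
    ultimately show ?thesis using c by (auto elim: eventually_elim2)
  qed
  have wp0: "AE x in RM V. 0 \<le> wp x" by (simp add: wp_def)
  have "AE x in RM V. wp x \<le> \<bar>c\<bar>" using hw2[OF zero_less_one] c' hn_pos[OF zero_less_one wpi wp0]
  proof eventually_elim
    case (elim x)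
    have "exp (- 1 * lam) * hn V 1 wp x \<le> hn V 1 wp x"
      using elim(3) lam by (intro mult_left_le_one_le) auto
    then show ?case using elim by (simp add: wp_def)
  qed
  from wp0 have wpL: "wp \<in> L2 (RM V)"
    by (intro L2_bounded[of _ "\<bar>c\<bar>"]) (use wpi \<open>AE x in RM V. wp x \<le> \<bar>c\<bar>\<close> in \<open>auto elim: eventually_elim2\<close>)
  define C where "C = (if lam = 0 then \<bar>c\<bar> else 0)"
  have wC: "AE x in RM V. w x \<le> C"
  proof (cases "lam = 0")
    case True
    show ?thesis using \<open>AE x in RM V. wp x \<le> \<bar>c\<bar>\<close>
      by eventually_elim (use True in \<open>auto simp: wp_def C_def\<close>)
  next
    \<comment> \<open>From \<open>w^+ <= e^(-lam) P 1 w^+\<close> the norm of \<open>w^+\<close> is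
      at most \<open>e^(-lam)\<close> times itself, hence 0.\<close>
    case False
    then have lam: "0 < lam" using lam by simp
    have PL: "Pt V 1 wp \<in> L2 (RM V)" by (rule Pt_L2[OF oV _ wpL]) simp
    have "AE x in RM V. hn V 1 wp x = Pt V 1 wp x" by (rule hn_L2[OF oV _ wpL wp0]) simp
    moreover have "AE x in RM V. 0 \<le> Pt V 1 wp x" by (rule Pt_pos[OF oV _ wpL wp0]) simp
    ultimately have "AE x in RM V. \<bar>wp x\<bar> \<le> \<bar>(exp (- lam) *\<^sub>R Pt V 1 wp) x\<bar>" using hw2[of 1]
      by (auto simp: wp_def elim!: eventually_elim2)
    from nrm2_mono[OF wpL L2.S_scale[OF PL] this]
    have "nrm2 (RM V) wp \<le> exp (- lam) * nrm2 (RM V) (Pt V 1 wp)"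
      unfolding L2.nrm_scale[OF PL] by simp
    also have "\<dots> \<le> exp (- lam) * nrm2 (RM V) wp"
      by (intro mult_left_mono Pt_contraction[OF oV _ wpL]) auto
    finally have "(1 - exp (- lam)) * nrm2 (RM V) wp \<le> 0" by (simp add: algebra_simps)
    moreover have "exp (- lam) < 1" using lam by simp
    ultimately have "nrm2 (RM V) wp \<le> 0" by (simp add: mult_le_0_iff)
    then have "nrm2 (RM V) wp = 0" using L2.nrm_ge_0[OF wpL] by simp
    then have "AE x in RM V. wp x = 0" using nrm2_eq_0_iff[OF wpL] by simp
    then show ?thesis by eventually_elim (use False in \<open>auto simp: wp_def C_def max_def split: if_splits\<close>)
  qed
  have "smed V lam (\<lambda>x. C - w x)"
    by (rule smed_of_heat[OF oV finite_measure_axioms wi lam _ wC hw]) (simp_all add: C_def)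
  with wC B g gm show ?thesis
    by (intro that[of g B C]) (auto simp: w_def C_def)
qed

text \<open>\<open>g\<close> lies only locally in the form domain. The representative
  \<open>h\<close> agrees with it on a neighbourhood \<open>W\<close> of the closure of
  \<open>U\<close>, which is enough to test with functions supported in \<open>U\<close>; truncation
  keeps the bound \<open>B\<close> valid also outside \<open>W\<close>.\<close>

lemma weakly_harmonic_rep:
  assumes V: "openin X V" and U: "rc U" and UV: "X closure_of U \<subseteq> V" and B: "0 \<le> B"
    and g: "g \<in> borel_measurable (RM V)" "weakly_harmonic (R V) lam g" "\<forall>x\<in>V. \<bar>g x\<bar> \<le> B"
  obtains h where "h \<in> FU V" "AE x in M. h x \<le> B" "AE x in M. x \<in> U \<longrightarrow> h x = g x"
    "\<forall>p\<in>FU U. E h p + lam * ip2 M h p = 0"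
proof -
  note oU = rc_open[OF U]
  obtain W where W: "openin X W" "X closure_of U \<subseteq> W" "X closure_of W \<subseteq> V" "compactin X (X closure_of W)"
    by (rule compact_nbhd[OF rc_compact[OF U] V UV])
  have WW: "W \<subseteq> X closure_of W" using W(1) by (simp add: closure_of_subset openin_subset)
  have UU: "U \<subseteq> X closure_of U" using oU by (simp add: closure_of_subset openin_subset)
  have cl: "subtopology X V closure_of W = X closure_of W"
    using W(3) WW by (auto simp: closure_of_subtopology Int_absorb1)
  have cW: "compactly_inside (subtopology X V) W (topspace (subtopology X V))"
    unfolding compactly_inside_def cl
    using W V WW openin_subset[OF V] by (auto simp: openin_open_subtopology compactin_subtopology)
  have "g \<in> dom_loc (R V)" using g(2) by (simp add: weakly_harmonic_def)
  then have "\<exists>h\<in>fs_dom (R V). AE x in RM V. x \<in> W \<longrightarrow> g x = h x"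
    using cW unfolding dom_loc_def R_simps(1,2) by (elim CollectE conjE) (rule mp, rule spec)
  then obtain h0 where h0: "zero_ext V h0 \<in> FU V" "AE x in RM V. x \<in> W \<longrightarrow> g x = h0 x"
    by (elim bexE) (rule that, simp_all)
  define h1 where "h1 = zero_ext V h0"
  have h1: "h1 \<in> FU V" using h0(1) by (simp add: h1_def)
  have clamp: "(\<lambda>x. min (max (u x) 0) B) \<in> FU V" if u: "u \<in> FU V" for u
  proof (rule FU_sandwich[OF _ FU_pos[OF u]])
    show "(\<lambda>x. min (max (u x) 0) B) \<in> F" by (rule min_const_F[OF pos_F[OF FU_F[OF u]] B])
  qed (use B in auto)
  \<comment> \<open>Truncation to values between \<open>-B\<close> and \<open>B\<close>, done
    separately for the positive and the negative part because \<open>FU_sandwich\<close> needs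
    nonnegative functions.\<close>
  define h where "h = (\<lambda>x. min (max (h1 x) 0) B) - (\<lambda>x. min (max (((- 1) *\<^sub>R h1) x) 0) B)"
  have hU: "h \<in> FU V" unfolding h_def
    by (intro subspace_diff[OF FU_subspace] clamp h1 subspace_scale[OF FU_subspace])
  have hF: "h \<in> F" by (rule FU_F[OF hU])
  have hB: "AE x in M. h x \<le> B" using B by (intro AE_I2) (auto simp: h_def min_def max_def)
  have hW: "AE x in M. x \<in> W \<longrightarrow> h x = g x"
    using h0(2) unfolding AE_restrict_iff[OF Um[OF V]]
  proof eventually_elim
    case (elim x)
    show ?case
    proof
      assume x: "x \<in> W"
      then have xV: "x \<in> V" using WW W(3) by blast
      have "h1 x = g x" using elim x xV by (simp add: h1_def zero_ext_def)
      moreover have "\<bar>g x\<bar> \<le> B" using g(3) xV by blast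
      ultimately show "h x = g x" by (auto simp: h_def min_def max_def abs_if split: if_splits)
    qed
  qed
  have pos: "E h p + lam * ip2 M h p = 0" if p: "p \<in> core U" and p0: "AE x in M. 0 \<le> p x" for p
  proof -
    have pF: "p \<in> F" "p \<in> FU V" using core_dest(1)[OF p] FU_mono[OF _ core_FU[OF p]] UU UV by auto
    have AEp: "AE x in M. zero_ext V p x = p x" by (rule FU_zero_ext[OF Um[OF V] pF(2)])
    have zU: "zero_ext V p \<in> FU V" by (rule FU_zero_ext_FU[OF V pF(2)])
    let ?S = "meas_support (R V) p"
    have tU: "top_support X p \<subseteq> U" and tc: "compactin X (top_support X p)" using core_dest[OF p] by auto
    have "?S \<subseteq> top_support X p"
    proof
      fix x assume x: "x \<in> ?S"
      show "x \<in> top_support X p"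
      proof (rule ccontr)
        assume nx: "x \<notin> top_support X p"
        have xV: "x \<in> V" using x unfolding meas_support_def by simp
        have "openin X (V \<inter> (topspace X - top_support X p))"
          by (intro openin_Int V openin_diff compact_closed[OF tc]) simp
        then have "openin (subtopology X V) (V \<inter> (topspace X - top_support X p))"
          using V by (auto simp: openin_open_subtopology)
        moreover have "AE y in RM V. y \<in> V \<inter> (topspace X - top_support X p) \<longrightarrow> p y = 0"
          by (rule AE_I2) (use core_zero[OF p] in blast)
        ultimately show False using x xV nx openin_subset[OF V] unfolding meas_support_def R_simps by blast
      qed
    qed
    moreover have "closedin (subtopology X V) ?S"
      unfolding meas_support_def R_simps by (intro closedin_diff openin_Union closedin_topspace) auto
    ultimately have Sc: "compactin (subtopology X V) ?S"
      using closed_compactin[of "subtopology X V" "top_support X p" ?S] tc tU UU UV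
      by (auto simp: compactin_subtopology)
    have dc: "p \<in> dom_c (R V)" unfolding dom_c_def using zU Sc by simp
    have SW: "?S \<subseteq> W" using \<open>?S \<subseteq> top_support X p\<close> tU UU W(2) by blast
    have WV: "W \<subseteq> V" using WW W(3) by blast
    have p0': "AE x in fs_meas (R V). 0 \<le> p x"
      unfolding R_simps AE_restrict_iff[OF Um[OF V]] using p0 by eventually_elim simp
    have int: "(\<integral>x. g x * p x \<partial>RM V) = ip2 M h p"
    proof -
      have "(\<integral>x. g x * p x \<partial>RM V) = (\<integral>x. zero_ext V (\<lambda>x. g x * p x) x \<partial>M)"
        by (rule integral_restrict[OF Um[OF V]])
      also have "\<dots> = (\<integral>x. h x * p x \<partial>M)"
      proof (rule integral_cong_AE)
        have "AE x in M. x \<notin> U \<longrightarrow> p x = 0" by (rule FU_zero[OF Um[OF oU] core_FU[OF p]])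
        then show "AE x in M. zero_ext V (\<lambda>x. g x * p x) x = h x * p x" using hW
          by eventually_elim (use UU UV W(2) WV in \<open>auto simp: zero_ext_def\<close>)
        have "p \<in> borel_measurable (RM V)" using L2R_of_L2[OF V F_L2[OF pF(1)]] by simp
        then show "zero_ext V (\<lambda>x. g x * p x) \<in> borel_measurable M"
          using g(1) measurable_restrict_iff[OF Um[OF V]] by (metis borel_measurable_times)
        show "(\<lambda>x. h x * p x) \<in> borel_measurable M"
          using F_L2[OF hF] F_L2[OF pF(1)] by (auto intro!: borel_measurable_times)
      qed
      finally show ?thesis unfolding ip2_def .
    qed
    have zF: "zero_ext V p \<in> F" by (rule FU_F[OF zU])
    have Ez: "E k (zero_ext V p) = E k p" if "k \<in> F" for k
      by (rule E_cong) (use that zF pF AEp in auto)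
    have "form_loc (R V) g p = E h (zero_ext V p)"
      by (rule form_loc_eq[OF V dc hU W(1) WV SW hW])
    moreover have "form_loc (R V) (\<lambda>x. - g x) p = E ((- 1) *\<^sub>R h) (zero_ext V p)"
    proof (rule form_loc_eq[OF V dc _ W(1) WV SW])
      show "(- 1) *\<^sub>R h \<in> FU V" by (rule subspace_scale[OF FU_subspace hU])
      show "AE x in M. x \<in> W \<longrightarrow> ((- 1) *\<^sub>R h) x = - g x" using hW by eventually_elim simp
    qed
    moreover have "E ((- 1) *\<^sub>R h) (zero_ext V p) = - E h (zero_ext V p)"
      using E.ip_scale_left[OF hF zF, of "- 1"] by simp
    moreover have "form_loc_shift (R V) lam g p \<le> 0" "form_loc_shift (R V) lam (\<lambda>x. - g x) p \<le> 0"
      using g(2) dc p0' unfolding weakly_harmonic_def by blast+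
    ultimately show ?thesis
      unfolding form_loc_shift_def R_simps(2) by (simp add: int Ez[OF hF])
  qed
  have core: "E h p = ip2 M ((- lam) *\<^sub>R h) p" if p: "p \<in> core U" for p
  proof -
    let ?p = "\<lambda>x. max (p x) 0" and ?m = "\<lambda>x. max (((- 1) *\<^sub>R p) x) 0"
    have c: "?p \<in> core U" "?m \<in> core U" by (intro core_pos core_scale p)+
    have F: "?p \<in> F" "?m \<in> F" using core_dest(1)[OF c(1)] core_dest(1)[OF c(2)] .
    have e: "p = ?p - ?m" by (auto simp: fun_eq_iff max_def)
    have "E h (?p - ?m) + lam * ip2 M h (?p - ?m) = 0"
      using pos[OF c(1)] pos[OF c(2)] F F_L2[OF F(1)] F_L2[OF F(2)] hF F_L2[OF hF]
      by (simp add: E.ip_diff_right L2.ip_diff_right right_diff_distrib)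
    then have "E h p + lam * ip2 M h p = 0" using e by simp
    then show ?thesis using L2.ip_scale_left[OF F_L2[OF hF] F_L2[OF core_dest(1)[OF p]], of "- lam"] by simp
  qed
  have "\<forall>p\<in>FU U. E h p + lam * ip2 M h p = 0"
  proof
    fix p assume p: "p \<in> FU U"
    have "E h p = ip2 M ((- lam) *\<^sub>R h) p"
      by (rule FU_weak_eq[OF hF L2.S_scale[OF F_L2[OF hF]] core p])
    then show "E h p + lam * ip2 M h p = 0"
      using L2.ip_scale_left[OF F_L2[OF hF] F_L2[OF FU_F[OF p]], of "- lam"] by simp
  qed
  moreover have "AE x in M. x \<in> U \<longrightarrow> h x = g x"
    using hW by eventually_elim (use UU W(2) in blast)
  ultimately show ?thesis using hU hB by (intro that[of h])
qed

section \<open>Comparison of defective functions with harmonic functions\<close>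

lemma E_shift_add: "\<lbrakk>a \<in> F; b \<in> F; p \<in> F\<rbrakk> \<Longrightarrow> E (a + b) p + s * ip2 M (a + b) p = (E a p + s * ip2 M a p) + (E b p + s * ip2 M b p)"
  by (simp add: E.ip_add_left L2.ip_add_left distrib_left)

lemma E_shift_scale: "\<lbrakk>a \<in> F; p \<in> F\<rbrakk> \<Longrightarrow> E (c *\<^sub>R a) p + s * ip2 M (c *\<^sub>R a) p = c * (E a p + s * ip2 M a p)"
  by (simp add: E.ip_scale_left L2.ip_scale_left distrib_left)

text \<open>On \<open>U\<close>, \<open>q = B - u\<close> with \<open>u = h + B v\<close>, and
  \<open>q\<close> solves the homogeneous \<open>lam\<close>-equation. As \<open>v\<close> vanishes
  at the boundary, the maximum principle gives \<open>u <= B\<close>. A second application gives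
  \<open>(b - lam) / b * rs U b q <= q\<close>, the resolvent form of the supermedian
  property.\<close>

lemma smed_defect_minus_harmonic:
  assumes U: "rc U" and lam: "0 \<le> lam" and v: "defect U lam v" "lam = 0 \<longrightarrow> v = (\<lambda>_. 0)"
    and h: "h \<in> F" "\<forall>p\<in>FU U. E h p + lam * ip2 M h p = 0" "AE x in M. h x \<le> B" and B: "0 \<le> B"
    and hg: "AE x in M. x \<in> U \<longrightarrow> h x = g x" and gm: "g \<in> borel_measurable (RM U)"
  defines "q \<equiv> \<lambda>x. B * (1 - v x) - g x"
  shows "AE x in RM U. 0 \<le> q x" "smed U lam q"
proof -
  note oU = rc_open[OF U]
  let ?o = "zero_ext U (\<lambda>_. 1) :: 'a \<Rightarrow> real"
  have one: "?o \<in> L2 M" by (rule one_L2(1)[OF U])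
  have vU: "v \<in> FU U" and v01: "AE x in M. 0 \<le> v x" "AE x in M. v x \<le> 1"
    and veq: "\<And>p. p \<in> FU U \<Longrightarrow> E v p + lam * ip2 M v p = lam * ip2 M ?o p"
    using v unfolding defect_def by auto
  have vF: "v \<in> F" by (rule FU_F[OF vU])
  have BvU: "B *\<^sub>R v \<in> FU U" by (rule subspace_scale[OF FU_subspace vU])
  have BvF: "B *\<^sub>R v \<in> F" by (rule FU_F[OF BvU])
  define u where "u = h + B *\<^sub>R v"
  have uF: "u \<in> F" unfolding u_def by (rule E.S_add[OF h(1) BvF])
  have qu: "AE x in M. x \<in> U \<longrightarrow> q x = (B *\<^sub>R ?o - u) x"
    using hg by eventually_elim (simp add: q_def u_def zero_ext_def algebra_simps)
  have B1: "B *\<^sub>R ?o \<in> L2 M" by (rule L2.S_scale[OF one])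
  have Bu: "B *\<^sub>R ?o - u \<in> L2 M" by (rule L2.S_diff[OF B1 F_L2[OF uF]])
  have B1le: "AE x in M. (b *\<^sub>R (B *\<^sub>R ?o)) x \<le> b * B" if "0 < b" for b
    using that B by (intro AE_I2) (auto simp: zero_ext_def)
  have eq_u: "E u p + lam * ip2 M u p = B * (lam * ip2 M ?o p)" if p: "p \<in> FU U" for p
    unfolding u_def E_shift_add[OF h(1) BvF FU_F[OF p]] E_shift_scale[OF vF FU_F[OF p]]
    using h(2) p veq[OF p] by simp
  have u_le: "AE x in M. u x \<le> B"
  proof (cases "lam = 0")
    \<comment> \<open>Here \<open>v = 0\<close>, and the bound on \<open>h\<close> is the claim; the
      maximum principle would need a positive parameter.\<close>
    case True
    then show ?thesis using v(2) h(3) by (simp add: u_def)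
  next
    case False
    then have lam: "0 < lam" using lam by simp
    show ?thesis
    proof (rule max_principle[OF uF B lam BvU _ _ L2.S_scale[OF B1] B1le[OF lam]])
      show "AE x in M. u x \<le> B + (B *\<^sub>R v) x" using h(3) by eventually_elim (simp add: u_def)
      show "AE x in M. 0 \<le> (B *\<^sub>R v) x" using v01(1) by eventually_elim (use B in simp)
      show "E u p + lam * ip2 M u p \<le> ip2 M (lam *\<^sub>R B *\<^sub>R ?o) p" if p: "p \<in> FU U" for p
        unfolding eq_u[OF p] using one F_L2[OF FU_F[OF p]] by (simp add: L2.ip_scale_left L2.S_scale)
    qed
  qed
  have qU: "AE x in RM U. q x = (B *\<^sub>R ?o - u) x"
    using qu unfolding AE_restrict_iff[OF Um[OF oU]] .
  show q0: "AE x in RM U. 0 \<le> q x"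
    unfolding AE_restrict_iff[OF Um[OF oU]] using qu u_le by eventually_elim (auto simp: zero_ext_def)
  have qm: "q \<in> borel_measurable (RM U)"
    unfolding q_def using gm L2R_of_L2[OF oU F_L2[OF vF]] by auto
  have q: "q \<in> L2 (RM U)" by (rule L2_cong_AE[OF L2R_of_L2[OF oU Bu] qm qU])
  show "smed U lam q"
  proof (rule smed_L2[OF oU q], rule Pt_supermedian[OF oU _ lam q])
    fix b assume b: "lam < b"
    then have b0: "0 < b" using lam by simp
    define c where "c = (b - lam) / b"
    have c: "0 < c" "c * b = b - lam" using b b0 by (simp_all add: c_def)
    define w where "w = c *\<^sub>R zero_ext U (rs U b q)"
    have rU: "zero_ext U (rs U b q) \<in> FU U" by (rule rs_FU[OF oU b0 q])
    have rF: "zero_ext U (rs U b q) \<in> F" by (rule FU_F[OF rU])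
    have wU: "w \<in> FU U" unfolding w_def by (rule subspace_scale[OF FU_subspace rU])
    have wF: "w \<in> F" by (rule FU_F[OF wU])
    have "AE x in RM U. 0 \<le> rs U b q x" by (rule rs_pos[OF oU b0 q q0])
    then have w0: "AE x in M. 0 \<le> w x"
      unfolding AE_restrict_iff[OF Um[OF oU]] by eventually_elim (use c in \<open>auto simp: w_def zero_ext_def\<close>)
    \<comment> \<open>On \<open>U\<close> this says \<open>w <= q\<close>. The boundary condition
      holds because \<open>u <= B\<close> and \<open>w\<close> lies in \<open>FU U\<close>.\<close>
    have "AE x in M. (w + u) x \<le> B"
    proof (rule max_principle[OF E.S_add[OF wF uF] B b0 wU _ w0 L2.S_scale[OF B1] B1le[OF b0]])
      show "AE x in M. (w + u) x \<le> B + w x" using u_le by eventually_elim simp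
      fix p assume p: "p \<in> FU U"
      have pF: "p \<in> F" by (rule FU_F[OF p])
      have "ip2 M (zero_ext U q) p = ip2 M (B *\<^sub>R ?o - u) p"
        by (rule ip2_FU_cong[OF oU p q[unfolded L2R[OF oU]] Bu])
          (use qu in \<open>auto simp: zero_ext_def elim: eventually_mono\<close>)
      then have "E w p + b * ip2 M w p = (b - lam) * (B * ip2 M ?o p - ip2 M u p)"
        unfolding w_def E_shift_scale[OF rF pF] rs_eq[OF oU b0 q p]
        using F_L2[OF uF] F_L2[OF pF] one B1 c(2) by (simp add: L2.ip_diff_left L2.ip_scale_left mult.assoc[symmetric])
      moreover have "E u p + b * ip2 M u p = B * (lam * ip2 M ?o p) + (b - lam) * ip2 M u p"
        using eq_u[OF p] by (simp add: algebra_simps)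
      ultimately have "E (w + u) p + b * ip2 M (w + u) p = b * (B * ip2 M ?o p)"
        unfolding E_shift_add[OF wF uF pF] by (simp add: algebra_simps)
      then show "E (w + u) p + b * ip2 M (w + u) p \<le> ip2 M (b *\<^sub>R B *\<^sub>R ?o) p"
        using one F_L2[OF pF] B1 by (simp add: L2.ip_scale_left)
    qed
    then show "AE x in RM U. rs U b q x \<le> b / (b - lam) * q x"
      unfolding AE_restrict_iff[OF Um[OF oU]] using qu
    proof eventually_elim
      case (elim x)
      show ?case
      proof
        assume x: "x \<in> U"
        have "c * rs U b q x \<le> q x" using elim x by (simp add: w_def zero_ext_def)
        then show "rs U b q x \<le> b / (b - lam) * q x" using c b b0 by (simp add: c_def field_simps)
      qed
    qed
  qed
qed

text \<open>\<open>k (1 - v) - f\<close> is the sum of \<open>b (1 - v) - g\<close> with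
  \<open>b = k - C\<close> and of \<open>C - (f - g)\<close>; both are nonnegative and supermedian
  on \<open>U\<close>. All large \<open>k\<close> are allowed so that one \<open>k\<close> can serve
  two functions.\<close>

lemma shift_defective_below_defect:
  assumes ls: "locally_smoothing D" and U: "rc U" and lam: "0 \<le> lam"
    and v: "defect U lam v" "lam = 0 \<longrightarrow> v = (\<lambda>_. 0)" and f: "locally_shift_defective D lam f"
  obtains K where "\<forall>k\<ge>K. (AE x in RM U. 0 \<le> k * (1 - v x) - f x) \<and> smed U lam (\<lambda>x. k * (1 - v x) - f x)"
proof -
  note oU = rc_open[OF U]
  obtain V where V: "rc V" "X closure_of U \<subseteq> V" "U \<subseteq> V" by (rule rc_nbhd[OF U])
  note oV = rc_open[OF V(1)]
  have ultra: "ultracontractive (R V)" using ls V(1) unfolding locally_smoothing_def by blast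
  obtain g C B where g: "g \<in> borel_measurable (RM V)" "weakly_harmonic (R V) lam g" and B: "0 \<le> B" "\<forall>x\<in>V. \<bar>g x\<bar> \<le> B"
    and C: "0 \<le> C" "0 < lam \<longrightarrow> C = 0" "AE x in RM V. f x - g x \<le> C" and s: "smed V lam (\<lambda>x. C - (f x - g x))"
    by (rule shift_defective_smed[OF V(1) lam f ultra])
  have C0: "AE x in RM V. 0 \<le> C - (f x - g x)" using C(3) by eventually_elim simp
  have s': "smed U lam (\<lambda>x. C - (f x - g x))" by (rule smed_domain[OF oU oV V(3) C0 s])
  have C0': "AE x in RM U. 0 \<le> C - (f x - g x)" by (rule AE_RM_mono[OF oU oV V(3) C0])
  have gU: "g \<in> borel_measurable (RM U)"
  proof -
    have "zero_ext U (zero_ext V g) = zero_ext U g" using V(3) by (auto simp: zero_ext_def fun_eq_iff)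
    then show ?thesis using g(1) zero_ext_measurable[OF Um[OF oU], of "zero_ext V g"]
      unfolding measurable_restrict_iff[OF Um[OF oU]] measurable_restrict_iff[OF Um[OF oV]] by simp
  qed
  \<comment> \<open>For \<open>lam > 0\<close> the constant \<open>C\<close> is 0, and for
    \<open>lam = 0\<close> the function \<open>v\<close> is 0. This is what allows \<open>C\<close>
    to be absorbed into \<open>k (1 - v)\<close>.\<close>
  have Cv: "C * v x = 0" for x using C(2) lam v(2) by (cases "lam = 0") auto
  have "(AE x in RM U. 0 \<le> k * (1 - v x) - f x) \<and> smed U lam (\<lambda>x. k * (1 - v x) - f x)" if k: "B + C \<le> k" for k
  proof -
    define b where "b = k - C"
    have b: "B \<le> b" "0 \<le> b" using k B(1) by (auto simp: b_def)
    have gb: "\<forall>x\<in>V. \<bar>g x\<bar> \<le> b" using B(2) b(1) by force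
    obtain h where h: "h \<in> FU V" "AE x in M. h x \<le> b" "AE x in M. x \<in> U \<longrightarrow> h x = g x"
      "\<forall>p\<in>FU U. E h p + lam * ip2 M h p = 0"
      by (rule weakly_harmonic_rep[OF oV U V(2) b(2) g gb])
    note q = smed_defect_minus_harmonic[OF U lam v FU_F[OF h(1)] h(4) h(2) b(2) h(3) gU]
    have qm: "(\<lambda>x. b * (1 - v x) - g x) \<in> borel_measurable (RM U)"
      using gU L2R_of_L2[OF oU F_L2[OF FU_F[of v U]]] v(1) unfolding defect_def by auto
    have e: "(\<lambda>x. (b * (1 - v x) - g x) + (C - (f x - g x))) = (\<lambda>x. k * (1 - v x) - f x)"
      using Cv by (auto simp: b_def fun_eq_iff algebra_simps)
    have "AE x in RM U. 0 \<le> (b * (1 - v x) - g x) + (C - (f x - g x))"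
      using q(1) C0' by eventually_elim simp
    then show ?thesis using smed_add[OF oU qm q(1) C0' q(2) s'] unfolding e fun_cong[OF e] by simp
  qed
  then show ?thesis by (intro that[of "B + C"]) blast
qed

text \<open>With \<open>k = g - f\<close>, the approximations satisfy
  \<open>(H + lam) kn = n (k - kn) >= 0\<close>, so on \<open>U\<close> the function
  \<open>fn = h - kn\<close> satisfies \<open>H fn <= - lam * fn\<close>. Because of
  \<open>fn >= f >= 0\<close> there, \<open>H fn <= 0\<close>, and \<open>B - fn\<close> is
  supermedian without the factor \<open>e^(-lam t)\<close>. The claim for \<open>B - f\<close>
  follows as \<open>n\<close> grows.\<close>

lemma shift_defective_below_const:
  assumes ls: "locally_smoothing D" and U: "rc U" and lam: "0 < lam"
    and f: "locally_shift_defective D lam f" and f0: "AE x in M. 0 \<le> f x"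
  obtains K where "AE x in RM U. 0 \<le> K - f x" "smed U 0 (\<lambda>x. K - f x)"
proof -
  note oU = rc_open[OF U]
  obtain V where V: "rc V" "X closure_of U \<subseteq> V" "U \<subseteq> V" by (rule rc_nbhd[OF U])
  note oV = rc_open[OF V(1)]
  interpret finite_measure "RM V" by (rule rc_finite_measure[OF V(1)])
  have ultra: "ultracontractive (R V)" using ls V(1) unfolding locally_smoothing_def by blast
  have lam0: "0 \<le> lam" using lam by simp
  obtain g C B where g: "g \<in> borel_measurable (RM V)" "weakly_harmonic (R V) lam g" and B: "0 \<le> B" "\<forall>x\<in>V. \<bar>g x\<bar> \<le> B"
    and C: "0 \<le> C" "0 < lam \<longrightarrow> C = 0" "AE x in RM V. f x - g x \<le> C" and s: "smed V lam (\<lambda>x. C - (f x - g x))"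
    by (rule shift_defective_smed[OF V(1) lam0 f ultra])
  obtain h where h: "h \<in> FU V" "AE x in M. h x \<le> B" "AE x in M. x \<in> U \<longrightarrow> h x = g x"
      "\<forall>p\<in>FU U. E h p + lam * ip2 M h p = 0"
    by (rule weakly_harmonic_rep[OF oV U V(2) B(1) g B(2)])
  have hF: "h \<in> F" by (rule FU_F[OF h(1)])
  define k where "k = (\<lambda>x. g x - f x)"
  have sk: "smed V lam k" using s C(2) lam by (simp add: k_def)
  have k0: "AE x in RM V. 0 \<le> k x" using C(3) by eventually_elim (use C(2) lam in \<open>simp add: k_def\<close>)
  have f0V: "AE x in RM V. 0 \<le> f x"
    unfolding AE_restrict_iff[OF Um[OF oV]] using f0 by eventually_elim simp
  have gB: "AE x in RM V. \<bar>g x\<bar> \<le> B" by (rule AE_I2) (use B(2) in \<open>simp add: space_restrict_space\<close>)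
  have km: "k \<in> borel_measurable (RM V)"
    using g(1) borel_measurable_integrable[OF L1_loc_integrable[OF V(1)]] f
    unfolding k_def locally_shift_defective_def by (auto intro: borel_measurable_diff)
  \<comment> \<open>Nonnegativity of \<open>f\<close> bounds \<open>k = g - f\<close> from above by
    \<open>B\<close>, so \<open>k\<close> is square integrable.\<close>
  have k: "k \<in> L2 (RM V)"
  proof (rule L2_bounded[OF km])
    show "AE x in RM V. \<bar>k x\<bar> \<le> B" using k0 f0V gB by eventually_elim (simp add: k_def)
  qed
  have kP: "AE x in RM V. exp (- lam * t) * Pt V t k x \<le> k x" if "0 < t" for t
    using sk that k k0 unfolding smed_def by blast
  have rk: "AE x in RM V. rs V b k x \<le> b / (b - lam) * k x" if "lam < b" for b
    by (rule rs_le_of_Pt[OF oV k lam0 that kP])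
  let ?o = "zero_ext U (\<lambda>_. 1) :: 'a \<Rightarrow> real"
  have one: "?o \<in> L2 M" by (rule one_L2(1)[OF U])
  have B1: "B *\<^sub>R ?o \<in> L2 M" by (rule L2.S_scale[OF one])
  \<comment> \<open>\<open>k\<^sub>n = n (H + n + lam)\<^sup>-\<^sup>1 k \<le> k\<close> lies in the form domain, unlike k itself.\<close>
  define kn where "kn n = (real n / (real n + lam)) *\<^sub>R zero_ext V (rs V (real n + lam) k)" for n :: nat
  define fn where "fn n = h - kn n" for n
  have b: "0 < real n + lam" for n using lam by simp
  have knU: "kn n \<in> FU V" for n unfolding kn_def
    by (intro subspace_scale[OF FU_subspace] rs_FU[OF oV b k])
  have knF: "kn n \<in> F" for n by (rule FU_F[OF knU])
  have fnF: "fn n \<in> F" for n unfolding fn_def by (rule E.S_diff[OF hF knF])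
  have kn0: "AE x in M. 0 \<le> kn n x" for n
    using rs_pos[OF oV b k k0, of n] unfolding AE_restrict_iff[OF Um[OF oV]]
    by eventually_elim (use lam in \<open>auto simp: kn_def zero_ext_def\<close>)
  have knk: "AE x in M. x \<in> V \<longrightarrow> kn n x \<le> k x" for n
  proof (cases "n = 0")
    case True
    show ?thesis using k0 unfolding AE_restrict_iff[OF Um[OF oV]]
      by eventually_elim (use True in \<open>simp add: kn_def\<close>)
  next
    case False
    then have n: "lam < real n + lam" by simp
    show ?thesis using rk[OF n] unfolding AE_restrict_iff[OF Um[OF oV]]
    proof eventually_elim
      case (elim x)
      show ?case
      proof
        assume "x \<in> V"
        then have "real n / (real n + lam) * rs V (real n + lam) k x
            \<le> real n / (real n + lam) * ((real n + lam) / real n * k x)"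
          using elim lam by (intro mult_left_mono) auto
        also have "\<dots> = k x"
        proof -
          have "m / s * (s / m * y) = y" if "m \<noteq> 0" "s \<noteq> 0" for m s y :: real using that by simp
          then show ?thesis using False b[of n] by simp
        qed
        finally show "kn n x \<le> k x" using \<open>x \<in> V\<close> by (simp add: kn_def zero_ext_def)
      qed
    qed
  qed
  have fnB: "AE x in M. fn n x \<le> B" for n using kn0[of n] h(2) by eventually_elim (simp add: fn_def)
  have fn0: "AE x in M. x \<in> U \<longrightarrow> 0 \<le> fn n x" for n
    using knk[of n] h(3) f0 by eventually_elim (use V(3) in \<open>auto simp: fn_def k_def subset_iff\<close>)
  have med: "AE x in RM U. rs U a (B *\<^sub>R ?o - fn n) x \<le> (B *\<^sub>R ?o - fn n) x" if a: "0 < a" for a n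
  proof -
    let ?q = "B *\<^sub>R ?o - fn n"
    have qM: "?q \<in> L2 M" by (rule L2.S_diff[OF B1 F_L2[OF fnF]])
    have q: "?q \<in> L2 (RM U)" by (rule L2R_of_L2[OF oU qM])
    have q0: "AE x in RM U. 0 \<le> ?q x"
      unfolding AE_restrict_iff[OF Um[OF oU]] using fnB[of n] by eventually_elim (simp add: zero_ext_def)
    define w where "w = zero_ext U (rs U a ?q)"
    have wU: "w \<in> FU U" unfolding w_def by (rule rs_FU[OF oU a q])
    have wF: "w \<in> F" by (rule FU_F[OF wU])
    have w0: "AE x in M. 0 \<le> w x"
      using rs_pos[OF oU a q q0] unfolding AE_restrict_iff[OF Um[OF oU]]
      by eventually_elim (auto simp: w_def zero_ext_def)
    have "AE x in M. (w + fn n) x \<le> B"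
    proof (rule max_principle[OF E.S_add[OF wF fnF] B(1) a wU _ w0 L2.S_scale[OF B1]])
      show "AE x in M. (w + fn n) x \<le> B + w x" using fnB[of n] by eventually_elim simp
      show "AE x in M. (a *\<^sub>R B *\<^sub>R ?o) x \<le> a * B"
        using a B by (intro AE_I2) (auto simp: zero_ext_def)
      fix p assume p: "p \<in> FU U" and p0: "AE x in M. 0 \<le> p x"
      have pF: "p \<in> F" by (rule FU_F[OF p])
      have pV: "p \<in> FU V" by (rule FU_mono[OF V(3) p])
      have L: "ip2 M (fn n) p = ip2 M h p - ip2 M (kn n) p" "E (fn n) p = E h p - E (kn n) p"
        unfolding fn_def using hF knF[of n] pF by (simp_all add: L2.ip_diff_left E.ip_diff_left)
      have "ip2 M (zero_ext U ?q) p = ip2 M ?q p"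
        by (rule ip2_FU_cong[OF oU p q[unfolded L2R[OF oU]] qM]) (simp add: zero_ext_def)
      also have "ip2 M ?q p = B * ip2 M ?o p - ip2 M (fn n) p"
        using F_L2[OF fnF] F_L2[OF pF] one B1 by (simp add: L2.ip_diff_left L2.ip_scale_left)
      finally have "ip2 M (zero_ext U ?q) p = B * ip2 M ?o p - ip2 M (fn n) p" .
      then have wq: "E w p + a * ip2 M w p = a * (B * ip2 M ?o p - ip2 M (fn n) p)"
        using rs_eq[OF oU a q p] unfolding w_def by simp
      have zk: "zero_ext V k \<in> L2 M" using k L2R[OF oV] by simp
      have kneq: "E (kn n) p + (real n + lam) * ip2 M (kn n) p = real n * ip2 M (zero_ext V k) p"
        unfolding kn_def E_shift_scale[OF FU_F[OF rs_FU[OF oV b k]] pF] rs_eq[OF oV b k pV]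
        using b[of n] by simp
      have m1: "ip2 M (kn n) p \<le> ip2 M (zero_ext V k) p"
        by (rule ip2_FU_mono[OF oU p p0 F_L2[OF knF] zk])
          (use knk[of n] V(3) in \<open>auto simp: zero_ext_def elim!: eventually_mono\<close>)
      have m2: "0 \<le> ip2 M (fn n) p"
        using ip2_FU_mono[OF oU p p0 L2.S_0 F_L2[OF fnF[of n]]] fn0[of n] F_L2[OF pF] by simp
      have "E (w + fn n) p + a * ip2 M (w + fn n) p
          = a * (B * ip2 M ?o p) + (E (fn n) p)"
        unfolding E_shift_add[OF wF fnF pF] wq by (simp add: algebra_simps)
      also have "\<dots> = a * (B * ip2 M ?o p) - lam * ip2 M (fn n) p
          - real n * (ip2 M (zero_ext V k) p - ip2 M (kn n) p)"
        using kneq h(4) p unfolding L by (auto simp: algebra_simps)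
      also have "\<dots> \<le> a * (B * ip2 M ?o p)"
        using mult_nonneg_nonneg[OF lam0 m2] mult_left_mono[OF m1, of "real n"] by (simp add: right_diff_distrib)
      finally show "E (w + fn n) p + a * ip2 M (w + fn n) p \<le> ip2 M (a *\<^sub>R B *\<^sub>R ?o) p"
        using one F_L2[OF pF] B1 by (simp add: L2.ip_scale_left)
    qed
    then show ?thesis unfolding AE_restrict_iff[OF Um[OF oU]]
      by eventually_elim (auto simp: w_def zero_ext_def algebra_simps)
  qed
  define q where "q = (\<lambda>x. B - f x)"
  have kU: "k \<in> L2 (RM U)" by (rule L2R_mono(1)[OF oU oV V(3) k])
  have hU: "h \<in> L2 (RM U)" by (rule L2R_of_L2[OF oU F_L2[OF hF]])
  have oneU: "(\<lambda>_. B) \<in> L2 (RM U)" by (rule one_L2(2)[OF U])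
  have qeq: "AE x in RM U. q x = ((\<lambda>_. B) - h + k) x"
    unfolding AE_restrict_iff[OF Um[OF oU]] using h(3) by eventually_elim (simp add: q_def k_def)
  have qm: "q \<in> borel_measurable (RM U)"
    using borel_measurable_integrable[OF L1_loc_integrable[OF U]] f
    unfolding q_def locally_shift_defective_def by (auto intro: borel_measurable_diff)
  have q: "q \<in> L2 (RM U)"
    by (rule L2_cong_AE[OF L2.S_add[OF L2.S_diff[OF oneU hU] kU] qm qeq])
  define qn where "qn n = B *\<^sub>R ?o - fn n" for n
  have qnL: "qn n \<in> L2 (RM U)" for n
    unfolding qn_def by (rule L2R_of_L2[OF oU L2.S_diff[OF B1 F_L2[OF fnF]]])
  define r where "r n = rs V (real n + lam) k" for n :: nat
  define c where "c n = real n / (real n + lam)" for n :: nat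
  have r: "r n \<in> L2 (RM V)" for n unfolding r_def by (rule rs_L2[OF oV b k])
  have "filterlim (\<lambda>n. lam + real n) at_top sequentially"
    by (rule filterlim_tendsto_add_at_top[OF tendsto_const filterlim_real_sequentially])
  then have rlim: "(\<lambda>n. nrm2 (RM V) (r n - k)) \<longlonglongrightarrow> 0"
    unfolding r_def by (intro rs_tendsto[OF oV k]) (simp add: add.commute)
  have "(\<lambda>n. lam / (lam + real n)) \<longlonglongrightarrow> 0"
    by (rule tendsto_divide_0[OF tendsto_const])
      (intro filterlim_at_top_imp_at_infinity filterlim_tendsto_add_at_top[OF tendsto_const filterlim_real_sequentially])
  then have "(\<lambda>n. 1 - lam / (lam + real n)) \<longlonglongrightarrow> 1 - 0" by (intro tendsto_intros)
  moreover have "1 - lam / (lam + real n) = c n" for n using lam by (simp add: c_def field_simps)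
  ultimately have clim: "c \<longlonglongrightarrow> 1" by simp
  have ck: "nrm2 (RM V) (c n *\<^sub>R r n - k) \<le> \<bar>c n\<bar> * nrm2 (RM V) (r n - k) + \<bar>c n - 1\<bar> * nrm2 (RM V) k" for n
  proof -
    have e: "c n *\<^sub>R r n - k = c n *\<^sub>R (r n - k) + (c n - 1) *\<^sub>R k"
      by (simp add: scaleR_diff_right scaleR_diff_left)
    show "nrm2 (RM V) (c n *\<^sub>R r n - k) \<le> \<bar>c n\<bar> * nrm2 (RM V) (r n - k) + \<bar>c n - 1\<bar> * nrm2 (RM V) k"
      using L2.nrm_triangle[OF L2.S_scale[OF L2.S_diff[OF r[of n] k], of "c n"] L2.S_scale[OF k, of "c n - 1"]]
      unfolding L2.nrm_scale[OF L2.S_diff[OF r k]] L2.nrm_scale[OF k] e .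
  qed
  have "(\<lambda>n. \<bar>c n\<bar> * nrm2 (RM V) (r n - k) + \<bar>c n - 1\<bar> * nrm2 (RM V) k) \<longlonglongrightarrow> \<bar>1\<bar> * 0 + \<bar>1 - 1\<bar> * nrm2 (RM V) k"
    by (intro tendsto_intros clim rlim)
  then have lim0: "(\<lambda>n. \<bar>c n\<bar> * nrm2 (RM V) (r n - k) + \<bar>c n - 1\<bar> * nrm2 (RM V) k) \<longlonglongrightarrow> 0" by simp
  have lim: "(\<lambda>n. nrm2 (RM U) (qn n - q)) \<longlonglongrightarrow> 0"
  proof (rule nrm2_sandwich[OF qnL q lim0])
    fix n
    have cr: "c n *\<^sub>R r n - k \<in> L2 (RM V)" by (rule L2.S_diff[OF L2.S_scale[OF r] k])
    have "AE x in RM U. (qn n - q) x = (c n *\<^sub>R r n - k) x"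
      unfolding AE_restrict_iff[OF Um[OF oU]] using h(3)
      by eventually_elim (use V(3) in \<open>auto simp: q_def k_def qn_def fn_def kn_def c_def r_def zero_ext_def\<close>)
    then have "nrm2 (RM U) (qn n - q) = nrm2 (RM U) (c n *\<^sub>R r n - k)"
      by (rule nrm2_cong_AE[OF L2.S_diff[OF qnL q] L2R_mono(1)[OF oU oV V(3) cr]])
    also have "\<dots> \<le> nrm2 (RM V) (c n *\<^sub>R r n - k)" by (rule L2R_mono(2)[OF oU oV V(3) cr])
    also note ck
    finally show "nrm2 (RM U) (qn n - q) \<le> \<bar>c n\<bar> * nrm2 (RM V) (r n - k) + \<bar>c n - 1\<bar> * nrm2 (RM V) k" .
  qed
  have "AE x in RM U. g x \<le> B" "AE x in RM U. 0 \<le> k x"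
    using AE_RM_mono[OF oU oV V(3) gB] AE_RM_mono[OF oU oV V(3) k0] by (auto elim: eventually_mono)
  then have q0: "AE x in RM U. 0 \<le> q x" by eventually_elim (simp add: q_def k_def)
  have "smed U 0 q"
  proof (rule smed_L2[OF oU q], rule Pt_supermedian[OF oU _ order_refl q])
    fix a :: real assume a: "0 < a"
    have "AE x in RM U. rs U a q x \<le> q x"
    proof (rule limit_le_AE[OF rs_L2[OF oU a qnL] qnL rs_L2[OF oU a q] q _ _ lim])
      show "AE x in RM U. rs U a (qn n) x \<le> qn n x" for n using med[OF a] unfolding qn_def .
      show "(\<lambda>n. nrm2 (RM U) (rs U a (qn n) - rs U a q)) \<longlonglongrightarrow> 0"
        by (rule nrm2_sandwich[OF rs_L2[OF oU a qnL] rs_L2[OF oU a q] lim])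
          (use rs_contraction[OF oU a L2.S_diff[OF qnL q]] rs_diff[OF oU a qnL q] in simp)
    qed
    then show "AE x in RM U. rs U a q x \<le> a / (a - 0) * q x" using a by simp
  qed
  with q0 show ?thesis unfolding q_def by (rule that)
qed

section \<open>Continuity of the harmonic comparison function\<close>

lemma AE_open_ex:
  assumes W: "openin X W" "x \<in> W" and Q: "AE y in M. y \<in> W \<longrightarrow> Q y"
  obtains y where "y \<in> W" "Q y"
proof (rule ccontr)
  assume "\<not> thesis"
  then have "\<forall>y\<in>W. \<not> Q y" using that by blast
  with Q have "AE y in M. y \<notin> W" by (auto elim: eventually_mono)
  then have "emeasure M W = 0"
    using AE_iff_measurable[OF Um[OF W(1)], of "\<lambda>x. x \<notin> W"] openin_subset[OF W(1)] by auto
  then show False using full W unfolding full_support_def by force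
qed

lemma Cont_nbhd:
  assumes W: "openin X W" and u: "u \<in> Cont (subtopology X W)" and x: "x \<in> W" and e: "0 < e"
  obtains N where "openin X N" "x \<in> N" "N \<subseteq> W" "\<forall>y\<in>N. \<bar>u y - u x\<bar> < (e::real)"
proof -
  let ?N = "{y \<in> topspace (subtopology X W). u y \<in> ball (u x) e}"
  have "openin (subtopology X W) ?N"
    by (rule openin_continuous_map_preimage[of _ euclideanreal])
      (use u in \<open>simp_all add: Cont_def del: topspace_subtopology\<close>)
  then have "openin X ?N" "?N \<subseteq> W" using openin_open_subtopology[OF W] by auto
  moreover have "x \<in> ?N" using x e openin_subset[OF W] by auto
  moreover have "\<forall>y\<in>?N. \<bar>u y - u x\<bar> < e" by (auto simp: dist_real_def abs_minus_commute)
  ultimately show ?thesis by (intro that[of ?N])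
qed

lemma Cont_le:
  assumes W: "openin X W" and u: "u \<in> Cont (subtopology X W)" and v: "v \<in> Cont (subtopology X W)"
    and le: "AE x in M. x \<in> W \<longrightarrow> u x \<le> v x + e" and x: "x \<in> W"
  shows "u x \<le> v x + (e::real)"
proof (rule field_le_epsilon)
  fix d :: real assume d: "0 < d"
  then have d2: "0 < d / 2" by simp
  obtain N1 where N1: "openin X N1" "x \<in> N1" "N1 \<subseteq> W" "\<forall>y\<in>N1. \<bar>u y - u x\<bar> < d/2"
    by (rule Cont_nbhd[OF W u x d2])
  obtain N2 where N2: "openin X N2" "x \<in> N2" "N2 \<subseteq> W" "\<forall>y\<in>N2. \<bar>v y - v x\<bar> < d/2"
    by (rule Cont_nbhd[OF W v x d2])
  have "AE y in M. y \<in> N1 \<inter> N2 \<longrightarrow> u y \<le> v y + e" using le by eventually_elim (use N1(3) in blast)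
  then obtain y where y: "y \<in> N1 \<inter> N2" "u y \<le> v y + e"
    by (rule AE_open_ex[OF openin_Int[OF N1(1) N2(1)] IntI[OF N1(2) N2(2)]])
  have "\<bar>u y - u x\<bar> < d/2" "\<bar>v y - v x\<bar> < d/2" using y N1(4) N2(4) by auto
  then show "u x \<le> v x + e + d" using y(2) by linarith
qed

lemma Cont_subset:
  assumes W: "N \<subseteq> W" and u: "u \<in> Cont (subtopology X W)" shows "u \<in> Cont (subtopology X N)"
  using continuous_map_from_subtopology_mono[of X W euclideanreal u N] u W by (simp add: Cont_def)

text \<open>A local a.e. form of the fact that uniform limits of continuous functions are
  continuous. The neighbourhood \<open>N\<close> may shrink with \<open>e\<close>, so the
  approximating functions need not have a common domain around \<open>x\<close>.\<close>

lemma continuous_version_local: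
  fixes g :: "'a \<Rightarrow> real"
  assumes U: "openin X U" and g: "g \<in> borel_measurable (RM U)"
    and loc: "\<And>x e. \<lbrakk>x \<in> U; 0 < e\<rbrakk> \<Longrightarrow> \<exists>N u. openin X N \<and> x \<in> N \<and> N \<subseteq> U \<and> u \<in> Cont (subtopology X N) \<and>
      (AE y in M. y \<in> N \<longrightarrow> \<bar>u y - g y\<bar> \<le> e)"
  obtains g' where "g' \<in> Cont (subtopology X U)" "AE x in RM U. g' x = g x"
proof -
  \<comment> \<open>c is the essential limit of g at x; by full support it is unique.\<close>
  define Q where "Q x c \<longleftrightarrow> (\<forall>e>0. \<exists>N. openin X N \<and> x \<in> N \<and> N \<subseteq> U \<and> (AE y in M. y \<in> N \<longrightarrow> \<bar>g y - c\<bar> \<le> e))"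
    for x and c :: real
  have QD: "\<exists>N. openin X N \<and> x \<in> N \<and> N \<subseteq> U \<and> (AE y in M. y \<in> N \<longrightarrow> \<bar>g y - c\<bar> \<le> e)" if "Q x c" "0 < e" for x c e
    using that unfolding Q_def by simp
  have approx: "\<exists>c N. openin X N \<and> x \<in> N \<and> N \<subseteq> U \<and> (AE y in M. y \<in> N \<longrightarrow> \<bar>g y - c\<bar> \<le> e)"
    if x: "x \<in> U" and e: "0 < e" for x e
  proof -
    have e2: "0 < e/2" using e by simp
    from loc[OF x e2] obtain N u where N: "openin X N" "x \<in> N" "N \<subseteq> U" "u \<in> Cont (subtopology X N)"
      "AE y in M. y \<in> N \<longrightarrow> \<bar>u y - g y\<bar> \<le> e/2" by blast
    obtain N' where N': "openin X N'" "x \<in> N'" "N' \<subseteq> N" "\<forall>y\<in>N'. \<bar>u y - u x\<bar> < e/2"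
      by (rule Cont_nbhd[OF N(1,4,2) e2])
    have "AE y in M. y \<in> N' \<longrightarrow> \<bar>g y - u x\<bar> \<le> e" using N(5)
    proof eventually_elim
      case (elim y)
      show ?case
      proof
        assume y: "y \<in> N'"
        then have "\<bar>u y - g y\<bar> \<le> e/2" "\<bar>u y - u x\<bar> < e/2" using elim N'(3,4) by auto
        then show "\<bar>g y - u x\<bar> \<le> e" by linarith
      qed
    qed
    with N' N(3) show ?thesis by (intro exI[of _ "u x"] exI[of _ N']) auto
  qed
  have meet: "\<bar>c - c'\<bar> \<le> e + e'"
    if m: "openin X N" "openin X N'" "x \<in> N" "x \<in> N'" "AE y in M. y \<in> N \<longrightarrow> \<bar>g y - c\<bar> \<le> e" "AE y in M. y \<in> N' \<longrightarrow> \<bar>g y - c'\<bar> \<le> e'"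
    for N N' x c c' e e'
  proof -
    have "AE y in M. y \<in> N \<inter> N' \<longrightarrow> \<bar>g y - c\<bar> \<le> e \<and> \<bar>g y - c'\<bar> \<le> e'"
      using m(5,6) by eventually_elim auto
    then obtain y where "\<bar>g y - c\<bar> \<le> e \<and> \<bar>g y - c'\<bar> \<le> e'"
      by (rule AE_open_ex[OF openin_Int[OF m(1,2)] IntI[OF m(3,4)]])
    then show ?thesis by linarith
  qed
  have ex: "\<exists>c. Q x c" if x: "x \<in> U" for x
  proof -
    have "\<forall>n. \<exists>p. openin X (snd p) \<and> x \<in> snd p \<and> snd p \<subseteq> U \<and>
        (AE y in M. y \<in> snd p \<longrightarrow> \<bar>g y - fst p\<bar> \<le> 1 / real (Suc n))"
    proof
      fix n
      have "0 < 1 / real (Suc n)" by simp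
      from approx[OF x this] obtain c N where "openin X N" "x \<in> N" "N \<subseteq> U"
        "AE y in M. y \<in> N \<longrightarrow> \<bar>g y - c\<bar> \<le> 1 / real (Suc n)" by (elim exE conjE) (rule that)
      then show "\<exists>p. openin X (snd p) \<and> x \<in> snd p \<and> snd p \<subseteq> U \<and>
        (AE y in M. y \<in> snd p \<longrightarrow> \<bar>g y - fst p\<bar> \<le> 1 / real (Suc n))"
        by (intro exI[of _ "(c, N)"]) simp
    qed
    from choice[OF this] obtain p where p: "\<And>n. openin X (snd (p n))" "\<And>n. x \<in> snd (p n)" "\<And>n. snd (p n) \<subseteq> U"
        "\<And>n. AE y in M. y \<in> snd (p n) \<longrightarrow> \<bar>g y - fst (p n)\<bar> \<le> 1 / real (Suc n)" by auto
    define c where "c n = fst (p n)" for n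
    have d: "\<bar>c m - c n\<bar> \<le> 1 / real (Suc m) + 1 / real (Suc n)" for m n
      unfolding c_def by (rule meet[OF p(1) p(1) p(2) p(2) p(4) p(4)])
    have "Cauchy c"
    proof (rule CauchyI)
      fix e :: real assume e: "0 < e"
      obtain k where k: "1 / real (Suc k) < e / 2" using nat_approx_posE[of "e/2"] e by auto
      have "norm (c m - c n) < e" if "k \<le> m" "k \<le> n" for m n
      proof -
        have "1 / real (Suc m) \<le> 1 / real (Suc k)" "1 / real (Suc n) \<le> 1 / real (Suc k)"
          using that by (auto intro!: divide_left_mono)
        then show ?thesis using d[of m n] k by simp
      qed
      then show "\<exists>k. \<forall>m\<ge>k. \<forall>n\<ge>k. norm (c m - c n) < e" by blast
    qed
    from real_Cauchy_convergent[OF this] obtain l where l: "c \<longlonglongrightarrow> l" unfolding convergent_def ..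
    have "Q x l"
      unfolding Q_def
    proof (intro allI impI)
      fix e :: real assume e: "0 < e"
      then have "\<forall>\<^sub>F n in sequentially. dist (c n) l < e / 2" using tendstoD[OF l, of "e/2"] by simp
      moreover have "\<forall>\<^sub>F n in sequentially. 1 / real (Suc n) < e / 2"
        using order_tendstoD(2)[OF LIMSEQ_Suc[OF lim_1_over_n], of "e/2"] e by simp
      ultimately have "\<forall>\<^sub>F n in sequentially. dist (c n) l < e / 2 \<and> 1 / real (Suc n) < e / 2" by eventually_elim simp
      then obtain n where n: "dist (c n) l < e / 2" "1 / real (Suc n) < e / 2"
        unfolding eventually_sequentially by blast
      have "AE y in M. y \<in> snd (p n) \<longrightarrow> \<bar>g y - l\<bar> \<le> e" using p(4)[of n]
      proof eventually_elim
        case (elim y)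
        show ?case
        proof
          assume "y \<in> snd (p n)"
          then have "\<bar>g y - c n\<bar> \<le> 1 / real (Suc n)" using elim by (simp add: c_def)
          then show "\<bar>g y - l\<bar> \<le> e" using n unfolding dist_real_def by linarith
        qed
      qed
      then show "\<exists>N. openin X N \<and> x \<in> N \<and> N \<subseteq> U \<and> (AE y in M. y \<in> N \<longrightarrow> \<bar>g y - l\<bar> \<le> e)"
        using p(1-3)[of n] by (intro exI[of _ "snd (p n)"]) simp
    qed
    then show ?thesis ..
  qed
  define g' where "g' x = (SOME c. Q x c)" for x
  have g': "Q x (g' x)" if "x \<in> U" for x unfolding g'_def by (rule someI_ex[OF ex[OF that]])
  have near: "\<exists>N. openin X N \<and> x \<in> N \<and> N \<subseteq> U \<and> (\<forall>y\<in>N. \<bar>g' y - g' x\<bar> \<le> e) \<and> (AE y in M. y \<in> N \<longrightarrow> \<bar>g y - g' x\<bar> \<le> e)"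
    if x: "x \<in> U" and e: "0 < e" for x e
  proof -
    from QD[OF g'[OF x] e] obtain N where N: "openin X N" "x \<in> N" "N \<subseteq> U" "AE y in M. y \<in> N \<longrightarrow> \<bar>g y - g' x\<bar> \<le> e"
      by blast
    have "\<bar>g' y - g' x\<bar> \<le> e" if y: "y \<in> N" for y
    proof (rule field_le_epsilon)
      fix d :: real assume d: "0 < d"
      have yU: "y \<in> U" using y N(3) by blast
      from QD[OF g'[OF yU] d] obtain N' where N': "openin X N'" "y \<in> N'" "AE z in M. z \<in> N' \<longrightarrow> \<bar>g z - g' y\<bar> \<le> d"
        by blast
      show "\<bar>g' y - g' x\<bar> \<le> e + d" using meet[OF N'(1) N(1) N'(2) y N'(3) N(4)] by simp
    qed
    with N show ?thesis by blast
  qed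
  have "continuous_map (subtopology X U) euclideanreal g'"
    unfolding continuous_map
  proof (intro conjI allI impI)
    fix S :: "real set" assume S: "openin euclideanreal S"
    have "openin X {x \<in> U. g' x \<in> S}"
    proof (subst openin_subopen, intro ballI)
      fix x assume x: "x \<in> {x \<in> U. g' x \<in> S}"
      have "open S" "g' x \<in> S" using S x by auto
      then obtain e where e: "0 < e" "ball (g' x) e \<subseteq> S" by (rule openE)
      have "0 < e / 2" "x \<in> U" using e x by auto
      from near[OF this(2,1)] obtain N where "openin X N" "x \<in> N" "N \<subseteq> U" "\<forall>y\<in>N. \<bar>g' y - g' x\<bar> \<le> e / 2"
        by (elim exE conjE) (rule that)
      moreover from this(4) have "\<forall>y\<in>N. g' y \<in> ball (g' x) e"
        using e(1) by (auto simp: dist_real_def abs_minus_commute)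
      ultimately show "\<exists>T. openin X T \<and> x \<in> T \<and> T \<subseteq> {x \<in> U. g' x \<in> S}"
        using e(2) by (intro exI[of _ N]) auto
    qed
    moreover have "{x \<in> topspace (subtopology X U). g' x \<in> S} = {x \<in> U. g' x \<in> S}"
      using openin_subset[OF U] by auto
    ultimately show "openin (subtopology X U) {x \<in> topspace (subtopology X U). g' x \<in> S}"
      using U by (auto simp: openin_open_subtopology)
  qed simp
  then have C: "g' \<in> Cont (subtopology X U)" by (simp add: Cont_def)
  have gm': "g' \<in> borel_measurable (RM U)" by (rule Cont_measurable_R[OF U C])
  have "AE x in M. x \<in> U \<longrightarrow> \<bar>g' x - g x\<bar> \<le> 1 / real (Suc n)" for n
  proof (rule AE_local[OF U])
    have "{x \<in> space (RM U). \<not> \<bar>g' x - g x\<bar> \<le> 1 / real (Suc n)} \<in> sets (RM U)"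
      using gm' g by measurable
    then show "{x \<in> U. \<not> \<bar>g' x - g x\<bar> \<le> 1 / real (Suc n)} \<in> sets M"
      using openin_subset[OF U] Um[OF U] by (simp add: space_restrict_space sets_restrict_space_iff Int_absorb2)
    fix x assume x: "x \<in> U"
    have "0 < 1 / (2 * real (Suc n))" by simp
    from near[OF x this] obtain N where N: "openin X N" "x \<in> N" "\<forall>y\<in>N. \<bar>g' y - g' x\<bar> \<le> 1 / (2 * real (Suc n))"
        "AE y in M. y \<in> N \<longrightarrow> \<bar>g y - g' x\<bar> \<le> 1 / (2 * real (Suc n))"
      by (elim exE conjE) (rule that)
    have "AE y in M. y \<in> N \<longrightarrow> y \<in> U \<longrightarrow> \<bar>g' y - g y\<bar> \<le> 1 / real (Suc n)" using N(4)
    proof eventually_elim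
      case (elim y)
      show ?case
      proof (intro impI)
        assume "y \<in> N"
        then have le: "\<bar>g' y - g' x\<bar> \<le> 1 / (2 * real (Suc n))" "\<bar>g y - g' x\<bar> \<le> 1 / (2 * real (Suc n))"
          using elim N(3) by auto
        have "\<bar>g' y - g y\<bar> \<le> a + a" if "\<bar>g' y - g' x\<bar> \<le> a" "\<bar>g y - g' x\<bar> \<le> a" for a
          using that by linarith
        from this[OF le] show "\<bar>g' y - g y\<bar> \<le> 1 / real (Suc n)" by (simp add: field_simps)
      qed
    qed
    then show "\<exists>W. openin X W \<and> x \<in> W \<and> (AE y in M. y \<in> W \<longrightarrow> y \<in> U \<longrightarrow> \<bar>g' y - g y\<bar> \<le> 1 / real (Suc n))"
      using N(1,2) by blast
  qed
  then have "AE x in M. \<forall>n. x \<in> U \<longrightarrow> \<bar>g' x - g x\<bar> \<le> 1 / real (Suc n)"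
    unfolding AE_all_countable by blast
  then have "AE x in RM U. g' x = g x"
    unfolding AE_restrict_iff[OF Um[OF U]]
  proof eventually_elim
    case (elim x)
    show ?case
    proof
      assume "x \<in> U"
      then have le: "\<bar>g' x - g x\<bar> \<le> 1 / real (Suc n)" for n using elim by blast
      have "\<bar>g' x - g x\<bar> \<le> 0"
        by (rule LIMSEQ_le_const[OF LIMSEQ_Suc[OF lim_1_over_n]]) (use le in blast)
      then show "g' x = g x" by simp
    qed
  qed
  with C show ?thesis by (rule that)
qed

end

text \<open>The resolvent identity for the normalised \<open>res b = b (H + b)^-1\<close>:
  \<open>g = res b f\<close> satisfies \<open>(H + c) g = c g + b (f - g)\<close>, so
  \<open>g\<close> is \<open>res c\<close> of \<open>g + (b / c) (f - g)\<close>.\<close>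

lemma (in dform) res_identity:
  assumes b: "0 < b" and c: "0 < c" and f: "f \<in> L2 M"
  shows "AE x in M. res c (res b f) x - res b f x = b / c * res c (res b f - f) x"
proof -
  define g where "g = res b f"
  have gF: "g \<in> F" unfolding g_def using b f by (rule res_F)
  have g: "g \<in> L2 M" by (rule F_L2[OF gF])
  have fg: "f - g \<in> L2 M" by (rule L2.S_diff[OF f g])
  define h where "h = g + (b / c) *\<^sub>R (f - g)"
  have h: "h \<in> L2 M" unfolding h_def by (rule L2.S_add[OF g L2.S_scale[OF fg]])
  have "AE x in M. res c h x = g x"
  proof (rule res_unique[OF c h gF])
    fix v assume v: "v \<in> F"
    have vL: "v \<in> L2 M" by (rule F_L2[OF v])
    have "E g v + b * ip2 M g v = b * ip2 M f v" unfolding g_def by (rule res_eq[OF b f v])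
    moreover have "ip2 M h v = ip2 M g v + b / c * (ip2 M f v - ip2 M g v)"
      unfolding h_def using f g fg vL by (simp add: L2.ip_add_left L2.ip_scale_left L2.ip_diff_left L2.S_scale)
    then have "c * ip2 M h v = c * ip2 M g v + b * (ip2 M f v - ip2 M g v)" using c by (simp add: distrib_left)
    ultimately show "E g v + c * ip2 M g v = c * ip2 M h v" by (simp add: algebra_simps)
  qed
  moreover have "res c h = res c g + (b / c) *\<^sub>R res c (f - g)"
    unfolding h_def by (simp only: res_add[OF c g L2.S_scale[OF fg]] res_scale[OF c fg])
  moreover have "res c (g - f) = (- 1) *\<^sub>R res c (f - g)"
    using res_scale[OF c fg, of "- 1"] by simp
  ultimately show ?thesis unfolding g_def[symmetric]
    by (auto elim!: eventually_mono)
qed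

context dirichlet
begin

context
  fixes U assumes U: "openin X U"
begin

interpretation r: dform "R U" by (rule dform_R[OF U])

lemmas rs_identity = r.res_identity[folded rs_def, unfolded R_simps]

lemma rs_abs:
  assumes b: "0 < b" and f: "f \<in> L2 (RM U)" and le: "AE x in RM U. \<bar>f x\<bar> \<le> C" and C: "0 \<le> C"
  shows "AE x in RM U. \<bar>rs U b f x\<bar> \<le> C"
proof -
  have "AE x in RM U. rs U b f x \<le> C"
    by (rule rs_max[OF U b f C]) (use le in \<open>auto elim: eventually_mono\<close>)
  moreover have "AE x in RM U. rs U b ((- 1) *\<^sub>R f) x \<le> C"
    by (rule rs_max[OF U b L2.S_scale[OF f] C]) (use le in \<open>auto elim: eventually_mono\<close>)
  ultimately show ?thesis unfolding rs_scale[OF U b f] by eventually_elim simp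
qed

lemma heat_L2:
  assumes t: "0 < t" and f: "f \<in> L2 (RM U)" shows "AE x in RM U. heat (R U) t f x = Pt U t f x"
proof -
  let ?p = "\<lambda>x. max (f x) 0" and ?m = "\<lambda>x. max (- f x) 0"
  have p: "?p \<in> L2 (RM U)" by (rule L2_dominated[OF _ f]) (use f in auto)
  have m: "?m \<in> L2 (RM U)" by (rule L2_dominated[OF _ f]) (use f in auto)
  have e: "f = ?p - ?m" by (auto simp: fun_eq_iff max_def)
  have "AE x in RM U. Pt U t (?p - ?m) x = Pt U t ?p x - Pt U t ?m x" by (rule Pt_diff[OF U _ p m]) (use t in simp)
  moreover have "AE x in RM U. hn U t ?p x = Pt U t ?p x" by (rule hn_L2[OF U t p]) simp
  moreover have "AE x in RM U. hn U t ?m x = Pt U t ?m x" by (rule hn_L2[OF U t m]) simp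
  ultimately show ?thesis unfolding e[symmetric] by eventually_elim (simp add: heat_def)
qed

text \<open>H maps \<open>rs U b f\<close> to \<open>b (f - rs U b f)\<close>, which is bounded by
  \<open>2 b C\<close>, so the orbit moves with at most this speed in the supremum norm. Each of
  \<open>n\<close> Euler steps of length \<open>t / n\<close> contributes at most
  \<open>2 b C t / n\<close>.\<close>

lemma Pt_rs_near:
  assumes b: "0 < b" and t: "0 < t" and f: "f \<in> L2 (RM U)" and le: "AE x in RM U. \<bar>f x\<bar> \<le> C" and C: "0 \<le> C"
  shows "AE x in RM U. \<bar>Pt U t (rs U b f) x - rs U b f x\<bar> \<le> 2 * b * C * t"
proof -
  define g where "g = rs U b f"
  have g: "g \<in> L2 (RM U)" unfolding g_def by (rule rs_L2[OF U b f])
  have gC: "AE x in RM U. \<bar>g x\<bar> \<le> C" unfolding g_def by (rule rs_abs[OF b f le C])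
  have gf: "AE x in RM U. \<bar>(g - f) x\<bar> \<le> 2 * C" using le gC by eventually_elim simp
  have step: "AE x in RM U. \<bar>(rs U c g - g) x\<bar> \<le> b / c * (2 * C)" if c: "0 < c" for c
  proof -
    have "AE x in RM U. \<bar>rs U c (g - f) x\<bar> \<le> 2 * C"
      by (rule rs_abs[OF c L2.S_diff[OF g f] gf]) (use C in simp)
    then show ?thesis using rs_identity[OF b c f] unfolding g_def[symmetric]
    proof eventually_elim
      case (elim x)
      have "\<bar>b / c * rs U c (g - f) x\<bar> = b / c * \<bar>rs U c (g - f) x\<bar>" using b c by (simp add: abs_mult)
      also have "\<dots> \<le> b / c * (2 * C)" using elim(1) b c by (intro mult_left_mono) auto
      finally show ?case using elim(2) by simp
    qed
  qed
  have iter: "AE x in RM U. \<bar>((rs U c ^^ n) g - g) x\<bar> \<le> real n * (b / c * (2 * C))" if c: "0 < c" for c n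
  proof (induction n)
    case (Suc n)
    have gn: "(rs U c ^^ n) g \<in> L2 (RM U)" by (rule rsn_L2[OF U c g])
    have "AE x in RM U. \<bar>rs U c ((rs U c ^^ n) g - g) x\<bar> \<le> real n * (b / c * (2 * C))"
      by (rule rs_abs[OF c L2.S_diff[OF gn g] Suc]) (use b c C in simp)
    then show ?case using step[OF c] unfolding rs_diff[OF U c gn g]
    proof eventually_elim
      case (elim x)
      have "real (Suc n) * (b / c * (2 * C)) = real n * (b / c * (2 * C)) + b / c * (2 * C)"
        by (simp only: of_nat_Suc distrib_right mult_1_left add.commute)
      moreover have "((rs U c ^^ Suc n) g - g) x = (rs U c ((rs U c ^^ n) g) - rs U c g) x + (rs U c g - g) x" by simp
      ultimately show ?case using elim by linarith
    qed
  qed simp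
  have c: "0 < real (Suc n) / t" for n using t by simp
  have e: "real (Suc n) * (b / (real (Suc n) / t) * (2 * C)) = 2 * b * C * t" for n by (simp add: field_simps)
  have near: "AE x in RM U. \<bar>((rs U (real (Suc n) / t) ^^ Suc n) g - g) x\<bar> \<le> 2 * b * C * t" for n
    using iter[OF c[of n], of "Suc n"] unfolding e .
  have L: "(rs U (real (Suc n) / t) ^^ Suc n) g \<in> L2 (RM U)" for n by (rule rsn_L2[OF U c g])
  have PL: "Pt U t g \<in> L2 (RM U)" by (rule Pt_L2[OF U _ g]) (use t in simp)
  have lim: "(\<lambda>n. nrm2 (RM U) ((rs U (real (Suc n) / t) ^^ Suc n) g - Pt U t g)) \<longlonglongrightarrow> 0"
    by (rule Pt_Euler[OF U g t])
  have "AE x in RM U. Pt U t g x \<le> g x + 2 * b * C * t"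
  proof (rule limit_le_measurable[OF L PL _ _ lim])
    show "(\<lambda>x. g x + 2 * b * C * t) \<in> borel_measurable (RM U)" using g by simp
    show "AE x in RM U. (rs U (real (Suc n) / t) ^^ Suc n) g x \<le> g x + 2 * b * C * t" for n
      using near[of n] by eventually_elim (simp del: funpow.simps)
  qed
  moreover have "AE x in RM U. ((- 1) *\<^sub>R Pt U t g) x \<le> - g x + 2 * b * C * t"
  proof (rule limit_le_measurable[OF L2.S_scale[OF L] L2.S_scale[OF PL]])
    have "nrm2 (RM U) ((- 1) *\<^sub>R ((rs U (real (Suc n) / t) ^^ Suc n) g - Pt U t g))
        = nrm2 (RM U) ((rs U (real (Suc n) / t) ^^ Suc n) g - Pt U t g)" for n
      using L2.nrm_scale[OF L2.S_diff[OF L[of n] PL], of "- 1"] by (simp del: funpow.simps)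
    then show "(\<lambda>n. nrm2 (RM U) ((- 1) *\<^sub>R (rs U (real (Suc n) / t) ^^ Suc n) g - (- 1) *\<^sub>R Pt U t g)) \<longlonglongrightarrow> 0"
      using lim unfolding scaleR_diff_right[symmetric] by (simp only:)
    show "(\<lambda>x. - g x + 2 * b * C * t) \<in> borel_measurable (RM U)" using g by simp
    show "AE x in RM U. ((- 1) *\<^sub>R (rs U (real (Suc n) / t) ^^ Suc n) g) x \<le> - g x + 2 * b * C * t" for n
      using near[of n] by eventually_elim (simp del: funpow.simps)
  qed
  ultimately show ?thesis unfolding g_def[symmetric] by eventually_elim auto
qed

lemma Pt_Cont:
  assumes df: "doubly_feller (R U)" and t: "0 < t" and f: "f \<in> L2 (RM U)" and le: "AE x in RM U. \<bar>f x\<bar> \<le> C"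
  obtains u where "u \<in> Cont (subtopology X U)" "AE x in RM U. u x = Pt U t f x"
proof -
  have "f \<in> Linf (RM U)" unfolding Linf_def using f le by auto
  then obtain u where u: "u \<in> Cont (subtopology X U)" "AE x in RM U. u x = heat (R U) t f x"
    using df t unfolding doubly_feller_def R_simps by blast
  have "AE x in RM U. u x = Pt U t f x" using u(2) heat_L2[OF t f] by eventually_elim simp
  with u(1) show ?thesis by (rule that)
qed

text \<open>For \<open>t > 0\<close> the semigroup maps bounded functions to continuous ones, and
  \<open>Pt U t (rs U b f)\<close> is uniformly close to \<open>rs U b f\<close> for small
  \<open>t\<close>.\<close>

lemma rs_Cont:
  assumes df: "doubly_feller (R U)" and b: "0 < b" and f: "f \<in> L2 (RM U)" and le: "AE x in RM U. \<bar>f x\<bar> \<le> C"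
    and C: "0 \<le> C"
  obtains u where "u \<in> Cont (subtopology X U)" "AE x in RM U. u x = rs U b f x"
proof (rule continuous_version_local[OF U])
  have g: "rs U b f \<in> L2 (RM U)" by (rule rs_L2[OF U b f])
  then show "rs U b f \<in> borel_measurable (RM U)" by simp
  fix x and e :: real assume x: "x \<in> U" and e: "0 < e"
  \<comment> \<open>The 1 covers the case \<open>C = 0\<close>.\<close>
  define t where "t = e / (2 * b * C + 1)"
  have bC: "0 \<le> 2 * b * C" using b C by simp
  have t: "0 < t" "2 * b * C * t \<le> e" using e bC by (simp_all add: t_def field_simps)
  obtain u where u: "u \<in> Cont (subtopology X U)" "AE x in RM U. u x = Pt U t (rs U b f) x"
    by (rule Pt_Cont[OF df t(1) g rs_abs[OF b f le C]])
  have "AE x in RM U. \<bar>u x - rs U b f x\<bar> \<le> e"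
    using u(2) Pt_rs_near[OF b t(1) f le C] by eventually_elim (use t(2) in simp)
  then have "AE y in M. y \<in> U \<longrightarrow> \<bar>u y - rs U b f y\<bar> \<le> e"
    unfolding AE_restrict_iff[OF Um[OF U]] .
  then show "\<exists>N u. openin X N \<and> x \<in> N \<and> N \<subseteq> U \<and> u \<in> Cont (subtopology X N) \<and>
      (AE y in M. y \<in> N \<longrightarrow> \<bar>u y - rs U b f y\<bar> \<le> e)"
    using u(1) U x by (intro exI[of _ U] exI[of _ u]) simp
qed (rule that)

end

lemma nbhd_sequence:
  assumes U: "openin X U" and x: "x \<in> U"
  obtains N :: "nat \<Rightarrow> 'a set" where "\<forall>k. openin X (N k) \<and> x \<in> N k \<and> N k \<subseteq> U \<and> emeasure M (N k) < \<infinity>"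
    "\<forall>W. openin X W \<longrightarrow> x \<in> W \<longrightarrow> (\<exists>K. \<forall>k\<ge>K. N k \<subseteq> W)"
proof -
  obtain S d where "Metric_space S d" and Xd: "X = Metric_space.mtopology S d"
    using metr unfolding metrizable_space_def by blast
  then interpret Metric_space S d by simp
  have xX: "x \<in> topspace X" using x openin_subset[OF U] by blast
  have "compactin X {x}" using xX by simp
  then obtain N0 where N0: "openin X N0" "{x} \<subseteq> N0" "X closure_of N0 \<subseteq> U" "compactin X (X closure_of N0)"
    by (rule compact_nbhd[OF _ U]) (use x in simp)
  have N0c: "N0 \<subseteq> X closure_of N0" using N0(1) by (simp add: closure_of_subset openin_subset)
  define N where "N k = N0 \<inter> mball x (1 / real (Suc k))" for k
  have xS: "x \<in> S" using xX by (simp add: Xd)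
  show ?thesis
  proof (rule that[of N])
    show "\<forall>k. openin X (N k) \<and> x \<in> N k \<and> N k \<subseteq> U \<and> emeasure M (N k) < \<infinity>"
    proof
      fix k
      have "openin X (N k)" unfolding N_def using N0(1) by (intro openin_Int) (simp_all add: Xd)
      moreover have "x \<in> N k" using N0(2) xS by (simp add: N_def)
      moreover have NN: "N k \<subseteq> X closure_of N0" using N0c by (auto simp: N_def)
      moreover have "emeasure M (N k) \<le> emeasure M (X closure_of N0)"
        by (rule emeasure_mono[OF NN compact_sets[OF N0(4)]])
      ultimately show "openin X (N k) \<and> x \<in> N k \<and> N k \<subseteq> U \<and> emeasure M (N k) < \<infinity>"
        using N0(3) compact_finite[OF N0(4)] by (auto intro: le_less_trans)
    qed
    show "\<forall>W. openin X W \<longrightarrow> x \<in> W \<longrightarrow> (\<exists>K. \<forall>k\<ge>K. N k \<subseteq> W)"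
    proof (intro allI impI)
      fix W assume "openin X W" "x \<in> W"
      then obtain e where e: "0 < e" "mball x e \<subseteq> W" unfolding Xd openin_mtopology by blast
      obtain K where K: "1 / real (Suc K) < e" using nat_approx_posE[OF e(1)] by blast
      have "N k \<subseteq> W" if "K \<le> k" for k
      proof -
        have "1 / real (Suc k) \<le> 1 / real (Suc K)" using that by (intro divide_left_mono) auto
        then have "mball x (1 / real (Suc k)) \<subseteq> mball x e" using K by (intro mball_subset_concentric) linarith
        then show ?thesis using e(2) by (auto simp: N_def)
      qed
      then show "\<exists>K. \<forall>k\<ge>K. N k \<subseteq> W" by blast
    qed
  qed
qed

text \<open>Normalised indicators of shrinking neighbourhoods of \<open>x\<close> stand in for the
  evaluation at \<open>x\<close>, which is not a functional on \<open>L2\<close>.\<close>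

lemma point_averages:
  assumes U: "openin X U" and x: "x \<in> U"
  obtains a :: "nat \<Rightarrow> 'a \<Rightarrow> real" where "\<forall>k. a k \<in> L2 (RM U)"
    "\<forall>k f B. f \<in> L2 (RM U) \<longrightarrow> (AE y in RM U. \<bar>f y\<bar> \<le> B) \<longrightarrow> \<bar>ip2 (RM U) (a k) f\<bar> \<le> B"
    "\<forall>u f. u \<in> Cont (subtopology X U) \<longrightarrow> f \<in> L2 (RM U) \<longrightarrow> (AE y in RM U. u y = f y) \<longrightarrow>
      (\<lambda>k. ip2 (RM U) (a k) f) \<longlonglongrightarrow> u x"
proof -
  obtain N :: "nat \<Rightarrow> 'a set" where N: "\<forall>k. openin X (N k) \<and> x \<in> N k \<and> N k \<subseteq> U \<and> emeasure M (N k) < \<infinity>"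
    "\<forall>W. openin X W \<longrightarrow> x \<in> W \<longrightarrow> (\<exists>K. \<forall>k\<ge>K. N k \<subseteq> W)"
    by (rule nbhd_sequence[OF U x])
  have NmU: "N k \<in> sets (RM U)" for k
    using N(1) by (auto simp: sets_restrict_space intro!: image_eqI[of _ _ "N k"])
  have em: "emeasure (RM U) (N k) = emeasure M (N k)" for k
    using N(1) Um[OF U] openin_subset[OF U] by (intro emeasure_restrict_space) (auto simp: Int_absorb2)
  define m where "m k = measure (RM U) (N k)" for k
  have "0 < emeasure M (N k)" for k using full N(1) unfolding full_support_def by blast
  then have m: "0 < m k" for k unfolding m_def measure_def em using N(1)
    by (auto simp: enn2real_positive_iff)
  define a where "a k = (\<lambda>y. indicator (N k) y / m k)" for k
  have fin: "emeasure (RM U) (N k) < \<infinity>" for k using N(1) em by simp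
  have ai: "integrable (RM U) (a k)" for k unfolding a_def
    by (intro integrable_divide integrable_real_indicator NmU fin)
  have a1: "(\<integral>y. a k y \<partial>RM U) = 1" for k unfolding a_def using m[of k] NmU[of k]
    by (simp add: m_def Int_absorb1 sets.sets_into_space)
  have aL: "a k \<in> L2 (RM U)" for k
  proof -
    have "(\<lambda>y. (a k y)\<^sup>2) = (\<lambda>y. a k y / m k)" by (auto simp: a_def fun_eq_iff indicator_def power2_eq_square)
    then show ?thesis unfolding L2_def using ai[of k] by simp
  qed
  have a0: "0 \<le> a k y" for k y using m[of k] by (simp add: a_def)
  have near: "\<bar>ip2 (RM U) (a k) f - c\<bar> \<le> e"
    if f: "f \<in> L2 (RM U)" and le: "AE y in RM U. y \<in> N k \<longrightarrow> \<bar>f y - c\<bar> \<le> e" for f k c e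
  proof -
    have i: "integrable (RM U) (\<lambda>y. a k y * f y)" by (rule L2_mult[OF aL f])
    have "(\<integral>y. a k y * f y \<partial>RM U) \<le> (\<integral>y. a k y * (c + e) \<partial>RM U)"
    proof (rule integral_mono_AE[OF i])
      show "AE y in RM U. a k y * f y \<le> a k y * (c + e)" using le
        by eventually_elim (use m[of k] in \<open>auto simp: a_def indicator_def divide_right_mono\<close>)
    qed (use ai in simp)
    moreover have "(\<integral>y. a k y * (c - e) \<partial>RM U) \<le> (\<integral>y. a k y * f y \<partial>RM U)"
    proof (rule integral_mono_AE[OF _ i])
      show "AE y in RM U. a k y * (c - e) \<le> a k y * f y" using le
        by eventually_elim (use m[of k] in \<open>auto simp: a_def indicator_def divide_right_mono\<close>)
    qed (use ai in simp)
    ultimately show ?thesis using a1[of k] by (simp add: ip2_def abs_le_iff)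
  qed
  show ?thesis
  proof (rule that[of a])
    show "\<forall>k. a k \<in> L2 (RM U)" using aL by blast
    show "\<forall>k f B. f \<in> L2 (RM U) \<longrightarrow> (AE y in RM U. \<bar>f y\<bar> \<le> B) \<longrightarrow> \<bar>ip2 (RM U) (a k) f\<bar> \<le> B"
    proof (intro allI impI)
      fix k f B assume "f \<in> L2 (RM U)" "AE y in RM U. \<bar>f y\<bar> \<le> B"
      then show "\<bar>ip2 (RM U) (a k) f\<bar> \<le> B" using near[of f k 0 B] by (simp add: eventually_mono)
    qed
    show "\<forall>u f. u \<in> Cont (subtopology X U) \<longrightarrow> f \<in> L2 (RM U) \<longrightarrow> (AE y in RM U. u y = f y) \<longrightarrow>
      (\<lambda>k. ip2 (RM U) (a k) f) \<longlonglongrightarrow> u x"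
    proof (intro allI impI LIMSEQ_I)
      fix u f and r :: real
      assume u: "u \<in> Cont (subtopology X U)" and f: "f \<in> L2 (RM U)" and uf: "AE y in RM U. u y = f y" and r: "0 < r"
      then have r2: "0 < r / 2" by simp
      obtain W where W: "openin X W" "x \<in> W" "W \<subseteq> U" "\<forall>y\<in>W. \<bar>u y - u x\<bar> < r / 2"
        by (rule Cont_nbhd[OF U u x r2])
      then obtain K where K: "\<forall>k\<ge>K. N k \<subseteq> W" using N(2) by blast
      have "norm (ip2 (RM U) (a k) f - u x) < r" if "K \<le> k" for k
      proof -
        have "AE y in RM U. y \<in> N k \<longrightarrow> \<bar>f y - u x\<bar> \<le> r / 2" using uf
        proof eventually_elim
          case (elim y)
          show ?case
          proof
            assume "y \<in> N k"
            then have "\<bar>u y - u x\<bar> < r / 2" using K that W(4) by blast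
            then show "\<bar>f y - u x\<bar> \<le> r / 2" using elim by simp
          qed
        qed
        from near[OF f this] r show ?thesis by simp
      qed
      then show "\<exists>no. \<forall>k\<ge>no. norm (ip2 (RM U) (a k) f - u x) < r" by blast
    qed
  qed
qed

lemma Pt_abs:
  assumes U: "openin X U" and t: "0 < t" and f: "f \<in> L2 (RM U)" and C: "0 \<le> C" and le: "AE x in RM U. \<bar>f x\<bar> \<le> C"
  shows "AE x in RM U. \<bar>Pt U t f x\<bar> \<le> C"
proof -
  have "AE x in RM U. Pt U t f x \<le> C"
    by (rule Pt_max[OF U t f C]) (use le in \<open>auto elim: eventually_mono\<close>)
  moreover have "AE x in RM U. Pt U t ((- 1) *\<^sub>R f) x \<le> C"
    by (rule Pt_max[OF U t L2.S_scale[OF f] C]) (use le in \<open>auto elim: eventually_mono\<close>)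
  moreover have "AE x in RM U. Pt U t ((- 1) *\<^sub>R f) x = - Pt U t f x"
    using Pt_lin[OF U _ f L2.S_0, of t "- 1" 0] t by simp
  ultimately show ?thesis by eventually_elim simp
qed

lemma core_C0:
  assumes U: "openin X U" and p: "p \<in> core U" shows "p \<in> C0 (subtopology X U)"
  unfolding C0_def
proof (intro CollectI conjI allI impI)
  note c = core_dest[OF p]
  show "p \<in> Cont (subtopology X U)" using c(2) by (simp add: Cont_def continuous_map_from_subtopology)
  fix e :: real assume e: "0 < e"
  let ?A = "{x \<in> topspace (subtopology X U). e \<le> \<bar>p x\<bar>}"
  have "closedin X {x \<in> topspace X. p x \<in> {y. e \<le> \<bar>y\<bar>}}"
  proof (rule closedin_continuous_map_preimage[of _ euclideanreal])
    show "continuous_map X euclideanreal p" using c(2) by (simp add: Cont_def)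
    show "closedin euclideanreal {y::real. e \<le> \<bar>y\<bar>}" by (auto intro!: closed_Collect_le continuous_intros)
  qed
  moreover have sub: "{x \<in> topspace X. p x \<in> {y. e \<le> \<bar>y\<bar>}} \<subseteq> top_support X p"
    using core_zero[OF p] e by force
  ultimately have "compactin X {x \<in> topspace X. p x \<in> {y. e \<le> \<bar>y\<bar>}}"
    using closed_compactin c(3) by blast
  moreover have "?A = {x \<in> topspace X. p x \<in> {y. e \<le> \<bar>y\<bar>}}" using sub c(4) by auto
  ultimately show "compactin (subtopology X U) ?A" by (auto simp: compactin_subtopology)
qed

text \<open>\<open>(rs U b p)(x)\<close> is the integral of \<open>b e\<^sup>-\<^sup>b\<^sup>t (P\<^sub>t p)(x)\<close> over t. To avoid measurability in t
  of the pointwise values, the integral is taken for averages over small neighbourhoods of x,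
  where the semigroup is continuous in t, and the limit is taken by dominated convergence.\<close>

lemma rs_pointwise:
  assumes U: "openin X U" and df: "doubly_feller (R U)" and p: "p \<in> core U" and p1: "\<forall>x\<in>topspace X. \<bar>p x\<bar> \<le> 1"
    and x: "x \<in> U" and e: "0 < e"
  obtains b0 where "0 < b0" "\<forall>b\<ge>b0. \<forall>w\<in>Cont (subtopology X U). (AE y in RM U. w y = rs U b p y) \<longrightarrow> \<bar>w x - p x\<bar> \<le> e"
proof -
  have pL: "p \<in> L2 (RM U)" by (rule L2R_of_L2[OF U F_L2[OF core_dest(1)[OF p]]])
  have pC: "p \<in> C0 (subtopology X U)" by (rule core_C0[OF U p])
  have ple: "AE y in RM U. \<bar>p y\<bar> \<le> 1" by (rule AE_I2) (use p1 in \<open>simp add: space_restrict_space\<close>)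
  have "\<forall>t. \<exists>u. 0 < t \<longrightarrow> u \<in> Cont (subtopology X U) \<and> (AE y in RM U. u y = Pt U t p y)"
  proof
    fix t :: real
    show "\<exists>u. 0 < t \<longrightarrow> u \<in> Cont (subtopology X U) \<and> (AE y in RM U. u y = Pt U t p y)"
    proof (cases "0 < t")
      case True
      obtain u where "u \<in> Cont (subtopology X U)" "AE y in RM U. u y = Pt U t p y"
        by (rule Pt_Cont[OF U df True pL ple])
      then show ?thesis by blast
    qed simp
  qed
  from choice[OF this] obtain u where u: "\<And>t. 0 < t \<Longrightarrow> u t \<in> Cont (subtopology X U)"
      "\<And>t. 0 < t \<Longrightarrow> AE y in RM U. u t y = Pt U t p y" by blast
  have "AE y in RM U. u t y = heat (R U) t p y" if "0 < t" for t
    using u(2)[OF that] heat_L2[OF U that pL] by eventually_elim simp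
  then have "((\<lambda>t. u t x) \<longlongrightarrow> p x) (at_right 0)"
    using df pC u(1) x openin_subset[OF U] unfolding doubly_feller_def R_simps by auto
  then have "\<forall>\<^sub>F t in at_right 0. dist (u t x) (p x) < e / 2" using tendstoD[of _ _ _ "e/2"] e by simp
  then obtain T where T: "0 < T" "\<forall>t>0. t < T \<longrightarrow> dist (u t x) (p x) < e / 2"
    unfolding eventually_at_right_field by blast
  \<comment> \<open>Half of \<open>T\<close>, so that the estimate holds up to and including
    \<open>T'\<close>.\<close>
  define T' where "T' = T / 2"
  have T': "0 < T'" "\<And>t. 0 < t \<Longrightarrow> t \<le> T' \<Longrightarrow> \<bar>u t x - p x\<bar> \<le> e / 2"
    using T by (auto simp: T'_def dist_real_def less_imp_le)
  obtain a :: "nat \<Rightarrow> 'a \<Rightarrow> real" where a: "\<forall>k. a k \<in> L2 (RM U)"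
    "\<forall>k f B. f \<in> L2 (RM U) \<longrightarrow> (AE y in RM U. \<bar>f y\<bar> \<le> B) \<longrightarrow> \<bar>ip2 (RM U) (a k) f\<bar> \<le> B"
    "\<forall>u f. u \<in> Cont (subtopology X U) \<longrightarrow> f \<in> L2 (RM U) \<longrightarrow> (AE y in RM U. u y = f y) \<longrightarrow>
      (\<lambda>k. ip2 (RM U) (a k) f) \<longlonglongrightarrow> u x"
    by (rule point_averages[OF U x])
  \<comment> \<open>One \<open>exp (- b * T')\<close> bounds the part of the Laplace integral after
    \<open>T'\<close>, the other the mass that the weight \<open>b e^(-b t)\<close> lacks on the
    interval up to \<open>T'\<close>.\<close>
  have est: "\<bar>w x - p x\<bar> \<le> e / 2 + 2 * exp (- b * T')"
    if b: "0 < b" and w: "w \<in> Cont (subtopology X U)" "AE y in RM U. w y = rs U b p y" for b w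
  proof -
    let ?g = "rs U b p"
    have g: "?g \<in> L2 (RM U)" by (rule rs_L2[OF U b pL])
    have g1: "AE y in RM U. \<bar>?g y\<bar> \<le> 1" by (rule rs_abs[OF U b pL ple]) simp
    define l where "l t = (if t = 0 then p x else u t x)" for t
    define f where "f k t = b * exp (- b * t) * ip2 (RM U) (a k) (Pt U t p)" for k t
    define G where "G k t = exp (- b * t) * ip2 (RM U) (a k) (Pt U t ?g)" for k t
    have P0: "AE y in RM U. Pt U 0 h y = h y" if "h \<in> L2 (RM U)" for h by (rule Pt_0[OF U that])
    have cont: "continuous_on {0..T'} (\<lambda>t. ip2 (RM U) (a k) (Pt U t h))" if "h \<in> L2 (RM U)" for k h
      by (rule continuous_on_subset[OF Pt_cont[OF U that]]) (use a(1) in auto)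
    have hint: "(f k has_integral G k 0 - G k T') {0..T'}" for k
    proof -
      have "((\<lambda>t. - (f k t)) has_integral G k T' - G k 0) {0..T'}"
      proof (rule fundamental_theorem_of_calculus_interior)
        show "continuous_on {0..T'} (G k)" unfolding G_def by (intro continuous_intros cont g)
        fix t assume "t \<in> {0<..<T'}"
        then have t: "0 < t" by simp
        show "(G k has_vector_derivative - f k t) (at t)"
          using rs_deriv[OF U b pL _ t, of "a k"] a(1)
          unfolding has_real_derivative_iff_has_vector_derivative G_def f_def by simp
      qed (use T'(1) in simp)
      from has_integral_neg[OF this] show ?thesis by simp
    qed
    have conv: "(\<lambda>k. ip2 (RM U) (a k) (Pt U t p)) \<longlonglongrightarrow> l t" if "0 \<le> t" for t
    proof (cases "t = 0")
      case True
      have "Pt U 0 p \<in> L2 (RM U)" using Pt_L2[OF U _ pL] by simp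
      moreover have "AE y in RM U. p y = Pt U 0 p y" using P0[OF pL] by eventually_elim simp
      ultimately show ?thesis using a(3) pC True unfolding C0_def l_def by auto
    next
      case False
      then have t: "0 < t" using that by simp
      have "Pt U t p \<in> L2 (RM U)" using Pt_L2[OF U _ pL] t by simp
      then show ?thesis using a(3) u[OF t] t unfolding l_def by auto
    qed
    define I where "I = integral {0..T'} (\<lambda>t. b * exp (- b * t) * l t)"
    have Pabs: "AE y in RM U. \<bar>Pt U t p y\<bar> \<le> 1" if "0 \<le> t" for t
    proof (cases "t = 0")
      case True
      show ?thesis unfolding True using P0[OF pL] ple by eventually_elim simp
    next
      case False
      then show ?thesis using that by (intro Pt_abs[OF U _ pL _ ple]) auto
    qed
    have f_le: "norm (f k t) \<le> b * 1" if t: "t \<in> {0..T'}" for k t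
    proof -
      have "\<bar>ip2 (RM U) (a k) (Pt U t p)\<bar> \<le> 1"
        using a(2) Pt_L2[OF U _ pL] Pabs t by simp
      then have "exp (- b * t) * \<bar>ip2 (RM U) (a k) (Pt U t p)\<bar> \<le> 1 * 1"
        using b t by (intro mult_mono) auto
      then show ?thesis using b by (simp add: f_def abs_mult mult.assoc)
    qed
    have f_lim: "(\<lambda>k. f k t) \<longlonglongrightarrow> b * exp (- b * t) * l t" if "t \<in> {0..T'}" for t
      unfolding f_def using that by (intro tendsto_intros conv) simp
    note DC = dominated_convergence[of f "{0..T'}" "\<lambda>t. b * 1", OF has_integral_integrable[OF hint]
        integrable_const_ivl f_le f_lim]
    have eint: "((\<lambda>t. b * exp (- b * t)) has_integral 1 - exp (- b * T')) {0..T'}"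
    proof -
      have "((\<lambda>t. b * exp (- b * t)) has_integral - exp (- b * T') - - exp (- b * 0)) {0..T'}"
        using T'(1) by (intro fundamental_theorem_of_calculus)
          (auto intro!: derivative_eq_intros simp flip: has_real_derivative_iff_has_vector_derivative)
      then show ?thesis by simp
    qed
    have N1: "norm (integral {0..T'} (\<lambda>t. b * exp (- b * t) * l t - b * exp (- b * t) * p x))
        \<le> integral {0..T'} (\<lambda>t. e / 2 * (b * exp (- b * t)))"
    proof (rule integral_norm_bound_integral)
      show "(\<lambda>t. b * exp (- b * t) * l t - b * exp (- b * t) * p x) integrable_on {0..T'}"
        by (intro integrable_diff DC(1) integrable_on_mult_left has_integral_integrable[OF eint])
      show "(\<lambda>t. e / 2 * (b * exp (- b * t))) integrable_on {0..T'}"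
        by (intro integrable_on_mult_right has_integral_integrable[OF eint])
      fix t assume t: "t \<in> {0..T'}"
      then have "\<bar>l t - p x\<bar> \<le> e / 2" using T'(2)[of t] e by (auto simp: l_def)
      then have "b * exp (- b * t) * \<bar>l t - p x\<bar> \<le> b * exp (- b * t) * (e / 2)" using b by (intro mult_left_mono) auto
      moreover have "b * exp (- b * t) * l t - b * exp (- b * t) * p x = (b * exp (- b * t)) * (l t - p x)"
        by (simp only: right_diff_distrib)
      then have "norm (b * exp (- b * t) * l t - b * exp (- b * t) * p x) = b * exp (- b * t) * \<bar>l t - p x\<bar>"
        using b by (simp only: real_norm_def abs_mult abs_exp_cancel abs_of_pos)
      ultimately show "norm (b * exp (- b * t) * l t - b * exp (- b * t) * p x) \<le> e / 2 * (b * exp (- b * t))"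
        by (simp only: mult.commute)
    qed
    have N2: "integral {0..T'} (\<lambda>t. b * exp (- b * t) * l t - b * exp (- b * t) * p x) = I - (1 - exp (- b * T')) * p x"
      unfolding I_def using DC(1) has_integral_integrable[OF eint] integral_unique[OF eint]
      by (simp add: integral_diff integrable_on_mult_left)
    have N3: "integral {0..T'} (\<lambda>t. e / 2 * (b * exp (- b * t))) = e / 2 * (1 - exp (- b * T'))"
      by (rule integral_unique[OF has_integral_mult_right[OF eint]])
    have N4: "e / 2 * (1 - exp (- b * T')) \<le> e / 2" using e by (simp add: mult_le_cancel_left1)
    have I: "\<bar>I - (1 - exp (- b * T')) * p x\<bar> \<le> e / 2"
      by (rule order_trans[OF N1[unfolded N2 N3 real_norm_def] N4])
    have absG: "(\<lambda>k. \<bar>G k 0 - integral {0..T'} (f k)\<bar>) \<longlonglongrightarrow> \<bar>w x - I\<bar>"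
    proof (intro tendsto_intros)
      have "Pt U 0 ?g \<in> L2 (RM U)" using Pt_L2[OF U _ g] by simp
      moreover have "AE y in RM U. w y = Pt U 0 ?g y" using P0[OF g] w(2) by eventually_elim simp
      ultimately show "(\<lambda>k. G k 0) \<longlonglongrightarrow> w x" using a(3) w(1) unfolding G_def by auto
      show "(\<lambda>k. integral {0..T'} (f k)) \<longlonglongrightarrow> I" unfolding I_def by (rule DC(2))
    qed
    have "\<bar>G k 0 - integral {0..T'} (f k)\<bar> \<le> exp (- b * T')" for k
    proof -
      have "\<bar>ip2 (RM U) (a k) (Pt U T' ?g)\<bar> \<le> 1"
        using a(2) Pt_L2[OF U _ g] Pt_abs[OF U T'(1) g _ g1] T'(1) by simp
      then have "exp (- b * T') * \<bar>ip2 (RM U) (a k) (Pt U T' ?g)\<bar> \<le> exp (- b * T') * 1" by (intro mult_left_mono) auto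
      then show ?thesis using integral_unique[OF hint[of k]] by (simp add: G_def abs_mult)
    qed
    then have wI: "\<bar>w x - I\<bar> \<le> exp (- b * T')" by (intro LIMSEQ_le_const2[OF absG]) blast
    have "\<bar>p x\<bar> \<le> 1" using p1 x openin_subset[OF U] by blast
    then have "exp (- b * T') * \<bar>p x\<bar> \<le> exp (- b * T') * 1" by (intro mult_left_mono) auto
    then have "\<bar>exp (- b * T') * p x\<bar> \<le> exp (- b * T')" by (simp add: abs_mult)
    moreover have "w x - p x = (w x - I) + (I - (1 - exp (- b * T')) * p x) - exp (- b * T') * p x"
      by (simp add: algebra_simps)
    ultimately show ?thesis using wI I by linarith
  qed
  \<comment> \<open>With this choice \<open>b0 * T' = 4 / e\<close>, and
    \<open>4 / e <= exp (4 / e)\<close> gives \<open>2 * exp (- b0 * T') <= e / 2\<close>.\<close>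
  define b0 where "b0 = 4 / (e * T')"
  have b0: "0 < b0" "2 * exp (- b0 * T') \<le> e / 2"
  proof -
    show "0 < b0" using e T'(1) by (simp add: b0_def)
    have y: "b0 * T' = 4 / e" using e T'(1) by (simp add: b0_def)
    have "4 / e \<le> exp (4 / e)" using exp_ge_add_one_self[of "4 / e"] by linarith
    then have "inverse (exp (4 / e)) \<le> inverse (4 / e)" using e by (intro le_imp_inverse_le) auto
    then show "2 * exp (- b0 * T') \<le> e / 2" unfolding minus_mult_left[symmetric] y exp_minus by simp
  qed
  have "\<bar>w x - p x\<bar> \<le> e" if "b0 \<le> b" "w \<in> Cont (subtopology X U)" "AE y in RM U. w y = rs U b p y" for b w
  proof -
    have "b0 * T' \<le> b * T'" using that(1) T'(1) by (intro mult_right_mono) auto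
    then have "exp (- b * T') \<le> exp (- b0 * T')" by simp
    then show ?thesis using est[OF _ that(2,3)] that(1) b0 by linarith
  qed
  with b0(1) show ?thesis by (intro that[of b0]) blast+
qed

text \<open>The boundary condition is now an a.e. bound on an open set \<open>Q\<close> around the
  boundary. On \<open>U\<close> the excess of \<open>u\<close> over \<open>C\<close> is 0 inside
  \<open>Q\<close> and at most \<open>L\<close> elsewhere, so it lies below \<open>L\<close> times a
  cutoff that is 1 on the compact remainder of the closure. This puts it into
  \<open>FU U\<close>.\<close>

lemma max_principle_rel:
  assumes U: "rc U" and O: "openin X Q" "X closure_of U - U \<subseteq> Q" and u: "u \<in> F" and C: "0 \<le> C" and b: "0 < b"
    and L: "0 \<le> L" and uO: "AE x in M. x \<in> U \<longrightarrow> x \<in> Q \<longrightarrow> u x \<le> C" and uL: "AE x in M. x \<in> U \<longrightarrow> u x \<le> C + L"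
    and r: "r \<in> L2 M" "AE x in M. r x \<le> b * C"
    and sub: "\<And>\<phi>. \<lbrakk>\<phi> \<in> FU U; AE x in M. 0 \<le> \<phi> x\<rbrakk> \<Longrightarrow> E u \<phi> + b * ip2 M u \<phi> \<le> ip2 M r \<phi>"
  shows "AE x in M. x \<in> U \<longrightarrow> u x \<le> C"
proof -
  note oU = rc_open[OF U]
  have K: "compactin X (X closure_of U - Q)"
    by (rule closed_compactin[OF rc_compact[OF U]]) (auto intro!: closedin_diff O)
  have KU: "X closure_of U - Q \<subseteq> U" using O(2) by blast
  have UU: "U \<subseteq> X closure_of U" using oU by (simp add: closure_of_subset openin_subset)
  obtain \<zeta> where \<zeta>: "\<zeta> \<in> core U" "\<forall>x\<in>topspace X. 0 \<le> \<zeta> x \<and> \<zeta> x \<le> 1" "\<forall>x\<in>X closure_of U - Q. \<zeta> x = 1"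
    by (rule cutoff[OF K oU KU])
  define up where "up = (\<lambda>x. max (u x - C) 0)"
  have upF: "up \<in> F" unfolding up_def by (rule E_trunc_nonneg(1)[OF u C])
  define \<xi> where "\<xi> = (\<lambda>x. min (max (up x) 0) (max ((L *\<^sub>R \<zeta>) x) 0))"
  have \<xi>U: "\<xi> \<in> FU U" unfolding \<xi>_def
    by (intro FU_truncate[OF upF] core_FU core_scale \<zeta>(1))
  have \<xi>F: "\<xi> \<in> F" by (rule FU_F[OF \<xi>U])
  have \<xi>up: "AE x in M. x \<in> U \<longrightarrow> \<xi> x = up x"
    using uO uL AE_space_M
  proof eventually_elim
    case (elim x)
    show ?case
    proof
      assume x: "x \<in> U"
      have z: "0 \<le> \<zeta> x" using \<zeta>(2) elim(3) by blast
      show "\<xi> x = up x"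
      proof (cases "x \<in> Q")
        case True
        then show ?thesis using elim(1) x z L by (simp add: \<xi>_def up_def)
      next
        case False
        then have "\<zeta> x = 1" using \<zeta>(3) x UU by blast
        then show ?thesis using elim(2) x L by (simp add: \<xi>_def up_def)
      qed
    qed
  qed
  have \<xi>0: "AE x in M. x \<notin> U \<longrightarrow> \<xi> x = 0" by (rule FU_zero[OF Um[OF oU] \<xi>U])
  have up\<xi>: "up - \<xi> \<in> F" by (rule E.S_diff[OF upF \<xi>F])
  have zero: "AE x in M. x \<in> U \<longrightarrow> (up - \<xi>) x = 0" using \<xi>up by eventually_elim simp
  \<comment> \<open>Cut u off at C outside of U; by locality this does not change the form on \<open>FU U\<close>.\<close>
  define u1 where "u1 = u - (up - \<xi>)"
  have u1F: "u1 \<in> F" unfolding u1_def by (rule E.S_diff[OF u up\<xi>])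
  have "AE x in M. u1 x \<le> C"
  proof (rule max_principle[OF u1F C b \<xi>U _ _ r])
    show "AE x in M. u1 x \<le> C + \<xi> x"
      using \<xi>0 by eventually_elim (auto simp: u1_def up_def)
    show "AE x in M. 0 \<le> \<xi> x" by (simp add: \<xi>_def)
    fix p assume p: "p \<in> FU U" "AE x in M. 0 \<le> p x"
    have pF: "p \<in> F" by (rule FU_F[OF p(1)])
    have "E (up - \<xi>) p = 0" by (rule E_local[OF up\<xi> zero p(1)])
    moreover have "ip2 M (up - \<xi>) p = ip2 M 0 p"
      by (rule ip2_FU_cong[OF oU p(1) F_L2[OF up\<xi>] L2.S_0]) (use zero in simp)
    ultimately have "E u1 p + b * ip2 M u1 p = E u p + b * ip2 M u p"
      unfolding u1_def using E.ip_diff_left[OF u up\<xi> pF] L2.ip_diff_left[OF F_L2[OF u] F_L2[OF up\<xi>] F_L2[OF pF]]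
        L2.ip_0_left[OF F_L2[OF pF]] by simp
    then show "E u1 p + b * ip2 M u1 p \<le> ip2 M r p" using sub[OF p] by simp
  qed
  then show ?thesis using zero by eventually_elim (auto simp: u1_def)
qed

text \<open>The resolvent identity, with the nonnegative term \<open>n * rs U b p\<close>
  dropped.\<close>

lemma rs_excessive:
  assumes U: "openin X U" and n: "0 < n" "n < b" and p: "p \<in> L2 (RM U)" "AE x in RM U. 0 \<le> p x"
  shows "AE x in RM U. rs U b (rs U n p) x \<le> b / (b - n) * rs U n p x"
proof -
  have b: "0 < b" using n by simp
  have w: "rs U n p \<in> L2 (RM U)" by (rule rs_L2[OF U n(1) p(1)])
  have "AE x in RM U. 0 \<le> rs U b p x" by (rule rs_pos[OF U b p])
  then show ?thesis using rs_identity[OF U n(1) b p(1)] unfolding rs_diff[OF U b w p(1)]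
  proof eventually_elim
    case (elim x)
    let ?y = "rs U b (rs U n p) x"
    have "b * (?y - rs U n p x) = n * (?y - rs U b p x)" using elim(2) b by (simp add: field_simps)
    moreover have "0 \<le> n * rs U b p x" using n(1) elim(1) by simp
    ultimately have "(b - n) * ?y \<le> b * rs U n p x" by (simp add: algebra_simps)
    then show ?case using n(2) by (simp add: field_simps)
  qed
qed

lemma Cont_min:
  assumes "u \<in> Cont Y" "v \<in> Cont Y" shows "(\<lambda>x. min (u x) (v x)) \<in> Cont Y"
  using assms unfolding Cont_def by (auto intro: continuous_map_real_min)

lemma Cont_const: "(\<lambda>x. c) \<in> Cont Y"
  by (simp add: Cont_def)

text \<open>The resolvent form of \<open>P t \<rho> <= e^(n t) \<rho>\<close>; the factor
  \<open>b / (b - n)\<close> is \<open>b\<close> times the Laplace transform of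
  \<open>e^(n t)\<close>. Resolvents of nonnegative functions satisfy this bound, and unlike them
  the class is closed under minima.\<close>

definition excessive :: "'a set \<Rightarrow> real \<Rightarrow> ('a \<Rightarrow> real) \<Rightarrow> bool" where
  "excessive W n \<rho> \<longleftrightarrow> 0 < n \<and> \<rho> \<in> Cont (subtopology X W) \<and> \<rho> \<in> L2 (RM W) \<and> (AE x in RM W. 0 \<le> \<rho> x) \<and>
     (\<forall>b>n. AE x in RM W. rs W b \<rho> x \<le> b / (b - n) * \<rho> x)"

lemma excessive_min:
  assumes W: "openin X W" and r: "excessive W n \<rho>" and s: "excessive W m \<sigma>"
  shows "excessive W (max n m) (\<lambda>x. min (\<rho> x) (\<sigma> x))"
  unfolding excessive_def
proof (intro conjI allI impI)
  let ?m = "\<lambda>x. min (\<rho> x) (\<sigma> x)"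
  have nm: "0 < n" "0 < m" and L: "\<rho> \<in> L2 (RM W)" "\<sigma> \<in> L2 (RM W)"
    and pos: "AE x in RM W. 0 \<le> \<rho> x" "AE x in RM W. 0 \<le> \<sigma> x"
    using r s unfolding excessive_def by auto
  show "0 < max n m" using nm by simp
  show "?m \<in> Cont (subtopology X W)" using r s Cont_min unfolding excessive_def by blast
  have "?m \<in> borel_measurable (RM W)" using L by simp
  then show mL: "?m \<in> L2 (RM W)"
    by (rule L2_dominated[OF _ L(1)]) (use pos in \<open>auto elim!: eventually_elim2\<close>)
  show "AE x in RM W. 0 \<le> ?m x" using pos by eventually_elim simp
  fix b assume b: "max n m < b"
  then have b0: "0 < b" using nm by simp
  have "AE x in RM W. rs W b ?m x \<le> rs W b \<rho> x" "AE x in RM W. rs W b ?m x \<le> rs W b \<sigma> x"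
    by (rule rs_mono[OF W b0 mL L(1)] rs_mono[OF W b0 mL L(2)], simp)+
  moreover have "AE x in RM W. rs W b \<rho> x \<le> b / (b - n) * \<rho> x" "AE x in RM W. rs W b \<sigma> x \<le> b / (b - m) * \<sigma> x"
    using r s b unfolding excessive_def by auto
  ultimately show "AE x in RM W. rs W b ?m x \<le> b / (b - max n m) * ?m x" using pos
  proof eventually_elim
    case (elim x)
    have "b / (b - n) * \<rho> x \<le> b / (b - max n m) * \<rho> x" "b / (b - m) * \<sigma> x \<le> b / (b - max n m) * \<sigma> x"
      using elim b b0 by (auto intro!: mult_right_mono divide_left_mono mult_pos_pos)
    moreover have "b / (b - max n m) * ?m x = min (b / (b - max n m) * \<rho> x) (b / (b - max n m) * \<sigma> x)"
      using b b0 by (intro min_mult_distrib_left[THEN trans]) auto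
    ultimately show ?case using elim by simp
  qed
qed

lemma excessive_min_const:
  assumes W: "openin X W" and r: "excessive W n \<rho>" and c: "0 \<le> c"
  shows "excessive W n (\<lambda>x. min (\<rho> x) c)"
  unfolding excessive_def
proof (intro conjI allI impI)
  let ?m = "\<lambda>x. min (\<rho> x) c"
  have n: "0 < n" and L: "\<rho> \<in> L2 (RM W)" and pos: "AE x in RM W. 0 \<le> \<rho> x"
    using r unfolding excessive_def by auto
  show "0 < n" by (rule n)
  show "?m \<in> Cont (subtopology X W)" using r Cont_min Cont_const unfolding excessive_def by blast
  have "?m \<in> borel_measurable (RM W)" using L by simp
  then show mL: "?m \<in> L2 (RM W)"
    by (rule L2_dominated[OF _ L(1)]) (use pos c in \<open>auto elim!: eventually_mono\<close>)
  show "AE x in RM W. 0 \<le> ?m x" using pos by eventually_elim (use c in simp)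
  fix b assume b: "n < b"
  then have b0: "0 < b" using n by simp
  have "AE x in RM W. rs W b ?m x \<le> rs W b \<rho> x" by (rule rs_mono[OF W b0 mL L]) simp
  moreover have "AE x in RM W. rs W b ?m x \<le> c" by (rule rs_max[OF W b0 mL c]) simp
  moreover have "AE x in RM W. rs W b \<rho> x \<le> b / (b - n) * \<rho> x"
    using r b unfolding excessive_def by auto
  ultimately show "AE x in RM W. rs W b ?m x \<le> b / (b - n) * ?m x"
  proof eventually_elim
    case (elim x)
    have "1 * c \<le> b / (b - n) * c" using c b n by (intro mult_right_mono) (auto simp: field_simps)
    then show ?case using elim by (auto simp: min_def)
  qed
qed

text \<open>Take \<open>\<rho>\<close> as the minimum of \<open>3/4\<close> and finitely many resolvents \<open>w\<close> of a cutoff function that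
  satisfy \<open>w x\<^sub>0 > 3/4\<close> and such that some \<open>w\<close> is below \<open>1/2\<close> near each boundary point of U. As \<open>\<rho>\<close>
  is excessive, \<open>rs W b \<rho>\<close> stays below \<open>5/8\<close> near the boundary, whereas it tends to \<open>3/4\<close> at
  \<open>x\<^sub>0\<close> as b grows. Minima, unlike \<open>w\<close> itself, make the bound at the boundary independent of
  the precision at \<open>x\<^sub>0\<close>.\<close>

lemma barrier:
  assumes U: "rc U" and W: "openin X W" "X closure_of U \<subseteq> W" and df: "doubly_feller (R W)" and x0: "x0 \<in> U"
  obtains Q where "openin X Q" "X closure_of U - U \<subseteq> Q"
    "\<forall>e B. 0 < e \<and> e \<le> 1 \<longrightarrow> (\<exists>b>B. \<exists>\<rho> N. 0 < b \<and> \<rho> \<in> L2 (RM W) \<and> (AE x in RM W. 0 \<le> \<rho> x) \<and> (AE x in RM W. \<rho> x \<le> 3/4) \<and>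
       openin X N \<and> x0 \<in> N \<and> N \<subseteq> U \<and> (AE x in RM W. x \<in> N \<longrightarrow> 3/4 - e \<le> rs W b \<rho> x) \<and>
       (AE x in RM W. x \<in> Q \<longrightarrow> rs W b \<rho> x \<le> 5/8))"
proof -
  note oU = rc_open[OF U]
  have UU: "U \<subseteq> X closure_of U" using oU by (simp add: closure_of_subset openin_subset)
  have xX: "x0 \<in> topspace X" using x0 openin_subset[OF oU] by blast
  have xW: "x0 \<in> W" using x0 UU W(2) by blast
  have cx: "compactin X {x0}" using xX by simp
  obtain p where p: "p \<in> core U" "\<forall>x\<in>topspace X. 0 \<le> p x \<and> p x \<le> 1" "\<forall>x\<in>{x0}. p x = 1"
    by (rule cutoff[OF cx oU]) (use x0 in simp)
  have pW: "p \<in> core W" using p(1) UU W(2) unfolding core_def by auto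
  have p1: "\<forall>x\<in>topspace X. \<bar>p x\<bar> \<le> 1" using p(2) by auto
  have pL: "p \<in> L2 (RM W)" by (rule L2R_of_L2[OF W(1) F_L2[OF core_dest(1)[OF p(1)]]])
  have p0: "AE x in RM W. 0 \<le> p x" and ple: "AE x in RM W. \<bar>p x\<bar> \<le> 1"
    by (rule AE_I2, use p(2) in \<open>simp add: space_restrict_space\<close>)+
  define good where "good n w \<longleftrightarrow> excessive W n w \<and> 3/4 < w x0" for n w
  \<comment> \<open>As \<open>p x0 = 1\<close>, precision 1/5 gives values above 3/4. On the
    boundary, where \<open>p\<close> vanishes, precision 1/3 will give values below 1/2.\<close>
  have x0e: "0 < (1/5 :: real)" by simp
  obtain b1 where b1: "0 < b1" "\<forall>b\<ge>b1. \<forall>w\<in>Cont (subtopology X W). (AE y in RM W. w y = rs W b p y) \<longrightarrow> \<bar>w x0 - p x0\<bar> \<le> 1/5"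
    by (rule rs_pointwise[OF W(1) df pW p1 xW x0e])
  have ver: "\<exists>w. w \<in> Cont (subtopology X W) \<and> (AE y in RM W. w y = rs W b p y) \<and> good b w" if b: "b1 \<le> b" for b
  proof -
    have b0: "0 < b" using b b1(1) by simp
    obtain w where w: "w \<in> Cont (subtopology X W)" "AE y in RM W. w y = rs W b p y"
      by (rule rs_Cont[OF W(1) df b0 pL ple zero_le_one])
    have "\<bar>w x0 - p x0\<bar> \<le> 1/5" using b1(2) b w by blast
    moreover have "p x0 = 1" using p(3) by simp
    ultimately have "3/4 < w x0" by linarith
    moreover have rL: "rs W b p \<in> L2 (RM W)" by (rule rs_L2[OF W(1) b0 pL])
    have wL: "w \<in> L2 (RM W)" by (rule L2_cong_AE[OF rL Cont_measurable_R[OF W(1) w(1)] w(2)])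
    have "AE x in RM W. rs W c w x \<le> c / (c - b) * w x" if c: "b < c" for c
    proof -
      have "rs W c w = rs W c (rs W b p)"
        by (rule rs_cong[OF W(1) _ wL rL w(2)]) (use c b0 in simp)
      then show ?thesis using rs_excessive[OF W(1) b0 c pL p0] w(2) by (auto elim: eventually_elim2)
    qed
    moreover have "AE x in RM W. 0 \<le> w x" using rs_pos[OF W(1) b0 pL p0] w(2) by eventually_elim simp
    ultimately have "good b w" unfolding good_def excessive_def using b0 w(1) wL by blast
    with w show ?thesis by blast
  qed
  have bdry: "\<exists>w n. good n w \<and> w y < 1/2" if y: "y \<in> X closure_of U - U" for y
  proof -
    have yW: "y \<in> W" using y W(2) by blast
    have yX: "y \<in> topspace X" using y by (simp add: in_closure_of)
    have "y \<notin> top_support X p" using y core_dest(4)[OF p(1)] by blast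
    then have "p y = 0" by (rule core_zero[OF p(1) yX])
    have e: "0 < (1/3 :: real)" by simp
    obtain b2 where b2: "0 < b2" "\<forall>b\<ge>b2. \<forall>w\<in>Cont (subtopology X W). (AE y in RM W. w y = rs W b p y) \<longrightarrow> \<bar>w y - p y\<bar> \<le> 1/3"
      by (rule rs_pointwise[OF W(1) df pW p1 yW e])
    obtain w where w: "w \<in> Cont (subtopology X W)" "AE y in RM W. w y = rs W (max b1 b2) p y" "good (max b1 b2) w"
      using ver[of "max b1 b2"] by auto
    have "\<bar>w y - p y\<bar> \<le> 1/3" using b2(2) w by (meson max.cobounded2)
    then have "w y < 1/2" using \<open>p y = 0\<close> by linarith
    with w(3) show ?thesis by blast
  qed
  then have "\<forall>y\<in>X closure_of U - U. \<exists>w. (\<exists>n. good n w) \<and> w y < 1/2" by blast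
  from bchoice[OF this] obtain ww where ww: "\<And>y. y \<in> X closure_of U - U \<Longrightarrow> (\<exists>n. good n (ww y)) \<and> ww y y < 1/2" by blast
  define V where "V y = {x \<in> topspace (subtopology X W). ww y x \<in> {..<1/2}}" for y
  have Vo: "openin X (V y)" if y: "y \<in> X closure_of U - U" for y
  proof -
    have "ww y \<in> Cont (subtopology X W)" using ww[OF y] unfolding good_def excessive_def by blast
    then have "openin (subtopology X W) (V y)"
      unfolding V_def by (intro openin_continuous_map_preimage[of _ euclideanreal])
        (simp_all add: Cont_def del: topspace_subtopology)
    then show ?thesis using openin_open_subtopology[OF W(1)] by simp
  qed
  have bc: "compactin X (X closure_of U - U)"
    by (rule closed_compactin[OF rc_compact[OF U]]) (auto intro!: closedin_diff oU)
  have "X closure_of U - U \<subseteq> \<Union> (V ` (X closure_of U - U))"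
    using ww W(2) openin_subset[OF W(1)] unfolding V_def by auto
  moreover have "openin X S" if "S \<in> V ` (X closure_of U - U)" for S using that Vo by blast
  ultimately have "\<exists>\<F>. finite \<F> \<and> \<F> \<subseteq> V ` (X closure_of U - U) \<and> X closure_of U - U \<subseteq> \<Union>\<F>"
    by (intro compactinD[OF bc])
  then obtain \<F> where \<F>: "finite \<F>" "\<F> \<subseteq> V ` (X closure_of U - U)" "X closure_of U - U \<subseteq> \<Union>\<F>"
    by (elim exE conjE) (rule that)
  from finite_subset_image[OF \<F>(1,2)] obtain Y where Y: "Y \<subseteq> X closure_of U - U" "finite Y" "\<F> = V ` Y"
    by (elim exE conjE) (rule that)
  have "\<exists>n \<rho>. excessive W n \<rho> \<and> 3/4 \<le> \<rho> x0 \<and> (\<forall>x\<in>W. \<rho> x \<le> 3/4) \<and> (\<forall>y\<in>Y. \<forall>x\<in>W. \<rho> x \<le> ww y x)"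
    using Y(2,1)
  proof (induction Y rule: finite_induct)
    case empty
    obtain w where "good b1 w" using ver[of b1] by auto
    then have "excessive W b1 (\<lambda>x. min (w x) (3/4)) \<and> 3/4 \<le> min (w x0) (3/4)"
      using excessive_min_const[OF W(1), of b1 w "3/4"] unfolding good_def by auto
    moreover have "\<forall>x\<in>W. min (w x) (3/4) \<le> 3/4" by (intro ballI min.cobounded2)
    ultimately show ?case by (intro exI[of _ b1] exI[of _ "\<lambda>x. min (w x) (3/4)"]) blast
  next
    case (insert y Y)
    then obtain n \<rho> where r: "excessive W n \<rho>" "3/4 \<le> \<rho> x0" "\<forall>x\<in>W. \<rho> x \<le> 3/4" "\<forall>y\<in>Y. \<forall>x\<in>W. \<rho> x \<le> ww y x"
      by auto
    from ww[of y] insert.prems obtain m where m: "excessive W m (ww y)" "3/4 < ww y x0" unfolding good_def by auto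
    let ?r = "\<lambda>x. min (\<rho> x) (ww y x)"
    have "excessive W (max n m) ?r" by (rule excessive_min[OF W(1) r(1) m(1)])
    moreover have "3/4 \<le> ?r x0" using r(2) m(2) by simp
    moreover have "\<forall>x\<in>W. ?r x \<le> 3/4" using r(3) by (auto simp: min_le_iff_disj)
    moreover have "\<forall>y'\<in>insert y Y. \<forall>x\<in>W. ?r x \<le> ww y' x" using r(4) by (auto simp: min_le_iff_disj)
    ultimately show ?case by (intro exI[of _ "max n m"] exI[of _ ?r]) blast
  qed
  then obtain n \<rho> where ex: "excessive W n \<rho>" and r0: "3/4 \<le> \<rho> x0" and r34: "\<forall>x\<in>W. \<rho> x \<le> 3/4"
    and rw: "\<forall>y\<in>Y. \<forall>x\<in>W. \<rho> x \<le> ww y x" by blast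
  have n: "0 < n" and rC: "\<rho> \<in> Cont (subtopology X W)" and rL: "\<rho> \<in> L2 (RM W)" and rpos: "AE x in RM W. 0 \<le> \<rho> x"
    using ex unfolding excessive_def by auto
  define Q where "Q = \<Union> (V ` Y)"
  show ?thesis
  proof (rule that[of Q])
    show "openin X Q" unfolding Q_def by (rule openin_Union) (use Vo Y(1) in auto)
    show "X closure_of U - U \<subseteq> Q" using \<F>(3) Y(3) by (simp add: Q_def)
    show "\<forall>e B. 0 < e \<and> e \<le> 1 \<longrightarrow> (\<exists>b>B. \<exists>\<rho> N. 0 < b \<and> \<rho> \<in> L2 (RM W) \<and> (AE x in RM W. 0 \<le> \<rho> x) \<and> (AE x in RM W. \<rho> x \<le> 3/4) \<and>
       openin X N \<and> x0 \<in> N \<and> N \<subseteq> U \<and> (AE x in RM W. x \<in> N \<longrightarrow> 3/4 - e \<le> rs W b \<rho> x) \<and>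
       (AE x in RM W. x \<in> Q \<longrightarrow> rs W b \<rho> x \<le> 5/8))"
    proof (intro allI impI)
      fix e B :: real assume e: "0 < e \<and> e \<le> 1"
      have e2: "0 < e/2" "0 < e/4" using e by auto
      obtain N1 where N1: "openin X N1" "x0 \<in> N1" "N1 \<subseteq> W" "\<forall>y\<in>N1. \<bar>\<rho> y - \<rho> x0\<bar> < e/2"
        by (rule Cont_nbhd[OF W(1) rC xW e2(1)])
      obtain q where q: "q \<in> core N1" "\<forall>x\<in>topspace X. 0 \<le> q x \<and> q x \<le> 1" "\<forall>x\<in>{x0}. q x = 1"
        by (rule cutoff[OF cx N1(1)]) (use N1(2) in simp)
      have qW: "q \<in> core W" using q(1) N1(3) unfolding core_def by auto
      have q1: "\<forall>x\<in>topspace X. \<bar>q x\<bar> \<le> 1" using q(2) by auto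
      have qL: "q \<in> L2 (RM W)" by (rule L2R_of_L2[OF W(1) F_L2[OF core_dest(1)[OF q(1)]]])
      have qle: "AE x in RM W. \<bar>q x\<bar> \<le> 1" by (rule AE_I2) (use q(2) in \<open>simp add: space_restrict_space\<close>)
      obtain b2 where b2: "0 < b2" "\<forall>b\<ge>b2. \<forall>w\<in>Cont (subtopology X W). (AE y in RM W. w y = rs W b q y) \<longrightarrow> \<bar>w x0 - q x0\<bar> \<le> e/4"
        by (rule rs_pointwise[OF W(1) df qW q1 xW e2(2)])
      \<comment> \<open>For \<open>b >= 5 n\<close> the factor \<open>b / (b - n)\<close> is at most
        5/4, and 5/4 of 1/2 is the bound 5/8.\<close>
      define b where "b = max (B + 1) (max b2 (5 * n))"
      have b: "B < b" "b2 \<le> b" "5 * n \<le> b" "0 < b" using b2(1) by (auto simp: b_def)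
      obtain w where w: "w \<in> Cont (subtopology X W)" "AE y in RM W. w y = rs W b q y"
        by (rule rs_Cont[OF W(1) df b(4) qL qle zero_le_one])
      have "\<bar>w x0 - q x0\<bar> \<le> e/4" using b2(2) b(2) w by blast
      moreover have "q x0 = 1" using q(3) by simp
      ultimately have w0: "1 - e/4 \<le> w x0" by linarith
      obtain N2 where N2: "openin X N2" "x0 \<in> N2" "N2 \<subseteq> W" "\<forall>y\<in>N2. \<bar>w y - w x0\<bar> < e/4"
        by (rule Cont_nbhd[OF W(1) w(1) xW e2(2)])
      \<comment> \<open>Near \<open>x0\<close>, \<open>\<rho>\<close> is at least \<open>c\<close>,
        so it dominates \<open>c\<close> times the cutoff \<open>q\<close>. Where
        \<open>rs W b q\<close> is at least \<open>1 - e/2\<close>, the product with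
        \<open>c <= 1\<close> is at least \<open>3/4 - e\<close>.\<close>
      define c where "c = 3/4 - e/2"
      have c: "0 \<le> c" "c \<le> 3/4" using e by (auto simp: c_def)
      have "AE x in RM W. (c *\<^sub>R q) x \<le> \<rho> x"
        using rpos AE_space
      proof eventually_elim
        case (elim x)
        then have x: "x \<in> topspace X" by (simp add: space_restrict_space)
        show ?case
        proof (cases "x \<in> N1")
          case True
          then have "\<bar>\<rho> x - \<rho> x0\<bar> < e/2" using N1(4) by blast
          then have "c \<le> \<rho> x" using r0 unfolding c_def by linarith
          moreover have "c * q x \<le> c * 1" using c q(2) x by (intro mult_left_mono) auto
          ultimately show ?thesis by simp
        next
          case False
          then have "x \<notin> top_support X q" using core_dest(4)[OF q(1)] by blast
          then show ?thesis using core_zero[OF q(1) x] elim(1) by simp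
        qed
      qed
      from rs_mono[OF W(1) b(4) L2.S_scale[OF qL] rL this]
      have low: "AE x in RM W. c * rs W b q x \<le> rs W b \<rho> x" unfolding rs_scale[OF W(1) b(4) qL] by simp
      have A1: "AE x in RM W. x \<in> N2 \<inter> U \<longrightarrow> 3/4 - e \<le> rs W b \<rho> x" using low w(2)
      proof eventually_elim
        case (elim x)
        show ?case
        proof
          assume "x \<in> N2 \<inter> U"
          then have "\<bar>w x - w x0\<bar> < e/4" using N2(4) by blast
          then have "1 - e/2 \<le> rs W b q x" using w0 elim(2) by linarith
          then have "c * (1 - e/2) \<le> c * rs W b q x" using c by (intro mult_left_mono) auto
          moreover have "c * (e/2) \<le> 1 * (e/2)" using c e by (intro mult_right_mono) auto
          moreover have "c * (1 - e/2) = c - c * (e/2)" by (simp only: right_diff_distrib mult_1_right)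
          ultimately have "3/4 - e \<le> c * rs W b q x" using c_def by linarith
          then show "3/4 - e \<le> rs W b \<rho> x" using elim(1) by linarith
        qed
      qed
      have "n < b" using b(3) n by linarith
      then have "AE x in RM W. rs W b \<rho> x \<le> b / (b - n) * \<rho> x" using ex unfolding excessive_def by blast
      then have A2: "AE x in RM W. x \<in> Q \<longrightarrow> rs W b \<rho> x \<le> 5/8" using rpos
      proof eventually_elim
        case (elim x)
        show ?case
        proof
          assume "x \<in> Q"
          then obtain y where y: "y \<in> Y" "x \<in> W" "ww y x < 1/2" unfolding Q_def V_def by auto
          then have r: "\<rho> x \<le> 1/2" using rw by force
          have "b / (b - n) \<le> 5/4" using b(3) \<open>n < b\<close> by (simp add: field_simps)
          then have "b / (b - n) * \<rho> x \<le> 5/4 * (1/2)" using r elim(2) by (intro mult_mono) auto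
          then show "rs W b \<rho> x \<le> 5/8" using elim(1) by linarith
        qed
      qed
      have A3: "AE x in RM W. \<rho> x \<le> 3/4" by (rule AE_I2) (use r34 in \<open>simp add: space_restrict_space\<close>)
      have N: "openin X (N2 \<inter> U)" "x0 \<in> N2 \<inter> U" "N2 \<inter> U \<subseteq> U" using N2 oU x0 by auto
      show "\<exists>b>B. \<exists>\<rho> N. 0 < b \<and> \<rho> \<in> L2 (RM W) \<and> (AE x in RM W. 0 \<le> \<rho> x) \<and> (AE x in RM W. \<rho> x \<le> 3/4) \<and>
       openin X N \<and> x0 \<in> N \<and> N \<subseteq> U \<and> (AE x in RM W. x \<in> N \<longrightarrow> 3/4 - e \<le> rs W b \<rho> x) \<and>
       (AE x in RM W. x \<in> Q \<longrightarrow> rs W b \<rho> x \<le> 5/8)"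
        by (rule exI[of _ b], rule conjI[OF b(1)], rule exI[of _ \<rho>], rule exI[of _ "N2 \<inter> U"])
          (intro conjI b(4) rL rpos A3 N A1 A2)
    qed
  qed
qed

lemma defect_cong:
  assumes v: "defect U lam v" and w: "w \<in> borel_measurable M" "AE x in M. v x = w x"
  shows "defect U lam w"
proof -
  have vU: "v \<in> FU U" and v01: "AE x in M. 0 \<le> v x" "AE x in M. v x \<le> 1"
    and veq: "\<And>p. p \<in> FU U \<Longrightarrow> E v p + lam * ip2 M v p = lam * ip2 M (zero_ext U (\<lambda>_. 1)) p"
    using v unfolding defect_def by auto
  have wU: "w \<in> FU U" by (rule FU_cong[OF vU w])
  have "E w p + lam * ip2 M w p = E v p + lam * ip2 M v p" if p: "p \<in> FU U" for p
  proof -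
    have "E v p = E w p" by (rule E_cong) (use FU_F[OF vU] FU_F[OF wU] FU_F[OF p] w(2) in auto)
    moreover have "ip2 M v p = ip2 M w p"
      by (rule ip2_cong_AE) (use F_L2[OF FU_F[OF vU]] F_L2[OF FU_F[OF wU]] F_L2[OF FU_F[OF p]] w(2) in auto)
    ultimately show ?thesis by simp
  qed
  moreover have "AE x in M. 0 \<le> w x" using v01(1) w(2) by eventually_elim simp
  moreover have "AE x in M. w x \<le> 1" using v01(2) w(2) by eventually_elim simp
  ultimately show ?thesis unfolding defect_def using wU veq by simp
qed

lemma defect_near:
  assumes U: "rc U" and lam: "0 < lam" and v: "defect U lam v" and W: "openin X W" "X closure_of U \<subseteq> W"
    and df: "doubly_feller (R W)" and x: "x \<in> U" and e: "0 < e"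
  shows "\<exists>N u. openin X N \<and> x \<in> N \<and> N \<subseteq> U \<and> u \<in> Cont (subtopology X N) \<and>
      (AE y in M. y \<in> N \<longrightarrow> \<bar>u y - v y\<bar> \<le> e)"
proof -
  note oU = rc_open[OF U]
  let ?o = "zero_ext U (\<lambda>_. 1) :: 'a \<Rightarrow> real"
  have UW: "U \<subseteq> W" using W(2) closure_of_subset[OF openin_subset[OF oU]] by blast
  have vU: "v \<in> FU U" and v01: "AE x in M. 0 \<le> v x" "AE x in M. v x \<le> 1"
    and veq: "\<And>p. p \<in> FU U \<Longrightarrow> E v p + lam * ip2 M v p = lam * ip2 M ?o p"
    using v unfolding defect_def by auto
  have vF: "v \<in> F" by (rule FU_F[OF vU])
  have vL: "v \<in> L2 M" by (rule F_L2[OF vF])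
  have one: "?o \<in> L2 M" by (rule one_L2(1)[OF U])
  obtain Q where Q: "openin X Q" "X closure_of U - U \<subseteq> Q"
    "\<forall>e B. 0 < e \<and> e \<le> 1 \<longrightarrow> (\<exists>b>B. \<exists>\<rho> N. 0 < b \<and> \<rho> \<in> L2 (RM W) \<and> (AE x in RM W. 0 \<le> \<rho> x) \<and> (AE x in RM W. \<rho> x \<le> 3/4) \<and>
       openin X N \<and> x \<in> N \<and> N \<subseteq> U \<and> (AE x in RM W. x \<in> N \<longrightarrow> 3/4 - e \<le> rs W b \<rho> x) \<and>
       (AE x in RM W. x \<in> Q \<longrightarrow> rs W b \<rho> x \<le> 5/8))"
    by (rule barrier[OF U W df x])
  define e' where "e' = min 1 (e / 8)"
  have e': "0 < e' \<and> e' \<le> 1" using e by (simp add: e'_def)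
  from Q(3)[rule_format, OF e', of lam] obtain b \<rho> N where b: "lam < b" "0 < b" and \<rho>: "\<rho> \<in> L2 (RM W)" "AE x in RM W. 0 \<le> \<rho> x" "AE x in RM W. \<rho> x \<le> 3/4"
    and N: "openin X N" "x \<in> N" "N \<subseteq> U" and WN: "AE x in RM W. x \<in> N \<longrightarrow> 3/4 - e' \<le> rs W b \<rho> x"
    and WQ: "AE x in RM W. x \<in> Q \<longrightarrow> rs W b \<rho> x \<le> 5/8"
    by (elim exE conjE) (rule that)
  \<comment> \<open>The right-hand side of the equation with parameter \<open>b\<close>, divided by
    \<open>b\<close> because \<open>rs W b\<close> is normalised. It is a convex combination of
    \<open>v\<close> and the indicator of \<open>U\<close>, hence between 0 and 1.\<close>
  define f where "f = ((b - lam) / b) *\<^sub>R v + (lam / b) *\<^sub>R ?o"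
  have fL: "f \<in> L2 M" unfolding f_def by (intro L2.S_add L2.S_scale vL one)
  have f0: "AE x in M. 0 \<le> f x" using v01(1)
    by eventually_elim (use b lam in \<open>auto simp: f_def zero_ext_def\<close>)
  have f1: "AE x in M. f x \<le> 1" using v01(2)
  proof eventually_elim
    case (elim x)
    have "(b - lam) / b * v x \<le> (b - lam) / b * 1" using b elim by (intro mult_left_mono) auto
    moreover have "lam / b * ?o x \<le> lam / b * 1" using b lam by (intro mult_left_mono) (auto simp: zero_ext_def)
    moreover have "(b - lam) / b + lam / b = 1" using b by (simp add: field_simps)
    ultimately show ?case by (simp add: f_def)
  qed
  have fW: "f \<in> L2 (RM W)" by (rule L2R_of_L2[OF W(1) fL])
  have f0W: "AE x in RM W. 0 \<le> f x" and f1W: "AE x in RM W. f x \<le> 1" and fabs: "AE x in RM W. \<bar>f x\<bar> \<le> 1"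
    unfolding AE_restrict_iff[OF Um[OF W(1)]] using f0 f1 by (eventually_elim, simp)+
  define g where "g = zero_ext W (rs W b f)"
  have gW: "g \<in> FU W" unfolding g_def by (rule rs_FU[OF W(1) b(2) fW])
  have gF: "g \<in> F" by (rule FU_F[OF gW])
  have g01: "AE x in M. 0 \<le> g x" "AE x in M. g x \<le> 1"
    using rs_pos[OF W(1) b(2) fW f0W] rs_max[OF W(1) b(2) fW zero_le_one f1W]
    unfolding AE_restrict_iff[OF Um[OF W(1)]] by (eventually_elim, simp add: g_def zero_ext_def)+
  define h where "h = zero_ext W (rs W b \<rho>)"
  have hF: "h \<in> F" unfolding h_def by (rule FU_F[OF rs_FU[OF W(1) b(2) \<rho>(1)]])
  have h34: "AE x in M. h x \<le> 3/4"
    using rs_max[OF W(1) b(2) \<rho>(1) _ \<rho>(3)] unfolding AE_restrict_iff[OF Um[OF W(1)]]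
    by (auto simp: h_def zero_ext_def elim!: eventually_mono)
  have \<rho>M: "zero_ext W \<rho> \<in> L2 M" using \<rho>(1) L2R[OF W(1)] by simp
  have zF: "g - v \<in> F" by (rule E.S_diff[OF gF vF])
  have zeq: "E (g - v) p + b * ip2 M (g - v) p = 0" if p: "p \<in> FU U" for p
  proof -
    have pF: "p \<in> F" by (rule FU_F[OF p])
    have pL: "p \<in> L2 M" by (rule F_L2[OF pF])
    have "ip2 M (zero_ext W f) p = ip2 M f p"
      by (rule ip2_FU_cong[OF W(1) FU_mono[OF UW p] fW[unfolded L2R[OF W(1)]] fL]) (simp add: zero_ext_def)
    then have "E g p + b * ip2 M g p = b * ip2 M f p"
      using rs_eq[OF W(1) b(2) fW FU_mono[OF UW p]] unfolding g_def by simp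
    moreover have "b * ip2 M f p = (b - lam) * ip2 M v p + lam * ip2 M ?o p"
      unfolding f_def using vL one pL b(2) by (simp add: L2.ip_add_left L2.ip_scale_left L2.S_scale distrib_left)
    moreover have "E (g - v) p + b * ip2 M (g - v) p = (E g p + b * ip2 M g p) - (E v p + b * ip2 M v p)"
      using gF vF pF by (simp add: E.ip_diff_left L2.ip_diff_left right_diff_distrib)
    ultimately show ?thesis using veq[OF p] by (simp add: algebra_simps)
  qed
  \<comment> \<open>The constants match: near the boundary the sum is at most
    \<open>1 + 8 * 5/8 = 6\<close>, and the source is at most \<open>8 b * 3/4 = 6 b\<close>. On
    \<open>N\<close> the barrier term is at least \<open>6 - 8 e'\<close>, which leaves at most
    \<open>8 e' <= e\<close> for the modulus of \<open>g - v\<close>.\<close>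
  have main: "AE y in M. y \<in> U \<longrightarrow> (s *\<^sub>R (g - v) + 8 *\<^sub>R h) y \<le> 6" if s: "\<bar>s\<bar> = 1" for s
  proof (rule max_principle_rel[OF U Q(1,2) _ _ b(2) zero_le_one])
    have z1: "AE y in M. s * (g y - v y) \<le> 1" using v01 g01
    proof eventually_elim
      case (elim y)
      have "s * (g y - v y) \<le> \<bar>s\<bar> * \<bar>g y - v y\<bar>" by (simp flip: abs_mult)
      then show ?case using elim s by auto
    qed
    show "s *\<^sub>R (g - v) + 8 *\<^sub>R h \<in> F" by (intro E.S_add E.S_scale zF hF)
    show "AE y in M. y \<in> U \<longrightarrow> y \<in> Q \<longrightarrow> (s *\<^sub>R (g - v) + 8 *\<^sub>R h) y \<le> 6"
      using z1 WQ unfolding AE_restrict_iff[OF Um[OF W(1)]]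
      by eventually_elim (use UW in \<open>auto simp: h_def zero_ext_def\<close>)
    show "AE y in M. y \<in> U \<longrightarrow> (s *\<^sub>R (g - v) + 8 *\<^sub>R h) y \<le> 6 + 1"
      using z1 h34 by eventually_elim simp
    show "(8 * b) *\<^sub>R zero_ext W \<rho> \<in> L2 M" by (rule L2.S_scale[OF \<rho>M])
    show "AE y in M. ((8 * b) *\<^sub>R zero_ext W \<rho>) y \<le> b * 6"
      using \<rho>(3) unfolding AE_restrict_iff[OF Um[OF W(1)]]
      by eventually_elim (use b(2) in \<open>auto simp: zero_ext_def\<close>)
    fix p assume p: "p \<in> FU U"
    have pF: "p \<in> F" by (rule FU_F[OF p])
    have "E h p + b * ip2 M h p = b * ip2 M (zero_ext W \<rho>) p"
      unfolding h_def by (rule rs_eq[OF W(1) b(2) \<rho>(1) FU_mono[OF UW p]])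
    then have "E (s *\<^sub>R (g - v) + 8 *\<^sub>R h) p + b * ip2 M (s *\<^sub>R (g - v) + 8 *\<^sub>R h) p = 8 * (b * ip2 M (zero_ext W \<rho>) p)"
      unfolding E_shift_add[OF E.S_scale[OF zF] E.S_scale[OF hF] pF] E_shift_scale[OF zF pF] E_shift_scale[OF hF pF] zeq[OF p]
      by simp
    then show "E (s *\<^sub>R (g - v) + 8 *\<^sub>R h) p + b * ip2 M (s *\<^sub>R (g - v) + 8 *\<^sub>R h) p \<le> ip2 M ((8 * b) *\<^sub>R zero_ext W \<rho>) p"
      using \<rho>M F_L2[OF pF] by (simp add: L2.ip_scale_left)
  qed simp
  obtain u where u: "u \<in> Cont (subtopology X W)" "AE y in RM W. u y = rs W b f y"
    by (rule rs_Cont[OF W(1) df b(2) fW fabs zero_le_one])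
  have "8 * e' \<le> e" by (simp add: e'_def)
  have "AE y in M. y \<in> N \<longrightarrow> \<bar>u y - v y\<bar> \<le> e"
    using main[OF abs_one] main[of "- 1", OF abs_neg_one] u(2) WN unfolding AE_restrict_iff[OF Um[OF W(1)]]
  proof eventually_elim
    case (elim y)
    show ?case
    proof
      assume y: "y \<in> N"
      then have yU: "y \<in> U" and yW: "y \<in> W" using N(3) UW by auto
      have "g y = u y" "3/4 - e' \<le> h y" using elim(3,4) y yW by (simp_all add: g_def h_def zero_ext_def)
      moreover have "(g y - v y) + 8 * h y \<le> 6" "- (g y - v y) + 8 * h y \<le> 6" using elim(1,2) yU by simp_all
      ultimately show "\<bar>u y - v y\<bar> \<le> e" using \<open>8 * e' \<le> e\<close> by linarith
    qed
  qed
  moreover have "u \<in> Cont (subtopology X N)" by (rule Cont_subset[OF _ u(1)]) (use N(3) UW in blast)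
  ultimately show ?thesis using N by blast
qed

lemma defect_Cont:
  assumes ls: "locally_smoothing D" and U: "rc U" and lam: "0 \<le> lam"
  obtains v where "defect U lam v" "v \<in> Cont (subtopology X U)" "\<forall>x\<in>U. 0 \<le> v x \<and> v x \<le> 1" "lam = 0 \<longrightarrow> v = (\<lambda>_. 0)"
proof (cases "lam = 0")
  case True
  then show ?thesis using defect_0 by (intro that[of "\<lambda>_. 0"]) (simp_all add: Cont_const)
next
  case False
  note oU = rc_open[OF U]
  have lam: "0 < lam" using False lam by simp
  define v where "v = zero_ext U (rs U lam (\<lambda>_. 1))"
  have v: "defect U lam v" unfolding v_def by (rule defect_rs[OF U lam])
  have vU: "v \<in> FU U" and v01: "AE x in M. 0 \<le> v x" "AE x in M. v x \<le> 1"
    using v unfolding defect_def by auto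
  have vL: "v \<in> L2 (RM U)" by (rule L2R_of_L2[OF oU F_L2[OF FU_F[OF vU]]])
  \<comment> \<open>For \<open>U\<close> itself, local smoothing gives a set that contains
    \<open>U\<close> but perhaps not its closure. Applied to the larger \<open>V\<close> it gives a
    \<open>W\<close> that contains the closure of \<open>U\<close>.\<close>
  obtain V where V: "rc V" "X closure_of U \<subseteq> V" "U \<subseteq> V" by (rule rc_nbhd[OF U])
  obtain W where W: "openin X W" "V \<subseteq> W" "doubly_feller (R W)"
    using ls V(1) unfolding locally_smoothing_def by blast
  have UW: "X closure_of U \<subseteq> W" using V(2) W(2) by blast
  obtain g where g: "g \<in> Cont (subtopology X U)" "AE x in RM U. g x = v x"
  proof (rule continuous_version_local[OF oU])
    show "v \<in> borel_measurable (RM U)" using vL by simp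
    show "\<exists>N u. openin X N \<and> x \<in> N \<and> N \<subseteq> U \<and> u \<in> Cont (subtopology X N) \<and>
      (AE y in M. y \<in> N \<longrightarrow> \<bar>u y - v y\<bar> \<le> e)" if "x \<in> U" "0 < e" for x e
      by (rule defect_near[OF U lam v W(1) UW W(3) that])
  qed (rule that)
  have gv: "AE x in M. x \<in> U \<longrightarrow> g x = v x" using g(2) unfolding AE_restrict_iff[OF Um[OF oU]] .
  have g0: "0 \<le> g x" if x: "x \<in> U" for x
  proof -
    have "AE x in M. x \<in> U \<longrightarrow> 0 \<le> g x + 0" using gv v01(1) by eventually_elim auto
    from Cont_le[OF oU Cont_const g(1) this x] show ?thesis by simp
  qed
  have g1: "g x \<le> 1" if x: "x \<in> U" for x
  proof -
    have "AE x in M. x \<in> U \<longrightarrow> g x \<le> 1 + 0" using gv v01(2) by eventually_elim auto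
    from Cont_le[OF oU g(1) Cont_const this x] show ?thesis by simp
  qed
  show ?thesis
  proof (rule that[of "zero_ext U g"])
    show "defect U lam (zero_ext U g)"
    proof (rule defect_cong[OF v])
      show "zero_ext U g \<in> borel_measurable M"
        using Cont_measurable_R[OF oU g(1)] measurable_restrict_iff[OF Um[OF oU]] by blast
      show "AE x in M. v x = zero_ext U g x" using gv FU_zero[OF Um[OF oU] vU]
        by eventually_elim (auto simp: zero_ext_def)
    qed
    have "continuous_map (subtopology X U) euclideanreal (zero_ext U g)"
      by (rule continuous_map_eq[of _ _ g]) (use g(1) in \<open>auto simp: Cont_def zero_ext_def\<close>)
    then show "zero_ext U g \<in> Cont (subtopology X U)" by (simp add: Cont_def)
    show "\<forall>x\<in>U. 0 \<le> zero_ext U g x \<and> zero_ext U g x \<le> 1" using g0 g1 by (simp add: zero_ext_def)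
  qed (use False in simp)
qed

lemma defect_Cb:
  assumes v: "v \<in> Cont (subtopology X U)" "\<forall>x\<in>U. 0 \<le> v x \<and> v x \<le> 1"
  shows "(\<lambda>x. k * (1 - v x)) \<in> Cb (subtopology X U)"
  unfolding Cb_def
proof (intro CollectI conjI)
  show "(\<lambda>x. k * (1 - v x)) \<in> Cont (subtopology X U)"
    using v(1) unfolding Cont_def by (auto intro!: continuous_map_real_mult continuous_map_diff)
  have "\<bar>k * (1 - v x)\<bar> \<le> \<bar>k\<bar> * 1" if "x \<in> U" for x
    unfolding abs_mult using v(2) that by (intro mult_left_mono) auto
  then show "bounded ((\<lambda>x. k * (1 - v x)) ` topspace (subtopology X U))"
    by (auto simp: bounded_iff)
qed

section \<open>Shift defective functions\<close>

text \<open>With the harmonic function \<open>k (1 - v)\<close>, its difference to \<open>f\<close>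
  is nonnegative and supermedian, and \<open>smed_heat\<close> turns this into the shift
  inequality.\<close>

lemma shift_defectiveI:
  assumes f: "f \<in> L1_loc D" and lam: "0 \<le> lam"
    and loc: "\<And>U. rc U \<Longrightarrow> \<exists>v k. defect U lam v \<and> v \<in> Cont (subtopology X U) \<and> (\<forall>x\<in>U. 0 \<le> v x \<and> v x \<le> 1) \<and>
      (AE x in RM U. 0 \<le> k * (1 - v x) - f x) \<and> smed U lam (\<lambda>x. k * (1 - v x) - f x)"
  shows "locally_shift_defective D lam f"
  unfolding locally_shift_defective_def Let_def
proof (intro conjI allI impI f)
  fix U assume U: "rc U"
  note oU = rc_open[OF U]
  interpret finite_measure "RM U" by (rule rc_finite_measure[OF U])
  obtain v k where v: "defect U lam v" "v \<in> Cont (subtopology X U)" "\<forall>x\<in>U. 0 \<le> v x \<and> v x \<le> 1"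
    and p0: "AE x in RM U. 0 \<le> k * (1 - v x) - f x" and s: "smed U lam (\<lambda>x. k * (1 - v x) - f x)"
    using loc[OF U] by (elim exE conjE) (rule that)
  let ?g = "\<lambda>x. k * (1 - v x)"
  have gC: "?g \<in> Cb (subtopology X U)" by (rule defect_Cb[OF v(2,3)])
  obtain B where B: "\<forall>x\<in>U. \<bar>?g x\<bar> \<le> B" by (rule Cb_bound[OF oU gC])
  have "integrable (RM U) ?g"
    by (rule integrable_const_bound[of _ B])
      (use B Cont_measurable_R[OF oU, of ?g] gC in \<open>auto simp: Cb_def space_restrict_space intro!: AE_I2\<close>)
  then have pi: "integrable (RM U) (\<lambda>x. ?g x - f x)"
    by (rule Bochner_Integration.integrable_diff[OF _ L1_loc_integrable[OF U f]])
  have "weakly_harmonic (R U) lam ?g"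
    by (rule weakly_harmonic_defect[OF U v(1)]) (use v(3) in auto)
  moreover have "AE x in RM U. f x - ?g x \<le> exp (- t * lam) * heat (R U) t (\<lambda>y. f y - ?g y) x" if t: "0 < t" for t
    using smed_heat[OF oU finite_measure_axioms pi p0 s t] by simp
  ultimately show "\<exists>g\<in>Cb (fs_top (R U)). weakly_harmonic (R U) lam g \<and>
     (\<forall>t>0. AE x in fs_meas (R U). f x - g x \<le> exp (- t * lam) * heat (R U) t (\<lambda>y. f y - g y) x)"
    unfolding R_simps(1,2) using gC by (intro bexI[of _ ?g] conjI allI impI)
qed

lemma L1_loc_max:
  assumes f: "f \<in> L1_loc D" and g: "g \<in> L1_loc D" shows "(\<lambda>x. max (f x) (g x)) \<in> L1_loc D"
  unfolding L1_loc_def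
proof (intro CollectI conjI allI impI)
  show "(\<lambda>x. max (f x) (g x)) \<in> borel_measurable M"
    using f g unfolding L1_loc_def by (auto intro: borel_measurable_max)
  fix K assume "compactin X K"
  then have "integrable M (\<lambda>x. max (indicator K x *\<^sub>R f x) (indicator K x *\<^sub>R g x))"
    using f g unfolding L1_loc_def set_integrable_def by (intro integrable_max) auto
  moreover have "(\<lambda>x. max (indicator K x *\<^sub>R f x) (indicator K x *\<^sub>R g x)) = (\<lambda>x. indicator K x *\<^sub>R max (f x) (g x))"
    by (auto simp: fun_eq_iff indicator_def)
  ultimately show "set_integrable M K (\<lambda>x. max (f x) (g x))" unfolding set_integrable_def by simp
qed

lemma shift_defective_max:
  assumes ls: "locally_smoothing D" and lam: "0 \<le> lam"
    and f: "locally_shift_defective D lam f" and g: "locally_shift_defective D lam g"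
  shows "locally_shift_defective D lam (\<lambda>x. max (f x) (g x))"
proof (rule shift_defectiveI[OF L1_loc_max lam])
  show "f \<in> L1_loc D" "g \<in> L1_loc D" using f g by (simp_all add: locally_shift_defective_def)
  fix U assume U: "rc U"
  obtain v where v: "defect U lam v" "v \<in> Cont (subtopology X U)" "\<forall>x\<in>U. 0 \<le> v x \<and> v x \<le> 1" "lam = 0 \<longrightarrow> v = (\<lambda>_. 0)"
    by (rule defect_Cont[OF ls U lam])
  obtain K where K: "\<forall>k\<ge>K. (AE x in RM U. 0 \<le> k * (1 - v x) - f x) \<and> smed U lam (\<lambda>x. k * (1 - v x) - f x)"
    by (rule shift_defective_below_defect[OF ls U lam v(1,4) f])
  obtain L where L: "\<forall>k\<ge>L. (AE x in RM U. 0 \<le> k * (1 - v x) - g x) \<and> smed U lam (\<lambda>x. k * (1 - v x) - g x)"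
    by (rule shift_defective_below_defect[OF ls U lam v(1,4) g])
  define k where "k = max K L"
  have Kk: "AE x in RM U. 0 \<le> k * (1 - v x) - f x" "smed U lam (\<lambda>x. k * (1 - v x) - f x)"
    using K unfolding k_def by simp_all
  have Lk: "AE x in RM U. 0 \<le> k * (1 - v x) - g x" "smed U lam (\<lambda>x. k * (1 - v x) - g x)"
    using L unfolding k_def by simp_all
  have e: "(\<lambda>x. min (k * (1 - v x) - f x) (k * (1 - v x) - g x)) = (\<lambda>x. k * (1 - v x) - max (f x) (g x))"
    by (auto simp: fun_eq_iff)
  have "AE x in RM U. 0 \<le> k * (1 - v x) - max (f x) (g x)" using Kk(1) Lk(1) by eventually_elim simp
  moreover have "smed U lam (\<lambda>x. k * (1 - v x) - max (f x) (g x))"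
    using smed_min[OF rc_open[OF U] Kk(2) Lk(2)] unfolding e .
  ultimately show "\<exists>v k. defect U lam v \<and> v \<in> Cont (subtopology X U) \<and> (\<forall>x\<in>U. 0 \<le> v x \<and> v x \<le> 1) \<and>
      (AE x in RM U. 0 \<le> k * (1 - v x) - max (f x) (g x)) \<and> smed U lam (\<lambda>x. k * (1 - v x) - max (f x) (g x))"
    by (intro exI[of _ v] exI[of _ k] conjI v)
qed

lemma shift_defective_0:
  assumes ls: "locally_smoothing D" and lam: "0 \<le> lam"
    and f: "locally_shift_defective D lam f" "AE x in M. 0 \<le> f x"
  shows "locally_shift_defective D 0 f"
proof (cases "lam = 0")
  case True
  then show ?thesis using f(1) by simp
next
  case False
  then have lam: "0 < lam" using lam by simp
  show ?thesis
  proof (rule shift_defectiveI)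
    show "f \<in> L1_loc D" using f(1) by (simp add: locally_shift_defective_def)
    fix U assume U: "rc U"
    obtain K where K: "AE x in RM U. 0 \<le> K - f x" "smed U 0 (\<lambda>x. K - f x)"
      by (rule shift_defective_below_const[OF ls U lam f])
    show "\<exists>v k. defect U 0 v \<and> v \<in> Cont (subtopology X U) \<and> (\<forall>x\<in>U. 0 \<le> v x \<and> v x \<le> 1) \<and>
      (AE x in RM U. 0 \<le> k * (1 - v x) - f x) \<and> smed U 0 (\<lambda>x. k * (1 - v x) - f x)"
      by (intro exI[of _ "\<lambda>_. 0"] exI[of _ K] conjI defect_0 Cont_const) (use K in simp_all)
  qed simp
qed

end

theorem theorem5p3:
  fixes D :: "'a form_space" and lam :: real
  assumes "strongly_local_dirichlet_space D"
    and "locally_smoothing D"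
    and "0 \<le> lam"
  shows "(\<forall>f \<in> L1_loc D. \<forall>g \<in> L1_loc D.
            locally_shift_defective D lam f \<and> locally_shift_defective D lam g \<longrightarrow>
            locally_shift_defective D lam (\<lambda>x. max (f x) (g x))) \<and>
         (\<forall>f \<in> L1_loc D. (AE x in fs_meas D. 0 \<le> f x) \<and> locally_shift_defective D lam f \<longrightarrow>
            locally_shift_defective D 0 f)"
proof -
  interpret dirichlet D by unfold_locales (rule assms(1))
  show ?thesis
    using shift_defective_max[OF assms(2,3)] shift_defective_0[OF assms(2,3)] by blast
qed

end
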